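(* Let $(X,r)$ be a (bijective, non-degenerate) set-theoretical YBE solution and let $H_{\omega}$ be the co-quasitriangular Hopf algebra in $\mathrm{SupLat}$ obtained from $(X,r)$ by FRT reconstruction. Then the remnant of $H_{\omega}$ recovers the universal group $G(X,r)$ of the solution along with its braiding operator; that is, there is a group isomorphism $R(H_{\omega})\cong G(X,r)$ under which the braiding operator induced on $R(H_{\omega})$ by the co-quasitriangular structure of $H_\omega$ corresponds to the braiding operator $\overline{r}$ of $G(X,r)$.
   Context: Solutions. A set-theoretical YBE solution is a set $X$ with a bijection $r:X\times X\to X\times X$, $r(x,y)=(\sigma_x(y),\gamma_y(x))$, satisfying $(\mathrm{id}\times r)(r\times\mathrm{id})(\mathrm{id}\times r)=(r\times\mathrm{id})(\mathrm{id}\times r)(r\times\mathrm{id})$ on $X^3$ and non-degenerate: all $\sigma_x,\gamma_y:X\to X$ are bijections. Write $r^{-1}(x,y)=(\tau_x(y),\rho_y(x))$; the maps $\tau_x,\rho_y$ are then also bijections. The universal group is $G(X,r)=F_g(X)/\langle xy=\sigma_x(y)\gamma_y(x)\mid x,y\in X\rangle$ ($F_g(X)$ the free group); $\overline{r}$ is the braiding operator on it extending $r$, i.e. with $\overline{r}(\overline{x},\overline{y})=(\overline{\sigma_x(y)},\overline{\gamma_y(x)})$ for $x,y\in X$. A braiding operator on a group $(G,m,e)$ is a map $s:G\times G\to G\times G$ with $m\,s(g,h)=g.h$, $s(e,g)=(g,e)$, $s(g,e)=(e,g)$, $s(g.h,f)=(\mathrm{id}\times m)(s\times\mathrm{id})(g,s(h,f))$,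 $s(g,h.f)=(m\times\mathrm{id})(\mathrm{id}\times s)(s(g,h),f)$. $\mathrm{SupLat}$: objects are complete lattices, morphisms are maps preserving arbitrary joins; least elements are denoted $\emptyset$; $\mathcal{L}\otimes\mathcal{M}$ is universal for maps on $\mathcal{L}\times\mathcal{M}$ preserving joins in each variable, $(l,m)$ denotes the image of a pair; unit $\mathcal{P}(1)=\{\emptyset,1\}$, acting on lattices by $1.l=l$, $\emptyset.l=\emptyset$; $\mathcal{P}(X)\otimes\mathcal{P}(Y)\cong\mathcal{P}(X\times Y)$. Hopf algebras $(\mathcal{H},m,1,\Delta,\epsilon,S)$ in this symmetric monoidal category are as usual, with $S$ invertible. Sweedler notation $\Delta(a)=\vee(a_{(1)},a_{(2)})$; expressions denote joins over all terms. A co-quasitriangular structure is a join-preserving, convolution-invertible $\mathcal{R}:\mathcal{H}\otimes\mathcal{H}\to\mathcal{P}(1)$ with $\mathcal{R}(a.b,c)=\mathcal{R}(b,c_{(1)}).\mathcal{R}(a,c_{(2)})$, $\mathcal{R}(a,b.c)=\mathcal{R}(a_{(1)},b).\mathcal{R}(a_{(2)},c)$, $\mathcal{R}(b_{(1)},a_{(1)})a_{(2)}.b_{(2)}=b_{(1)}.a_{(1)}\mathcal{R}(b_{(2)},a_{(2)})$. Remnant. For a Hopf algebra $\mathcal{H}$ let $D=\vee\epsilon^{-1}(\emptyset)$, let $\mathcal{Q}$ be the quotient of $\mathcal{H}$ by $h\sim h\vee D$ (ordered by $\overline{a}\le\overline{b}$ iff $a\vee D\le b\vee D$), $\pi(h)=\overline{h}$,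 $\iota(\overline{h})=h\vee D$. $\mathcal{Q}$ has a Hopf algebra structure making $\pi$ a Hopf algebra morphism, and with it is isomorphic to the group algebra $\mathcal{P}(R(\mathcal{H}))$ of a group $R(\mathcal{H})$, the remnant ($\{g\}.\{h\}=\{gh\}$, $\Delta\{g\}=(\{g\},\{g\})$, $\epsilon\{g\}=1$, $S\{g\}=\{g^{-1}\}$); concretely $R(\mathcal{H})$ is the set of $q\neq\emptyset$ in $\mathcal{Q}$ with $\Delta(q)=(q,q)$. If $\mathcal{R}$ is a co-quasitriangular structure on $\mathcal{H}$ and $\Gamma(a,b)=\mathcal{R}(a_{(1)},b_{(1)}).(b_{(2)},a_{(2)}).\mathcal{R}^{-1}(a_{(3)},b_{(3)})$, then $(\pi\otimes\pi)\Gamma(\iota\otimes\iota)$ sends singletons of $\mathcal{Q}\otimes\mathcal{Q}\cong\mathcal{P}(R(\mathcal{H})\times R(\mathcal{H}))$ to singletons, and the resulting map on $R(\mathcal{H})\times R(\mathcal{H})$ is the induced braiding operator. FRT reconstruction. Let $\tilde{\mathcal{B}}$ be the strict braided rigid monoidal category generated by objects $\mathbf{x},\mathbf{y}$, morphisms $\mathrm{ev}:\mathbf{x}\otimes\mathbf{y}\to\mathtt{1}$, $\mathrm{coev}:\mathtt{1}\to\mathbf{y}\otimes\mathbf{x}$ and invertible $\kappa_{\mathbf{a},\mathbf{b}}:\mathbf{a}\otimes\mathbf{b}\to\mathbf{b}\otimes\mathbf{a}$ ($\mathbf{a},\mathbf{b}\in\{\mathbf{x},\mathbf{y}\}$), subject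 to the relations making $\kappa$ (extended to tensor products) a braiding and $\mathbf{y}$ the right dual of $\mathbf{x}$. Objects $\mathbf{a}$ are words of length $n$ in $\mathbf{x},\mathbf{y}$; put $X_{\mathbf{a}}=X^n$. The strong monoidal functor $\omega:\tilde{\mathcal{B}}\to\mathrm{SupLat}$ has $\omega(\mathbf{a})=\mathcal{P}(X_{\mathbf{a}})$ (with $\omega(\mathbf{y})=\mathcal{P}(X)$ the self-dual of $\mathcal{P}(X)$) and is determined by $\omega(\mathrm{ev})(\{(x,y)\})=1$ iff $x=y$ (else $\emptyset$), $\omega(\mathrm{coev})(1)=\{(x,x)\mid x\in X\}$, and $\omega(\kappa_{\mathbf{a},\mathbf{b}})$ induced by the bijections of $X\times X$: $\kappa_{\mathbf{x},\mathbf{x}}:(x,y)\mapsto(\sigma_x(y),\gamma_y(x))$; $\kappa_{\mathbf{x},\mathbf{y}}:(x,y)\mapsto(\rho_x^{-1}(y),\gamma_y^{-1}(x))$; $\kappa_{\mathbf{y},\mathbf{x}}:(x,y)\mapsto(\sigma_x^{-1}(y),\tau_y^{-1}(x))$; $\kappa_{\mathbf{y},\mathbf{y}}:(x,y)\mapsto(\rho_x(y),\tau_y(x))$. $H_{\omega}$ is the coend $\int^{\mathbf{a}\in\tilde{\mathcal{B}}}\omega(\mathbf{a})\otimes\omega(\mathbf{a})^{\vee}$ in $\mathrm{SupLat}$. Explicitly, it is the complete lattice generated under joins by symbols $[p,q]_{\mathbf{a}}$ ($\mathbf{a}$ an object, $p,q\in X_{\mathbf{a}}$), universal subject to the relations,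 for each morphism $f:\mathbf{a}\to\mathbf{b}$ of $\tilde{\mathcal{B}}$, $p\in X_{\mathbf{a}}$, $q\in X_{\mathbf{b}}$: $$\vee\{[p',q]_{\mathbf{b}}\mid p'\in\omega(f)(\{p\})\}=\vee\{[p,q']_{\mathbf{a}}\mid q'\in X_{\mathbf{a}},\ q\in\omega(f)(\{q'\})\}.$$ Its structure is: $[p,q]_{\mathbf{a}}.[p',q']_{\mathbf{b}}=[pp',qq']_{\mathbf{a}\otimes\mathbf{b}}$ (concatenation), unit the generator indexed by $\mathtt{1}$, $\Delta([p,q]_{\mathbf{a}})=\vee_{l\in X_{\mathbf{a}}}([p,l]_{\mathbf{a}},[l,q]_{\mathbf{a}})$, $\epsilon([p,q]_{\mathbf{a}})=1$ iff $p=q$ (else $\emptyset$). This bialgebra has a (necessarily unique) bijective antipode, and the co-quasitriangular structure is $\mathcal{R}([p,q]_{\mathbf{a}},[p',q']_{\mathbf{b}})=1$ iff the bijection $\omega(\kappa_{\mathbf{a},\mathbf{b}}):X_{\mathbf{a}}\times X_{\mathbf{b}}\to X_{\mathbf{b}}\times X_{\mathbf{a}}$ sends $(p,p')$ to $(q',q)$ (else $\emptyset$). *)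

theory Defs
  imports "HOL-Algebra.Complete_Lattice" "HOL-Algebra.Coset"
begin

section \<open>Set-theoretical solutions of the Yang--Baxter equation\<close>

definition sigma :: "('x \<times> 'x \<Rightarrow> 'x \<times> 'x) \<Rightarrow> 'x \<Rightarrow> 'x \<Rightarrow> 'x"
  where "sigma r x y = fst (r (x, y))"

definition gamma :: "('x \<times> 'x \<Rightarrow> 'x \<times> 'x) \<Rightarrow> 'x \<Rightarrow> 'x \<Rightarrow> 'x"
  where "gamma r y x = snd (r (x, y))"

definition tau :: "'x set \<Rightarrow> ('x \<times> 'x \<Rightarrow> 'x \<times> 'x) \<Rightarrow> 'x \<Rightarrow> 'x \<Rightarrow> 'x"
  where "tau X r x y = fst (inv_into (X \<times> X) r (x, y))"

definition rho :: "'x set \<Rightarrow> ('x \<times> 'x \<Rightarrow> 'x \<times> 'x) \<Rightarrow> 'x \<Rightarrow> 'x \<Rightarrow> 'x"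
  where "rho X r y x = snd (inv_into (X \<times> X) r (x, y))"

definition on12 :: "('x \<times> 'x \<Rightarrow> 'x \<times> 'x) \<Rightarrow> 'x \<times> 'x \<times> 'x \<Rightarrow> 'x \<times> 'x \<times> 'x"
  where "on12 r = (\<lambda>(x, y, z). let (x', y') = r (x, y) in (x', y', z))"

definition on23 :: "('x \<times> 'x \<Rightarrow> 'x \<times> 'x) \<Rightarrow> 'x \<times> 'x \<times> 'x \<Rightarrow> 'x \<times> 'x \<times> 'x"
  where "on23 r = (\<lambda>(x, y, z). (x, r (y, z)))"

definition ybe_solution :: "'x set \<Rightarrow> ('x \<times> 'x \<Rightarrow> 'x \<times> 'x) \<Rightarrow> bool"
  where "ybe_solution X r \<longleftrightarrow>
    bij_betw r (X \<times> X) (X \<times> X) \<and>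
    (\<forall>t \<in> X \<times> X \<times> X. on23 r (on12 r (on23 r t)) = on12 r (on23 r (on12 r t))) \<and>
    (\<forall>x\<in>X. bij_betw (sigma r x) X X) \<and>
    (\<forall>y\<in>X. bij_betw (gamma r y) X X)"


section \<open>Free groups, the universal group and its braiding operator\<close>

text \<open>A letter \<open>(x, True)\<close> stands for \<open>x\<close>, and \<open>(x, False)\<close> for its inverse.\<close>

definition group_words :: "'x set \<Rightarrow> ('x \<times> bool) list set"
  where "group_words X = lists (X \<times> UNIV)"

definition cancellation :: "'x set \<Rightarrow> (('x \<times> bool) list \<times> ('x \<times> bool) list) set"
  where "cancellation X =
    {(u @ [(x, b), (x, \<not> b)] @ v, u @ v) | u x b v.
      u \<in> group_words X \<and> v \<in> group_words X \<and> x \<in> X}"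

definition freely_equal :: "'x set \<Rightarrow> (('x \<times> bool) list \<times> ('x \<times> bool) list) set"
  where "freely_equal X = (cancellation X \<union> (cancellation X)\<inverse>)\<^sup>*"

definition free_group :: "'x set \<Rightarrow> ('x \<times> bool) list set monoid"
  where "free_group X =
    \<lparr>carrier = group_words X // freely_equal X,
     monoid.mult = (\<lambda>A B. freely_equal X `` {u @ v | u v. u \<in> A \<and> v \<in> B}),
     one = freely_equal X `` {[]}\<rparr>"

definition normal_closure :: "('g, 'b) monoid_scheme \<Rightarrow> 'g set \<Rightarrow> 'g set"
  where "normal_closure G S = \<Inter> {N. N \<lhd> G \<and> S \<subseteq> N}"

definition universal_relators ::
  "'x set \<Rightarrow> ('x \<times> 'x \<Rightarrow> 'x \<times> 'x) \<Rightarrow> ('x \<times> bool) list set set"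
  where "universal_relators X r =
    {freely_equal X ``
       {[(x, True), (y, True), (gamma r y x, False), (sigma r x y, False)]} | x y. x \<in> X \<and> y \<in> X}"

definition universal_group ::
  "'x set \<Rightarrow> ('x \<times> 'x \<Rightarrow> 'x \<times> 'x) \<Rightarrow> ('x \<times> bool) list set set monoid"
  where "universal_group X r =
    free_group X Mod normal_closure (free_group X) (universal_relators X r)"

definition universal_gen ::
  "'x set \<Rightarrow> ('x \<times> 'x \<Rightarrow> 'x \<times> 'x) \<Rightarrow> 'x \<Rightarrow> ('x \<times> bool) list set set"
  where "universal_gen X r x =
    normal_closure (free_group X) (universal_relators X r)
      #>\<^bsub>free_group X\<^esub> (freely_equal X `` {[(x, True)]})"

definition braiding_operator :: "('g, 'b) monoid_scheme \<Rightarrow> ('g \<times> 'g \<Rightarrow> 'g \<times> 'g) \<Rightarrow> bool"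
  where "braiding_operator G s \<longleftrightarrow>
    s \<in> carrier G \<times> carrier G \<rightarrow> carrier G \<times> carrier G \<and>
    (\<forall>g\<in>carrier G. \<forall>h\<in>carrier G. fst (s (g, h)) \<otimes>\<^bsub>G\<^esub> snd (s (g, h)) = g \<otimes>\<^bsub>G\<^esub> h) \<and>
    (\<forall>g\<in>carrier G. s (\<one>\<^bsub>G\<^esub>, g) = (g, \<one>\<^bsub>G\<^esub>) \<and> s (g, \<one>\<^bsub>G\<^esub>) = (\<one>\<^bsub>G\<^esub>, g)) \<and>
    (\<forall>g\<in>carrier G. \<forall>h\<in>carrier G. \<forall>f\<in>carrier G.
      s (g \<otimes>\<^bsub>G\<^esub> h, f) =
        (let (f', h') = s (h, f); (f'', g') = s (g, f') in (f'', g' \<otimes>\<^bsub>G\<^esub> h'))) \<and>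
    (\<forall>g\<in>carrier G. \<forall>h\<in>carrier G. \<forall>f\<in>carrier G.
      s (g, h \<otimes>\<^bsub>G\<^esub> f) =
        (let (h', g') = s (g, h); (f', g'') = s (g', f) in (h' \<otimes>\<^bsub>G\<^esub> f', g'')))"

text \<open>The choice below is harmless: a braiding operator on the universal group extending \<open>r\<close>
  is unique on pairs of group elements.\<close>

definition universal_braiding :: "'x set \<Rightarrow> ('x \<times> 'x \<Rightarrow> 'x \<times> 'x) \<Rightarrow>
    ('x \<times> bool) list set set \<times> ('x \<times> bool) list set set \<Rightarrow>
    ('x \<times> bool) list set set \<times> ('x \<times> bool) list set set"
  where "universal_braiding X r = (SOME s.
    braiding_operator (universal_group X r) s \<and>
    (\<forall>x\<in>X. \<forall>y\<in>X. s (universal_gen X r x, universal_gen X r y) =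
      (universal_gen X r (sigma r x y), universal_gen X r (gamma r y x))))"


section \<open>Complete lattices by generators and relations\<close>

definition sup_morphism ::
  "('a, 'c) gorder_scheme \<Rightarrow> ('b, 'd) gorder_scheme \<Rightarrow> ('a \<Rightarrow> 'b) \<Rightarrow> bool"
  where "sup_morphism L M f \<longleftrightarrow>
    f \<in> carrier L \<rightarrow> carrier M \<and> (\<forall>A \<subseteq> carrier L. f (\<Squnion>\<^bsub>L\<^esub> A) = \<Squnion>\<^bsub>M\<^esub> (f ` A))"

text \<open>The complete lattice generated under joins by a set \<open>G\<close>, universal subject to the relations
  \<open>\<Or>A = \<Or>B\<close> for \<open>(A, B) \<in> E\<close>. As for any quotient in \<open>SupLat\<close>, it is realised inside
  the free complete lattice \<open>Pow G\<close> by the largest representatives of the congruence classes,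
  that is, by the sets \<open>C\<close> that do not distinguish between the two sides of a relation.
  The universal property is proved below.\<close>

definition presented :: "'g set \<Rightarrow> ('g set \<times> 'g set) set \<Rightarrow> 'g set gorder"
  where "presented G E =
    \<lparr>carrier = {C. C \<subseteq> G \<and> (\<forall>(A, B)\<in>E. A \<subseteq> C \<longleftrightarrow> B \<subseteq> C)}, eq = (=), le = (\<subseteq>)\<rparr>"

definition presented_gen :: "'g set \<Rightarrow> ('g set \<times> 'g set) set \<Rightarrow> 'g \<Rightarrow> 'g set"
  where "presented_gen G E g = \<Inter> {C \<in> carrier (presented G E). g \<in> C}"

text \<open>An element \<open>C\<close> of a presented lattice is the join of the generators given by its members;
  hence this is the join-preserving extension of a map \<open>f\<close> on generators.\<close>

definition join_ext :: "('b, 'd) gorder_scheme \<Rightarrow> ('g \<Rightarrow> 'b) \<Rightarrow> 'g set \<Rightarrow> 'b"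
  where "join_ext M f C = \<Squnion>\<^bsub>M\<^esub> (f ` C)"

lemma presented_iff:
  "C \<in> carrier (presented G E) \<longleftrightarrow>
    C \<subseteq> G \<and> (\<forall>A B. (A, B) \<in> E \<longrightarrow> (A \<subseteq> C \<longleftrightarrow> B \<subseteq> C))"
  by (simp add: presented_def split_beta) (metis fst_conv prod.collapse snd_conv)

lemma presented_Inter:
  assumes "\<C> \<subseteq> carrier (presented G E)" "\<C> \<noteq> {}"
  shows "\<Inter> \<C> \<in> carrier (presented G E)"
proof -
  have C: "C \<subseteq> G" "\<And>A B. (A, B) \<in> E \<Longrightarrow> A \<subseteq> C \<longleftrightarrow> B \<subseteq> C" if "C \<in> \<C>" for C
    using subsetD[OF assms(1) that] unfolding presented_iff by blast+
  have "A \<subseteq> \<Inter> \<C> \<longleftrightarrow> B \<subseteq> \<Inter> \<C>" if "(A, B) \<in> E" for A B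
    using C(2)[OF _ that] by (simp add: le_Inf_iff)
  moreover have "\<Inter> \<C> \<subseteq> G"
    using C(1) assms(2) by blast
  ultimately show ?thesis by (simp add: presented_iff)
qed

lemma presented_complete_lattice:
  assumes "\<And>A B. (A, B) \<in> E \<Longrightarrow> A \<subseteq> G \<and> B \<subseteq> G"
  shows "complete_lattice (presented G E)"
proof -
  let ?L = "presented G E"
  have po: "partial_order ?L"
    by unfold_locales (auto simp: presented_def)
  have top: "G \<in> carrier ?L"
    unfolding presented_iff using assms by blast
  show ?thesis
  proof (rule partial_order.complete_lattice_criterion1[OF po])
    show "\<exists>g. greatest ?L g (carrier ?L)"
      using top by (intro exI[of _ G]) (simp add: greatest_def presented_iff, simp add: presented_def)
  next
    fix A assume A: "A \<subseteq> carrier ?L" "A \<noteq> {}"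
    have "\<Inter> A \<in> carrier ?L" using presented_Inter[OF A] .
    moreover have "le ?L = (\<subseteq>)" by (simp add: presented_def)
    ultimately have "greatest ?L (\<Inter> A) (Lower ?L A)"
      unfolding greatest_def Lower_def using A(1) by (simp, blast)
    then show "\<exists>i. greatest ?L i (Lower ?L A)" ..
  qed
qed

lemma presented_gen_closed:
  assumes "\<And>A B. (A, B) \<in> E \<Longrightarrow> A \<subseteq> G \<and> B \<subseteq> G" "g \<in> G"
  shows "presented_gen G E g \<in> carrier (presented G E)" "g \<in> presented_gen G E g"
proof -
  have "G \<in> carrier (presented G E)"
    unfolding presented_iff using assms(1) by blast
  then show "presented_gen G E g \<in> carrier (presented G E)"
    unfolding presented_gen_def using assms(2) by (intro presented_Inter) auto
  show "g \<in> presented_gen G E g"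
    by (auto simp: presented_gen_def)
qed

theorem presented_universal:
  assumes E: "\<And>A B. (A, B) \<in> E \<Longrightarrow> A \<subseteq> G \<and> B \<subseteq> G"
    and M: "complete_lattice M"
    and f: "f \<in> G \<rightarrow> carrier M"
    and resp: "\<And>A B. (A, B) \<in> E \<Longrightarrow> \<Squnion>\<^bsub>M\<^esub> (f ` A) = \<Squnion>\<^bsub>M\<^esub> (f ` B)"
  shows "sup_morphism (presented G E) M (join_ext M f)"
    and "g \<in> G \<Longrightarrow> join_ext M f (presented_gen G E g) = f g"
    and "\<lbrakk>sup_morphism (presented G E) M h; \<And>g. g \<in> G \<Longrightarrow> h (presented_gen G E g) = f g;
          C \<in> carrier (presented G E)\<rbrakk> \<Longrightarrow> h C = join_ext M f C"
proof -
  let ?L = "presented G E"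
  interpret M: complete_lattice M by fact
  interpret L: complete_lattice ?L by (rule presented_complete_lattice[OF E])
  have le: "le ?L = (\<subseteq>)" by (simp add: presented_def)
  have sub: "C \<subseteq> G" if "C \<in> carrier ?L" for C using that by (auto simp: presented_def)
  have fim: "f ` A \<subseteq> carrier M" if "A \<subseteq> G" for A using f that by auto
  have sup_le: "\<Squnion>\<^bsub>M\<^esub> (f ` A) \<sqsubseteq>\<^bsub>M\<^esub> m \<longleftrightarrow> (\<forall>g\<in>A. f g \<sqsubseteq>\<^bsub>M\<^esub> m)"
    if "A \<subseteq> G" "m \<in> carrier M" for A m
  proof
    assume l: "\<Squnion>\<^bsub>M\<^esub> (f ` A) \<sqsubseteq>\<^bsub>M\<^esub> m"
    show "\<forall>g\<in>A. f g \<sqsubseteq>\<^bsub>M\<^esub> m"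
    proof
      fix g assume "g \<in> A"
      then have "f g \<sqsubseteq>\<^bsub>M\<^esub> \<Squnion>\<^bsub>M\<^esub> (f ` A)" by (intro M.sup_upper fim that) auto
      from this l show "f g \<sqsubseteq>\<^bsub>M\<^esub> m"
        by (rule M.le_trans) (use that fim[of A] \<open>g \<in> A\<close> in auto)
    qed
  next
    assume "\<forall>g\<in>A. f g \<sqsubseteq>\<^bsub>M\<^esub> m"
    then show "\<Squnion>\<^bsub>M\<^esub> (f ` A) \<sqsubseteq>\<^bsub>M\<^esub> m"
      using that by (intro M.sup_least fim) (auto simp: Upper_def)
  qed
  have below: "{g \<in> G. f g \<sqsubseteq>\<^bsub>M\<^esub> m} \<in> carrier ?L" if m: "m \<in> carrier M" for m
  proof -
    have "A \<subseteq> {g \<in> G. f g \<sqsubseteq>\<^bsub>M\<^esub> m} \<longleftrightarrow> B \<subseteq> {g \<in> G. f g \<sqsubseteq>\<^bsub>M\<^esub> m}" if "(A, B) \<in> E" for A B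
    proof -
      have "A \<subseteq> G" "B \<subseteq> G" using E[OF that] by auto
      then show ?thesis using sup_le[of A m] sup_le[of B m] resp[OF that] m by auto
    qed
    then show ?thesis unfolding presented_iff by blast
  qed
  have closed: "join_ext M f C \<in> carrier M" if "C \<in> carrier ?L" for C
    using that sub fim by (simp add: join_ext_def)
  have up: "C \<subseteq> {g \<in> G. f g \<sqsubseteq>\<^bsub>M\<^esub> join_ext M f C}" if "C \<in> carrier ?L" for C
  proof
    fix g assume g: "g \<in> C"
    then have "f g \<sqsubseteq>\<^bsub>M\<^esub> join_ext M f C"
      unfolding join_ext_def by (intro M.sup_upper fim sub that) simp
    then show "g \<in> {g \<in> G. f g \<sqsubseteq>\<^bsub>M\<^esub> join_ext M f C}"
      using sub[OF that] g by blast
  qed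
  have ext_le: "join_ext M f C \<sqsubseteq>\<^bsub>M\<^esub> m \<longleftrightarrow> C \<subseteq> {g \<in> G. f g \<sqsubseteq>\<^bsub>M\<^esub> m}"
    if "C \<in> carrier ?L" "m \<in> carrier M" for C m
    using that sup_le[of C m] sub[of C] by (auto simp: join_ext_def)
  show sm: "sup_morphism ?L M (join_ext M f)"
    unfolding sup_morphism_def
  proof (intro conjI allI impI funcsetI)
    fix \<C> assume C: "\<C> \<subseteq> carrier ?L"
    have SC: "\<Squnion>\<^bsub>?L\<^esub> \<C> \<in> carrier ?L" using C by simp
    have im: "join_ext M f ` \<C> \<subseteq> carrier M" using C closed by auto
    show "join_ext M f (\<Squnion>\<^bsub>?L\<^esub> \<C>) = \<Squnion>\<^bsub>M\<^esub> (join_ext M f ` \<C>)"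
    proof (rule M.le_antisym)
      let ?m = "\<Squnion>\<^bsub>M\<^esub> (join_ext M f ` \<C>)"
      have m: "?m \<in> carrier M" using im by simp
      have "D \<subseteq> {g \<in> G. f g \<sqsubseteq>\<^bsub>M\<^esub> ?m}" if "D \<in> \<C>" for D
      proof -
        have "join_ext M f D \<sqsubseteq>\<^bsub>M\<^esub> ?m" using that im by (intro M.sup_upper) auto
        then show ?thesis using ext_le[of D ?m] C that m by auto
      qed
      then have "\<Squnion>\<^bsub>?L\<^esub> \<C> \<subseteq> {g \<in> G. f g \<sqsubseteq>\<^bsub>M\<^esub> ?m}"
        using L.sup_least[of \<C> "{g \<in> G. f g \<sqsubseteq>\<^bsub>M\<^esub> ?m}"] below[OF m] C
        by (auto simp: Upper_def le)
      then show "join_ext M f (\<Squnion>\<^bsub>?L\<^esub> \<C>) \<sqsubseteq>\<^bsub>M\<^esub> ?m" using ext_le SC m by simp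
    next
      let ?m = "join_ext M f (\<Squnion>\<^bsub>?L\<^esub> \<C>)"
      have m: "?m \<in> carrier M" using SC closed by simp
      have "join_ext M f D \<sqsubseteq>\<^bsub>M\<^esub> ?m" if "D \<in> \<C>" for D
      proof -
        have "D \<subseteq> \<Squnion>\<^bsub>?L\<^esub> \<C>" using L.sup_upper[of \<C> D] that C by (auto simp: le)
        then show ?thesis using up[OF SC] ext_le[of D ?m] that C m by auto
      qed
      then show "\<Squnion>\<^bsub>M\<^esub> (join_ext M f ` \<C>) \<sqsubseteq>\<^bsub>M\<^esub> ?m"
        using m im by (intro M.sup_least) (auto simp: Upper_def)
    qed (use SC im closed in auto)
  qed (use closed in auto)
  show "join_ext M f (presented_gen G E g) = f g" if g: "g \<in> G"
  proof (rule M.le_antisym)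
    note pg = presented_gen_closed[where E=E and G=G, OF E g]
    have fg: "f g \<in> carrier M" using f g by auto
    have "presented_gen G E g \<subseteq> {h \<in> G. f h \<sqsubseteq>\<^bsub>M\<^esub> f g}"
      using below[OF fg] fg g by (auto simp: presented_gen_def)
    then show "join_ext M f (presented_gen G E g) \<sqsubseteq>\<^bsub>M\<^esub> f g"
      using ext_le pg fg by auto
    show "f g \<sqsubseteq>\<^bsub>M\<^esub> join_ext M f (presented_gen G E g)"
      using up pg by auto
    show "f g \<in> carrier M" by (rule fg)
    show "join_ext M f (presented_gen G E g) \<in> carrier M" using closed pg by auto
  qed
  show "h C = join_ext M f C"
    if h: "sup_morphism ?L M h" "\<And>g. g \<in> G \<Longrightarrow> h (presented_gen G E g) = f g"
      and C: "C \<in> carrier ?L"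
  proof -
    note pg = presented_gen_closed[where E=E and G=G, OF E]
    have im: "presented_gen G E ` C \<subseteq> carrier ?L" using pg(1) sub[OF C] by blast
    have "\<Squnion>\<^bsub>?L\<^esub> (presented_gen G E ` C) = C"
    proof (rule L.le_antisym)
      show "\<Squnion>\<^bsub>?L\<^esub> (presented_gen G E ` C) \<sqsubseteq>\<^bsub>?L\<^esub> C"
        using C im by (intro L.sup_least) (auto simp: Upper_def le presented_gen_def)
      have "presented_gen G E g \<subseteq> \<Squnion>\<^bsub>?L\<^esub> (presented_gen G E ` C)" if "g \<in> C" for g
        using L.sup_upper[of "presented_gen G E ` C" "presented_gen G E g"] im that
        by (auto simp: le)
      then show "C \<sqsubseteq>\<^bsub>?L\<^esub> \<Squnion>\<^bsub>?L\<^esub> (presented_gen G E ` C)"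
        using pg sub[OF C] by (fastforce simp: le)
    qed (use C im in auto)
    moreover have "h (\<Squnion>\<^bsub>?L\<^esub> (presented_gen G E ` C)) = \<Squnion>\<^bsub>M\<^esub> (h ` presented_gen G E ` C)"
      using h(1) im by (simp add: sup_morphism_def)
    moreover have "h ` presented_gen G E ` C = f ` C"
      unfolding image_image by (rule image_cong[OF refl]) (use h(2) sub[OF C] in blast)
    ultimately show ?thesis by (simp add: join_ext_def)
  qed
qed


section \<open>Tensor products and the unit object\<close>

text \<open>An element of a tensor product is a set of pairs, and equals the join of the pure tensors
  \<open>(l, m)\<close> given by its members. The relations make pure tensors preserve joins in each
  variable.\<close>

definition tensor_rels ::
  "('a, 'c) gorder_scheme \<Rightarrow> ('b, 'd) gorder_scheme \<Rightarrow> (('a \<times> 'b) set \<times> ('a \<times> 'b) set) set"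
  where "tensor_rels L M =
    {({(\<Squnion>\<^bsub>L\<^esub> A, m)}, A \<times> {m}) | A m. A \<subseteq> carrier L \<and> m \<in> carrier M} \<union>
    {({(l, \<Squnion>\<^bsub>M\<^esub> B)}, {l} \<times> B) | l B. l \<in> carrier L \<and> B \<subseteq> carrier M}"

definition tensor ::
  "('a, 'c) gorder_scheme \<Rightarrow> ('b, 'd) gorder_scheme \<Rightarrow> ('a \<times> 'b) set gorder"
  where "tensor L M = presented (carrier L \<times> carrier M) (tensor_rels L M)"

definition pure_tensor ::
  "('a, 'c) gorder_scheme \<Rightarrow> ('b, 'd) gorder_scheme \<Rightarrow> 'a \<Rightarrow> 'b \<Rightarrow> ('a \<times> 'b) set"
  where "pure_tensor L M l m = presented_gen (carrier L \<times> carrier M) (tensor_rels L M) (l, m)"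

definition tensor_map ::
  "('c, 'm) gorder_scheme \<Rightarrow> ('d, 'n) gorder_scheme \<Rightarrow> ('a \<Rightarrow> 'c) \<Rightarrow> ('b \<Rightarrow> 'd) \<Rightarrow>
    ('a \<times> 'b) set \<Rightarrow> ('c \<times> 'd) set"
  where "tensor_map L' M' f g =
    join_ext (tensor L' M') (\<lambda>(l, m). pure_tensor L' M' (f l) (g m))"

text \<open>The unit object \<open>P(1)\<close> is the powerset of \<^typ>\<open>unit\<close>; its elements are \<open>{}\<close> and
  \<open>{()}\<close>, and its multiplication is intersection.\<close>

definition unit_obj :: "unit set gorder"
  where "unit_obj = \<lparr>carrier = UNIV, eq = (=), le = (\<subseteq>)\<rparr>"

definition truth :: "bool \<Rightarrow> unit set"
  where "truth P = (if P then {()} else {})"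

definition act :: "('a, 'c) gorder_scheme \<Rightarrow> unit set \<Rightarrow> 'a \<Rightarrow> 'a"
  where "act L s l = (if s = {} then \<bottom>\<^bsub>L\<^esub> else l)"

text \<open>By the universal property of the tensor product, morphisms \<open>L \<otimes> M \<rightarrow> N\<close> are given as
  maps of two arguments preserving joins in each of them.\<close>

definition sup_bimorphism ::
  "('a, 'c) gorder_scheme \<Rightarrow> ('b, 'd) gorder_scheme \<Rightarrow> ('e, 'f) gorder_scheme \<Rightarrow>
    ('a \<Rightarrow> 'b \<Rightarrow> 'e) \<Rightarrow> bool"
  where "sup_bimorphism L M N f \<longleftrightarrow>
    (\<forall>l\<in>carrier L. sup_morphism M N (f l)) \<and>
    (\<forall>m\<in>carrier M. sup_morphism L N (\<lambda>l. f l m))"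


section \<open>Hopf algebras in SupLat\<close>

record 'a suplat_bialgebra = "'a gorder" +
  hmult :: "'a \<Rightarrow> 'a \<Rightarrow> 'a"
  hone :: 'a
  comult :: "'a \<Rightarrow> ('a \<times> 'a) set"
  counit :: "'a \<Rightarrow> unit set"

record 'a suplat_hopf = "'a suplat_bialgebra" +
  antipode :: "'a \<Rightarrow> 'a"

text \<open>Since \<open>comult H a\<close> is a set of pairs with join \<open>\<Delta>(a)\<close>, Sweedler sums are joins over
  \<open>(a1, a2) \<in> comult H a\<close>.\<close>

definition is_antipode :: "('a, 'b) suplat_bialgebra_scheme \<Rightarrow> ('a \<Rightarrow> 'a) \<Rightarrow> bool"
  where "is_antipode H S \<longleftrightarrow>
    sup_morphism H H S \<and> bij_betw S (carrier H) (carrier H) \<and>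
    (\<forall>a\<in>carrier H.
      \<Squnion>\<^bsub>H\<^esub> {hmult H (S a1) a2 | a1 a2. (a1, a2) \<in> comult H a} = act H (counit H a) (hone H) \<and>
      \<Squnion>\<^bsub>H\<^esub> {hmult H a1 (S a2) | a1 a2. (a1, a2) \<in> comult H a} = act H (counit H a) (hone H))"

definition is_convolution_inverse ::
  "('a, 'b) suplat_bialgebra_scheme \<Rightarrow> ('a \<Rightarrow> 'a \<Rightarrow> unit set) \<Rightarrow> ('a \<Rightarrow> 'a \<Rightarrow> unit set) \<Rightarrow> bool"
  where "is_convolution_inverse H R R' \<longleftrightarrow>
    sup_bimorphism H H unit_obj R' \<and>
    (\<forall>a\<in>carrier H. \<forall>b\<in>carrier H.
      \<Squnion>\<^bsub>unit_obj\<^esub> {R a1 b1 \<inter> R' a2 b2 | a1 a2 b1 b2.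
        (a1, a2) \<in> comult H a \<and> (b1, b2) \<in> comult H b} = counit H a \<inter> counit H b \<and>
      \<Squnion>\<^bsub>unit_obj\<^esub> {R' a1 b1 \<inter> R a2 b2 | a1 a2 b1 b2.
        (a1, a2) \<in> comult H a \<and> (b1, b2) \<in> comult H b} = counit H a \<inter> counit H b)"

definition convolution_inverse ::
  "('a, 'b) suplat_bialgebra_scheme \<Rightarrow> ('a \<Rightarrow> 'a \<Rightarrow> unit set) \<Rightarrow> 'a \<Rightarrow> 'a \<Rightarrow> unit set"
  where "convolution_inverse H R = (SOME R'. is_convolution_inverse H R R')"


section \<open>The remnant and the induced braiding operator\<close>

definition counit_kernel :: "('a, 'b) suplat_bialgebra_scheme \<Rightarrow> 'a"
  where "counit_kernel H = \<Squnion>\<^bsub>H\<^esub> {h \<in> carrier H. counit H h = {}}"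

definition remnant_proj :: "('a, 'b) suplat_bialgebra_scheme \<Rightarrow> 'a \<Rightarrow> 'a set"
  where "remnant_proj H h =
    {k \<in> carrier H. k \<squnion>\<^bsub>H\<^esub> counit_kernel H = h \<squnion>\<^bsub>H\<^esub> counit_kernel H}"

definition remnant_incl :: "('a, 'b) suplat_bialgebra_scheme \<Rightarrow> 'a set \<Rightarrow> 'a"
  where "remnant_incl H q = the_elem ((\<lambda>h. h \<squnion>\<^bsub>H\<^esub> counit_kernel H) ` q)"

definition remnant_lattice :: "('a, 'b) suplat_bialgebra_scheme \<Rightarrow> 'a set gorder"
  where "remnant_lattice H =
    \<lparr>carrier = remnant_proj H ` carrier H, eq = (=),
     le = (\<lambda>p q. remnant_incl H p \<sqsubseteq>\<^bsub>H\<^esub> remnant_incl H q)\<rparr>"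

text \<open>As \<open>remnant_proj H\<close> is surjective with section \<open>remnant_incl H\<close>, the following is the only
  structure on the quotient that can make it a Hopf algebra morphism.\<close>

definition remnant_hopf :: "('a, 'b) suplat_hopf_scheme \<Rightarrow> 'a set suplat_hopf"
  where "remnant_hopf H =
    \<lparr>carrier = carrier (remnant_lattice H), eq = eq (remnant_lattice H), le = le (remnant_lattice H),
     hmult = (\<lambda>p q. remnant_proj H (hmult H (remnant_incl H p) (remnant_incl H q))),
     hone = remnant_proj H (hone H),
     comult = (\<lambda>q. tensor_map (remnant_lattice H) (remnant_lattice H)
       (remnant_proj H) (remnant_proj H) (comult H (remnant_incl H q))),
     counit = (\<lambda>q. counit H (remnant_incl H q)),
     antipode = (\<lambda>q. remnant_proj H (antipode H (remnant_incl H q)))\<rparr>"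

definition remnant :: "('a, 'b) suplat_hopf_scheme \<Rightarrow> 'a set monoid"
  where "remnant H = (let Q = remnant_hopf H in
    \<lparr>carrier = {q \<in> carrier Q. q \<noteq> \<bottom>\<^bsub>Q\<^esub> \<and> comult Q q = pure_tensor Q Q q q},
     monoid.mult = hmult Q, one = hone Q\<rparr>)"

definition sweedler3 :: "('a, 'b) suplat_bialgebra_scheme \<Rightarrow> 'a \<Rightarrow> ('a \<times> 'a \<times> 'a) set"
  where "sweedler3 H a =
    {(a1, a2, a3). \<exists>a'. (a', a3) \<in> comult H a \<and> (a1, a2) \<in> comult H a'}"

definition Gamma ::
  "('a, 'b) suplat_bialgebra_scheme \<Rightarrow> ('a \<Rightarrow> 'a \<Rightarrow> unit set) \<Rightarrow> 'a \<Rightarrow> 'a \<Rightarrow> ('a \<times> 'a) set"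
  where "Gamma H R a b = \<Squnion>\<^bsub>tensor H H\<^esub>
    {act (tensor H H) (R a1 b1 \<inter> convolution_inverse H R a3 b3) (pure_tensor H H b2 a2)
      | a1 a2 a3 b1 b2 b3. (a1, a2, a3) \<in> sweedler3 H a \<and> (b1, b2, b3) \<in> sweedler3 H b}"

text \<open>Under \<open>Q \<otimes> Q \<cong> P(R(H) \<times> R(H))\<close> a singleton \<open>{(p, q)}\<close> is the pure tensor of the
  group-like elements \<open>p\<close> and \<open>q\<close>.\<close>

definition induced_braiding ::
  "('a, 'b) suplat_hopf_scheme \<Rightarrow> ('a \<Rightarrow> 'a \<Rightarrow> unit set) \<Rightarrow> 'a set \<times> 'a set \<Rightarrow> 'a set \<times> 'a set"
  where "induced_braiding H R = (\<lambda>(p, q). let Q = remnant_hopf H in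
    (THE (p', q'). p' \<in> carrier (remnant H) \<and> q' \<in> carrier (remnant H) \<and>
      tensor_map Q Q (remnant_proj H) (remnant_proj H)
        (Gamma H R (remnant_incl H p) (remnant_incl H q)) = pure_tensor Q Q p' q'))"


section \<open>The braided rigid category generated by a dual pair\<close>

datatype base_obj = Xob | Yob

datatype mor_term =
    MId "base_obj list"
  | Ev
  | Coev
  | Kap base_obj base_obj
  | KapInv base_obj base_obj
  | MComp mor_term mor_term
  | MTens mor_term mor_term

fun dom_of :: "mor_term \<Rightarrow> base_obj list" where
  "dom_of (MId a) = a"
| "dom_of Ev = [Xob, Yob]"
| "dom_of Coev = []"
| "dom_of (Kap a b) = [a, b]"
| "dom_of (KapInv a b) = [b, a]"
| "dom_of (MComp g f) = dom_of f"
| "dom_of (MTens f g) = dom_of f @ dom_of g"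

fun cod_of :: "mor_term \<Rightarrow> base_obj list" where
  "cod_of (MId a) = a"
| "cod_of Ev = []"
| "cod_of Coev = [Yob, Xob]"
| "cod_of (Kap a b) = [b, a]"
| "cod_of (KapInv a b) = [a, b]"
| "cod_of (MComp g f) = cod_of g"
| "cod_of (MTens f g) = cod_of f @ cod_of g"

fun well_typed :: "mor_term \<Rightarrow> bool" where
  "well_typed (MComp g f) \<longleftrightarrow> well_typed g \<and> well_typed f \<and> dom_of g = cod_of f"
| "well_typed (MTens f g) \<longleftrightarrow> well_typed f \<and> well_typed g"
| "well_typed _ \<longleftrightarrow> True"

text \<open>The extension of \<open>\<kappa>\<close> to words, first in the second and then in the first argument,
  as dictated by the hexagon identities.\<close>

fun kap_letter :: "base_obj \<Rightarrow> base_obj list \<Rightarrow> mor_term" where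
  "kap_letter a [] = MId [a]"
| "kap_letter a (b # bs) =
    MComp (MTens (MId [b]) (kap_letter a bs)) (MTens (Kap a b) (MId bs))"

fun kap_word :: "base_obj list \<Rightarrow> base_obj list \<Rightarrow> mor_term" where
  "kap_word [] bs = MId bs"
| "kap_word (a # as) bs =
    MComp (MTens (kap_letter a bs) (MId as)) (MTens (MId [a]) (kap_word as bs))"

inductive mor_eq :: "mor_term \<Rightarrow> mor_term \<Rightarrow> bool" where
  refl: "well_typed f \<Longrightarrow> mor_eq f f"
| sym: "mor_eq f g \<Longrightarrow> mor_eq g f"
| trans: "mor_eq f g \<Longrightarrow> mor_eq g h \<Longrightarrow> mor_eq f h"
| comp_cong: "mor_eq g g' \<Longrightarrow> mor_eq f f' \<Longrightarrow> dom_of g = cod_of f \<Longrightarrow>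
    mor_eq (MComp g f) (MComp g' f')"
| tens_cong: "mor_eq f f' \<Longrightarrow> mor_eq g g' \<Longrightarrow> mor_eq (MTens f g) (MTens f' g')"
| comp_assoc: "well_typed (MComp h (MComp g f)) \<Longrightarrow>
    mor_eq (MComp h (MComp g f)) (MComp (MComp h g) f)"
| comp_id_left: "well_typed f \<Longrightarrow> mor_eq (MComp (MId (cod_of f)) f) f"
| comp_id_right: "well_typed f \<Longrightarrow> mor_eq (MComp f (MId (dom_of f))) f"
| tens_assoc: "well_typed (MTens f (MTens g h)) \<Longrightarrow>
    mor_eq (MTens f (MTens g h)) (MTens (MTens f g) h)"
| tens_unit_left: "well_typed f \<Longrightarrow> mor_eq (MTens (MId []) f) f"
| tens_unit_right: "well_typed f \<Longrightarrow> mor_eq (MTens f (MId [])) f"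
| tens_id: "mor_eq (MTens (MId a) (MId b)) (MId (a @ b))"
| interchange: "well_typed (MComp g f) \<Longrightarrow> well_typed (MComp g' f') \<Longrightarrow>
    mor_eq (MTens (MComp g f) (MComp g' f')) (MComp (MTens g g') (MTens f f'))"
| kap_inv_left: "mor_eq (MComp (KapInv a b) (Kap a b)) (MId [a, b])"
| kap_inv_right: "mor_eq (MComp (Kap a b) (KapInv a b)) (MId [b, a])"
| kap_natural: "well_typed f \<Longrightarrow> well_typed g \<Longrightarrow>
    mor_eq (MComp (kap_word (cod_of f) (cod_of g)) (MTens f g))
           (MComp (MTens g f) (kap_word (dom_of f) (dom_of g)))"
| zigzag_X: "mor_eq (MComp (MTens Ev (MId [Xob])) (MTens (MId [Xob]) Coev)) (MId [Xob])"
| zigzag_Y: "mor_eq (MComp (MTens (MId [Yob]) Ev) (MTens Coev (MId [Yob]))) (MId [Yob])"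

definition mor_class :: "mor_term \<Rightarrow> mor_term set"
  where "mor_class f = {g. mor_eq f g}"

definition Hom_B :: "base_obj list \<Rightarrow> base_obj list \<Rightarrow> mor_term set set"
  where "Hom_B a b = mor_class ` {f. well_typed f \<and> dom_of f = a \<and> cod_of f = b}"

definition kappa_B :: "base_obj list \<Rightarrow> base_obj list \<Rightarrow> mor_term set"
  where "kappa_B a b = mor_class (kap_word a b)"


section \<open>The functor to SupLat\<close>

definition Xpow :: "'x set \<Rightarrow> base_obj list \<Rightarrow> 'x list set"
  where "Xpow X a = {p. set p \<subseteq> X \<and> length p = length a}"

fun kappa :: "'x set \<Rightarrow> ('x \<times> 'x \<Rightarrow> 'x \<times> 'x) \<Rightarrow> base_obj \<Rightarrow> base_obj \<Rightarrow> 'x \<times> 'x \<Rightarrow> 'x \<times> 'x" where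
  "kappa X r Xob Xob (x, y) = (sigma r x y, gamma r y x)"
| "kappa X r Xob Yob (x, y) = (inv_into X (rho X r x) y, inv_into X (gamma r y) x)"
| "kappa X r Yob Xob (x, y) = (inv_into X (sigma r x) y, inv_into X (tau X r y) x)"
| "kappa X r Yob Yob (x, y) = (rho X r x y, tau X r y x)"

fun omega_term ::
  "'x set \<Rightarrow> ('x \<times> 'x \<Rightarrow> 'x \<times> 'x) \<Rightarrow> mor_term \<Rightarrow> 'x list set \<Rightarrow> 'x list set" where
  "omega_term X r (MId a) U = U"
| "omega_term X r Ev U = {[] | x. x \<in> X \<and> [x, x] \<in> U}"
| "omega_term X r Coev U = {[x, x] | x. x \<in> X \<and> [] \<in> U}"
| "omega_term X r (Kap a b) U =
    {[u, v] | u v. \<exists>x\<in>X. \<exists>y\<in>X. [x, y] \<in> U \<and> kappa X r a b (x, y) = (u, v)}"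
| "omega_term X r (KapInv a b) U =
    {[x, y] | x y. x \<in> X \<and> y \<in> X \<and> (\<exists>u v. [u, v] \<in> U \<and> kappa X r a b (x, y) = (u, v))}"
| "omega_term X r (MComp g f) U = omega_term X r g (omega_term X r f U)"
| "omega_term X r (MTens f g) U =
    {p' @ q' | p' q'. \<exists>p q. p \<in> Xpow X (dom_of f) \<and> q \<in> Xpow X (dom_of g) \<and> p @ q \<in> U \<and>
      p' \<in> omega_term X r f {p} \<and> q' \<in> omega_term X r g {q}}"

text \<open>The value of the functor on a morphism \<open>F\<close> with domain \<open>a\<close>, at a subset \<open>U\<close> of
  \<open>Xpow X a\<close>; it does not depend on the term representing \<open>F\<close>.\<close>

definition omega ::
  "'x set \<Rightarrow> ('x \<times> 'x \<Rightarrow> 'x \<times> 'x) \<Rightarrow> mor_term set \<Rightarrow> 'x list set \<Rightarrow> 'x list set"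
  where "omega X r F U = the_elem ((\<lambda>f. omega_term X r f U) ` F)"


section \<open>FRT reconstruction\<close>

text \<open>The triple \<open>(a, p, q)\<close> stands for the symbol \<open>[p, q]\<close> with index \<open>a\<close>.\<close>

type_synonym 'x frt_symbol = "base_obj list \<times> 'x list \<times> 'x list"

definition frt_symbols :: "'x set \<Rightarrow> 'x frt_symbol set"
  where "frt_symbols X = {(a, p, q). p \<in> Xpow X a \<and> q \<in> Xpow X a}"

definition frt_rels ::
  "'x set \<Rightarrow> ('x \<times> 'x \<Rightarrow> 'x \<times> 'x) \<Rightarrow> ('x frt_symbol set \<times> 'x frt_symbol set) set"
  where "frt_rels X r =
    {({(b, p', q) | p'. p' \<in> omega X r F {p}},
      {(a, p, q') | q'. q' \<in> Xpow X a \<and> q \<in> omega X r F {q'}}) | a b F p q.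
      F \<in> Hom_B a b \<and> p \<in> Xpow X a \<and> q \<in> Xpow X b}"

definition frt_lattice ::
  "'x set \<Rightarrow> ('x \<times> 'x \<Rightarrow> 'x \<times> 'x) \<Rightarrow> 'x frt_symbol set gorder"
  where "frt_lattice X r = presented (frt_symbols X) (frt_rels X r)"

definition frt_gen ::
  "'x set \<Rightarrow> ('x \<times> 'x \<Rightarrow> 'x \<times> 'x) \<Rightarrow> base_obj list \<Rightarrow> 'x list \<Rightarrow> 'x list \<Rightarrow> 'x frt_symbol set"
  where "frt_gen X r a p q = presented_gen (frt_symbols X) (frt_rels X r) (a, p, q)"

definition frt_bialgebra ::
  "'x set \<Rightarrow> ('x \<times> 'x \<Rightarrow> 'x \<times> 'x) \<Rightarrow> 'x frt_symbol set suplat_bialgebra"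
  where "frt_bialgebra X r = (let L = frt_lattice X r in
    \<lparr>carrier = carrier L, eq = eq L, le = le L,
     hmult = (\<lambda>A B. join_ext L (\<lambda>(a, p, q).
       join_ext L (\<lambda>(b, p', q'). frt_gen X r (a @ b) (p @ p') (q @ q')) B) A),
     hone = frt_gen X r [] [] [],
     comult = join_ext (tensor L L) (\<lambda>(a, p, q).
       \<Squnion>\<^bsub>tensor L L\<^esub> {pure_tensor L L (frt_gen X r a p l) (frt_gen X r a l q) | l. l \<in> Xpow X a}),
     counit = join_ext unit_obj (\<lambda>(a, p, q). truth (p = q))\<rparr>)"

definition frt_hopf ::
  "'x set \<Rightarrow> ('x \<times> 'x \<Rightarrow> 'x \<times> 'x) \<Rightarrow> 'x frt_symbol set suplat_hopf"
  where "frt_hopf X r = suplat_bialgebra.extend (frt_bialgebra X r)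
    (suplat_hopf.fields (SOME S. is_antipode (frt_bialgebra X r) S))"

definition frt_cqt ::
  "'x set \<Rightarrow> ('x \<times> 'x \<Rightarrow> 'x \<times> 'x) \<Rightarrow> 'x frt_symbol set \<Rightarrow> 'x frt_symbol set \<Rightarrow> unit set"
  where "frt_cqt X r A B = join_ext unit_obj (\<lambda>(a, p, q).
    join_ext unit_obj (\<lambda>(b, p', q'). truth (omega X r (kappa_B a b) {p @ p'} = {q' @ q})) B) A"

end

theory Submission
  imports Defs "HOL-Algebra.Generated_Groups"
begin

text \<open>
  Write \<open>[p, q]\<close> for the generators of \<open>H\<close>, the FRT bialgebra, and read a pair \<open>(a, p)\<close> as
  the signed word whose letters are the entries of \<open>p\<close>, positive at the places where \<open>a\<close> has
  \<open>Xob\<close> and inverted where it has \<open>Yob\<close>. Every morphism of the braided category acts as a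
  relation between signed words (\<open>mor_rel\<close>), and \<open>p, q\<close> run over the words of the right type.

  Why the remnant is the universal group: the counit is nonempty on \<open>[p, q]\<close> exactly if \<open>p
  = q\<close>, and the off-diagonal generators form an element of \<open>H\<close>, which is therefore the join \<open>D\<close>
  of the kernel of the counit. Once \<open>D\<close> is collapsed, the relation attached to a morphism \<open>f\<close>
  and words \<open>p, q\<close> says nothing unless \<open>f\<close> relates \<open>p\<close> to \<open>q\<close>, and then it identifies \<open>[p, p]\<close>
  with \<open>[q, q]\<close>. The quotient \<open>Q\<close> is thus the power set of the set of signed words modulo the
  equivalence generated by all morphisms. The evaluation and coevaluation contribute \<open>x x\<inverse> = 1 =
  x\<inverse> x\<close>, the braiding of \<open>Xob\<close> with itself contributes \<open>x y = \<sigma>\<^sub>x(y) \<gamma>\<^sub>y(x)\<close>, and the three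
  other braidings only contribute consequences of these, so the equivalence classes are the
  elements of \<open>G(X, r)\<close> (\<open>word_class_eq_iff_sim\<close>). Words are multiplied by concatenation, and
  the group-like elements are the singletons (\<open>grouplike_iff\<close>).

  Why the braiding is the right one: the co-quasitriangular structure records the
  permutation of pairs of words given by the categorical braiding (\<open>word_braid\<close>). At a pair of
  generators \<open>\<Gamma>\<close> is a single pure tensor, which survives in \<open>Q\<close> only if the generators are
  diagonal, and then gives the pair of classes of the braided words (\<open>Gamma_hull\<close>). The same
  formula defines a braiding operator on \<open>G(X, r)\<close> that extends \<open>r\<close>, its axioms being the
  hexagon identities. As a braiding operator is determined by its values on generators
  (\<open>braiding_operator_unique\<close>), it is the operator \<open>universal_braiding\<close>.

  Two things need work. First, the functor must be well defined: the relations of words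
  have to satisfy all identities of the category, above all the naturality of the braiding. This
  reduces to the Yang--Baxter equation for letters of arbitrary signs, where a solution is
  regarded as a set of labelled squares and the equation as a way of completing three edges to a
  labelled cube (\<open>cube_signed\<close>). Second, the structure maps of \<open>H\<close> are joins over the members of
  elements of tensor products. Such joins are never evaluated; they are compared by asking which
  elements lie above them. This turns every Sweedler expression into a predicate that respects
  joins in each variable, and such a predicate may be tested on generators (\<open>sweedler_symbols\<close>,
  \<open>sweedler3_symbols\<close>).
\<close>

section \<open>Predicates respecting joins\<close>

text \<open>An element of a complete lattice is determined by the elements above it. The predicates
  \<open>\<lambda>x. f x \<le> m\<close> for a join-preserving \<open>f\<close> have the following property, and so have the
  combinations of them used below; a predicate with this property is the characteristic function
  of a principal ideal.\<close>

definition join_stable :: "('a, 'c) gorder_scheme \<Rightarrow> ('a \<Rightarrow> bool) \<Rightarrow> bool"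
  where "join_stable L P \<longleftrightarrow> (\<forall>A \<subseteq> carrier L. P (\<Squnion>\<^bsub>L\<^esub> A) \<longleftrightarrow> (\<forall>a\<in>A. P a))"

lemma join_stableD: "join_stable L P \<Longrightarrow> A \<subseteq> carrier L \<Longrightarrow> P (\<Squnion>\<^bsub>L\<^esub> A) \<longleftrightarrow> (\<forall>a\<in>A. P a)"
  by (simp add: join_stable_def)

lemma join_stable_ball:
  assumes "\<And>i. i \<in> I \<Longrightarrow> join_stable L (P i)" shows "join_stable L (\<lambda>x. \<forall>i\<in>I. P i x)"
  using assms unfolding join_stable_def by blast

text \<open>A disjunction with a constant is again such a predicate, because an empty join satisfies
  \<open>P\<close>. This is what makes the pairing of two scalars, which vanishes if one of them does,
  respect joins in each variable.\<close>

lemma join_stable_disj: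
  assumes "join_stable L P" shows "join_stable L (\<lambda>x. c \<or> P x)" "join_stable L (\<lambda>x. P x \<or> c)"
  using assms unfolding join_stable_def by blast+

lemma (in complete_lattice) sup_le_iff:
  assumes "A \<subseteq> carrier L" "m \<in> carrier L"
  shows "\<Squnion> A \<sqsubseteq> m \<longleftrightarrow> (\<forall>a\<in>A. a \<sqsubseteq> m)"
proof
  assume "\<Squnion> A \<sqsubseteq> m"
  then show "\<forall>a\<in>A. a \<sqsubseteq> m"
    using assms by (meson le_trans subsetD sup_closed sup_upper)
next
  assume "\<forall>a\<in>A. a \<sqsubseteq> m"
  then show "\<Squnion> A \<sqsubseteq> m"
    using assms by (intro sup_least) (auto simp: Upper_def)
qed

lemma join_stable_morphism:
  assumes "sup_morphism L M f" "join_stable M P"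
  shows "join_stable L (\<lambda>x. P (f x))"
  unfolding join_stable_def
proof (intro allI impI)
  fix A assume A: "A \<subseteq> carrier L"
  then have "f ` A \<subseteq> carrier M" "f (\<Squnion>\<^bsub>L\<^esub> A) = \<Squnion>\<^bsub>M\<^esub> (f ` A)"
    using assms(1) by (auto simp: sup_morphism_def)
  then show "P (f (\<Squnion>\<^bsub>L\<^esub> A)) \<longleftrightarrow> (\<forall>a\<in>A. P (f a))"
    using join_stableD[OF assms(2)] by simp
qed

text \<open>Joins, and with them tensor products, depend only on the carrier and the order. These
  congruences allow the records for a lattice, a bialgebra and a Hopf algebra with the same
  underlying lattice to be exchanged.\<close>

lemma sup_cong:
  assumes "carrier L = carrier M" "le L = le M"
  shows "\<Squnion>\<^bsub>L\<^esub> A = \<Squnion>\<^bsub>M\<^esub> A"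
  using assms by (simp add: sup_def least_def Upper_def)

lemma bottom_cong:
  assumes "carrier L = carrier M" "le L = le M"
  shows "\<bottom>\<^bsub>L\<^esub> = \<bottom>\<^bsub>M\<^esub>"
  using assms by (simp add: bottom_def least_def)

lemma tensor_cong:
  assumes "carrier L = carrier L'" "le L = le L'" "carrier M = carrier M'" "le M = le M'"
  shows "tensor L M = tensor L' M'" "pure_tensor L M = pure_tensor L' M'"
  using sup_cong[OF assms(1,2)] sup_cong[OF assms(3,4)] assms(1,3)
  by (simp_all add: tensor_def tensor_rels_def pure_tensor_def fun_eq_iff)

lemma tensor_map_cong:
  assumes "carrier L = carrier L'" "le L = le L'" "carrier M = carrier M'" "le M = le M'"
  shows "tensor_map L M = tensor_map L' M'"
  using tensor_cong[OF assms] by (simp add: tensor_map_def fun_eq_iff)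

lemma join_stable_cong:
  assumes "carrier L = carrier L'" "le L = le L'"
  shows "join_stable L = join_stable L'"
  using sup_cong[OF assms(1,2)] assms(1) by (simp add: join_stable_def fun_eq_iff)

section \<open>Lattices given by generators and relations\<close>

locale presentation =
  fixes G :: "'g set" and E :: "('g set \<times> 'g set) set"
  assumes sides: "(A, B) \<in> E \<Longrightarrow> A \<subseteq> G \<and> B \<subseteq> G"
begin

sublocale complete_lattice "presented G E"
  by (rule presented_complete_lattice[OF sides])

lemma le_presented [simp]: "le (presented G E) = (\<subseteq>)"
  by (simp add: presented_def)

lemma subset_G: "C \<in> carrier (presented G E) \<Longrightarrow> C \<subseteq> G"
  by (simp add: presented_iff)

lemma sup_subset_iff:
  "\<C> \<subseteq> carrier (presented G E) \<Longrightarrow> D \<in> carrier (presented G E) \<Longrightarrow>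
    \<Squnion>\<^bsub>presented G E\<^esub> \<C> \<subseteq> D \<longleftrightarrow> (\<forall>C\<in>\<C>. C \<subseteq> D)"
  using sup_le_iff[of \<C> D] by simp

lemma gen_closed [simp]: "g \<in> G \<Longrightarrow> presented_gen G E g \<in> carrier (presented G E)"
  and gen_member: "g \<in> G \<Longrightarrow> g \<in> presented_gen G E g"
  using presented_gen_closed[OF sides] by blast+

lemma gen_subset_iff:
  "g \<in> G \<Longrightarrow> D \<in> carrier (presented G E) \<Longrightarrow> presented_gen G E g \<subseteq> D \<longleftrightarrow> g \<in> D"
  using gen_member by (auto simp: presented_gen_def)

lemma sup_gen_rel:
  assumes "(A, B) \<in> E"
  shows "\<Squnion>\<^bsub>presented G E\<^esub> (presented_gen G E ` A) = \<Squnion>\<^bsub>presented G E\<^esub> (presented_gen G E ` B)"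
proof -
  have s: "A \<subseteq> G" "B \<subseteq> G" using sides[OF assms] by auto
  then have im: "presented_gen G E ` A \<subseteq> carrier (presented G E)"
    "presented_gen G E ` B \<subseteq> carrier (presented G E)" by auto
  have "\<Squnion>\<^bsub>presented G E\<^esub> (presented_gen G E ` A) \<subseteq> Z \<longleftrightarrow>
      \<Squnion>\<^bsub>presented G E\<^esub> (presented_gen G E ` B) \<subseteq> Z" if Z: "Z \<in> carrier (presented G E)" for Z
  proof -
    have "(\<forall>C\<in>presented_gen G E ` K. C \<subseteq> Z) \<longleftrightarrow> K \<subseteq> Z" if "K \<subseteq> G" for K
      using gen_subset_iff[OF _ Z] that by blast
    moreover have "A \<subseteq> Z \<longleftrightarrow> B \<subseteq> Z" using Z assms by (simp add: presented_iff)
    ultimately show ?thesis using sup_subset_iff[OF im(1) Z] sup_subset_iff[OF im(2) Z] s by simp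
  qed
  then show ?thesis using sup_closed[OF im(1)] sup_closed[OF im(2)] by blast
qed

text \<open>The two sides of a relation have the same join, so a predicate respecting joins cannot
  tell them apart.\<close>

lemma join_stable_rel:
  assumes "join_stable (presented G E) P" "(A, B) \<in> E"
  shows "(\<forall>g\<in>A. P (presented_gen G E g)) \<longleftrightarrow> (\<forall>g\<in>B. P (presented_gen G E g))"
proof -
  have "presented_gen G E ` A \<subseteq> carrier (presented G E)" "presented_gen G E ` B \<subseteq> carrier (presented G E)"
    using sides[OF assms(2)] by auto
  from join_stableD[OF assms(1) this(1)] join_stableD[OF assms(1) this(2)] show ?thesis
    using sup_gen_rel[OF assms(2)] by simp
qed

text \<open>The converse of the previous lemma, and the way in which predicates on generators are
  extended: those that do not distinguish the two sides of any relation are membership in an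
  element of the presented lattice.\<close>

lemma join_stable_extension:
  assumes "\<And>A B. (A, B) \<in> E \<Longrightarrow> (\<forall>g\<in>A. P g) \<longleftrightarrow> (\<forall>g\<in>B. P g)"
  shows "join_stable (presented G E) (\<lambda>C. \<forall>g\<in>C. P g)"
    and "g \<in> G \<Longrightarrow> (\<forall>h\<in>presented_gen G E g. P h) \<longleftrightarrow> P g"
proof -
  let ?Z = "{g \<in> G. P g}"
  have Z: "?Z \<in> carrier (presented G E)"
  proof -
    have "A \<subseteq> ?Z \<longleftrightarrow> B \<subseteq> ?Z" if "(A, B) \<in> E" for A B
      using assms[OF that] sides[OF that] by blast
    then show ?thesis unfolding presented_iff by blast
  qed
  have eq: "(\<forall>g\<in>C. P g) \<longleftrightarrow> C \<subseteq> ?Z" if "C \<in> carrier (presented G E)" for C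
    using subset_G[OF that] by blast
  have "(\<forall>g\<in>\<Squnion>\<^bsub>presented G E\<^esub> \<C>. P g) \<longleftrightarrow> (\<forall>C\<in>\<C>. \<forall>g\<in>C. P g)" if "\<C> \<subseteq> carrier (presented G E)" for \<C>
  proof -
    have "(\<forall>g\<in>\<Squnion>\<^bsub>presented G E\<^esub> \<C>. P g) \<longleftrightarrow> (\<forall>C\<in>\<C>. C \<subseteq> ?Z)"
      unfolding eq[OF sup_closed[OF that]] by (rule sup_subset_iff[OF that Z])
    also have "\<dots> \<longleftrightarrow> (\<forall>C\<in>\<C>. \<forall>g\<in>C. P g)"
      by (rule ball_cong[OF HOL.refl], rule eq[symmetric]) (use that in blast)
    finally show ?thesis .
  qed
  then show "join_stable (presented G E) (\<lambda>C. \<forall>g\<in>C. P g)" by (simp add: join_stable_def)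
  show "(\<forall>h\<in>presented_gen G E g. P h) \<longleftrightarrow> P g" if "g \<in> G"
    using eq[OF gen_closed[OF that]] gen_subset_iff[OF that Z] that by simp
qed

end

lemma join_ext_le_iff:
  assumes "complete_lattice M" "f ` C \<subseteq> carrier M" "m \<in> carrier M"
  shows "join_ext M f C \<sqsubseteq>\<^bsub>M\<^esub> m \<longleftrightarrow> (\<forall>g\<in>C. f g \<sqsubseteq>\<^bsub>M\<^esub> m)"
  using complete_lattice.sup_le_iff[OF assms] by (simp add: join_ext_def)

section \<open>Tensor products of complete lattices\<close>

lemma presentation_tensor:
  assumes "complete_lattice L" "complete_lattice M"
  shows "presentation (carrier L \<times> carrier M) (tensor_rels L M)"
proof -
  interpret L: complete_lattice L by fact
  interpret M: complete_lattice M by fact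
  show ?thesis by unfold_locales (auto simp: tensor_rels_def)
qed

lemma tensor_complete_lattice:
  assumes "complete_lattice L" "complete_lattice M"
  shows "complete_lattice (tensor L M)"
proof -
  interpret presentation "carrier L \<times> carrier M" "tensor_rels L M"
    by (rule presentation_tensor[OF assms])
  show ?thesis unfolding tensor_def by (rule complete_lattice_axioms)
qed

lemma le_tensor [simp]: "le (tensor L M) = (\<subseteq>)"
  by (simp add: tensor_def presented_def)

text \<open>Elements of a tensor product are the binary predicates that respect joins in each
  variable. All computations in tensor products below go through this description.\<close>

lemma tensor_iff:
  "Z \<in> carrier (tensor L M) \<longleftrightarrow> Z \<subseteq> carrier L \<times> carrier M \<and>
    (\<forall>m\<in>carrier M. join_stable L (\<lambda>l. (l, m) \<in> Z)) \<and>
    (\<forall>l\<in>carrier L. join_stable M (\<lambda>m. (l, m) \<in> Z))"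
proof -
  have "(\<forall>A B. (A, B) \<in> tensor_rels L M \<longrightarrow> A \<subseteq> Z \<longleftrightarrow> B \<subseteq> Z) \<longleftrightarrow>
    (\<forall>m\<in>carrier M. join_stable L (\<lambda>l. (l, m) \<in> Z)) \<and>
    (\<forall>l\<in>carrier L. join_stable M (\<lambda>m. (l, m) \<in> Z))"
  proof -
    have e1: "A \<times> {m} \<subseteq> Z \<longleftrightarrow> (\<forall>a\<in>A. (a, m) \<in> Z)" for A m by auto
    have e2: "{l} \<times> B \<subseteq> Z \<longleftrightarrow> (\<forall>b\<in>B. (l, b) \<in> Z)" for B l by auto
    show ?thesis (is "?L \<longleftrightarrow> ?R")
    proof
      assume L: ?L
      have "({(\<Squnion>\<^bsub>L\<^esub> A, m)} \<subseteq> Z) = (A \<times> {m} \<subseteq> Z)" if "A \<subseteq> carrier L" "m \<in> carrier M" for A m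
        using that by (intro L[rule_format]) (auto simp: tensor_rels_def)
      moreover have "({(l, \<Squnion>\<^bsub>M\<^esub> B)} \<subseteq> Z) = ({l} \<times> B \<subseteq> Z)" if "l \<in> carrier L" "B \<subseteq> carrier M" for l B
        using that by (intro L[rule_format]) (auto simp: tensor_rels_def)
      ultimately show ?R unfolding e1 e2 join_stable_def by simp
    next
      assume R: ?R
      show ?L
      proof (intro allI impI)
        fix A B assume "(A, B) \<in> tensor_rels L M"
        then consider A' m where "A = {(\<Squnion>\<^bsub>L\<^esub> A', m)}" "B = A' \<times> {m}" "A' \<subseteq> carrier L" "m \<in> carrier M"
          | l B' where "A = {(l, \<Squnion>\<^bsub>M\<^esub> B')}" "B = {l} \<times> B'" "l \<in> carrier L" "B' \<subseteq> carrier M"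
          unfolding tensor_rels_def by blast
        then show "A \<subseteq> Z \<longleftrightarrow> B \<subseteq> Z"
        proof cases
          case 1
          then show ?thesis using R join_stableD[of L "\<lambda>l. (l, m) \<in> Z" A'] by (simp add: e1)
        next
          case 2
          then show ?thesis using R join_stableD[of M "\<lambda>m. (l, m) \<in> Z" B'] by (simp add: e2)
        qed
      qed
    qed
  qed
  then show ?thesis by (simp add: tensor_def presented_iff)
qed

lemma tensor_Collect:
  assumes "complete_lattice L" "complete_lattice M"
    "\<And>m. m \<in> carrier M \<Longrightarrow> join_stable L (\<lambda>l. P l m)"
    "\<And>l. l \<in> carrier L \<Longrightarrow> join_stable M (\<lambda>m. P l m)"
  shows "{(l, m). l \<in> carrier L \<and> m \<in> carrier M \<and> P l m} \<in> carrier (tensor L M)"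
proof -
  interpret L: complete_lattice L by fact
  interpret M: complete_lattice M by fact
  show ?thesis
    using assms(3,4) unfolding tensor_iff join_stable_def by (auto simp: subset_iff)
qed

lemma pure_tensor_subset_iff:
  assumes "complete_lattice L" "complete_lattice M" "l \<in> carrier L" "m \<in> carrier M"
    "Z \<in> carrier (tensor L M)"
  shows "pure_tensor L M l m \<subseteq> Z \<longleftrightarrow> (l, m) \<in> Z"
proof -
  interpret presentation "carrier L \<times> carrier M" "tensor_rels L M"
    by (rule presentation_tensor[OF assms(1,2)])
  show ?thesis unfolding pure_tensor_def
    by (rule gen_subset_iff) (use assms in \<open>auto simp: tensor_def\<close>)
qed

lemma pure_tensor_closed:
  assumes "complete_lattice L" "complete_lattice M" "l \<in> carrier L" "m \<in> carrier M"
  shows "pure_tensor L M l m \<in> carrier (tensor L M)"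
proof -
  interpret presentation "carrier L \<times> carrier M" "tensor_rels L M"
    by (rule presentation_tensor[OF assms(1,2)])
  show ?thesis unfolding pure_tensor_def tensor_def
    by (rule gen_closed) (use assms in auto)
qed

lemma tensor_map_closed:
  assumes "complete_lattice L'" "complete_lattice M'"
    "\<And>l m. (l, m) \<in> Z \<Longrightarrow> f l \<in> carrier L' \<and> g m \<in> carrier M'"
  shows "tensor_map L' M' f g Z \<in> carrier (tensor L' M')"
proof -
  interpret complete_lattice "tensor L' M'" by (rule tensor_complete_lattice[OF assms(1,2)])
  show ?thesis unfolding tensor_map_def join_ext_def
    by (rule sup_closed) (use assms pure_tensor_closed[OF assms(1,2)] in auto)
qed

lemma tensor_map_subset_iff:
  assumes "complete_lattice L'" "complete_lattice M'"
    "\<And>l m. (l, m) \<in> Z \<Longrightarrow> f l \<in> carrier L' \<and> g m \<in> carrier M'"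
    "Z' \<in> carrier (tensor L' M')"
  shows "tensor_map L' M' f g Z \<subseteq> Z' \<longleftrightarrow> (\<forall>(l, m)\<in>Z. (f l, g m) \<in> Z')"
proof -
  have "tensor_map L' M' f g Z \<subseteq> Z' \<longleftrightarrow>
    (\<forall>p\<in>Z. (\<lambda>(l, m). pure_tensor L' M' (f l) (g m)) p \<subseteq> Z')"
    unfolding tensor_map_def
    by (subst join_ext_le_iff[OF tensor_complete_lattice[OF assms(1,2)], simplified])
      (use assms pure_tensor_closed[OF assms(1,2)] in auto)
  also have "\<dots> \<longleftrightarrow> (\<forall>(l, m)\<in>Z. (f l, g m) \<in> Z')"
  proof (rule ball_cong[OF HOL.refl])
    fix p assume "p \<in> Z"
    then show "(\<lambda>(l, m). pure_tensor L' M' (f l) (g m)) p \<subseteq> Z' \<longleftrightarrow> (case p of (l, m) \<Rightarrow> (f l, g m) \<in> Z')"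
      using pure_tensor_subset_iff[OF assms(1,2) _ _ assms(4)] assms(3)
      by (cases p) (simp del: le_tensor)
  qed
  finally show ?thesis .
qed

lemma subset_antisym_Galois:
  assumes "C \<in> K" "D \<in> K" "\<And>Z. Z \<in> K \<Longrightarrow> C \<subseteq> Z \<longleftrightarrow> D \<subseteq> Z"
  shows "C = D"
  using assms by blast

section \<open>The unit object\<close>

lemma unit_obj_complete_lattice: "complete_lattice unit_obj"
proof -
  have po: "partial_order unit_obj" by unfold_locales (auto simp: unit_obj_def)
  show ?thesis
  proof (rule partial_order.complete_lattice_criterion1[OF po])
    show "\<exists>g. greatest unit_obj g (carrier unit_obj)"
      by (rule exI[of _ UNIV]) (simp add: greatest_def unit_obj_def)
    show "\<exists>i. greatest unit_obj i (Lower unit_obj A)" for A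
      by (rule exI[of _ "\<Inter>A"]) (auto simp: greatest_def unit_obj_def Lower_def)
  qed
qed

lemma sup_unit_obj: "\<Squnion>\<^bsub>unit_obj\<^esub> A = \<Union>A"
proof -
  interpret complete_lattice unit_obj by (rule unit_obj_complete_lattice)
  have "\<Squnion>\<^bsub>unit_obj\<^esub> A \<subseteq> m \<longleftrightarrow> \<Union>A \<subseteq> m" for m
    using sup_le_iff[of A m] by (auto simp: unit_obj_def)
  then show ?thesis by blast
qed

lemma unit_set_eqI: "(s = {} \<longleftrightarrow> t = {}) \<Longrightarrow> s = t" for s t :: "unit set"
  by auto

text \<open>A scalar is known once it is known whether it vanishes.\<close>

lemma sup_morphism_unit_iff:
  "sup_morphism L unit_obj f \<longleftrightarrow> join_stable L (\<lambda>x. f x = {})"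
proof -
  have "f (\<Squnion>\<^bsub>L\<^esub> A) = \<Union>(f ` A) \<longleftrightarrow> (f (\<Squnion>\<^bsub>L\<^esub> A) = {} \<longleftrightarrow> (\<forall>a\<in>A. f a = {}))" for A
  proof -
    have "\<Union>(f ` A) = {} \<longleftrightarrow> (\<forall>a\<in>A. f a = {})" by auto
    then show ?thesis using unit_set_eqI[of "f (\<Squnion>\<^bsub>L\<^esub> A)" "\<Union>(f ` A)"] by metis
  qed
  then show ?thesis
    by (simp add: sup_morphism_def join_stable_def sup_unit_obj) (simp add: unit_obj_def)
qed

lemma join_ext_unit_empty_iff: "join_ext unit_obj f C = {} \<longleftrightarrow> (\<forall>g\<in>C. f g = {})"
  by (auto simp: join_ext_def sup_unit_obj)

lemma truth_empty_iff [simp]: "truth P = {} \<longleftrightarrow> \<not> P"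
  by (simp add: truth_def)

section \<open>Crossings and the Yang--Baxter equation for signed letters\<close>

locale ybe =
  fixes X :: "'x set" and r :: "'x \<times> 'x \<Rightarrow> 'x \<times> 'x"
  assumes solution: "ybe_solution X r"
begin

text \<open>A square with the labels \<open>x, y\<close> along one path and \<open>u, v\<close> along the other path between
  the same two corners. Non-degeneracy makes this relation symmetric in the corners: the two
  labels at any one of the four corners determine the other two labels.\<close>

definition crossing :: "'x \<Rightarrow> 'x \<Rightarrow> 'x \<Rightarrow> 'x \<Rightarrow> bool"
  where "crossing x y u v \<longleftrightarrow> x \<in> X \<and> y \<in> X \<and> r (x, y) = (u, v)"

lemma crossing_closed:
  assumes "crossing x y u v"
  shows "x \<in> X" "y \<in> X" "u \<in> X" "v \<in> X"
proof -
  show "x \<in> X" "y \<in> X" using assms by (auto simp: crossing_def)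
  have "r (x, y) \<in> X \<times> X"
    using solution assms unfolding ybe_solution_def crossing_def by (meson SigmaI bij_betw_apply)
  then show "u \<in> X" "v \<in> X" using assms by (auto simp: crossing_def)
qed

lemma crossing_in: "x \<in> X \<Longrightarrow> y \<in> X \<Longrightarrow> \<exists>u v. crossing x y u v"
  by (cases "r (x, y)") (auto simp: crossing_def)

lemma crossing_out:
  assumes "u \<in> X" "v \<in> X"
  shows "\<exists>x y. crossing x y u v"
proof -
  have "(u, v) \<in> r ` (X \<times> X)"
    using solution assms by (simp add: ybe_solution_def bij_betw_def)
  then obtain p where p: "p \<in> X \<times> X" "(u, v) = r p" by (rule imageE) simp
  then show ?thesis by (intro exI[of _ "fst p"] exI[of _ "snd p"]) (auto simp: crossing_def)
qed

lemma crossing_left: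
  assumes "x \<in> X" "u \<in> X"
  shows "\<exists>y v. crossing x y u v"
proof -
  have "u \<in> sigma r x ` X"
    using solution assms by (simp add: ybe_solution_def bij_betw_def)
  then obtain y where "y \<in> X" "u = sigma r x y" by (rule imageE) simp
  then show ?thesis using assms
    by (intro exI[of _ y] exI[of _ "snd (r (x, y))"]) (simp add: crossing_def sigma_def)
qed

lemma crossing_right:
  assumes "y \<in> X" "v \<in> X"
  shows "\<exists>x u. crossing x y u v"
proof -
  have "v \<in> gamma r y ` X"
    using solution assms by (simp add: ybe_solution_def bij_betw_def)
  then obtain x where "x \<in> X" "v = gamma r y x" by (rule imageE) simp
  then show ?thesis using assms
    by (intro exI[of _ x] exI[of _ "fst (r (x, y))"]) (simp add: crossing_def gamma_def)
qed

lemma crossing_in_unique: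
  "crossing x y u v \<Longrightarrow> crossing x y u' v' \<Longrightarrow> u = u' \<and> v = v'"
  by (auto simp: crossing_def)

lemma crossing_out_unique:
  assumes "crossing x y u v" "crossing x' y' u v"
  shows "x = x' \<and> y = y'"
proof -
  have "inj_on r (X \<times> X)" using solution by (auto simp: ybe_solution_def bij_betw_def)
  then have "(x, y) = (x', y')"
    by (rule inj_onD) (use assms in \<open>auto simp: crossing_def\<close>)
  then show ?thesis by simp
qed

lemma crossing_left_unique:
  assumes "crossing x y u v" "crossing x y' u v'"
  shows "y = y' \<and> v = v'"
proof -
  have "x \<in> X" using assms by (auto simp: crossing_def)
  then have "inj_on (sigma r x) X" using solution by (auto simp: ybe_solution_def bij_betw_def)
  then have "y = y'"
    by (rule inj_onD) (use assms in \<open>auto simp: crossing_def sigma_def\<close>)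
  then show ?thesis using assms by (auto simp: crossing_def)
qed

lemma crossing_right_unique:
  assumes "crossing x y u v" "crossing x' y u' v"
  shows "x = x' \<and> u = u'"
proof -
  have "y \<in> X" using assms by (auto simp: crossing_def)
  then have "inj_on (gamma r y) X" using solution by (auto simp: ybe_solution_def bij_betw_def)
  then have "x = x'"
    by (rule inj_onD) (use assms in \<open>auto simp: crossing_def gamma_def\<close>)
  then show ?thesis using assms by (auto simp: crossing_def)
qed

text \<open>The twelve edges of a cube, all six faces of which are squares of the solution. The
  function \<open>ex\<close> gives the four edges in the first direction, indexed by the positions in the
  second and third direction; likewise \<open>ey\<close> is indexed by the first and third, and \<open>ez\<close> by the
  first and second position.\<close>

definition cube :: "(bool \<Rightarrow> bool \<Rightarrow> 'x) \<Rightarrow> (bool \<Rightarrow> bool \<Rightarrow> 'x) \<Rightarrow> (bool \<Rightarrow> bool \<Rightarrow> 'x) \<Rightarrow> bool"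
  where "cube ex ey ez \<longleftrightarrow>
    (\<forall>k. crossing (ex False k) (ey True k) (ey False k) (ex True k)) \<and>
    (\<forall>j. crossing (ex j False) (ez True j) (ez False j) (ex j True)) \<and>
    (\<forall>i. crossing (ey i False) (ez i True) (ez i False) (ey i True))"

text \<open>This is the Yang--Baxter equation: its two sides fill the two halves of the surface of a
  cube, starting from the path \<open>x, y, z\<close>, and agreement of the results glues the halves
  together.\<close>

lemma cube_positive:
  assumes "x \<in> X" "y \<in> X" "z \<in> X"
  obtains ex ey ez where "cube ex ey ez"
    "ex False False = x" "ey True False = y" "ez True True = z"
proof -
  obtain y0 x1 where 1: "crossing x y y0 x1" using crossing_in assms by blast
  obtain z0 x2 where 2: "crossing x1 z z0 x2" using crossing_in assms crossing_closed[OF 1] by blast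
  obtain z00 y01 where 3: "crossing y0 z0 z00 y01" using crossing_in crossing_closed[OF 1] crossing_closed[OF 2] by blast
  obtain z1 y1 where 4: "crossing y z z1 y1" using crossing_in assms by blast
  obtain z2 x3 where 5: "crossing x z1 z2 x3" using crossing_in assms crossing_closed[OF 4] by blast
  obtain y2 x4 where 6: "crossing x3 y1 y2 x4" using crossing_in crossing_closed[OF 4] crossing_closed[OF 5] by blast
  have "on23 r (on12 r (on23 r (x, y, z))) = on12 r (on23 r (on12 r (x, y, z)))"
    using solution assms unfolding ybe_solution_def by blast
  moreover have "on23 r (on12 r (on23 r (x, y, z))) = (z2, y2, x4)"
    using 4 5 6 by (simp add: on12_def on23_def crossing_def)
  moreover have "on12 r (on23 r (on12 r (x, y, z))) = (z00, y01, x2)"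
    using 1 2 3 by (simp add: on12_def on23_def crossing_def)
  ultimately have e: "z2 = z00" "y2 = y01" "x4 = x2" by auto
  \<comment> \<open>the labels of the two halves, with the three common ones identified by \<open>e\<close>\<close>
  define ex where "ex = (\<lambda>j k. if j then (if k then x2 else x1) else (if k then x3 else x))"
  define ey where "ey = (\<lambda>i k. if i then (if k then y1 else y) else (if k then y01 else y0))"
  define ez where "ez = (\<lambda>i j. if i then (if j then z else z1) else (if j then z0 else z00))"
  show ?thesis
  proof (rule that[of ex ey ez])
    show "cube ex ey ez"
      unfolding cube_def
    proof (intro conjI allI)
      fix b
      show "crossing (ex False b) (ey True b) (ey False b) (ex True b)"
        using 1 6 e by (cases b) (simp_all add: ex_def ey_def)
      show "crossing (ex b False) (ez True b) (ez False b) (ex b True)"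
        using 2 5 e by (cases b) (simp_all add: ex_def ez_def)
      show "crossing (ey b False) (ez b True) (ez b False) (ey b True)"
        using 3 4 e by (cases b) (simp_all add: ey_def ez_def)
    qed
  qed (simp_all add: ex_def ey_def ez_def)
qed

lemma cube_faces:
  assumes "cube ex ey ez"
  shows "crossing (ex False k) (ey True k) (ey False k) (ex True k)"
    "crossing (ex j False) (ez True j) (ez False j) (ex j True)"
    "crossing (ey i False) (ez i True) (ez i False) (ey i True)"
  using assms unfolding cube_def by blast+

lemmas crossing_functional =
  crossing_in_unique crossing_out_unique crossing_left_unique crossing_right_unique

text \<open>Any path through the three directions extends to a cube, also if it runs against the
  orientation of some edges. The signs tell which corner the path starts from. By non-degeneracy
  a few faces can be filled in, one after the other, until the positive path from the corner
  \<open>(0, 0, 0)\<close> is known. The cube over this path contains the faces just filled, as two adjacent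
  edges determine a face, and hence the given edges.\<close>

lemma cube_signed:
  assumes "x \<in> X" "y \<in> X" "z \<in> X"
  shows "\<exists>ex ey ez. cube ex ey ez \<and> ex (\<not> b) (\<not> c) = x \<and> ey a (\<not> c) = y \<and> ez a b = z"
proof -
  consider "a" "b" "c" | "\<not> a" "b" "c" | "a" "\<not> b" "c" | "a" "b" "\<not> c"
    | "\<not> a" "\<not> b" "c" | "\<not> a" "b" "\<not> c" | "a" "\<not> b" "\<not> c" | "\<not> a" "\<not> b" "\<not> c"
    by (cases a; cases b; cases c; simp)
  then show ?thesis
  proof cases
    case 1
    obtain ex ey ez where "cube ex ey ez"
      "ex False False = x" "ey True False = y" "ez True True = z"
      using cube_positive[OF assms] .
    then show ?thesis using 1 by (intro exI[of _ ex] exI[of _ ey] exI[of _ ez]) simp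
  next
    case 2
    obtain y10 x10 where 1: "crossing x y10 y x10" using crossing_left assms by blast
    obtain z00 y01 where 2: "crossing y z z00 y01" using crossing_in assms by blast
    obtain z11 x11 where 3: "crossing x10 z11 z x11"
      using crossing_left assms crossing_closed[OF 1] by blast
    obtain ex ey ez where c: "cube ex ey ez"
      "ex False False = x" "ey True False = y10" "ez True True = z11"
      using cube_positive[of x y10 z11] assms crossing_closed[OF 1] crossing_closed[OF 3] by blast
    note f = cube_faces[OF c(1)]
    have e1: "ey False False = y" "ex True False = x10"
      using crossing_in_unique[OF f(1)[of False, unfolded c ] 1] by simp_all
    have e2: "ez False True = z"
      using crossing_in_unique[OF f(2)[of True, unfolded c e1] 3] by simp_all
    show ?thesis using c e1 e2 \<open>\<not> a\<close> \<open>b\<close> \<open>c\<close> by (intro exI[of _ ex] exI[of _ ey] exI[of _ ez]) simp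
  next
    case 3
    obtain x00 y00 where 1: "crossing x00 y y00 x" using crossing_right assms by blast
    obtain z11 y11 where 2: "crossing y z11 z y11" using crossing_left assms by blast
    obtain ex ey ez where c: "cube ex ey ez"
      "ex False False = x00" "ey True False = y" "ez True True = z11"
      using cube_positive[of x00 y z11] assms crossing_closed[OF 1] crossing_closed[OF 2] by blast
    note f = cube_faces[OF c(1)]
    have e1: "ex True False = x"
      using crossing_in_unique[OF f(1)[of False, unfolded c ] 1] by simp_all
    have e2: "ez True False = z"
      using crossing_in_unique[OF f(3)[of True, unfolded c e1] 2] by simp_all
    show ?thesis using c e1 e2 3 by (intro exI[of _ ex] exI[of _ ey] exI[of _ ez]) simp
  next
    case 4
    obtain y10 z10 where 1: "crossing y10 z z10 y" using crossing_right assms by blast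
    obtain x00 z00 where 2: "crossing x00 z10 z00 x"
      using crossing_right assms crossing_closed[OF 1] by blast
    obtain ex ey ez where c: "cube ex ey ez"
      "ex False False = x00" "ey True False = y10" "ez True True = z"
      using cube_positive[of x00 y10 z] assms crossing_closed[OF 1] crossing_closed[OF 2] by blast
    note f = cube_faces[OF c(1)]
    have e1: "ey True True = y" "ez True False = z10"
      using crossing_in_unique[OF f(3)[of True, unfolded c ] 1] by simp_all
    have e2: "ex False True = x"
      using crossing_in_unique[OF f(2)[of False, unfolded c e1] 2] by simp_all
    show ?thesis using c e1 e2 4 by (intro exI[of _ ex] exI[of _ ey] exI[of _ ez]) simp
  next
    case 5
    obtain x00 y10 where 1: "crossing x00 y10 y x" using crossing_out assms by blast
    obtain z10 x01 where 2: "crossing x00 z10 z x01"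
      using crossing_left assms crossing_closed[OF 1] by blast
    obtain z11 y11 where 3: "crossing y10 z11 z10 y11"
      using crossing_left crossing_closed[OF 1] crossing_closed[OF 2] by blast
    obtain ex ey ez where c: "cube ex ey ez"
      "ex False False = x00" "ey True False = y10" "ez True True = z11"
      using cube_positive[of x00 y10 z11] crossing_closed[OF 1] crossing_closed[OF 3] by blast
    note f = cube_faces[OF c(1)]
    have e1: "ey False False = y" "ex True False = x"
      using crossing_in_unique[OF f(1)[of False, unfolded c ] 1] by simp_all
    have e2: "ez True False = z10"
      using crossing_in_unique[OF f(3)[of True, unfolded c e1] 3] by simp_all
    have e3: "ez False False = z"
      using crossing_in_unique[OF f(2)[of False, unfolded c e1 e2] 2] by simp_all
    show ?thesis using c e1 e2 e3 5 by (intro exI[of _ ex] exI[of _ ey] exI[of _ ez]) simp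
  next
    case 6
    obtain y00 z00 where 1: "crossing y00 z z00 y" using crossing_right assms by blast
    obtain x00 z10 where 2: "crossing x00 z10 z00 x"
      using crossing_out assms crossing_closed[OF 1] by blast
    obtain y10 x10 where 3: "crossing x00 y10 y00 x10"
      using crossing_left crossing_closed[OF 1] crossing_closed[OF 2] by blast
    obtain z11 y11 where 4: "crossing y10 z11 z10 y11"
      using crossing_left crossing_closed[OF 3] crossing_closed[OF 2] by blast
    obtain ex ey ez where c: "cube ex ey ez"
      "ex False False = x00" "ey True False = y10" "ez True True = z11"
      using cube_positive[of x00 y10 z11] crossing_closed[OF 3] crossing_closed[OF 4] by blast
    note f = cube_faces[OF c(1)]
    have e1: "ey False False = y00"
      using crossing_in_unique[OF f(1)[of False, unfolded c ] 3] by simp_all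
    have e2: "ez True False = z10"
      using crossing_in_unique[OF f(3)[of True, unfolded c e1] 4] by simp_all
    have e3: "ez False False = z00" "ex False True = x"
      using crossing_in_unique[OF f(2)[of False, unfolded c e1 e2] 2] by simp_all
    have e4: "ey False True = y" "ez False True = z"
      using crossing_left_unique[OF f(3)[of False, unfolded c e1 e2 e3] 1] by simp_all
    show ?thesis using c e1 e2 e3 e4 6 by (intro exI[of _ ex] exI[of _ ey] exI[of _ ez]) simp
  next
    case 7
    obtain y10 z11 where 1: "crossing y10 z11 z y" using crossing_out assms by blast
    obtain x10 z01 where 2: "crossing x10 z11 z01 x"
      using crossing_right assms crossing_closed[OF 1] by blast
    obtain x00 y00 where 3: "crossing x00 y10 y00 x10"
      using crossing_right crossing_closed[OF 1] crossing_closed[OF 2] by blast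
    obtain ex ey ez where c: "cube ex ey ez"
      "ex False False = x00" "ey True False = y10" "ez True True = z11"
      using cube_positive[of x00 y10 z11] crossing_closed[OF 1] crossing_closed[OF 3] by blast
    note f = cube_faces[OF c(1)]
    have e1: "ex True False = x10"
      using crossing_in_unique[OF f(1)[of False, unfolded c ] 3] by simp_all
    have e2: "ez True False = z" "ey True True = y"
      using crossing_in_unique[OF f(3)[of True, unfolded c e1] 1] by simp_all
    have e3: "ex True True = x"
      using crossing_in_unique[OF f(2)[of True, unfolded c e1 e2] 2] by simp_all
    show ?thesis using c e1 e2 e3 7 by (intro exI[of _ ex] exI[of _ ey] exI[of _ ez]) simp
  next
    case 8
    obtain y00 z01 where 1: "crossing y00 z01 z y" using crossing_out assms by blast
    obtain x10 z11 where 2: "crossing x10 z11 z01 x"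
      using crossing_out assms crossing_closed[OF 1] by blast
    obtain x00 y10 where 3: "crossing x00 y10 y00 x10"
      using crossing_out crossing_closed[OF 1] crossing_closed[OF 2] by blast
    obtain ex ey ez where c: "cube ex ey ez"
      "ex False False = x00" "ey True False = y10" "ez True True = z11"
      using cube_positive[of x00 y10 z11] crossing_closed[OF 2] crossing_closed[OF 3] by blast
    note f = cube_faces[OF c(1)]
    have e1: "ey False False = y00" "ex True False = x10"
      using crossing_in_unique[OF f(1)[of False, unfolded c ] 3] by simp_all
    have e2: "ez False True = z01" "ex True True = x"
      using crossing_in_unique[OF f(2)[of True, unfolded c e1] 2] by simp_all
    have e3: "ez False False = z" "ey False True = y"
      using crossing_in_unique[OF f(3)[of False, unfolded c e1 e2] 1] by simp_all
    show ?thesis using c e1 e2 e3 8 by (intro exI[of _ ex] exI[of _ ey] exI[of _ ez]) simp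
  qed
qed

text \<open>The square read from another corner. Reversing the edges in the second direction
  exchanges the two edges in the first direction, and vice versa. This is the braiding of
  letters with signs \<open>a\<close> and \<open>b\<close>; see \<open>kappa_iff_signed_crossing\<close>.\<close>

definition signed_crossing :: "bool \<Rightarrow> bool \<Rightarrow> 'x \<Rightarrow> 'x \<Rightarrow> 'x \<Rightarrow> 'x \<Rightarrow> bool"
  where "signed_crossing a b x y u v \<longleftrightarrow>
    crossing (if b then x else v) (if a then y else u) (if a then u else y) (if b then v else x)"

lemma signed_crossing_closed:
  assumes "signed_crossing a b x y u v"
  shows "x \<in> X" "y \<in> X" "u \<in> X" "v \<in> X"
  using crossing_closed assms unfolding signed_crossing_def by (metis (full_types))+

lemma signed_crossing_ex: "x \<in> X \<Longrightarrow> y \<in> X \<Longrightarrow> \<exists>u v. signed_crossing a b x y u v"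
  unfolding signed_crossing_def
  using crossing_in[of x y] crossing_left[of x y] crossing_right[of y x] crossing_out[of y x]
  by (cases a; cases b; simp; blast)

lemma signed_crossing_ex_out: "u \<in> X \<Longrightarrow> v \<in> X \<Longrightarrow> \<exists>x y. signed_crossing a b x y u v"
  unfolding signed_crossing_def
  using crossing_in[of v u] crossing_left[of v u] crossing_right[of u v] crossing_out[of u v]
  by (cases a; cases b; simp; blast)

lemma signed_crossing_unique:
  assumes "signed_crossing a b x y u v" "signed_crossing a b x y u' v'"
  shows "u = u' \<and> v = v'"
  using assms unfolding signed_crossing_def
  by (cases a; cases b; simp) (blast dest: crossing_functional)+

lemma signed_crossing_out_unique:
  assumes "signed_crossing a b x y u v" "signed_crossing a b x' y' u v"
  shows "x = x' \<and> y = y'"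
  using assms unfolding signed_crossing_def
  by (cases a; cases b; simp) (blast dest: crossing_functional)+

lemma cube_signed_crossings:
  assumes "cube ex ey ez"
  shows "signed_crossing a b (ex (\<not> b) k) (ey a k) (ey (\<not> a) k) (ex b k)"
    "signed_crossing a c (ex j (\<not> c)) (ez a j) (ez (\<not> a) j) (ex j c)"
    "signed_crossing b c (ey i (\<not> c)) (ez i b) (ez i (\<not> b)) (ey i c)"
  using cube_faces(1)[OF assms, of k] cube_faces(2)[OF assms, of j] cube_faces(3)[OF assms, of i]
  unfolding signed_crossing_def by (cases a; cases b; cases c; simp)+

text \<open>Either side of the equation walks over three faces of one and the same cube.\<close>

theorem signed_yang_baxter:
  assumes "signed_crossing a b x y y1 x1" "signed_crossing a c x1 z z1 x2"
    "signed_crossing b c y1 z1 z2 y2"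
  shows "\<exists>z' y' x'. signed_crossing b c y z z' y' \<and> signed_crossing a c x z' z2 x' \<and>
    signed_crossing a b x' y' y2 x2"
proof -
  obtain ex ey ez where c: "cube ex ey ez" and
    e: "ex (\<not> b) (\<not> c) = x" "ey a (\<not> c) = y" "ez a b = z"
    using cube_signed[of x y z] signed_crossing_closed[OF assms(1)] signed_crossing_closed[OF assms(2)]
    by blast
  note f = cube_signed_crossings[OF c]
  have 1: "ey (\<not> a) (\<not> c) = y1" "ex b (\<not> c) = x1"
    by (use signed_crossing_unique[OF f(1)[of a b "\<not> c", unfolded e] assms(1)] in simp_all)
  have 2: "ez (\<not> a) b = z1" "ex b c = x2"
    by (use signed_crossing_unique[OF f(2)[of a c b, unfolded e 1] assms(2)] in simp_all)
  have 3: "ez (\<not> a) (\<not> b) = z2" "ey (\<not> a) c = y2"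
    by (use signed_crossing_unique[OF f(3)[of b c "\<not> a", unfolded e 1 2] assms(3)] in simp_all)
  show ?thesis
    using f(1)[of a b c] f(2)[of a c "\<not> b"] f(3)[of b c a] unfolding e 1 2 3 by blast
qed

definition letter_obj :: "bool \<Rightarrow> base_obj"
  where "letter_obj b = (if b then Xob else Yob)"

lemma r_inv:
  assumes "crossing x y u v" shows "inv_into (X \<times> X) r (u, v) = (x, y)"
proof -
  have "inj_on r (X \<times> X)" using solution by (auto simp: ybe_solution_def bij_betw_def)
  then have "inv_into (X \<times> X) r (r (x, y)) = (x, y)"
    by (rule inv_into_f_f) (use assms in \<open>auto simp: crossing_def\<close>)
  then show ?thesis using assms by (simp add: crossing_def)
qed

text \<open>The inverses occurring in \<open>kappa\<close> are the completions of a square from two labels at a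
  corner: \<open>\<sigma>\<close> and \<open>\<gamma>\<close> are read off from a square starting at \<open>x, y\<close>, whereas \<open>\<tau>\<close> and \<open>\<rho>\<close> are
  read off from its opposite corner.\<close>

lemma kappa_signed_crossing:
  assumes "signed_crossing a b x y u v"
  shows "kappa X r (letter_obj a) (letter_obj b) (x, y) = (u, v)"
proof -
  have inj: "inj_on (rho X r z) X" "inj_on (tau X r z) X" if z: "z \<in> X" for z
  proof -
    show "inj_on (rho X r z) X"
    proof (rule inj_onI)
      fix y y' assume y: "y \<in> X" "y' \<in> X" and e: "rho X r z y = rho X r z y'"
      obtain a b where 1: "crossing a b y z" using crossing_out z y by blast
      obtain a' b' where 2: "crossing a' b' y' z" using crossing_out z y by blast
      have "b = b'" using e by (simp add: rho_def r_inv[OF 1] r_inv[OF 2])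
      then show "y = y'" using 1 2 crossing_functional by metis
    qed
    show "inj_on (tau X r z) X"
    proof (rule inj_onI)
      fix y y' assume y: "y \<in> X" "y' \<in> X" and e: "tau X r z y = tau X r z y'"
      obtain a b where 1: "crossing a b z y" using crossing_out z y by blast
      obtain a' b' where 2: "crossing a' b' z y'" using crossing_out z y by blast
      have "a = a'" using e by (simp add: tau_def r_inv[OF 1] r_inv[OF 2])
      then show "y = y'" using 1 2 crossing_functional by metis
    qed
  qed
  have bij: "inj_on (sigma r x) X" "inj_on (gamma r x) X" if "x \<in> X" for x
    using solution that by (auto simp: ybe_solution_def bij_betw_def)
  note cl = signed_crossing_closed[OF assms]
  consider "a" "b" | "a" "\<not> b" | "\<not> a" "b" | "\<not> a" "\<not> b" by blast
  then show ?thesis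
  proof cases
    case 1
    then show ?thesis using assms
      by (simp add: letter_obj_def signed_crossing_def crossing_def sigma_def gamma_def)
  next
    case 2
    then have c: "crossing v y u x" using assms by (simp add: signed_crossing_def)
    have "rho X r x u = y" by (simp add: rho_def r_inv[OF c])
    moreover have "gamma r y v = x" using c by (simp add: gamma_def crossing_def)
    ultimately show ?thesis
      using inv_into_f_f[OF inj(1), of x u] inv_into_f_f[OF bij(2), of y v] cl 2
      by (simp add: letter_obj_def)
  next
    case 3
    then have c: "crossing x u y v" using assms by (simp add: signed_crossing_def)
    have "tau X r y v = x" by (simp add: tau_def r_inv[OF c])
    moreover have "sigma r x u = y" using c by (simp add: sigma_def crossing_def)
    ultimately show ?thesis
      using inv_into_f_f[OF inj(2), of y v] inv_into_f_f[OF bij(1), of x u] cl 3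
      by (simp add: letter_obj_def)
  next
    case 4
    then have c: "crossing v u y x" using assms by (simp add: signed_crossing_def)
    show ?thesis using 4 by (simp add: letter_obj_def rho_def tau_def r_inv[OF c])
  qed
qed

lemma kappa_iff_signed_crossing:
  assumes "x \<in> X" "y \<in> X"
  shows "kappa X r (letter_obj a) (letter_obj b) (x, y) = (u, v) \<longleftrightarrow> signed_crossing a b x y u v"
  by (metis assms kappa_signed_crossing prod.inject signed_crossing_ex)

end

type_synonym 'x word = "('x \<times> bool) list"

section \<open>The braiding of signed words\<close>

definition word_tensor :: "('x word \<times> 'x word) set \<Rightarrow> ('x word \<times> 'x word) set \<Rightarrow> ('x word \<times> 'x word) set"
  where "word_tensor R S = {(u @ v, u' @ v') | u v u' v'. (u, u') \<in> R \<and> (v, v') \<in> S}"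

lemma word_tensorI: "(u, u') \<in> R \<Longrightarrow> (v, v') \<in> S \<Longrightarrow> (u @ v, u' @ v') \<in> word_tensor R S"
  by (auto simp: word_tensor_def)

lemma word_tensorE:
  assumes "(w, w') \<in> word_tensor R S"
  obtains u v u' v' where "w = u @ v" "w' = u' @ v'" "(u, u') \<in> R" "(v, v') \<in> S"
  using assms by (auto simp: word_tensor_def)

lemma group_words_append [simp]: "u @ v \<in> group_words X \<longleftrightarrow> u \<in> group_words X \<and> v \<in> group_words X"
  by (auto simp: group_words_def)

lemma group_words_Cons [simp]: "c # v \<in> group_words X \<longleftrightarrow> fst c \<in> X \<and> v \<in> group_words X"
  by (cases c) (auto simp: group_words_def)

lemma group_words_Nil [simp]: "[] \<in> group_words X"
  by (auto simp: group_words_def)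

context ybe
begin

abbreviation "words \<equiv> group_words X"

definition letter_braid :: "'x \<times> bool \<Rightarrow> 'x \<times> bool \<Rightarrow> ('x \<times> bool) \<times> ('x \<times> bool)"
  where "letter_braid c d =
    (case kappa X r (letter_obj (snd c)) (letter_obj (snd d)) (fst c, fst d) of
      (u, v) \<Rightarrow> ((u, snd d), (v, snd c)))"

lemma letter_braid_iff:
  assumes "fst c \<in> X" "fst d \<in> X"
  shows "letter_braid c d = (d', c') \<longleftrightarrow> snd c' = snd c \<and> snd d' = snd d \<and>
    signed_crossing (snd c) (snd d) (fst c) (fst d) (fst d') (fst c')"
  using kappa_iff_signed_crossing[OF assms, of "snd c" "snd d" "fst d'" "fst c'"]
  by (cases c'; cases d'; cases "kappa X r (letter_obj (snd c)) (letter_obj (snd d)) (fst c, fst d)")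
    (auto simp: letter_braid_def)

lemma letter_braid_closed:
  assumes "fst c \<in> X" "fst d \<in> X" "letter_braid c d = (d', c')"
  shows "fst c' \<in> X" "fst d' \<in> X" "snd c' = snd c" "snd d' = snd d"
  using assms signed_crossing_closed by (auto simp: letter_braid_iff)

lemma letter_braid_surj:
  assumes "fst c' \<in> X" "fst d' \<in> X"
  shows "\<exists>c d. fst c \<in> X \<and> fst d \<in> X \<and> letter_braid c d = (d', c')"
proof -
  obtain x y where s: "signed_crossing (snd c') (snd d') x y (fst d') (fst c')"
    using signed_crossing_ex_out assms by blast
  then have "letter_braid (x, snd c') (y, snd d') = (d', c')"
    using signed_crossing_closed[OF s] by (subst letter_braid_iff) auto
  then show ?thesis using signed_crossing_closed[OF s]
    by (intro exI[of _ "(x, snd c')"] exI[of _ "(y, snd d')"]) simp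
qed

lemma letter_braid_inj:
  assumes "fst c \<in> X" "fst d \<in> X" "fst c1 \<in> X" "fst d1 \<in> X"
    "letter_braid c d = (d', c')" "letter_braid c1 d1 = (d', c')"
  shows "c = c1 \<and> d = d1"
proof -
  have 1: "snd c = snd c'" "snd d = snd d'"
    "signed_crossing (snd c) (snd d) (fst c) (fst d) (fst d') (fst c')"
    using assms(5) by (simp_all add: letter_braid_iff[OF assms(1,2)])
  have 2: "snd c1 = snd c'" "snd d1 = snd d'"
    "signed_crossing (snd c1) (snd d1) (fst c1) (fst d1) (fst d') (fst c')"
    using assms(6) by (simp_all add: letter_braid_iff[OF assms(3,4)])
  show ?thesis using signed_crossing_out_unique[OF 1(3)] 1 2 by (simp add: prod_eq_iff)
qed

fun letter_word_braid :: "'x \<times> bool \<Rightarrow> 'x word \<Rightarrow> 'x word \<times> ('x \<times> bool)"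
  where
    "letter_word_braid c [] = ([], c)"
  | "letter_word_braid c (d # w) =
      (let (d', c') = letter_braid c d; (w', c'') = letter_word_braid c' w in (d' # w', c''))"

text \<open>The strand of each letter of the first word passes over the second word, the last letter
  first. The result lists the second word in front, as it stands in front afterwards.\<close>

fun word_braid :: "'x word \<Rightarrow> 'x word \<Rightarrow> 'x word \<times> 'x word"
  where
    "word_braid [] w = (w, [])"
  | "word_braid (c # v) w =
      (let (w', v') = word_braid v w; (w'', c') = letter_word_braid c w' in (w'', c' # v'))"

lemma letter_word_braid_append:
  "letter_word_braid c (v @ w) =
    (let (v', c') = letter_word_braid c v; (w', c'') = letter_word_braid c' w in (v' @ w', c''))"
  by (induction v arbitrary: c) (auto simp: split_beta Let_def)

lemma word_braid_Nil_right [simp]: "word_braid v [] = ([], v)"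
  by (induction v) auto

text \<open>This lemma and the next one are the two hexagon identities. They become the axioms of a
  braiding operator for products.\<close>

lemma word_braid_append_left:
  "word_braid (u @ v) w =
    (let (w', v') = word_braid v w; (w'', u') = word_braid u w' in (w'', u' @ v'))"
  by (induction u) (auto simp: split_beta Let_def)

lemma word_braid_append_right:
  "word_braid u (v @ w) =
    (let (v', u') = word_braid u v; (w', u'') = word_braid u' w in (v' @ w', u''))"
  by (induction u arbitrary: v w) (auto simp: split_beta Let_def letter_word_braid_append)

lemma letter_word_braid_closed:
  assumes "fst c \<in> X" "w \<in> words" "letter_word_braid c w = (w', c')"
  shows "fst c' \<in> X \<and> w' \<in> words \<and> snd c' = snd c \<and> map snd w' = map snd w"
  using assms
proof (induction w arbitrary: c w')
  case (Cons d w)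
  obtain d1 c1 where 1: "letter_braid c d = (d1, c1)" by (rule prod.exhaust)
  obtain w2 where 2: "letter_word_braid c1 w = (w2, c')" "w' = d1 # w2"
    using Cons.prems 1 by (auto split: prod.splits)
  show ?case
    using letter_braid_closed[OF _ _ 1] Cons.IH[OF _ _ 2(1)] Cons.prems(1,2) 2(2) by simp
qed auto

lemma word_braid_closed:
  assumes "v \<in> words" "w \<in> words" "word_braid v w = (w', v')"
  shows "v' \<in> words \<and> w' \<in> words \<and> map snd v' = map snd v \<and> map snd w' = map snd w"
  using assms
proof (induction v arbitrary: w' v')
  case (Cons c v)
  obtain w1 v1 where 1: "word_braid v w = (w1, v1)" by (rule prod.exhaust)
  obtain c1 where 2: "letter_word_braid c w1 = (w', c1)" "v' = c1 # v1"
    using Cons.prems 1 by (auto split: prod.splits)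
  show ?case
    using Cons.IH[OF _ _ 1] Cons.prems(1,2) letter_word_braid_closed[OF _ _ 2(1)] 2(2) by simp
qed auto

lemma letter_word_braid_surj:
  assumes "fst c' \<in> X" "w' \<in> words"
  shows "\<exists>c w. fst c \<in> X \<and> w \<in> words \<and> letter_word_braid c w = (w', c')"
  using assms
proof (induction w')
  case Nil
  then show ?case by (intro exI[of _ c'] exI[of _ "[]"]) simp
next
  case (Cons d' w')
  then obtain c1 w where 1: "fst c1 \<in> X" "w \<in> words" "letter_word_braid c1 w = (w', c')"
    by auto
  obtain c d where 2: "fst c \<in> X" "fst d \<in> X" "letter_braid c d = (d', c1)"
    using letter_braid_surj[of c1 d'] 1(1) Cons.prems by auto
  show ?case using 1 2 by (intro exI[of _ c] exI[of _ "d # w"]) simp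
qed

lemma word_braid_surj:
  assumes "v' \<in> words" "w' \<in> words"
  shows "\<exists>v w. v \<in> words \<and> w \<in> words \<and> word_braid v w = (w', v')"
  using assms
proof (induction v' arbitrary: w')
  case Nil
  then show ?case by (intro exI[of _ "[]"] exI[of _ w']) simp
next
  case (Cons c' v')
  obtain c w1 where 1: "fst c \<in> X" "w1 \<in> words" "letter_word_braid c w1 = (w', c')"
    using letter_word_braid_surj[of c' w'] Cons.prems by auto
  obtain v w where 2: "v \<in> words" "w \<in> words" "word_braid v w = (w1, v')"
    using Cons.IH[of w1] 1(2) Cons.prems by auto
  show ?case using 1 2 by (intro exI[of _ "c # v"] exI[of _ w]) simp
qed

lemma letter_word_braid_inj:
  assumes "fst c \<in> X" "w \<in> words" "fst c1 \<in> X" "w1 \<in> words"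
    "letter_word_braid c w = (w', c')" "letter_word_braid c1 w1 = (w', c')"
  shows "c = c1 \<and> w = w1"
  using assms
proof (induction w arbitrary: c c1 w1 w')
  case Nil
  have "map snd w' = map snd w1" using letter_word_braid_closed[OF Nil(3,4,6)] by simp
  then have "w1 = []" using Nil by simp
  then show ?case using Nil by simp
next
  case (Cons d w)
  obtain d' c2 where a: "letter_braid c d = (d', c2)" by (rule prod.exhaust)
  obtain w2 where b: "letter_word_braid c2 w = (w2, c')" "w' = d' # w2"
    using Cons.prems a by (auto split: prod.splits)
  have "map snd w' = map snd w1" using letter_word_braid_closed[OF Cons.prems(3,4,6)] by simp
  then obtain d1 v1 where w1: "w1 = d1 # v1" using b by (cases w1) auto
  obtain e' c3 where a': "letter_braid c1 d1 = (e', c3)" by (rule prod.exhaust)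
  obtain v2 where b': "letter_word_braid c3 v1 = (v2, c')" "w' = e' # v2"
    using Cons.prems(6) a' w1 by (auto split: prod.splits)
  have "c2 = c3 \<and> w = v1"
    using Cons.IH[of c2 c3 v1 w2] b b' Cons.prems w1 letter_braid_closed[OF _ _ a]
      letter_braid_closed[OF _ _ a'] by simp
  then show ?case
    using letter_braid_inj[OF _ _ _ _ a, of c1 d1] a' b b' w1 Cons.prems by simp
qed

lemma word_braid_inj:
  assumes "v \<in> words" "w \<in> words" "v1 \<in> words" "w1 \<in> words"
    "word_braid v w = (w', v')" "word_braid v1 w1 = (w', v')"
  shows "v = v1 \<and> w = w1"
  using assms
proof (induction v arbitrary: v1 w' v')
  case Nil
  have "map snd v' = map snd v1" using word_braid_closed[OF Nil(3,4,6)] by simp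
  then have "v1 = []" using Nil by simp
  then show ?case using Nil by simp
next
  case (Cons c v)
  obtain w2 v2 where a: "word_braid v w = (w2, v2)" by (rule prod.exhaust)
  obtain c2 where b: "letter_word_braid c w2 = (w', c2)" "v' = c2 # v2"
    using Cons.prems a by (auto split: prod.splits)
  have "map snd v' = map snd v1" using word_braid_closed[OF Cons.prems(3,4,6)] by simp
  then obtain c1 u1 where v1: "v1 = c1 # u1" using b by (cases v1) auto
  obtain w3 u3 where a': "word_braid u1 w1 = (w3, u3)" by (rule prod.exhaust)
  obtain c3 where b': "letter_word_braid c1 w3 = (w', c3)" "v' = c3 # u3"
    using Cons.prems(6) a' v1 by (auto split: prod.splits)
  have "c = c1 \<and> w2 = w3"
    using letter_word_braid_inj[OF _ _ _ _ b(1), of c1 w3] b b' Cons.prems v1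
      word_braid_closed[OF _ _ a] word_braid_closed[OF _ _ a'] by simp
  then show ?case
    using Cons.IH[OF _ _ _ _ a, of u1] a' b b' v1 Cons.prems by simp
qed

section \<open>Relations between words that slide through the braiding\<close>

definition word_relation :: "('x word \<times> 'x word) set \<Rightarrow> bool"
  where "word_relation R \<longleftrightarrow> R \<subseteq> words \<times> words"

text \<open>Here \<open>F\<close> passes a fixed word over its argument; it returns that word, as changed by the
  passage, and the changed argument. The condition says that applying \<open>R\<close> commutes with the
  passage. The two directions of the passage are \<open>over_left\<close> and \<open>over_right\<close>.\<close>

definition slides :: "('x word \<Rightarrow> 'x word \<times> 'x word) \<Rightarrow> ('x word \<times> 'x word) set \<Rightarrow> bool"
  where "slides F R \<longleftrightarrow> (\<forall>w \<in> words. \<forall>z u'.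
    (\<exists>w'. (w, w') \<in> R \<and> F w' = (z, u')) \<longleftrightarrow> (\<exists>u. F w = (z, u) \<and> (u, u') \<in> R))"

lemma slidesD:
  assumes "slides F R" "w \<in> words"
  shows "(\<exists>w'. (w, w') \<in> R \<and> F w' = (z, u')) \<longleftrightarrow> (\<exists>u. F w = (z, u) \<and> (u, u') \<in> R)"
  using assms unfolding slides_def by blast

abbreviation "over_right v w \<equiv> prod.swap (word_braid v w)"
abbreviation "over_left v w \<equiv> word_braid w v"

lemma swap_eq_iff: "prod.swap p = (a, b) \<longleftrightarrow> p = (b, a)"
  by (cases p) auto

definition natural :: "('x word \<times> 'x word) set \<Rightarrow> bool"
  where "natural R \<longleftrightarrow> (\<forall>v \<in> words. slides (over_left v) R \<and> slides (over_right v) R)"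

lemma left_naturalD:
  assumes "natural R" "v \<in> words" "w \<in> words"
  shows "(\<exists>w'. (w, w') \<in> R \<and> word_braid w' v = (v', u')) \<longleftrightarrow>
    (\<exists>u. word_braid w v = (v', u) \<and> (u, u') \<in> R)"
  using assms slidesD unfolding natural_def by blast

lemma right_naturalD:
  assumes "natural R" "v \<in> words" "w \<in> words"
  shows "(\<exists>w'. (w, w') \<in> R \<and> word_braid v w' = (u', v')) \<longleftrightarrow>
    (\<exists>u. word_braid v w = (u, v') \<and> (u, u') \<in> R)"
  using slidesD[of "over_right v" R w v' u'] assms unfolding natural_def swap_eq_iff by blast

text \<open>Passing two words one after the other. The function \<open>k\<close> is concatenation in one of the
  two orders, depending on the direction of the passage.\<close>

lemma slides_successively:
  assumes G: "slides G R" "\<And>w. w \<in> words \<Longrightarrow> snd (G w) \<in> words" and H: "slides H R"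
    and F: "\<And>w z t. F w = (z, t) \<longleftrightarrow> (\<exists>z1 z2 s. z = k z1 z2 \<and> G w = (z1, s) \<and> H s = (z2, t))"
  shows "slides F R"
  unfolding slides_def
proof (intro ballI allI)
  fix w z u' assume w: "w \<in> words"
  have "(\<exists>w'. (w, w') \<in> R \<and> F w' = (z, u')) \<longleftrightarrow>
    (\<exists>z1 z2 s. z = k z1 z2 \<and> (\<exists>w'. (w, w') \<in> R \<and> G w' = (z1, s)) \<and> H s = (z2, u'))"
    unfolding F by blast
  also have "\<dots> \<longleftrightarrow> (\<exists>z1 z2 u. z = k z1 z2 \<and> G w = (z1, u) \<and> (\<exists>s. (u, s) \<in> R \<and> H s = (z2, u')))"
    unfolding slidesD[OF G(1) w] by blast
  also have "\<dots> \<longleftrightarrow> (\<exists>z1 z2 u. z = k z1 z2 \<and> G w = (z1, u) \<and> (\<exists>s. H u = (z2, s) \<and> (s, u') \<in> R))"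
  proof -
    have "(\<exists>s. (u, s) \<in> R \<and> H s = (z2, u')) \<longleftrightarrow> (\<exists>s. H u = (z2, s) \<and> (s, u') \<in> R)"
      if "G w = (z1, u)" for z1 z2 u
      by (rule slidesD[OF H]) (use G(2)[OF w] that in simp)
    then show ?thesis by (simp only: cong: conj_cong)
  qed
  also have "\<dots> \<longleftrightarrow> (\<exists>s. F w = (z, s) \<and> (s, u') \<in> R)"
    unfolding F by blast
  finally show "(\<exists>w'. (w, w') \<in> R \<and> F w' = (z, u')) \<longleftrightarrow> (\<exists>s. F w = (z, s) \<and> (s, u') \<in> R)" .
qed

lemma over_closed:
  assumes "v \<in> words" "w \<in> words" "F = over_left \<or> F = over_right"
  shows "fst (F v w) \<in> words \<and> snd (F v w) \<in> words \<and> length (snd (F v w)) = length w"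
proof -
  have c: "snd (word_braid a b) \<in> words \<and> fst (word_braid a b) \<in> words \<and>
    length (snd (word_braid a b)) = length a \<and> length (fst (word_braid a b)) = length b"
    if "a \<in> words" "b \<in> words" for a b
    using word_braid_closed[OF that prod.collapse[symmetric]] by (metis length_map)
  show ?thesis using assms(3) c[OF assms(1,2)] c[OF assms(2,1)] by auto
qed

text \<open>By the hexagon identities it is enough to braid past single letters.\<close>

lemma natural_letters:
  assumes "\<And>c. fst c \<in> X \<Longrightarrow> slides (over_left [c]) R \<and> slides (over_right [c]) R"
  shows "natural R"
  unfolding natural_def
proof
  fix v assume "v \<in> words"
  then show "slides (over_left v) R \<and> slides (over_right v) R"
  proof (induction v)
    case Nil
    then show ?case by (auto simp: slides_def)
  next
    case (Cons c v)
    then have c: "fst c \<in> X" "[c] \<in> words" and v: "v \<in> words" by auto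
    have "slides (over_left (c # v)) R"
    proof (rule slides_successively[of "over_left [c]" _ "over_left v"])
      show "word_braid w (c # v) = (z, t) \<longleftrightarrow>
        (\<exists>z1 z2 s. z = z1 @ z2 \<and> word_braid w [c] = (z1, s) \<and> word_braid s v = (z2, t))" for w z t
        using word_braid_append_right[of w "[c]" v] by (auto split: prod.splits)
    qed (use Cons assms c over_closed[of "[c]" _ over_left] in auto)
    moreover have "slides (over_right (c # v)) R"
    proof (rule slides_successively[of "over_right v" _ "over_right [c]" _ "\<lambda>z1 z2. z2 @ z1"])
      show "prod.swap (word_braid (c # v) w) = (z, t) \<longleftrightarrow> (\<exists>z1 z2 s. z = z2 @ z1 \<and>
        prod.swap (word_braid v w) = (z1, s) \<and> prod.swap (word_braid [c] s) = (z2, t))" for w z t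
        unfolding swap_eq_iff using word_braid_append_left[of "[c]" v w] by (auto split: prod.splits)
    qed (use Cons assms c v over_closed[of v _ over_right] in auto)
    ultimately show ?case ..
  qed
qed

text \<open>Naturality in both arguments: first slide \<open>S\<close> past the result of \<open>R\<close>, then \<open>R\<close> past the
  argument of \<open>S\<close>.\<close>

lemma natural_square:
  assumes "natural R" "natural S" "word_relation R" "w1 \<in> words" "w2 \<in> words"
  shows "(\<exists>w1' w2'. (w1, w1') \<in> R \<and> (w2, w2') \<in> S \<and> word_braid w1' w2' = (v2, v1)) \<longleftrightarrow>
    (\<exists>u2 u1. word_braid w1 w2 = (u2, u1) \<and> (u1, v1) \<in> R \<and> (u2, v2) \<in> S)"
proof -
  have "(\<exists>w1' w2'. (w1, w1') \<in> R \<and> (w2, w2') \<in> S \<and> word_braid w1' w2' = (v2, v1)) \<longleftrightarrow>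
    (\<exists>w1'. (w1, w1') \<in> R \<and> (\<exists>u2. word_braid w1' w2 = (u2, v1) \<and> (u2, v2) \<in> S))"
  proof -
    have "(\<exists>w2'. (w2, w2') \<in> S \<and> word_braid w1' w2' = (v2, v1)) \<longleftrightarrow>
      (\<exists>u2. word_braid w1' w2 = (u2, v1) \<and> (u2, v2) \<in> S)" if "(w1, w1') \<in> R" for w1'
      by (rule right_naturalD[OF assms(2) _ assms(5)])
        (use that assms(3) in \<open>auto simp: word_relation_def\<close>)
    then have "(\<exists>w1'. (w1, w1') \<in> R \<and> (\<exists>w2'. (w2, w2') \<in> S \<and> word_braid w1' w2' = (v2, v1))) \<longleftrightarrow>
      (\<exists>w1'. (w1, w1') \<in> R \<and> (\<exists>u2. word_braid w1' w2 = (u2, v1) \<and> (u2, v2) \<in> S))"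
      by (simp only: cong: conj_cong)
    then show ?thesis by simp
  qed
  also have "\<dots> \<longleftrightarrow> (\<exists>u2. (\<exists>w1'. (w1, w1') \<in> R \<and> word_braid w1' w2 = (u2, v1)) \<and> (u2, v2) \<in> S)"
    by blast
  also have "\<dots> \<longleftrightarrow> (\<exists>u2. (\<exists>u1. word_braid w1 w2 = (u2, u1) \<and> (u1, v1) \<in> R) \<and> (u2, v2) \<in> S)"
    using left_naturalD[OF assms(1,5,4)] by simp
  finally show ?thesis by blast
qed

lemma natural_Id_on: "natural (Id_on A)" if "\<And>w w'. map snd w = map snd w' \<Longrightarrow> w \<in> words \<Longrightarrow>
  w' \<in> words \<Longrightarrow> w \<in> A \<longleftrightarrow> w' \<in> A"
proof -
  have l: "u \<in> A \<longleftrightarrow> w \<in> A" "u' \<in> A \<longleftrightarrow> v \<in> A"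
    if "w \<in> words" "v \<in> words" "word_braid w v = (u', u)" for w v u u'
    using word_braid_closed[OF that] that that(1-2) \<open>\<And>w w'. _ \<Longrightarrow> _ \<Longrightarrow> _ \<Longrightarrow> w \<in> A \<longleftrightarrow> w' \<in> A\<close> by metis+
  show ?thesis unfolding natural_def slides_def swap_eq_iff
    using l by (auto simp: Id_on_iff)
qed

lemma slides_comp:
  assumes "slides F R" "slides F S" "word_relation R"
  shows "slides F (R O S)"
  unfolding slides_def
proof (intro ballI allI)
  fix w z u' assume w: "w \<in> words"
  have "(\<exists>w'. (w, w') \<in> R O S \<and> F w' = (z, u')) \<longleftrightarrow>
    (\<exists>y. (w, y) \<in> R \<and> (\<exists>w'. (y, w') \<in> S \<and> F w' = (z, u')))" by blast
  also have "\<dots> \<longleftrightarrow> (\<exists>y. (w, y) \<in> R \<and> (\<exists>u. F y = (z, u) \<and> (u, u') \<in> S))"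
  proof -
    have "(\<exists>w'. (y, w') \<in> S \<and> F w' = (z, u')) \<longleftrightarrow> (\<exists>u. F y = (z, u) \<and> (u, u') \<in> S)"
      if "(w, y) \<in> R" for y
      by (rule slidesD[OF assms(2)]) (use that assms(3) in \<open>auto simp: word_relation_def\<close>)
    then show ?thesis by (simp only: cong: conj_cong)
  qed
  also have "\<dots> \<longleftrightarrow> (\<exists>u. (\<exists>y. (w, y) \<in> R \<and> F y = (z, u)) \<and> (u, u') \<in> S)" by blast
  also have "\<dots> \<longleftrightarrow> (\<exists>u. (\<exists>y. F w = (z, y) \<and> (y, u) \<in> R) \<and> (u, u') \<in> S)"
    unfolding slidesD[OF assms(1) w] ..
  finally show "(\<exists>w'. (w, w') \<in> R O S \<and> F w' = (z, u')) \<longleftrightarrow> (\<exists>u. F w = (z, u) \<and> (u, u') \<in> R O S)"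
    by blast
qed

lemma natural_comp: "natural R \<Longrightarrow> natural S \<Longrightarrow> word_relation R \<Longrightarrow> natural (R O S)"
  unfolding natural_def using slides_comp by blast

text \<open>A passage is a bijection on pairs of words, so a relation commuting with it has a
  converse commuting with it. This takes care of the inverse of the braiding.\<close>

lemma slides_converse:
  assumes F: "\<And>v. v \<in> words \<Longrightarrow> slides (F v) R" and R: "word_relation R"
    and closed: "\<And>v w. v \<in> words \<Longrightarrow> w \<in> words \<Longrightarrow> fst (F v w) \<in> words"
    and surj: "\<And>z u. z \<in> words \<Longrightarrow> u \<in> words \<Longrightarrow>
      \<exists>v w. v \<in> words \<and> w \<in> words \<and> F v w = (z, u)"
    and inj: "\<And>v w v' w'. v \<in> words \<Longrightarrow> w \<in> words \<Longrightarrow> v' \<in> words \<Longrightarrow>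
      w' \<in> words \<Longrightarrow> F v w = F v' w' \<Longrightarrow> v = v' \<and> w = w'"
    and v: "v \<in> words"
  shows "slides (F v) (R\<inverse>)"
  unfolding slides_def
proof (intro ballI allI iffI)
  have gw: "a \<in> words" "b \<in> words" if "(a, b) \<in> R" for a b
    using that R by (auto simp: word_relation_def)
  fix w z u' assume w: "w \<in> words"
  {
    assume "\<exists>w'. (w, w') \<in> R\<inverse> \<and> F v w' = (z, u')"
    then obtain w' where w': "(w', w) \<in> R" "F v w' = (z, u')" by blast
    obtain z2 u where 2: "F v w = (z2, u)" by (rule prod.exhaust)
    have "\<exists>u1. F v w' = (z2, u1) \<and> (u1, u) \<in> R"
      using slidesD[OF F[OF v] gw(1)[OF w'(1)], of z2 u] w'(1) 2 by blast
    then show "\<exists>u. F v w = (z, u) \<and> (u, u') \<in> R\<inverse>" using w'(2) 2 by auto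
  next
    assume "\<exists>u. F v w = (z, u) \<and> (u, u') \<in> R\<inverse>"
    then obtain u where u: "F v w = (z, u)" "(u', u) \<in> R" by blast
    have "z \<in> words" using closed[OF v w] u(1) by simp
    then obtain v0 w' where 0: "v0 \<in> words" "w' \<in> words" "F v0 w' = (z, u')"
      using surj gw[OF u(2)] by blast
    then obtain w0 where w0: "(w', w0) \<in> R" "F v0 w0 = (z, u)"
      using slidesD[OF F[OF 0(1)] 0(2), of z u] u(2) by blast
    have "v0 = v \<and> w0 = w"
      by (rule inj) (use 0 v w gw[OF w0(1)] w0(2) u(1) in auto)
    then show "\<exists>w'. (w, w') \<in> R\<inverse> \<and> F v w' = (z, u')" using w0 0 by blast
  }
qed

lemma natural_converse:
  assumes "natural R" "word_relation R"
  shows "natural (R\<inverse>)"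
proof -
  have "slides (over_left v) (R\<inverse>)" if "v \<in> words" for v
    by (rule slides_converse[OF _ assms(2) _ _ _ that, of over_left])
      (use assms(1) over_closed[of _ _ over_left] word_braid_surj in \<open>auto simp: natural_def\<close>,
       (metis word_braid_inj prod.collapse)+)
  moreover have "slides (over_right v) (R\<inverse>)" if "v \<in> words" for v
    by (rule slides_converse[OF _ assms(2) _ _ _ that, of over_right])
      (use assms(1) over_closed[of _ _ over_right] word_braid_surj in \<open>auto simp: natural_def swap_eq_iff\<close>,
       (metis word_braid_inj prod.collapse prod.swap_def prod.inject)+)
  ultimately show ?thesis by (simp add: natural_def)
qed

text \<open>A word passes over a concatenation in two stages: over the second factor first if it
  moves to the left, and over the first one first if it moves to the right. The operation \<open>J\<close> is
  concatenation with the factors listed in the order of the passage.\<close>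

lemma slides_tensor:
  fixes J :: "'x word \<Rightarrow> 'x word \<Rightarrow> 'x word"
  assumes J: "J = (@) \<or> J = (\<lambda>a b. b @ a)"
    and F: "F = over_left \<or> F = over_right"
    and FJ: "\<And>v a b. F v (J a b) = (let (z1, a') = F v a; (z2, b') = F z1 b in (z2, J a' b'))"
    and R: "\<And>v. v \<in> words \<Longrightarrow> slides (F v) R" "word_relation R"
    and S: "\<And>v. v \<in> words \<Longrightarrow> slides (F v) S" "word_relation S"
    and v: "v \<in> words"
  shows "slides (F v) {(J a b, J a' b') | a b a' b'. (a, a') \<in> R \<and> (b, b') \<in> S}"
  unfolding slides_def
proof (intro ballI allI iffI)
  fix w z u' assume w: "w \<in> words"
  have gw: "(a, b) \<in> R \<or> (a, b) \<in> S \<Longrightarrow> a \<in> words \<and> b \<in> words" for a b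
    using R(2) S(2) by (auto simp: word_relation_def)
  note cl = over_closed[OF _ _ F]
  {
    assume "\<exists>w'. (w, w') \<in> {(J a b, J a' b') | a b a' b'. (a, a') \<in> R \<and> (b, b') \<in> S} \<and> F v w' = (z, u')"
    then obtain a b a' b' where ab: "w = J a b" "(a, a') \<in> R" "(b, b') \<in> S" "F v (J a' b') = (z, u')"
      by blast
    then obtain z1 s t where 1: "F v a' = (z1, s)" "F z1 b' = (z, t)" "u' = J s t"
      unfolding FJ by (auto split: prod.splits)
    obtain s0 where s0: "F v a = (z1, s0)" "(s0, s) \<in> R"
      using slidesD[OF R(1)[OF v], of a z1 s] gw ab 1 by blast
    have "a \<in> words" using gw ab(2) by blast
    then have "z1 \<in> words" using cl[OF v, of a] s0(1) by simp
    then obtain t0 where t0: "F z1 b = (z, t0)" "(t0, t) \<in> S"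
      using slidesD[OF S(1), of z1 b z t] gw ab 1 by blast
    have "F v w = (z, J s0 t0)" unfolding ab(1) FJ using s0(1) t0(1) by simp
    then show "\<exists>u. F v w = (z, u) \<and> (u, u') \<in> {(J a b, J a' b') | a b a' b'. (a, a') \<in> R \<and> (b, b') \<in> S}"
      using s0(2) t0(2) 1(3) by blast
  next
    assume "\<exists>u. F v w = (z, u) \<and> (u, u') \<in> {(J a b, J a' b') | a b a' b'. (a, a') \<in> R \<and> (b, b') \<in> S}"
    then obtain s t s' t' where st: "F v w = (z, J s t)" "(s, s') \<in> R" "(t, t') \<in> S" "u' = J s' t'" by blast
    have "length w = length (J s t)" using cl[OF v w] st(1) by simp
    then have "w = take (length s) w @ drop (length s) w \<and> length (take (length s) w) = length s \<and>
        length (drop (length s) w) = length t"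
      "w = take (length t) w @ drop (length t) w \<and> length (take (length t) w) = length t \<and>
        length (drop (length t) w) = length s"
      using J by auto
    then have "\<exists>a b. w = J a b \<and> length a = length s \<and> length b = length t"
      using J by blast
    then obtain a b where ab: "w = J a b" "length a = length s" "length b = length t" by blast
    have abw: "a \<in> words" "b \<in> words" using w J ab(1) by auto
    obtain z1 s0 where 1: "F v a = (z1, s0)" by (rule prod.exhaust)
    have z1: "z1 \<in> words" using cl[OF v abw(1)] 1 by simp
    obtain z2 t0 where 2: "F z1 b = (z2, t0)" by (rule prod.exhaust)
    have "z2 = z" "J s0 t0 = J s t" using st(1) unfolding ab(1) FJ by (simp_all add: 1 2)
    moreover have "length s0 = length s" "length t0 = length t"
      using cl[OF v abw(1)] cl[OF z1 abw(2)] 1 2 ab by simp_all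
    ultimately have e: "z2 = z" "s0 = s" "t0 = t" using J by auto
    obtain a' where a': "(a, a') \<in> R" "F v a' = (z1, s')"
      using slidesD[OF R(1)[OF v] abw(1), of z1 s'] 1 st(2) e by blast
    obtain b' where b': "(b, b') \<in> S" "F z1 b' = (z, t')"
      using slidesD[OF S(1)[OF z1] abw(2), of z t'] 2 st(3) e by blast
    have "F v (J a' b') = (z, u')" unfolding FJ st(4) using a'(2) b'(2) by simp
    then show "\<exists>w'. (w, w') \<in> {(J a b, J a' b') | a b a' b'. (a, a') \<in> R \<and> (b, b') \<in> S} \<and> F v w' = (z, u')"
      using a'(1) b'(1) ab(1) by blast
  }
qed

lemma natural_tensor:
  assumes "natural R" "natural S" "word_relation R" "word_relation S"
  shows "natural (word_tensor R S)"
proof -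
  have "slides (over_left v) (word_tensor R S)" if v: "v \<in> words" for v
  proof -
    have "word_tensor R S = {(b @ a, b' @ a') | a b a' b'. (a, a') \<in> S \<and> (b, b') \<in> R}"
      unfolding word_tensor_def by blast
    then show ?thesis
      using slides_tensor[of "\<lambda>a b. b @ a" over_left S R v] assms v
      by (auto simp: natural_def word_braid_append_left split_beta)
  qed
  moreover have "slides (over_right v) (word_tensor R S)" if v: "v \<in> words" for v
  proof -
    have "word_tensor R S = {(a @ b, a' @ b') | a b a' b'. (a, a') \<in> R \<and> (b, b') \<in> S}"
      unfolding word_tensor_def by blast
    then show ?thesis
      using slides_tensor[of "(@)" over_right R S v] assms v
      by (auto simp: natural_def word_braid_append_right split_beta)
  qed
  ultimately show ?thesis by (simp add: natural_def)
qed

end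

section \<open>The generating morphisms as relations between words\<close>

definition sign_of :: "base_obj \<Rightarrow> bool"
  where "sign_of a \<longleftrightarrow> a = Xob"

definition word_of :: "base_obj list \<Rightarrow> 'x list \<Rightarrow> 'x word"
  where "word_of a p = zip p (map sign_of a)"

lemma inj_sign_of: "inj sign_of"
  by (rule injI) (metis base_obj.exhaust sign_of_def)

lemma map_sign_of_eq [simp]: "map sign_of a = map sign_of b \<longleftrightarrow> a = b"
  using inj_sign_of by (simp add: inj_map_eq_map)

lemma word_of_Nil [simp]: "word_of [] [] = []"
  by (simp add: word_of_def)

lemma word_of_append: "length p = length a \<Longrightarrow> word_of (a @ b) (p @ q) = word_of a p @ word_of b q"
  by (simp add: word_of_def)

lemma map_word_of [simp]:
  "length p = length a \<Longrightarrow> map fst (word_of a p) = p"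
  "length p = length a \<Longrightarrow> map snd (word_of a p) = map sign_of a"
  by (simp_all add: word_of_def)

lemma word_of_map_fst: "map snd w = map sign_of a \<Longrightarrow> word_of a (map fst w) = w"
  by (metis word_of_def zip_map_fst_snd)

lemma word_of_group_words: "p \<in> Xpow X a \<Longrightarrow> word_of a p \<in> group_words X"
  by (auto simp: Xpow_def word_of_def group_words_def in_lists_conv_set dest: set_zip_leftD)

lemma map_fst_Xpow: "w \<in> group_words X \<Longrightarrow> map snd w = map sign_of a \<Longrightarrow> map fst w \<in> Xpow X a"
  by (auto simp: Xpow_def group_words_def in_lists_conv_set dest: map_eq_imp_length_eq)

lemma Xpow_append:
  "p @ q \<in> Xpow X (a @ b) \<longleftrightarrow> p \<in> Xpow X a \<and> q \<in> Xpow X b" if "length p = length a"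
  using that by (auto simp: Xpow_def)

lemma Xpow_appendE:
  assumes "w \<in> Xpow X (a @ b)"
  obtains p q where "w = p @ q" "p \<in> Xpow X a" "q \<in> Xpow X b"
proof (rule that[of "take (length a) w" "drop (length a) w"])
  show "take (length a) w \<in> Xpow X a" "drop (length a) w \<in> Xpow X b"
    using assms by (auto simp: Xpow_def dest: in_set_takeD in_set_dropD)
qed simp

context ybe
begin

lemma letter_obj_sign_of [simp]: "letter_obj (sign_of a) = a"
  by (cases a) (simp_all add: letter_obj_def sign_of_def)

definition signed_words :: "bool list \<Rightarrow> 'x word set"
  where "signed_words s = {w \<in> words. map snd w = s}"

abbreviation "typed_words a \<equiv> signed_words (map sign_of a)"

definition evaluation_rel :: "('x word \<times> 'x word) set"
  where "evaluation_rel = {([(x, True), (x, False)], []) | x. x \<in> X}"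

definition coevaluation_rel :: "('x word \<times> 'x word) set"
  where "coevaluation_rel = {([], [(x, False), (x, True)]) | x. x \<in> X}"

definition crossing_rel :: "bool \<Rightarrow> bool \<Rightarrow> ('x word \<times> 'x word) set"
  where "crossing_rel a b =
    {([(x, a), (y, b)], [(u, b), (v, a)]) | x y u v. signed_crossing a b x y u v}"

lemma letter_braid_signed:
  assumes "x \<in> X" "y \<in> X"
  shows "letter_braid (x, a) (y, b) = (d', c') \<longleftrightarrow>
    (\<exists>u v. d' = (u, b) \<and> c' = (v, a) \<and> signed_crossing a b x y u v)"
  using assms by (cases d'; cases c') (auto simp: letter_braid_iff)

lemma letter_braid_obtain:
  assumes "x \<in> X" "y \<in> X"
  obtains u v where "letter_braid (x, a) (y, b) = ((u, b), (v, a))" "signed_crossing a b x y u v"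
    "u \<in> X" "v \<in> X"
  using signed_crossing_ex[OF assms, of a b] letter_braid_signed[OF assms] signed_crossing_closed
  by metis

text \<open>The two crossings of a letter with \<open>x\<close> and with the inverse of \<open>y\<close> share two labels at
  one corner; hence \<open>x = y\<close> before the braiding if and only if the labels agree after it, and
  then the passing letter is unchanged.\<close>

lemma natural_evaluation: "natural evaluation_rel"
proof (rule natural_letters)
  fix c :: "'x \<times> bool" assume "fst c \<in> X"
  then obtain z e where c: "c = (z, e)" "z \<in> X" by (cases c) auto
  have L: "x = y \<longleftrightarrow> x1 = y1" "x = y \<Longrightarrow> z2 = z"
    if "signed_crossing False e y z z1 y1" "signed_crossing True e x z1 z2 x1" for x y z1 y1 z2 x1
    using that unfolding signed_crossing_def by (cases e; simp; blast dest: crossing_functional)+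
  have R: "x = y \<longleftrightarrow> x1 = y1" "x = y \<Longrightarrow> z2 = z"
    if "signed_crossing e True z x x1 z1" "signed_crossing e False z1 y y1 z2" for x y z1 y1 z2 x1
    using that unfolding signed_crossing_def by (cases e; simp; blast dest: crossing_functional)+
  show "slides (over_left [c]) evaluation_rel \<and> slides (over_right [c]) evaluation_rel"
  proof
    show "slides (over_left [c]) evaluation_rel"
      unfolding slides_def
    proof (intro ballI allI)
      fix w v' u' assume w: "w \<in> words"
      show "(\<exists>w'. (w, w') \<in> evaluation_rel \<and> word_braid w' [c] = (v', u')) \<longleftrightarrow>
        (\<exists>u. word_braid w [c] = (v', u) \<and> (u, u') \<in> evaluation_rel)"
      proof (cases "map snd w = [True, False]")
        case True
        then obtain x y where xy: "w = [(x, True), (y, False)]" by auto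
        then have "x \<in> X" "y \<in> X" using w by auto
        obtain z1 y1 where 1: "letter_braid (y, False) c = ((z1, e), (y1, False))"
          "signed_crossing False e y z z1 y1" "z1 \<in> X" "y1 \<in> X"
          using letter_braid_obtain[OF \<open>y \<in> X\<close> c(2)] c(1) by metis
        obtain z2 x1 where 2: "letter_braid (x, True) (z1, e) = ((z2, e), (x1, True))"
          "signed_crossing True e x z1 z2 x1" "z2 \<in> X" "x1 \<in> X"
          using letter_braid_obtain[OF \<open>x \<in> X\<close> 1(3)] by metis
        show ?thesis using L[OF 1(2) 2(2)] 1 2 xy c \<open>x \<in> X\<close>
          by (auto simp: evaluation_rel_def)
      next
        case False
        then have "(w, w') \<notin> evaluation_rel" for w' by (auto simp: evaluation_rel_def)
        moreover have "(u, u') \<notin> evaluation_rel" if "word_braid w [c] = (v', u)" for u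
          using word_braid_closed[OF w _ that] c False by (auto simp: evaluation_rel_def)
        ultimately show ?thesis by blast
      qed
    qed
    show "slides (over_right [c]) evaluation_rel"
      unfolding slides_def swap_eq_iff
    proof (intro ballI allI)
      fix w v' u' assume w: "w \<in> words"
      show "(\<exists>w'. (w, w') \<in> evaluation_rel \<and> word_braid [c] w' = (u', v')) \<longleftrightarrow>
        (\<exists>u. word_braid [c] w = (u, v') \<and> (u, u') \<in> evaluation_rel)"
      proof (cases "map snd w = [True, False]")
        case True
        then obtain x y where xy: "w = [(x, True), (y, False)]" by auto
        then have "x \<in> X" "y \<in> X" using w by auto
        obtain x1 z1 where 1: "letter_braid c (x, True) = ((x1, True), (z1, e))"
          "signed_crossing e True z x x1 z1" "z1 \<in> X" "x1 \<in> X"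
          using letter_braid_obtain[OF c(2) \<open>x \<in> X\<close>] c(1) by metis
        obtain y1 z2 where 2: "letter_braid (z1, e) (y, False) = ((y1, False), (z2, e))"
          "signed_crossing e False z1 y y1 z2" "z2 \<in> X" "y1 \<in> X"
          using letter_braid_obtain[OF 1(3) \<open>y \<in> X\<close>] by metis
        show ?thesis using R[OF 1(2) 2(2)] 1 2 xy c \<open>x \<in> X\<close>
          by (auto simp: evaluation_rel_def)
      next
        case False
        then have "(w, w') \<notin> evaluation_rel" for w' by (auto simp: evaluation_rel_def)
        moreover have "(u, u') \<notin> evaluation_rel" if "word_braid [c] w = (u, v')" for u
          using word_braid_closed[OF _ w that] c False by (auto simp: evaluation_rel_def)
        ultimately show ?thesis by blast
      qed
    qed
  qed
qed

text \<open>As for the evaluation, but now every label \<open>y\<close> after the braiding must also come from a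
  label \<open>x\<close> before it, which is where the surjectivity of the maps \<open>\<sigma>\<close>, \<open>\<gamma>\<close> and of \<open>r\<close> is used.\<close>

lemma natural_coevaluation: "natural coevaluation_rel"
proof (rule natural_letters)
  fix c :: "'x \<times> bool" assume "fst c \<in> X"
  then obtain z e where c: "c = (z, e)" "z \<in> X" by (cases c) auto
  have L: "x1 = x2 \<and> z2 = z"
    if "signed_crossing True e x z z1 x1" "signed_crossing False e x z1 z2 x2" for x z1 z2 x1 x2
    using that unfolding signed_crossing_def by (cases e; simp; blast dest: crossing_functional)+
  have L': "\<exists>x z1. signed_crossing True e x z z1 y \<and> signed_crossing False e x z1 z y"
    if "y \<in> X" for y
    using crossing_right[OF c(2) that] crossing_in[OF that c(2)] unfolding signed_crossing_def
    by (cases e) auto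
  have R: "x1 = x2 \<and> z2 = z"
    if "signed_crossing e False z x x1 z1" "signed_crossing e True z1 x x2 z2" for x z1 z2 x1 x2
    using that unfolding signed_crossing_def by (cases e; simp; blast dest: crossing_functional)+
  have R': "\<exists>x z1. signed_crossing e False z x y z1 \<and> signed_crossing e True z1 x y z"
    if "y \<in> X" for y
    using crossing_left[OF c(2) that] crossing_out[OF that c(2)] crossing_in[OF that c(2)]
      crossing_out[OF c(2) that] crossing_in[OF c(2) that] crossing_right[OF that c(2)]
    unfolding signed_crossing_def by (cases e) auto
  show "slides (over_left [c]) coevaluation_rel \<and> slides (over_right [c]) coevaluation_rel"
  proof
    show "slides (over_left [c]) coevaluation_rel"
      unfolding slides_def
    proof (intro ballI allI iffI)
      fix w v' u' assume w: "w \<in> words"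
      assume "\<exists>w'. (w, w') \<in> coevaluation_rel \<and> word_braid w' [c] = (v', u')"
      then obtain x where x: "x \<in> X" "w = []" "word_braid [(x, False), (x, True)] [c] = (v', u')"
        by (auto simp: coevaluation_rel_def)
      obtain z1 x1 where 1: "letter_braid (x, True) c = ((z1, e), (x1, True))"
        "signed_crossing True e x z z1 x1" "z1 \<in> X" "x1 \<in> X"
        using letter_braid_obtain[OF x(1) c(2)] c(1) by metis
      obtain z2 x2 where 2: "letter_braid (x, False) (z1, e) = ((z2, e), (x2, False))"
        "signed_crossing False e x z1 z2 x2" "z2 \<in> X" "x2 \<in> X"
        using letter_braid_obtain[OF x(1) 1(3)] by metis
      show "\<exists>u. word_braid w [c] = (v', u) \<and> (u, u') \<in> coevaluation_rel"
        using x 1 2 L[OF 1(2) 2(2)] c by (auto simp: coevaluation_rel_def)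
    next
      fix w v' u' assume w: "w \<in> words"
      assume "\<exists>u. word_braid w [c] = (v', u) \<and> (u, u') \<in> coevaluation_rel"
      then obtain u y where y: "word_braid w [c] = (v', u)" "u = []" "u' = [(y, False), (y, True)]" "y \<in> X"
        by (auto simp: coevaluation_rel_def)
      then have "w = []" using word_braid_closed[OF w _ y(1)] c by simp
      then have v': "v' = [c]" using y by simp
      obtain x z1 where s: "signed_crossing True e x z z1 y" "signed_crossing False e x z1 z y"
        using L' y(4) by blast
      note cl = signed_crossing_closed[OF s(1)]
      have "letter_braid (x, True) c = ((z1, e), (y, True))"
        "letter_braid (x, False) (z1, e) = ((z, e), (y, False))"
        using s cl c by (auto simp: letter_braid_signed)
      then have "word_braid [(x, False), (x, True)] [c] = (v', u')" using y v' c by simp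
      then show "\<exists>w'. (w, w') \<in> coevaluation_rel \<and> word_braid w' [c] = (v', u')"
        using cl(1) \<open>w = []\<close> by (auto simp: coevaluation_rel_def)
    qed
    show "slides (over_right [c]) coevaluation_rel"
      unfolding slides_def swap_eq_iff
    proof (intro ballI allI iffI)
      fix w v' u' assume w: "w \<in> words"
      assume "\<exists>w'. (w, w') \<in> coevaluation_rel \<and> word_braid [c] w' = (u', v')"
      then obtain x where x: "x \<in> X" "w = []" "word_braid [c] [(x, False), (x, True)] = (u', v')"
        by (auto simp: coevaluation_rel_def)
      obtain x1 z1 where 1: "letter_braid c (x, False) = ((x1, False), (z1, e))"
        "signed_crossing e False z x x1 z1" "z1 \<in> X" "x1 \<in> X"
        using letter_braid_obtain[OF c(2) x(1)] c(1) by metis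
      obtain x2 z2 where 2: "letter_braid (z1, e) (x, True) = ((x2, True), (z2, e))"
        "signed_crossing e True z1 x x2 z2" "z2 \<in> X" "x2 \<in> X"
        using letter_braid_obtain[OF 1(3) x(1)] by metis
      show "\<exists>u. word_braid [c] w = (u, v') \<and> (u, u') \<in> coevaluation_rel"
        using x 1 2 R[OF 1(2) 2(2)] c by (auto simp: coevaluation_rel_def)
    next
      fix w v' u' assume w: "w \<in> words"
      assume "\<exists>u. word_braid [c] w = (u, v') \<and> (u, u') \<in> coevaluation_rel"
      then obtain u y where y: "word_braid [c] w = (u, v')" "u = []" "u' = [(y, False), (y, True)]" "y \<in> X"
        by (auto simp: coevaluation_rel_def)
      then have "w = []" using word_braid_closed[OF _ w y(1)] c by simp
      then have v': "v' = [c]" using y by simp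
      obtain x z1 where s: "signed_crossing e False z x y z1" "signed_crossing e True z1 x y z"
        using R' y(4) by blast
      note cl = signed_crossing_closed[OF s(1)]
      have "letter_braid c (x, False) = ((y, False), (z1, e))"
        "letter_braid (z1, e) (x, True) = ((y, True), (z, e))"
        using s cl c by (auto simp: letter_braid_signed)
      then have "word_braid [c] [(x, False), (x, True)] = (u', v')" using y v' c by simp
      then show "\<exists>w'. (w, w') \<in> coevaluation_rel \<and> word_braid [c] w' = (u', v')"
        using cl(2) \<open>w = []\<close> by (auto simp: coevaluation_rel_def)
    qed
  qed
qed

lemma crossing_rel_iff:
  assumes "x \<in> X" "y \<in> X"
  shows "([(x, a), (y, b)], w') \<in> crossing_rel a' b' \<longleftrightarrow> a' = a \<and> b' = b \<and>
    (\<exists>u v. w' = [(u, b), (v, a)] \<and> signed_crossing a b x y u v)"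
  by (auto simp: crossing_rel_def)

text \<open>Both naturality statements are the signed Yang--Baxter equation: on the left the three
  strands have signs \<open>a, b, e\<close>, and on the right \<open>e, a, b\<close>.\<close>

lemma natural_crossing: "natural (crossing_rel a b)"
proof (rule natural_letters)
  fix c :: "'x \<times> bool" assume "fst c \<in> X"
  then obtain z e where c: "c = (z, e)" "z \<in> X" by (cases c) auto
  show "slides (over_left [c]) (crossing_rel a b) \<and> slides (over_right [c]) (crossing_rel a b)"
  proof
    show "slides (over_left [c]) (crossing_rel a b)"
      unfolding slides_def
    proof (intro ballI allI)
      fix w v' u' assume w: "w \<in> words"
      show "(\<exists>w'. (w, w') \<in> crossing_rel a b \<and> word_braid w' [c] = (v', u')) \<longleftrightarrow>
        (\<exists>u. word_braid w [c] = (v', u) \<and> (u, u') \<in> crossing_rel a b)"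
      proof (cases "map snd w = [a, b]")
        case True
        then obtain x y where xy: "w = [(x, a), (y, b)]" by auto
        then have "x \<in> X" "y \<in> X" using w by auto
        obtain y1 x1 where 1: "letter_braid (x, a) (y, b) = ((y1, b), (x1, a))"
          "signed_crossing a b x y y1 x1" "y1 \<in> X" "x1 \<in> X"
          using letter_braid_obtain[OF \<open>x \<in> X\<close> \<open>y \<in> X\<close>] by metis
        obtain z1 x2 where 2: "letter_braid (x1, a) (z, e) = ((z1, e), (x2, a))"
          "signed_crossing a e x1 z z1 x2" "z1 \<in> X" "x2 \<in> X"
          using letter_braid_obtain[OF 1(4) c(2)] by metis
        obtain z2 y2 where 3: "letter_braid (y1, b) (z1, e) = ((z2, e), (y2, b))"
          "signed_crossing b e y1 z1 z2 y2" "z2 \<in> X" "y2 \<in> X"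
          using letter_braid_obtain[OF 1(3) 2(3)] by metis
        obtain z' y' x' where ybe: "signed_crossing b e y z z' y'" "signed_crossing a e x z' z2 x'"
          "signed_crossing a b x' y' y2 x2"
          using signed_yang_baxter[OF 1(2) 2(2) 3(2)] by blast
        note cl = signed_crossing_closed[OF ybe(1)] signed_crossing_closed[OF ybe(2)]
        have 4: "letter_braid (y, b) (z, e) = ((z', e), (y', b))"
          "letter_braid (x, a) (z', e) = ((z2, e), (x', a))"
          using ybe cl by (auto simp: letter_braid_signed)
        have "(w, w') \<in> crossing_rel a b \<longleftrightarrow> w' = [(y1, b), (x1, a)]" for w'
          using 1(2) signed_crossing_unique[OF 1(2)]
          unfolding xy crossing_rel_iff[OF \<open>x \<in> X\<close> \<open>y \<in> X\<close>] by blast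
        then have "(\<exists>w'. (w, w') \<in> crossing_rel a b \<and> word_braid w' [c] = (v', u')) \<longleftrightarrow>
          v' = [(z2, e)] \<and> u' = [(y2, b), (x2, a)]"
          using 2 3 c by auto
        moreover have "word_braid w [c] = (v', u) \<longleftrightarrow> v' = [(z2, e)] \<and> u = [(x', a), (y', b)]" for u
          using 4 xy c by auto
        moreover have "([(x', a), (y', b)], u') \<in> crossing_rel a b \<longleftrightarrow> u' = [(y2, b), (x2, a)]"
          using ybe(3) signed_crossing_unique[OF ybe(3)] cl
          by (subst crossing_rel_iff) blast+
        ultimately show ?thesis by simp
      next
        case False
        then have "(w, w') \<notin> crossing_rel a b" for w' by (auto simp: crossing_rel_def)
        moreover have "(u, u') \<notin> crossing_rel a b" if "word_braid w [c] = (v', u)" for u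
          using word_braid_closed[OF w _ that] c False by (auto simp: crossing_rel_def)
        ultimately show ?thesis by blast
      qed
    qed
    show "slides (over_right [c]) (crossing_rel a b)"
      unfolding slides_def swap_eq_iff
    proof (intro ballI allI)
      fix w v' u' assume w: "w \<in> words"
      show "(\<exists>w'. (w, w') \<in> crossing_rel a b \<and> word_braid [c] w' = (u', v')) \<longleftrightarrow>
        (\<exists>u. word_braid [c] w = (u, v') \<and> (u, u') \<in> crossing_rel a b)"
      proof (cases "map snd w = [a, b]")
        case True
        then obtain x y where xy: "w = [(x, a), (y, b)]" by auto
        then have "x \<in> X" "y \<in> X" using w by auto
        obtain x1 z1 where 1: "letter_braid (z, e) (x, a) = ((x1, a), (z1, e))"
          "signed_crossing e a z x x1 z1" "x1 \<in> X" "z1 \<in> X"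
          using letter_braid_obtain[OF c(2) \<open>x \<in> X\<close>] by metis
        obtain y1 z2 where 2: "letter_braid (z1, e) (y, b) = ((y1, b), (z2, e))"
          "signed_crossing e b z1 y y1 z2" "y1 \<in> X" "z2 \<in> X"
          using letter_braid_obtain[OF 1(4) \<open>y \<in> X\<close>] by metis
        obtain y2 x2 where 3: "letter_braid (x1, a) (y1, b) = ((y2, b), (x2, a))"
          "signed_crossing a b x1 y1 y2 x2" "y2 \<in> X" "x2 \<in> X"
          using letter_braid_obtain[OF 1(3) 2(3)] by metis
        obtain y' x' z' where ybe: "signed_crossing a b x y y' x'" "signed_crossing e b z y' y2 z'"
          "signed_crossing e a z' x' x2 z2"
          using signed_yang_baxter[OF 1(2) 2(2) 3(2)] by blast
        note cl = signed_crossing_closed[OF ybe(1)] signed_crossing_closed[OF ybe(2)]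
        have 4: "letter_braid (z, e) (y', b) = ((y2, b), (z', e))"
          "letter_braid (z', e) (x', a) = ((x2, a), (z2, e))"
          using ybe cl by (auto simp: letter_braid_signed)
        have "(w, w') \<in> crossing_rel a b \<longleftrightarrow> w' = [(y', b), (x', a)]" for w'
          using ybe(1) signed_crossing_unique[OF ybe(1)]
          unfolding xy crossing_rel_iff[OF \<open>x \<in> X\<close> \<open>y \<in> X\<close>] by blast
        then have "(\<exists>w'. (w, w') \<in> crossing_rel a b \<and> word_braid [c] w' = (u', v')) \<longleftrightarrow>
          v' = [(z2, e)] \<and> u' = [(y2, b), (x2, a)]"
          using 4 c by auto
        moreover have "word_braid [c] w = (u, v') \<longleftrightarrow> v' = [(z2, e)] \<and> u = [(x1, a), (y1, b)]" for u
          using 1 2 xy c by auto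
        moreover have "([(x1, a), (y1, b)], u') \<in> crossing_rel a b \<longleftrightarrow> u' = [(y2, b), (x2, a)]"
          using 3(2) signed_crossing_unique[OF 3(2)]
          unfolding crossing_rel_iff[OF 1(3) 2(3)] by blast
        ultimately show ?thesis by simp
      next
        case False
        then have "(w, w') \<notin> crossing_rel a b" for w' by (auto simp: crossing_rel_def)
        moreover have "(u, u') \<notin> crossing_rel a b" if "word_braid [c] w = (u, v')" for u
          using word_braid_closed[OF _ w that] c False by (auto simp: crossing_rel_def)
        ultimately show ?thesis by blast
      qed
    qed
  qed
qed

section \<open>Soundness of the functor\<close>

fun mor_rel :: "mor_term \<Rightarrow> ('x word \<times> 'x word) set" where
  "mor_rel (MId a) = Id_on (typed_words a)"
| "mor_rel Ev = evaluation_rel"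
| "mor_rel Coev = coevaluation_rel"
| "mor_rel (Kap a b) = crossing_rel (sign_of a) (sign_of b)"
| "mor_rel (KapInv a b) = (crossing_rel (sign_of a) (sign_of b))\<inverse>"
| "mor_rel (MComp g f) = mor_rel f O mor_rel g"
| "mor_rel (MTens f g) = word_tensor (mor_rel f) (mor_rel g)"

lemma signed_words_append:
  "u \<in> signed_words s \<Longrightarrow> v \<in> signed_words t \<Longrightarrow> u @ v \<in> signed_words (s @ t)"
  by (auto simp: signed_words_def)

lemma signed_words_appendE:
  assumes "w \<in> signed_words (s @ t)"
  obtains u v where "w = u @ v" "u \<in> signed_words s" "v \<in> signed_words t"
proof (rule that[of "take (length s) w" "drop (length s) w"])
  have w: "take (length s) w @ drop (length s) w \<in> words" "map snd w = s @ t"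
    using assms by (simp_all add: signed_words_def)
  then show "take (length s) w \<in> signed_words s" "drop (length s) w \<in> signed_words t"
    unfolding signed_words_def group_words_append by (simp_all add: take_map[symmetric] drop_map[symmetric])
qed simp

lemma mor_rel_typed:
  "(w, w') \<in> mor_rel f \<Longrightarrow>
    w \<in> typed_words (dom_of f) \<and> w' \<in> typed_words (cod_of f)"
proof (induction f arbitrary: w w')
  case (MTens f g)
  then show ?case by (auto elim!: word_tensorE intro!: signed_words_append)
qed (auto simp: signed_words_def evaluation_rel_def coevaluation_rel_def crossing_rel_def sign_of_def
    dest: signed_crossing_closed)

lemma word_relation_mor_rel: "word_relation (mor_rel f)"
  unfolding word_relation_def using mor_rel_typed[of _ _ f] by (auto simp: signed_words_def)

lemma natural_signed_words: "natural (Id_on (signed_words s))"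
  by (rule natural_Id_on) (auto simp: signed_words_def)

lemma natural_mor_rel: "natural (mor_rel f)"
proof (induction f)
  case (KapInv a b)
  show ?case
    using natural_converse[OF natural_crossing] word_relation_mor_rel[of "Kap a b"] by simp
qed (simp_all add: natural_signed_words natural_evaluation natural_coevaluation natural_crossing
    natural_comp natural_tensor word_relation_mor_rel)

lemma kap_letter_typing:
  "well_typed (kap_letter a bs) \<and> dom_of (kap_letter a bs) = a # bs \<and> cod_of (kap_letter a bs) = bs @ [a]"
  by (induction bs) auto

lemma kap_word_typing:
  "well_typed (kap_word as bs) \<and> dom_of (kap_word as bs) = as @ bs \<and> cod_of (kap_word as bs) = bs @ as"
  by (induction as) (auto simp: kap_letter_typing)

lemma signed_words_Nil [simp]: "signed_words [] = {[]}"
  by (auto simp: signed_words_def)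

lemma signed_words_singleton: "w \<in> signed_words [a] \<longleftrightarrow> (\<exists>c. w = [c] \<and> fst c \<in> X \<and> snd c = a)"
  by (auto simp: signed_words_def map_eq_Cons_conv)

lemma signed_words_Cons: "w \<in> signed_words (a # s) \<longleftrightarrow>
    (\<exists>c v. w = c # v \<and> fst c \<in> X \<and> snd c = a \<and> v \<in> signed_words s)"
  by (auto simp: signed_words_def map_eq_Cons_conv)

lemma crossing_rel_letter_braid:
  "(p, q) \<in> crossing_rel a b \<longleftrightarrow> (\<exists>c d d' c'. p = [c, d] \<and> q = [d', c'] \<and> fst c \<in> X \<and> fst d \<in> X \<and>
    snd c = a \<and> snd d = b \<and> letter_braid c d = (d', c'))"
proof
  assume "(p, q) \<in> crossing_rel a b"
  then obtain x y u v where "p = [(x, a), (y, b)]" "q = [(u, b), (v, a)]" "signed_crossing a b x y u v"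
    by (auto simp: crossing_rel_def)
  moreover from this(3) have "x \<in> X" "y \<in> X" using signed_crossing_closed by blast+
  ultimately show "\<exists>c d d' c'. p = [c, d] \<and> q = [d', c'] \<and> fst c \<in> X \<and> fst d \<in> X \<and>
      snd c = a \<and> snd d = b \<and> letter_braid c d = (d', c')"
    by (auto simp: letter_braid_signed)
next
  assume "\<exists>c d d' c'. p = [c, d] \<and> q = [d', c'] \<and> fst c \<in> X \<and> fst d \<in> X \<and>
    snd c = a \<and> snd d = b \<and> letter_braid c d = (d', c')"
  then show "(p, q) \<in> crossing_rel a b"
    by (auto simp: crossing_rel_def letter_braid_signed)
qed

lemma crossing_tensor_iff:
  "(p, q) \<in> word_tensor (crossing_rel a b) (Id_on (signed_words s)) \<longleftrightarrow>
    (\<exists>c d d' c' w. p = c # d # w \<and> q = d' # c' # w \<and> fst c \<in> X \<and> fst d \<in> X \<and>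
      snd c = a \<and> snd d = b \<and> letter_braid c d = (d', c') \<and> w \<in> signed_words s)"
  unfolding word_tensor_def mem_Collect_eq prod.inject crossing_rel_letter_braid
  by (auto simp: Id_on_iff) (metis append_Cons append_Nil)

lemma letter_tensor_iff:
  "(p, q) \<in> word_tensor (Id_on (signed_words [b])) R \<longleftrightarrow>
    (\<exists>d p' q'. p = d # p' \<and> q = d # q' \<and> fst d \<in> X \<and> snd d = b \<and> (p', q') \<in> R)"
  unfolding word_tensor_def by (auto simp: Id_on_iff signed_words_singleton) (metis append_Cons append_Nil)

lemma mor_rel_kap_letter:
  "(p, q) \<in> mor_rel (kap_letter a bs) \<longleftrightarrow> (\<exists>c w w' c'. p = c # w \<and> q = w' @ [c'] \<and> fst c \<in> X \<and>
    snd c = sign_of a \<and> w \<in> typed_words bs \<and> letter_word_braid c w = (w', c'))"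
proof (induction bs arbitrary: p q)
  case Nil
  show ?case by (auto simp: Id_on_iff signed_words_singleton)
next
  case (Cons b bs)
  have "(p, q) \<in> mor_rel (kap_letter a (b # bs)) \<longleftrightarrow> (\<exists>c d d' c1 w w' c'.
    p = c # d # w \<and> q = d' # w' @ [c'] \<and> fst c \<in> X \<and> fst d \<in> X \<and> snd c = sign_of a \<and> snd d = sign_of b \<and>
    letter_braid c d = (d', c1) \<and> w \<in> typed_words bs \<and> letter_word_braid c1 w = (w', c'))"
    (is "?L = ?R")
  proof
    assume ?L
    then obtain m where m: "(p, m) \<in> word_tensor (crossing_rel (sign_of a) (sign_of b)) (Id_on (typed_words bs))"
      "(m, q) \<in> word_tensor (Id_on (signed_words [sign_of b])) (mor_rel (kap_letter a bs))"
      by auto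
    obtain c d d' c1 w where 1: "p = c # d # w" "m = d' # c1 # w" "fst c \<in> X" "fst d \<in> X"
      "snd c = sign_of a" "snd d = sign_of b" "letter_braid c d = (d', c1)" "w \<in> typed_words bs"
      using m(1) unfolding crossing_tensor_iff by blast
    obtain d2 p' q' where 2: "m = d2 # p'" "q = d2 # q'" "(p', q') \<in> mor_rel (kap_letter a bs)"
      using m(2) unfolding letter_tensor_iff by blast
    obtain c2 w2 w' c' where 3: "p' = c2 # w2" "q' = w' @ [c']" "letter_word_braid c2 w2 = (w', c')"
      using 2(3) unfolding Cons.IH by blast
    have "d2 = d'" "c2 = c1" "w2 = w" using 1(2) 2(1) 3(1) by auto
    then show ?R using 1 2(2) 3(2,3) by blast
  next
    assume ?R
    then obtain c d d' c1 w w' c' where 1: "p = c # d # w" "q = d' # w' @ [c']" "fst c \<in> X" "fst d \<in> X"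
      "snd c = sign_of a" "snd d = sign_of b" "letter_braid c d = (d', c1)" "w \<in> typed_words bs"
      "letter_word_braid c1 w = (w', c')" by blast
    note cl = letter_braid_closed[OF 1(3,4,7)]
    have "(p, d' # c1 # w) \<in> word_tensor (crossing_rel (sign_of a) (sign_of b)) (Id_on (typed_words bs))"
      unfolding crossing_tensor_iff using 1 by blast
    moreover have "(c1 # w, w' @ [c']) \<in> mor_rel (kap_letter a bs)"
      unfolding Cons.IH using 1 cl by metis
    then have "(d' # c1 # w, q) \<in> word_tensor (Id_on (signed_words [sign_of b])) (mor_rel (kap_letter a bs))"
      unfolding letter_tensor_iff using 1 cl by metis
    ultimately show ?L by auto
  qed
  also have "\<dots> \<longleftrightarrow> (\<exists>c w w' c'. p = c # w \<and> q = w' @ [c'] \<and> fst c \<in> X \<and>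
    snd c = sign_of a \<and> w \<in> typed_words (b # bs) \<and> letter_word_braid c w = (w', c'))"
    (is "?L = ?R")
  proof
    assume ?L
    then obtain c d d' c1 w w' c' where 1: "p = c # d # w" "q = d' # w' @ [c']" "fst c \<in> X" "fst d \<in> X"
      "snd c = sign_of a" "snd d = sign_of b" "letter_braid c d = (d', c1)" "w \<in> typed_words bs"
      "letter_word_braid c1 w = (w', c')" by blast
    then have "p = c # (d # w)" "q = (d' # w') @ [c']" "d # w \<in> typed_words (b # bs)"
      "letter_word_braid c (d # w) = (d' # w', c')"
      by (simp_all add: signed_words_Cons)
    then show ?R using 1(3,5) by blast
  next
    assume ?R
    then obtain c w0 w1 c' where 1: "p = c # w0" "q = w1 @ [c']" "fst c \<in> X" "snd c = sign_of a"
      "w0 \<in> typed_words (b # bs)" "letter_word_braid c w0 = (w1, c')" by blast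
    obtain d w where 2: "w0 = d # w" "fst d \<in> X" "snd d = sign_of b" "w \<in> typed_words bs"
      using 1(5) by (auto simp: signed_words_Cons)
    obtain d' c1 where 3: "letter_braid c d = (d', c1)" by (rule prod.exhaust)
    obtain w' c2 where 4: "letter_word_braid c1 w = (w', c2)" by (rule prod.exhaust)
    have "w1 = d' # w'" and c: "c2 = c'" using 1(6) 2(1) 3 4 by simp_all
    then have "p = c # d # w" "q = d' # w' @ [c']" using 1(1,2) 2(1) by simp_all
    then show ?L using 1(3,4) 2(2-4) 3 4[unfolded c] by blast
  qed
  finally show ?case .
qed

lemma kap_word_tensor_iff:
  "(p, q) \<in> word_tensor (mor_rel (kap_letter a bs)) (Id_on (signed_words s)) \<longleftrightarrow>
    (\<exists>c w w' c' v. p = c # w @ v \<and> q = w' @ c' # v \<and> fst c \<in> X \<and>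
    snd c = sign_of a \<and> w \<in> typed_words bs \<and> letter_word_braid c w = (w', c') \<and>
    v \<in> signed_words s)"
  (is "?L = ?R")
proof
  assume ?L
  then show ?R by (elim word_tensorE) (fastforce simp: mor_rel_kap_letter Id_on_iff)
next
  assume ?R
  then obtain c w w' c' v where 1: "p = (c # w) @ v" "q = (w' @ [c']) @ v" "fst c \<in> X"
    "snd c = sign_of a" "w \<in> typed_words bs" "letter_word_braid c w = (w', c')"
    "v \<in> signed_words s" by auto
  then have "(c # w, w' @ [c']) \<in> mor_rel (kap_letter a bs)" "(v, v) \<in> Id_on (signed_words s)"
    unfolding mor_rel_kap_letter by blast+
  then show ?L unfolding 1(1,2) by (rule word_tensorI)
qed

text \<open>The morphism assembled from crossings of letters acts as the braiding of words.\<close>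

lemma mor_rel_kap_word:
  "(p, q) \<in> mor_rel (kap_word as bs) \<longleftrightarrow> (\<exists>v w w' v'. p = v @ w \<and> q = w' @ v' \<and>
    v \<in> typed_words as \<and> w \<in> typed_words bs \<and> word_braid v w = (w', v'))"
proof (induction as arbitrary: p q)
  case Nil
  have "(p, q) \<in> mor_rel (kap_word [] bs) \<longleftrightarrow> p = q \<and> q \<in> typed_words bs"
    by (auto simp: Id_on_iff)
  moreover have "\<exists>v w w' v'. q = v @ w \<and> q = w' @ v' \<and> v \<in> signed_words (map sign_of []) \<and>
    w \<in> typed_words bs \<and> word_braid v w = (w', v')" if "q \<in> typed_words bs"
    using that by (intro exI[of _ "[]"] exI[of _ q]) simp
  ultimately show ?case by auto
next
  case (Cons a as)
  have "(p, q) \<in> mor_rel (kap_word (a # as) bs) \<longleftrightarrow> (\<exists>c v w w' v' w'' c'.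
    p = c # v @ w \<and> q = w'' @ c' # v' \<and> fst c \<in> X \<and> snd c = sign_of a \<and>
    v \<in> typed_words as \<and> w \<in> typed_words bs \<and>
    word_braid v w = (w', v') \<and> letter_word_braid c w' = (w'', c'))"
    (is "?L = ?R")
  proof
    assume ?L
    then obtain c m q1 q' where 1: "p = c # m" "q1 = c # q'" "fst c \<in> X" "snd c = sign_of a"
      "(m, q') \<in> mor_rel (kap_word as bs)"
      "(q1, q) \<in> word_tensor (mor_rel (kap_letter a bs)) (Id_on (typed_words as))"
      unfolding kap_word.simps mor_rel.simps relcomp_unfold mem_Collect_eq prod.case
        list.map letter_tensor_iff by blast
    obtain v w w' v' where 2: "m = v @ w" "q' = w' @ v'"
      "v \<in> typed_words as" "w \<in> typed_words bs" "word_braid v w = (w', v')"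
      using 1(5) unfolding Cons.IH by blast
    obtain c0 y y' c' u where 3: "q1 = c0 # y @ u" "q = y' @ c' # u" "y \<in> typed_words bs"
      "letter_word_braid c0 y = (y', c')"
      using 1(6) unfolding kap_word_tensor_iff by blast
    have "map snd w' = map snd w"
      using 2 word_braid_closed[OF _ _ 2(5)] by (simp add: signed_words_def)
    moreover have "map snd w = map snd y" using 2 3 by (simp add: signed_words_def)
    ultimately have "length w' = length y" by (metis length_map)
    then have "w' = y" "v' = u" "c0 = c" using 1(2) 2(2) 3(1) by auto
    then show ?R using 1 2 3 by blast
  next
    assume ?R
    then obtain c v w w' v' w'' c' where 1: "p = c # v @ w" "q = w'' @ c' # v'" "fst c \<in> X"
      "snd c = sign_of a"
      "v \<in> typed_words as" "w \<in> typed_words bs"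
      "word_braid v w = (w', v')" "letter_word_braid c w' = (w'', c')" by blast
    have 2: "v' \<in> typed_words as" "w' \<in> typed_words bs"
      using 1(5,6) word_braid_closed[OF _ _ 1(7)] by (auto simp: signed_words_def)
    have "(p, c # w' @ v') \<in> word_tensor (Id_on (signed_words [sign_of a])) (mor_rel (kap_word as bs))"
      unfolding letter_tensor_iff Cons.IH using 1 by blast
    moreover have "(c # w' @ v', q) \<in> word_tensor (mor_rel (kap_letter a bs)) (Id_on (typed_words as))"
      unfolding kap_word_tensor_iff using 1 2 by blast
    ultimately show ?L by auto
  qed
  also have "\<dots> \<longleftrightarrow> (\<exists>v w w' v'. p = v @ w \<and> q = w' @ v' \<and>
    v \<in> typed_words (a # as) \<and> w \<in> typed_words bs \<and> word_braid v w = (w', v'))"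
    (is "?L = ?R")
  proof
    assume ?L
    then obtain c v w w' v' w'' c' where 1: "p = c # v @ w" "q = w'' @ c' # v'" "fst c \<in> X"
      "snd c = sign_of a"
      "v \<in> typed_words as" "w \<in> typed_words bs"
      "word_braid v w = (w', v')" "letter_word_braid c w' = (w'', c')" by blast
    then have "p = (c # v) @ w" "c # v \<in> typed_words (a # as)"
      "word_braid (c # v) w = (w'', c' # v')"
      by (simp_all add: signed_words_Cons)
    then show ?R using 1(2,6) by blast
  next
    assume ?R
    then obtain v0 w w'' v1 where 1: "p = v0 @ w" "q = w'' @ v1"
      "v0 \<in> typed_words (a # as)" "w \<in> typed_words bs"
      "word_braid v0 w = (w'', v1)" by blast
    obtain c v where 2: "v0 = c # v" "fst c \<in> X" "snd c = sign_of a" "v \<in> typed_words as"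
      using 1(3) by (auto simp: signed_words_Cons)
    obtain w' v' where 3: "word_braid v w = (w', v')" by (rule prod.exhaust)
    obtain w2 c' where 4: "letter_word_braid c w' = (w2, c')" by (rule prod.exhaust)
    have w: "w2 = w''" and "v1 = c' # v'" using 1(5) 2(1) 3 4 by simp_all
    then have "p = c # v @ w" "q = w'' @ c' # v'" using 1(1,2) 2(1) by simp_all
    then show ?L using 1(4) 2(2-4) 3 4[unfolded w] by blast
  qed
  finally show ?case .
qed

text \<open>The interchange law. The middle words split at the same place because both halves have
  types of known length.\<close>

lemma word_tensor_comp:
  assumes "\<And>p q. (p, q) \<in> R \<Longrightarrow> q \<in> signed_words s" "\<And>p q. (p, q) \<in> R' \<Longrightarrow> p \<in> signed_words s"
  shows "word_tensor R S O word_tensor R' S' = word_tensor (R O R') (S O S')"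
proof (intro equalityI subrelI)
  fix p q assume "(p, q) \<in> word_tensor R S O word_tensor R' S'"
  then obtain m where m: "(p, m) \<in> word_tensor R S" "(m, q) \<in> word_tensor R' S'" by blast
  obtain a b a' b' where 1: "p = a @ b" "m = a' @ b'" "(a, a') \<in> R" "(b, b') \<in> S"
    using m(1) by (rule word_tensorE)
  obtain c d c' d' where 2: "m = c @ d" "q = c' @ d'" "(c, c') \<in> R'" "(d, d') \<in> S'"
    using m(2) by (rule word_tensorE)
  have "map snd a' = map snd c" using assms 1(3) 2(3) by (simp add: signed_words_def)
  then have "length a' = length c" by (metis length_map)
  then have "a' = c" "b' = d" using 1(2) 2(1) by simp_all
  then show "(p, q) \<in> word_tensor (R O R') (S O S')"
    unfolding 1(1) 2(2) using 1 2 by (intro word_tensorI) blast+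
next
  fix p q assume "(p, q) \<in> word_tensor (R O R') (S O S')"
  then obtain a b a' b' where 1: "p = a @ b" "q = a' @ b'" "(a, a') \<in> R O R'" "(b, b') \<in> S O S'"
    by (rule word_tensorE)
  then obtain m n where "(a, m) \<in> R" "(m, a') \<in> R'" "(b, n) \<in> S" "(n, b') \<in> S'" by blast
  then show "(p, q) \<in> word_tensor R S O word_tensor R' S'"
    unfolding 1 by (intro relcompI[where b="m @ n"] word_tensorI)
qed

lemma word_tensor_assoc: "word_tensor R (word_tensor S T) = word_tensor (word_tensor R S) T"
proof (intro equalityI subrelI)
  fix p q assume "(p, q) \<in> word_tensor R (word_tensor S T)"
  then obtain a b c a' b' c' where "p = a @ b @ c" "q = a' @ b' @ c'" "(a, a') \<in> R" "(b, b') \<in> S" "(c, c') \<in> T"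
    by (elim word_tensorE) blast
  then show "(p, q) \<in> word_tensor (word_tensor R S) T"
    by (metis append_assoc word_tensorI)
next
  fix p q assume "(p, q) \<in> word_tensor (word_tensor R S) T"
  then obtain a b c a' b' c' where "p = (a @ b) @ c" "q = (a' @ b') @ c'" "(a, a') \<in> R" "(b, b') \<in> S" "(c, c') \<in> T"
    by (elim word_tensorE) blast
  then show "(p, q) \<in> word_tensor R (word_tensor S T)"
    by (metis append_assoc word_tensorI)
qed

lemma word_tensor_Id_on:
  "word_tensor (Id_on (signed_words s)) (Id_on (signed_words t)) = Id_on (signed_words (s @ t))"
  by (auto elim!: word_tensorE signed_words_appendE intro: word_tensorI signed_words_append simp: Id_on_iff)

lemma mor_rel_kap_natural:
  "word_tensor (mor_rel f) (mor_rel g) O mor_rel (kap_word (cod_of f) (cod_of g)) =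
   mor_rel (kap_word (dom_of f) (dom_of g)) O word_tensor (mor_rel g) (mor_rel f)"
proof (intro equalityI subrelI)
  fix p q assume "(p, q) \<in> word_tensor (mor_rel f) (mor_rel g) O mor_rel (kap_word (cod_of f) (cod_of g))"
  then obtain m where m: "(p, m) \<in> word_tensor (mor_rel f) (mor_rel g)"
    "(m, q) \<in> mor_rel (kap_word (cod_of f) (cod_of g))" by blast
  obtain a b a' b' where 1: "p = a @ b" "m = a' @ b'" "(a, a') \<in> mor_rel f" "(b, b') \<in> mor_rel g"
    using m(1) by (rule word_tensorE)
  obtain v w w' v' where 2: "m = v @ w" "q = w' @ v'" "v \<in> typed_words (cod_of f)"
    "word_braid v w = (w', v')" using m(2) unfolding mor_rel_kap_word by blast
  have "map snd a' = map snd v" using mor_rel_typed[OF 1(3)] 2(3) by (simp add: signed_words_def)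
  then have "length a' = length v" by (metis length_map)
  then have "a' = v" "b' = w" using 1(2) 2(1) by simp_all
  then have "\<exists>w1' w2'. (a, w1') \<in> mor_rel f \<and> (b, w2') \<in> mor_rel g \<and> word_braid w1' w2' = (w', v')"
    using 1 2 by blast
  moreover note t = mor_rel_typed[OF 1(3)] mor_rel_typed[OF 1(4)]
  ultimately obtain u2 u1 where "word_braid a b = (u2, u1)" "(u1, v') \<in> mor_rel f" "(u2, w') \<in> mor_rel g"
    using natural_square[OF natural_mor_rel natural_mor_rel word_relation_mor_rel, of a b f g w' v']
    by (auto simp: signed_words_def)
  then show "(p, q) \<in> mor_rel (kap_word (dom_of f) (dom_of g)) O word_tensor (mor_rel g) (mor_rel f)"
    unfolding 1(1) 2(2) using t
    by (intro relcompI[where b="u2 @ u1"] word_tensorI) (auto simp: mor_rel_kap_word)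
next
  fix p q assume "(p, q) \<in> mor_rel (kap_word (dom_of f) (dom_of g)) O word_tensor (mor_rel g) (mor_rel f)"
  then obtain m where m: "(p, m) \<in> mor_rel (kap_word (dom_of f) (dom_of g))"
    "(m, q) \<in> word_tensor (mor_rel g) (mor_rel f)" by blast
  obtain a b a' b' where 1: "m = a @ b" "q = a' @ b'" "(a, a') \<in> mor_rel g" "(b, b') \<in> mor_rel f"
    using m(2) by (rule word_tensorE)
  obtain v w w' v' where 2: "p = v @ w" "m = w' @ v'" "v \<in> typed_words (dom_of f)"
    "w \<in> typed_words (dom_of g)"
    "word_braid v w = (w', v')" using m(1) unfolding mor_rel_kap_word by blast
  have vw: "v \<in> words" "w \<in> words" using 2 by (auto simp: signed_words_def)
  have "map snd a = map snd w'"
    using mor_rel_typed[OF 1(3)] 2(4) word_braid_closed[OF vw 2(5)] by (simp add: signed_words_def)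
  then have "length a = length w'" by (metis length_map)
  then have "a = w'" "b = v'" using 1(1) 2(2) by simp_all
  then obtain w1' w2' where 3: "(v, w1') \<in> mor_rel f" "(w, w2') \<in> mor_rel g" "word_braid w1' w2' = (a', b')"
    using natural_square[OF natural_mor_rel natural_mor_rel word_relation_mor_rel vw, of f g a' b'] 1 2
    by blast
  then show "(p, q) \<in> word_tensor (mor_rel f) (mor_rel g) O mor_rel (kap_word (cod_of f) (cod_of g))"
    unfolding 2(1) 1(2) using mor_rel_typed[OF 3(1)] mor_rel_typed[OF 3(2)]
    by (intro relcompI[where b="w1' @ w2'"] word_tensorI) (auto simp: mor_rel_kap_word)
qed

text \<open>Equal morphisms act by equal relations. The substantial case is \<open>kap_natural\<close>; together
  with the cases \<open>kap_inv_left\<close>, \<open>kap_inv_right\<close>, \<open>zigzag_X\<close> and \<open>zigzag_Y\<close> it says that the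
  words and their relations form a braided category in which the negative letter is dual to the
  positive one.\<close>

lemma mor_rel_soundness:
  assumes "mor_eq f g"
  shows "well_typed f \<and> well_typed g \<and> dom_of f = dom_of g \<and> cod_of f = cod_of g \<and> mor_rel f = mor_rel g"
  using assms
proof induction
  case (comp_id_left f)
  have "mor_rel f O Id_on (typed_words (cod_of f)) = mor_rel f"
    using mor_rel_typed by fast
  then show ?case using comp_id_left by simp
next
  case (comp_id_right f)
  have "Id_on (typed_words (dom_of f)) O mor_rel f = mor_rel f"
    using mor_rel_typed by fast
  then show ?case using comp_id_right by simp
next
  case (tens_unit_left f)
  have "word_tensor (Id_on {[]}) (mor_rel f) = mor_rel f"
    by (force simp: word_tensor_def Id_on_iff)
  then show ?case using tens_unit_left by simp
next
  case (tens_unit_right f)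
  have "word_tensor (mor_rel f) (Id_on {[]}) = mor_rel f"
    by (force simp: word_tensor_def Id_on_iff)
  then show ?case using tens_unit_right by simp
next
  case (interchange g f g' f')
  have "word_tensor (mor_rel f) (mor_rel f') O word_tensor (mor_rel g) (mor_rel g') =
    word_tensor (mor_rel f O mor_rel g) (mor_rel f' O mor_rel g')"
    by (rule word_tensor_comp[of _ "map sign_of (cod_of f)"]) (use mor_rel_typed interchange in force)+
  then show ?case using interchange by simp
next
  case (kap_inv_left a b)
  have "crossing_rel (sign_of a) (sign_of b) O (crossing_rel (sign_of a) (sign_of b))\<inverse> =
    Id_on (signed_words [sign_of a, sign_of b])"
  proof (intro equalityI subrelI)
    fix p q assume "(p, q) \<in> crossing_rel (sign_of a) (sign_of b) O (crossing_rel (sign_of a) (sign_of b))\<inverse>"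
    then show "(p, q) \<in> Id_on (signed_words [sign_of a, sign_of b])"
      by (auto simp: crossing_rel_def Id_on_iff signed_words_Cons
          dest: signed_crossing_out_unique signed_crossing_closed)
  next
    fix p q assume "(p, q) \<in> Id_on (signed_words [sign_of a, sign_of b])"
    then obtain x y where xy: "p = [(x, sign_of a), (y, sign_of b)]" "q = p" "x \<in> X" "y \<in> X"
      by (auto simp: Id_on_iff signed_words_Cons)
    then obtain u v where "signed_crossing (sign_of a) (sign_of b) x y u v"
      using signed_crossing_ex by blast
    then have "(p, [(u, sign_of b), (v, sign_of a)]) \<in> crossing_rel (sign_of a) (sign_of b)"
      using xy(1) unfolding crossing_rel_def by blast
    then show "(p, q) \<in> crossing_rel (sign_of a) (sign_of b) O (crossing_rel (sign_of a) (sign_of b))\<inverse>"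
      using xy(2) by blast
  qed
  then show ?case by simp
next
  case (kap_inv_right a b)
  have "(crossing_rel (sign_of a) (sign_of b))\<inverse> O crossing_rel (sign_of a) (sign_of b) =
    Id_on (signed_words [sign_of b, sign_of a])"
  proof (intro equalityI subrelI)
    fix p q assume "(p, q) \<in> (crossing_rel (sign_of a) (sign_of b))\<inverse> O crossing_rel (sign_of a) (sign_of b)"
    then show "(p, q) \<in> Id_on (signed_words [sign_of b, sign_of a])"
      by (auto simp: crossing_rel_def Id_on_iff signed_words_Cons
          dest: signed_crossing_unique signed_crossing_closed)
  next
    fix p q assume "(p, q) \<in> Id_on (signed_words [sign_of b, sign_of a])"
    then obtain u v where uv: "p = [(u, sign_of b), (v, sign_of a)]" "q = p" "u \<in> X" "v \<in> X"
      by (auto simp: Id_on_iff signed_words_Cons)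
    then obtain x y where "signed_crossing (sign_of a) (sign_of b) x y u v"
      using signed_crossing_ex_out by blast
    then have "([(x, sign_of a), (y, sign_of b)], p) \<in> crossing_rel (sign_of a) (sign_of b)"
      using uv(1) unfolding crossing_rel_def by blast
    then show "(p, q) \<in> (crossing_rel (sign_of a) (sign_of b))\<inverse> O crossing_rel (sign_of a) (sign_of b)"
      using uv(2) by blast
  qed
  then show ?case by simp
next
  case (kap_natural f g)
  then show ?case using mor_rel_kap_natural by (simp add: kap_word_typing)
next
  case zigzag_X
  have "word_tensor (Id_on (signed_words [True])) coevaluation_rel O
      word_tensor evaluation_rel (Id_on (signed_words [True])) = Id_on (signed_words [True])"
  proof (intro equalityI subrelI)
    fix p q assume "(p, q) \<in> Id_on (signed_words [True])"
    then obtain x where x: "x \<in> X" "p = [(x, True)]" "q = [(x, True)]"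
      by (auto simp: Id_on_iff signed_words_singleton)
    have "([(x, True)] @ [], [(x, True)] @ [(x, False), (x, True)]) \<in>
      word_tensor (Id_on (signed_words [True])) coevaluation_rel"
      by (rule word_tensorI) (use x in \<open>auto simp: coevaluation_rel_def signed_words_singleton\<close>)
    moreover have "([(x, True), (x, False)] @ [(x, True)], [] @ [(x, True)]) \<in>
      word_tensor evaluation_rel (Id_on (signed_words [True]))"
      by (rule word_tensorI) (use x in \<open>auto simp: evaluation_rel_def signed_words_singleton\<close>)
    ultimately show "(p, q) \<in> word_tensor (Id_on (signed_words [True])) coevaluation_rel O
      word_tensor evaluation_rel (Id_on (signed_words [True]))" using x by auto
  qed (auto simp: word_tensor_def coevaluation_rel_def evaluation_rel_def Id_on_iff signed_words_singleton)
  then show ?case by (simp add: sign_of_def)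
next
  case zigzag_Y
  have "word_tensor coevaluation_rel (Id_on (signed_words [False])) O
      word_tensor (Id_on (signed_words [False])) evaluation_rel = Id_on (signed_words [False])"
  proof (intro equalityI subrelI)
    fix p q assume "(p, q) \<in> Id_on (signed_words [False])"
    then obtain x where x: "x \<in> X" "p = [(x, False)]" "q = [(x, False)]"
      by (auto simp: Id_on_iff signed_words_singleton)
    have "([] @ [(x, False)], [(x, False), (x, True)] @ [(x, False)]) \<in>
      word_tensor coevaluation_rel (Id_on (signed_words [False]))"
      by (rule word_tensorI) (use x in \<open>auto simp: coevaluation_rel_def signed_words_singleton\<close>)
    moreover have "([(x, False)] @ [(x, True), (x, False)], [(x, False)] @ []) \<in>
      word_tensor (Id_on (signed_words [False])) evaluation_rel"
      by (rule word_tensorI) (use x in \<open>auto simp: evaluation_rel_def signed_words_singleton\<close>)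
    ultimately show "(p, q) \<in> word_tensor coevaluation_rel (Id_on (signed_words [False])) O
      word_tensor (Id_on (signed_words [False])) evaluation_rel" using x by auto
  qed (auto simp: word_tensor_def coevaluation_rel_def evaluation_rel_def Id_on_iff signed_words_singleton)
  then show ?case by (simp add: sign_of_def)
qed (auto simp: word_tensor_assoc word_tensor_Id_on O_assoc)

lemma word_of_signed_words: "p \<in> Xpow X a \<Longrightarrow> word_of a p \<in> typed_words a"
  using word_of_group_words by (auto simp: signed_words_def Xpow_def)

lemma signed_words_word_of:
  assumes "w \<in> typed_words a"
  obtains p where "p \<in> Xpow X a" "w = word_of a p" "map fst w = p"
proof -
  have "w \<in> words" "map snd w = map sign_of a" using assms by (simp_all add: signed_words_def)
  then show thesis using map_fst_Xpow word_of_map_fst that[of "map fst w"] by metis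
qed

lemma omega_term_Union: "omega_term X r f U = (\<Union>p\<in>U. omega_term X r f {p})"
proof (induction f arbitrary: U)
  case (MComp g f)
  have "omega_term X r (MComp g f) U = (\<Union>q\<in>(\<Union>p\<in>U. omega_term X r f {p}). omega_term X r g {q})"
    unfolding omega_term.simps MComp.IH(2)[of U, symmetric] by (rule MComp.IH(1))
  also have "\<dots> = (\<Union>p\<in>U. \<Union>q\<in>omega_term X r f {p}. omega_term X r g {q})" by blast
  also have "\<dots> = (\<Union>p\<in>U. omega_term X r (MComp g f) {p})"
    by (simp add: MComp.IH(1)[symmetric])
  finally show ?case .
next
  case (Kap a b)
  show ?case by (simp, fast)
next
  case (KapInv a b)
  show ?case by (simp, fast)
next
  case (MTens f g)
  show ?case by simp blast
qed auto

text \<open>The functor and the relations between words have the same content; they differ in that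
  the former keeps the types of words apart from their letters.\<close>

lemma omega_term_mor_rel:
  assumes "well_typed f" "p \<in> Xpow X (dom_of f)"
  shows "omega_term X r f {p} = {map fst w | w. (word_of (dom_of f) p, w) \<in> mor_rel f}"
  using assms
proof (induction f arbitrary: p)
  case (MId a)
  then show ?case using word_of_signed_words[of p a] by (auto simp: Id_on_iff Xpow_def)
next
  case Ev
  then obtain x y where "p = [x, y]" by (auto simp: Xpow_def length_Suc_conv)
  then show ?case using Ev by (auto simp: Xpow_def evaluation_rel_def word_of_def sign_of_def)
next
  case Coev
  then show ?case by (force simp: Xpow_def coevaluation_rel_def) 
next
  case (Kap a b)
  then obtain x y where "p = [x, y]" "x \<in> X" "y \<in> X" by (auto simp: Xpow_def length_Suc_conv)
  then show ?case
    using kappa_iff_signed_crossing[of x y "sign_of a" "sign_of b"]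
    by (force simp: crossing_rel_def word_of_def)
next
  case (KapInv a b)
  then obtain u v where p: "p = [u, v]" "u \<in> X" "v \<in> X" by (auto simp: Xpow_def length_Suc_conv)
  have k: "x \<in> X \<and> y \<in> X \<and> kappa X r a b (x, y) = (u, v) \<longleftrightarrow>
    signed_crossing (sign_of a) (sign_of b) x y u v" for x y
    using kappa_iff_signed_crossing[of x y "sign_of a" "sign_of b"] signed_crossing_closed by auto
  have "omega_term X r (KapInv a b) {p} =
    {[x, y] | x y. x \<in> X \<and> y \<in> X \<and> kappa X r a b (x, y) = (u, v)}"
    using p by auto
  also have "\<dots> = {[x, y] | x y. signed_crossing (sign_of a) (sign_of b) x y u v}"
    by (simp only: k)
  also have "\<dots> = {map fst w | w. (word_of (dom_of (KapInv a b)) p, w) \<in> mor_rel (KapInv a b)}"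
    using p by (force simp: crossing_rel_def word_of_def)
  finally show ?case .
next
  case (MComp g f)
  have "omega_term X r (MComp g f) {p} = (\<Union>q\<in>omega_term X r f {p}. omega_term X r g {q})"
    unfolding omega_term.simps by (rule omega_term_Union)
  also have "\<dots> = (\<Union>w\<in>{w. (word_of (dom_of f) p, w) \<in> mor_rel f}. omega_term X r g {map fst w})"
    using MComp by auto
  also have "\<dots> = (\<Union>w\<in>{w. (word_of (dom_of f) p, w) \<in> mor_rel f}. {map fst v | v. (w, v) \<in> mor_rel g})"
  proof (rule SUP_cong[OF HOL.refl])
    fix w assume "w \<in> {w. (word_of (dom_of f) p, w) \<in> mor_rel f}"
    then have "w \<in> typed_words (dom_of g)" using mor_rel_typed[of _ w f] MComp.prems by simp
    then obtain q where "q \<in> Xpow X (dom_of g)" "w = word_of (dom_of g) q" "map fst w = q"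
      by (rule signed_words_word_of)
    then show "omega_term X r g {map fst w} = {map fst v | v. (w, v) \<in> mor_rel g}"
      using MComp by simp
  qed
  also have "\<dots> = {map fst v | v. (word_of (dom_of (MComp g f)) p, v) \<in> mor_rel (MComp g f)}"
    by auto
  finally show ?case .
next
  case (MTens f g)
  obtain p1 p2 where p: "p = p1 @ p2" "p1 \<in> Xpow X (dom_of f)" "p2 \<in> Xpow X (dom_of g)"
    using MTens.prems by (auto elim: Xpow_appendE)
  have u: "q1 = p1 \<and> q2 = p2" if "q1 @ q2 = p1 @ p2" "q1 \<in> Xpow X (dom_of f)" for q1 q2
    using that p by (auto simp: Xpow_def)
  have "omega_term X r (MTens f g) {p} =
    {p' @ q' | p' q'. p' \<in> omega_term X r f {p1} \<and> q' \<in> omega_term X r g {p2}}"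
    using p u by auto
  also have "\<dots> = {map fst (u @ v) | u v. (word_of (dom_of f) p1, u) \<in> mor_rel f \<and> (word_of (dom_of g) p2, v) \<in> mor_rel g}"
    using MTens p by (simp, blast)
  also have "\<dots> = {map fst w | w. (word_of (dom_of f) p1 @ word_of (dom_of g) p2, w) \<in> mor_rel (MTens f g)}"
  proof -
    let ?u = "word_of (dom_of f) p1" and ?v = "word_of (dom_of g) p2"
    have un: "u' = ?u \<and> v' = ?v"
      if "(u', u) \<in> mor_rel f" "word_of (dom_of f) p1 @ word_of (dom_of g) p2 = u' @ v'" for u u' v'
    proof -
      have "map snd u' = map snd (word_of (dom_of f) p1)"
        using mor_rel_typed[OF that(1)] p by (simp add: signed_words_def Xpow_def)
      then have "length u' = length (word_of (dom_of f) p1)" by (metis length_map)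
      then show ?thesis using that(2) by simp
    qed
    have "(?u @ ?v, w) \<in> mor_rel (MTens f g) \<longleftrightarrow>
      (\<exists>u v. w = u @ v \<and> (?u, u) \<in> mor_rel f \<and> (?v, v) \<in> mor_rel g)" for w
    proof
      assume "(?u @ ?v, w) \<in> mor_rel (MTens f g)"
      then obtain u v u' v' where "?u @ ?v = u' @ v'" "w = u @ v" "(u', u) \<in> mor_rel f" "(v', v) \<in> mor_rel g"
        unfolding mor_rel.simps by (rule word_tensorE)
      then show "\<exists>u v. w = u @ v \<and> (?u, u) \<in> mor_rel f \<and> (?v, v) \<in> mor_rel g" using un by blast
    qed (auto intro: word_tensorI)
    then show ?thesis by (simp only:) blast
  qed
  finally show ?case using p by (simp add: word_of_append Xpow_def)
qed

lemma omega_mor_class: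
  assumes "well_typed f" "p \<in> Xpow X (dom_of f)"
  shows "omega X r (mor_class f) {p} = {map fst w | w. (word_of (dom_of f) p, w) \<in> mor_rel f}"
proof -
  have "omega_term X r g {p} = omega_term X r f {p}" if "g \<in> mor_class f" for g
  proof -
    have "mor_eq f g" using that by (simp add: mor_class_def)
    from mor_rel_soundness[OF this] show ?thesis
      using assms omega_term_mor_rel[of f p] omega_term_mor_rel[of g p] by simp
  qed
  then have "(\<lambda>g. omega_term X r g {p}) ` mor_class f = (\<lambda>g. omega_term X r f {p}) ` mor_class f"
    by (rule image_cong[OF HOL.refl])
  moreover have "f \<in> mor_class f" using mor_eq.refl[OF assms(1)] by (simp add: mor_class_def)
  ultimately have "(\<lambda>g. omega_term X r g {p}) ` mor_class f = {omega_term X r f {p}}"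
    by (simp add: image_constant)
  then show ?thesis using omega_term_mor_rel[OF assms] by (simp add: omega_def)
qed

end

section \<open>Words representing elements of the free and of the universal group\<close>

definition free_class :: "'x set \<Rightarrow> 'x word \<Rightarrow> 'x word set"
  where "free_class X w = freely_equal X `` {w}"

lemma freely_equal_sym: "(u, v) \<in> freely_equal X \<Longrightarrow> (v, u) \<in> freely_equal X"
  unfolding freely_equal_def by (metis converse_Un converse_converse rtrancl_converseI sup_commute)

lemma freely_equal_trans:
  "(u, v) \<in> freely_equal X \<Longrightarrow> (v, w) \<in> freely_equal X \<Longrightarrow> (u, w) \<in> freely_equal X"
  unfolding freely_equal_def by (rule rtrancl_trans)

lemma freely_equal_refl [simp]: "(u, u) \<in> freely_equal X"
  by (simp add: freely_equal_def)

lemma cancellation_iff: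
  "(p, q) \<in> cancellation X \<longleftrightarrow> (\<exists>u x b v. p = u @ (x, b) # (x, \<not> b) # v \<and> q = u @ v \<and>
    u \<in> group_words X \<and> v \<in> group_words X \<and> x \<in> X)"
  by (auto simp: cancellation_def)

lemma cancellation_words: "(p, q) \<in> cancellation X \<Longrightarrow> p \<in> group_words X \<and> q \<in> group_words X"
  by (auto simp: cancellation_iff)

text \<open>Free equality is the least equivalence relation on words that contains the cancellations.\<close>

lemma freely_equal_induct:
  assumes "(u, v) \<in> freely_equal X"
    and "\<And>w. w \<in> group_words X \<Longrightarrow> P w w"
    and "\<And>u v. P u v \<Longrightarrow> P v u" and "\<And>u v w. P u v \<Longrightarrow> P v w \<Longrightarrow> P u w"
    and "\<And>u v. (u, v) \<in> cancellation X \<Longrightarrow> P u v"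
    and "u \<in> group_words X"
  shows "P u v"
  using assms(1) unfolding freely_equal_def
proof (induction rule: rtrancl_induct)
  case base
  show ?case using assms(2,6) .
next
  case (step v w)
  then show ?case using assms(3-5) by blast
qed

lemma freely_equal_words: "(u, v) \<in> freely_equal X \<Longrightarrow> u \<in> group_words X \<Longrightarrow> v \<in> group_words X"
  unfolding freely_equal_def
  by (induction rule: rtrancl_induct) (auto dest: cancellation_words)

lemma freely_equal_append:
  assumes "(u, v) \<in> freely_equal X" "s \<in> group_words X" "t \<in> group_words X"
  shows "(s @ u @ t, s @ v @ t) \<in> freely_equal X"
  using assms(1) unfolding freely_equal_def
proof (induction rule: rtrancl_induct)
  case (step v w)
  have c: "(s @ p @ t, s @ q @ t) \<in> cancellation X" if pq: "(p, q) \<in> cancellation X" for p q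
  proof -
    obtain a x b c where "p = a @ (x, b) # (x, \<not> b) # c" "q = a @ c"
      "a \<in> group_words X" "c \<in> group_words X" "x \<in> X" using pq by (auto simp: cancellation_iff)
    then show ?thesis unfolding cancellation_iff using assms
      by (intro exI[of _ "s @ a"] exI[of _ x] exI[of _ b] exI[of _ "c @ t"]) simp
  qed
  then have "(s @ v @ t, s @ w @ t) \<in> cancellation X \<union> (cancellation X)\<inverse>" using step.hyps(2) by blast
  then show ?case using step.IH by (rule rtrancl_into_rtrancl[rotated])
qed simp

lemma free_class_eq_iff: "free_class X u = free_class X v \<longleftrightarrow> (u, v) \<in> freely_equal X"
  unfolding free_class_def using freely_equal_sym freely_equal_trans freely_equal_refl by blast

lemma carrier_free_group: "carrier (free_group X) = free_class X ` group_words X"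
  by (auto simp: free_group_def quotient_def free_class_def)

lemma one_free_group: "\<one>\<^bsub>free_group X\<^esub> = free_class X []"
  by (simp add: free_group_def free_class_def)

lemma mult_free_group:
  assumes "u \<in> group_words X" "v \<in> group_words X"
  shows "free_class X u \<otimes>\<^bsub>free_group X\<^esub> free_class X v = free_class X (u @ v)"
proof -
  have app: "(u @ v, u' @ v') \<in> freely_equal X"
    if u': "(u, u') \<in> freely_equal X" and v': "(v, v') \<in> freely_equal X" for u' v'
  proof (rule freely_equal_trans)
    show "(u @ v, u' @ v) \<in> freely_equal X"
      using freely_equal_append[OF u', of "[]" v] assms by simp
    show "(u' @ v, u' @ v') \<in> freely_equal X"
      using freely_equal_append[OF v', of u' "[]"] freely_equal_words[OF u'] assms by simp
  qed
  have "freely_equal X `` {u' @ v' | u' v'. u' \<in> free_class X u \<and> v' \<in> free_class X v} = free_class X (u @ v)"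
  proof (intro equalityI subsetI)
    fix w assume "w \<in> free_class X (u @ v)"
    then show "w \<in> freely_equal X `` {u' @ v' | u' v'. u' \<in> free_class X u \<and> v' \<in> free_class X v}"
      unfolding free_class_def using freely_equal_refl by blast
  next
    fix w assume "w \<in> freely_equal X `` {u' @ v' | u' v'. u' \<in> free_class X u \<and> v' \<in> free_class X v}"
    then show "w \<in> free_class X (u @ v)"
      unfolding free_class_def using app freely_equal_trans by blast
  qed
  then show ?thesis by (simp add: free_group_def)
qed

definition inverse_word :: "'x word \<Rightarrow> 'x word"
  where "inverse_word w = rev (map (\<lambda>(x, b). (x, \<not> b)) w)"

lemma inverse_word_simps [simp]:
  "inverse_word [] = []" "inverse_word ((x, b) # w) = inverse_word w @ [(x, \<not> b)]"
  by (simp_all add: inverse_word_def)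

lemma inverse_word_closed [simp]: "w \<in> group_words X \<Longrightarrow> inverse_word w \<in> group_words X"
  by (induction w) auto

lemma inverse_word_inverse [simp]: "inverse_word (inverse_word w) = w"
  by (simp add: inverse_word_def rev_map o_def split_beta)

lemma inverse_word_cancel:
  "w \<in> group_words X \<Longrightarrow> (w @ inverse_word w, []) \<in> freely_equal X"
proof (induction w)
  case (Cons c w)
  obtain x b where c: "c = (x, b)" by (cases c)
  have "([(x, b)] @ (w @ inverse_word w) @ [(x, \<not> b)], [(x, b)] @ [] @ [(x, \<not> b)]) \<in> freely_equal X"
    by (rule freely_equal_append) (use Cons c in auto)
  moreover have "([] @ (x, b) # (x, \<not> b) # [], [] @ []) \<in> cancellation X"
    unfolding cancellation_iff using Cons c by fastforce
  then have "([(x, b), (x, \<not> b)], []) \<in> freely_equal X" by (auto simp: freely_equal_def)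
  ultimately show ?case using c freely_equal_trans by fastforce
qed simp

lemma group_free_group: "group (free_group X)"
proof (rule groupI)
  fix a b assume ab: "a \<in> carrier (free_group X)" "b \<in> carrier (free_group X)"
  then show "a \<otimes>\<^bsub>free_group X\<^esub> b \<in> carrier (free_group X)"
    by (auto simp: carrier_free_group mult_free_group)
  fix c assume "c \<in> carrier (free_group X)"
  with ab show "a \<otimes>\<^bsub>free_group X\<^esub> b \<otimes>\<^bsub>free_group X\<^esub> c = a \<otimes>\<^bsub>free_group X\<^esub> (b \<otimes>\<^bsub>free_group X\<^esub> c)"
    by (auto simp: carrier_free_group mult_free_group)
next
  show "\<one>\<^bsub>free_group X\<^esub> \<in> carrier (free_group X)"
    by (auto simp: carrier_free_group one_free_group)
  fix a assume a: "a \<in> carrier (free_group X)"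
  then show "\<one>\<^bsub>free_group X\<^esub> \<otimes>\<^bsub>free_group X\<^esub> a = a"
    by (auto simp: carrier_free_group mult_free_group one_free_group)
  obtain w where w: "w \<in> group_words X" "a = free_class X w" using a by (auto simp: carrier_free_group)
  have "free_class X (inverse_word w @ w) = free_class X []"
    using inverse_word_cancel[of "inverse_word w" X] w(1) by (simp add: free_class_eq_iff)
  then show "\<exists>b\<in>carrier (free_group X). b \<otimes>\<^bsub>free_group X\<^esub> a = \<one>\<^bsub>free_group X\<^esub>"
    using w by (intro bexI[of _ "free_class X (inverse_word w)"])
      (auto simp: mult_free_group one_free_group carrier_free_group)
qed

lemma inv_free_group:
  assumes "w \<in> group_words X"
  shows "inv\<^bsub>free_group X\<^esub> (free_class X w) = free_class X (inverse_word w)"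
proof -
  interpret group "free_group X" by (rule group_free_group)
  have "free_class X (inverse_word w @ w) = free_class X []"
    using inverse_word_cancel[of "inverse_word w" X] assms by (simp add: free_class_eq_iff)
  then show ?thesis
    using assms by (intro inv_equality) (auto simp: mult_free_group one_free_group carrier_free_group)
qed

lemma (in group) normal_normal_closure:
  assumes "S \<subseteq> carrier G"
  shows "normal_closure G S \<lhd> G"
proof -
  have ne: "{N. N \<lhd> G \<and> S \<subseteq> N} \<noteq> {}" using normal_self assms by blast
  have "subgroup (normal_closure G S) G"
    unfolding normal_closure_def using ne by (intro subgroups_Inter) (auto simp: normal_imp_subgroup)
  moreover have "x \<otimes> h \<otimes> inv x \<in> normal_closure G S" if "x \<in> carrier G" "h \<in> normal_closure G S" for x h
    using that by (auto simp: normal_closure_def normal_inv_iff)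
  ultimately show ?thesis by (auto simp: normal_inv_iff)
qed

lemma normal_closure_superset: "S \<subseteq> normal_closure G S"
  by (auto simp: normal_closure_def)

lemma normal_closure_least: "N \<lhd> G \<Longrightarrow> S \<subseteq> N \<Longrightarrow> normal_closure G S \<subseteq> N"
  by (auto simp: normal_closure_def)

context ybe
begin

abbreviation "relator_closure \<equiv> normal_closure (free_group X) (universal_relators X r)"

definition word_class :: "'x word \<Rightarrow> 'x word set set"
  where "word_class w = relator_closure #>\<^bsub>free_group X\<^esub> free_class X w"

lemma sigma_gamma_closed: "x \<in> X \<Longrightarrow> y \<in> X \<Longrightarrow> sigma r x y \<in> X \<and> gamma r y x \<in> X"
  using solution unfolding ybe_solution_def by (metis bij_betw_apply)

lemma universal_relators_subset: "universal_relators X r \<subseteq> carrier (free_group X)"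
  unfolding carrier_free_group universal_relators_def using sigma_gamma_closed
  by (auto simp: free_class_def[symmetric])

lemma normal_relator_closure: "relator_closure \<lhd> free_group X"
  by (rule group.normal_normal_closure[OF group_free_group universal_relators_subset])

lemma group_universal_group: "group (universal_group X r)"
  unfolding universal_group_def by (rule normal.factorgroup_is_group[OF normal_relator_closure])

lemma carrier_universal_group: "carrier (universal_group X r) = word_class ` words"
  by (auto simp: universal_group_def FactGroup_def RCOSETS_def carrier_free_group word_class_def)

lemma word_class_closed [simp]: "w \<in> words \<Longrightarrow> word_class w \<in> carrier (universal_group X r)"
  by (simp add: carrier_universal_group)

lemma free_class_closed [simp]: "w \<in> words \<Longrightarrow> free_class X w \<in> carrier (free_group X)"
  by (simp add: carrier_free_group)

lemma word_class_mult:
  assumes "u \<in> words" "v \<in> words"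
  shows "word_class u \<otimes>\<^bsub>universal_group X r\<^esub> word_class v = word_class (u @ v)"
  using assms normal.rcos_sum[OF normal_relator_closure, of "free_class X u" "free_class X v"]
  by (simp add: universal_group_def FactGroup_def word_class_def mult_free_group)

lemma word_class_one: "\<one>\<^bsub>universal_group X r\<^esub> = word_class []"
proof -
  interpret group "free_group X" by (rule group_free_group)
  have "relator_closure #>\<^bsub>free_group X\<^esub> \<one>\<^bsub>free_group X\<^esub> = relator_closure"
    using normal_imp_subgroup[OF normal_relator_closure] by (intro coset_mult_one subgroup.subset)
  then show ?thesis
    by (simp add: universal_group_def FactGroup_def word_class_def one_free_group)
qed

lemma universal_gen_word_class: "universal_gen X r x = word_class [(x, True)]"
  by (simp add: universal_gen_def word_class_def free_class_def)

lemma word_class_eq_iff: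
  assumes "u \<in> words" "v \<in> words"
  shows "word_class u = word_class v \<longleftrightarrow> free_class X (u @ inverse_word v) \<in> relator_closure"
proof -
  interpret group "free_group X" by (rule group_free_group)
  have sub: "subgroup relator_closure (free_group X)"
    by (rule normal_imp_subgroup[OF normal_relator_closure])
  have "word_class u = word_class v \<longleftrightarrow> free_class X u \<in> relator_closure #>\<^bsub>free_group X\<^esub> free_class X v"
    unfolding word_class_def
    using assms rcos_self[OF _ sub] repr_independence[OF _ _ sub] by (metis free_class_closed)
  also have "\<dots> \<longleftrightarrow> free_class X u \<otimes>\<^bsub>free_group X\<^esub> inv\<^bsub>free_group X\<^esub> (free_class X v) \<in> relator_closure"
    using subgroup.rcos_module[OF sub group_axioms] assms by simp
  finally show ?thesis using assms by (simp add: inv_free_group mult_free_group)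
qed

lemma word_class_freely_equal: "(u, v) \<in> freely_equal X \<Longrightarrow> word_class u = word_class v"
  unfolding word_class_def by (simp flip: free_class_eq_iff)

lemma word_class_relator:
  assumes "x \<in> X" "y \<in> X"
  shows "word_class [(x, True), (y, True)] = word_class [(sigma r x y, True), (gamma r y x, True)]"
proof -
  let ?u = "[(x, True), (y, True)]" and ?v = "[(sigma r x y, True), (gamma r y x, True)]"
  have "?u @ inverse_word ?v = [(x, True), (y, True), (gamma r y x, False), (sigma r x y, False)]"
    by simp
  then have "free_class X (?u @ inverse_word ?v) \<in> universal_relators X r"
    unfolding universal_relators_def free_class_def using assms by (simp only:) blast
  then have "free_class X (?u @ inverse_word ?v) \<in> relator_closure"
    by (rule subsetD[OF normal_closure_superset])
  moreover have "?u \<in> words" "?v \<in> words"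
    using assms sigma_gamma_closed[OF assms] by simp_all
  ultimately show ?thesis using word_class_eq_iff by blast
qed

text \<open>The universal property of the universal group, in terms of words: a congruence on words
  that contains the defining relations contains equality in the group. For the words congruent
  to the empty word represent a normal subgroup of the free group that contains the relators.\<close>

lemma word_class_eq_imp:
  assumes refl: "\<And>w. w \<in> words \<Longrightarrow> R w w"
    and sym: "\<And>u v. R u v \<Longrightarrow> R v u" and trans: "\<And>u v w. R u v \<Longrightarrow> R v w \<Longrightarrow> R u w"
    and append: "\<And>s u v t. R u v \<Longrightarrow> s \<in> words \<Longrightarrow> t \<in> words \<Longrightarrow> R (s @ u @ t) (s @ v @ t)"
    and cancel: "\<And>x b. x \<in> X \<Longrightarrow> R [(x, b), (x, \<not> b)] []"
    and relator: "\<And>x y. x \<in> X \<Longrightarrow> y \<in> X \<Longrightarrow>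
      R [(x, True), (y, True)] [(sigma r x y, True), (gamma r y x, True)]"
    and uv: "u \<in> words" "v \<in> words" "word_class u = word_class v"
  shows "R u v"
proof -
  interpret group "free_group X" by (rule group_free_group)
  have fe: "R p q" if "(p, q) \<in> freely_equal X" "p \<in> words" for p q
  proof (rule freely_equal_induct[OF that(1)])
    fix p q assume "(p, q) \<in> cancellation X"
    then obtain s x b t where "p = s @ [(x, b), (x, \<not> b)] @ t" "q = s @ [] @ t"
      "s \<in> words" "t \<in> words" "x \<in> X" by (auto simp: cancellation_iff)
    then show "R p q" using append[OF cancel] by blast
  qed (use refl sym trans that in blast)+
  have inv: "R (inverse_word p @ p) []" "R (p @ inverse_word p) []" if "p \<in> words" for p
    using fe[OF inverse_word_cancel, of p] fe[OF inverse_word_cancel, of "inverse_word p"] that by simp_all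
  \<comment> \<open>the normal subgroup of words congruent to the empty word\<close>
  define K where "K = {free_class X w | w. w \<in> words \<and> R w []}"
  have K: "free_class X w \<in> K \<longleftrightarrow> R w []" if w: "w \<in> words" for w
  proof
    assume "free_class X w \<in> K"
    then obtain w' where "free_class X w = free_class X w'" "R w' []" by (auto simp: K_def)
    then show "R w []" using fe[of w w'] trans w by (simp add: free_class_eq_iff)
  qed (use w in \<open>auto simp: K_def\<close>)
  have "subgroup K (free_group X)"
  proof (rule subgroupI)
    show "K \<subseteq> carrier (free_group X)" by (auto simp: K_def)
    show "K \<noteq> {}" using K[of "[]"] refl[of "[]"] by auto
  next
    fix a assume "a \<in> K"
    then obtain w where w: "w \<in> words" "R w []" "a = free_class X w" by (auto simp: K_def)
    have "R (inverse_word w @ w) (inverse_word w)"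
      using append[OF w(2), of "inverse_word w" "[]"] w(1) by simp
    then have "R (inverse_word w) []" by (rule trans[OF sym inv(1)[OF w(1)]])
    then show "inv\<^bsub>free_group X\<^esub> a \<in> K" using w K by (simp add: inv_free_group)
  next
    fix a b assume "a \<in> K" "b \<in> K"
    then obtain w v where w: "w \<in> words" "R w []" "a = free_class X w"
      "v \<in> words" "R v []" "b = free_class X v" by (auto simp: K_def)
    have "R (w @ v) v" using append[OF w(2), of "[]" v] w by simp
    then have "R (w @ v) []" using w(5) by (rule trans)
    then show "a \<otimes>\<^bsub>free_group X\<^esub> b \<in> K" using w K by (simp add: mult_free_group)
  qed
  moreover have "a \<otimes>\<^bsub>free_group X\<^esub> k \<otimes>\<^bsub>free_group X\<^esub> inv\<^bsub>free_group X\<^esub> a \<in> K" if a: "a \<in> carrier (free_group X)" and k: "k \<in> K" for a k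
  proof -
    obtain w where w: "w \<in> words" "a = free_class X w" using a by (auto simp: carrier_free_group)
    obtain v where v: "v \<in> words" "R v []" "k = free_class X v" using k by (auto simp: K_def)
    have "R (w @ v @ inverse_word w) (w @ inverse_word w)"
      using append[OF v(2), of w "inverse_word w"] w by simp
    then have "R (w @ v @ inverse_word w) []" using inv(2)[OF w(1)] by (rule trans)
    then show ?thesis using w v K by (simp add: inv_free_group mult_free_group)
  qed
  ultimately have "K \<lhd> free_group X" by (auto simp: normal_inv_iff)
  moreover have "universal_relators X r \<subseteq> K"
  proof
    fix a assume "a \<in> universal_relators X r"
    then obtain x y where xy: "x \<in> X" "y \<in> X"
      "a = free_class X [(x, True), (y, True), (gamma r y x, False), (sigma r x y, False)]"
      by (auto simp: universal_relators_def free_class_def)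
    let ?t = "[(gamma r y x, False), (sigma r x y, False)]"
    let ?u = "[(sigma r x y, True), (gamma r y x, True)]"
    note sg = sigma_gamma_closed[OF xy(1,2)]
    have "R ([] @ [(x, True), (y, True)] @ ?t) ([] @ ?u @ ?t)"
      by (rule append[OF relator]) (use xy sg in auto)
    moreover have "R (?u @ inverse_word ?u) []" by (rule inv(2)) (use sg in auto)
    ultimately have "R [(x, True), (y, True), (gamma r y x, False), (sigma r x y, False)] []"
      using trans[of "[(x, True), (y, True), (gamma r y x, False), (sigma r x y, False)]"] by simp
    then show "a \<in> K" using xy K sg by simp
  qed
  ultimately have "relator_closure \<subseteq> K" by (rule normal_closure_least)
  then have "R (u @ inverse_word v) []"
    using uv K[of "u @ inverse_word v"] word_class_eq_iff[OF uv(1,2)] by auto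
  then have "R (u @ inverse_word v @ v) v"
    using append[of "u @ inverse_word v" "[]" "[]" v] uv by simp
  moreover have "R (u @ inverse_word v @ v) u"
    using append[OF inv(1)[OF uv(2)], of u "[]"] uv by simp
  ultimately show ?thesis by (rule trans[OF sym, rotated])
qed

end

section \<open>Braiding operators are determined by generators\<close>

lemma braiding_operatorD:
  assumes "braiding_operator G s" "g \<in> carrier G" "h \<in> carrier G"
  shows "fst (s (g, h)) \<in> carrier G" "snd (s (g, h)) \<in> carrier G"
    "fst (s (g, h)) \<otimes>\<^bsub>G\<^esub> snd (s (g, h)) = g \<otimes>\<^bsub>G\<^esub> h"
    "s (\<one>\<^bsub>G\<^esub>, g) = (g, \<one>\<^bsub>G\<^esub>)" "s (g, \<one>\<^bsub>G\<^esub>) = (\<one>\<^bsub>G\<^esub>, g)"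
  using assms by (auto simp: braiding_operator_def Pi_iff mem_Times_iff)

lemma braiding_operator_mult_left:
  assumes "braiding_operator G s" "g \<in> carrier G" "h \<in> carrier G" "f \<in> carrier G"
  shows "s (g \<otimes>\<^bsub>G\<^esub> h, f) =
    (fst (s (g, fst (s (h, f)))), snd (s (g, fst (s (h, f)))) \<otimes>\<^bsub>G\<^esub> snd (s (h, f)))"
  using assms by (simp add: braiding_operator_def Let_def split_beta)

lemma braiding_operator_mult_right:
  assumes "braiding_operator G s" "g \<in> carrier G" "h \<in> carrier G" "f \<in> carrier G"
  shows "s (g, h \<otimes>\<^bsub>G\<^esub> f) =
    (fst (s (g, h)) \<otimes>\<^bsub>G\<^esub> fst (s (snd (s (g, h)), f)), snd (s (snd (s (g, h)), f)))"
  using assms by (simp add: braiding_operator_def Let_def split_beta)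

text \<open>The product rule for \<open>s (z, y \<otimes> inv y)\<close>, read backwards.\<close>

lemma (in group) braiding_operator_inv_right:
  assumes s: "braiding_operator G s" and zy: "z \<in> carrier G" "y \<in> carrier G" "s (z, y) = (p, x)"
  shows "s (x, inv y) = (inv p, z)"
proof -
  have cl: "p \<in> carrier G" "x \<in> carrier G" using braiding_operatorD[OF s zy(1,2)] zy(3) by simp_all
  have "(\<one>, z) = s (z, y \<otimes> inv y)" using braiding_operatorD(5)[OF s zy(1) zy(1)] zy(2) by simp
  also have "\<dots> = (p \<otimes> fst (s (x, inv y)), snd (s (x, inv y)))"
    using braiding_operator_mult_right[OF s, of z y "inv y"] zy by simp
  finally have "p \<otimes> fst (s (x, inv y)) = \<one>" "snd (s (x, inv y)) = z" by simp_all
  moreover have "fst (s (x, inv y)) \<in> carrier G" using braiding_operatorD[OF s cl(2)] zy(2) by simp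
  ultimately show ?thesis using cl(1) by (metis inv_equality inv_inv inv_closed prod.collapse)
qed

lemma (in group) braiding_operator_inv_left:
  assumes s: "braiding_operator G s" and xf: "x \<in> carrier G" "f \<in> carrier G" "s (x, f) = (f', k)"
  shows "s (inv x, f') = (f, inv k)"
proof -
  have cl: "f' \<in> carrier G" "k \<in> carrier G" using braiding_operatorD[OF s xf(1,2)] xf(3) by simp_all
  have "(f, \<one>) = s (inv x \<otimes> x, f)" using braiding_operatorD(4)[OF s xf(2) xf(2)] xf(1) by simp
  also have "\<dots> = (fst (s (inv x, f')), snd (s (inv x, f')) \<otimes> k)"
    using braiding_operator_mult_left[OF s, of "inv x" x f] xf by simp
  finally have "snd (s (inv x, f')) \<otimes> k = \<one>" "fst (s (inv x, f')) = f" by simp_all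
  moreover have "snd (s (inv x, f')) \<in> carrier G" using braiding_operatorD[OF s _ cl(1)] xf(1) by simp
  ultimately show ?thesis using cl(2) by (metis inv_equality prod.collapse)
qed

text \<open>Let \<open>S\<close> generate the group. In the second argument, the product rule and the rule for
  inverses lead from generators to arbitrary elements, as long as the first argument remains a
  generator; this is what the hypotheses \<open>closed\<close> and \<open>surj\<close> are for. Then the first argument is
  extended in the same way. An inverse \<open>inv x\<close> there is reached because every element \<open>h\<close> is the
  first component of some \<open>s (x, f)\<close>.\<close>

lemma (in group) braiding_operator_unique:
  assumes s: "braiding_operator G s" and t: "braiding_operator G t"
    and S: "S \<subseteq> carrier G" "generate G S = carrier G"
    and eq: "\<And>x y. x \<in> S \<Longrightarrow> y \<in> S \<Longrightarrow> s (x, y) = t (x, y)"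
    and closed: "\<And>x y. x \<in> S \<Longrightarrow> y \<in> S \<Longrightarrow> snd (s (x, y)) \<in> S"
    and surj: "\<And>x y. x \<in> S \<Longrightarrow> y \<in> S \<Longrightarrow> \<exists>z\<in>S. snd (s (z, y)) = x"
    and gh: "g \<in> carrier G" "h \<in> carrier G"
  shows "s (g, h) = t (g, h)"
proof -
  have 1: "\<forall>x\<in>S. s (x, h) = t (x, h) \<and> snd (s (x, h)) \<in> S" if "h \<in> generate G S" for h
    using that
  proof (induction rule: generate.induct)
    case one
    show ?case using braiding_operatorD(5)[OF s] braiding_operatorD(5)[OF t] S by auto
  next
    case (incl y)
    then show ?case using eq closed by blast
  next
    case (inv y)
    show ?case
    proof
      fix x assume x: "x \<in> S"
      \<comment> \<open>so \<open>s (x, inv y)\<close> can be computed from \<open>s (z, y)\<close>, which involves generators only\<close>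
      obtain z where z: "z \<in> S" "snd (s (z, y)) = x" using surj x inv by blast
      have "s (z, y) = (fst (s (z, y)), x)" using z(2) by (metis prod.collapse)
      moreover from this have "t (z, y) = (fst (s (z, y)), x)" using eq z(1) inv by simp
      ultimately have "s (x, inv y) = (inv (fst (s (z, y))), z)" "t (x, inv y) = (inv (fst (s (z, y))), z)"
        using z(1) inv S braiding_operator_inv_right s t by blast+
      then show "s (x, inv y) = t (x, inv y) \<and> snd (s (x, inv y)) \<in> S" using z(1) by simp
    qed
  next
    case (eng h1 h2)
    have h: "h1 \<in> carrier G" "h2 \<in> carrier G" using eng.hyps S by auto
    show ?case
    proof
      fix x assume x: "x \<in> S"
      define y where "y = snd (s (x, h1))"
      have xy: "s (x, h1) = t (x, h1)" "y \<in> S" "s (y, h2) = t (y, h2)" "snd (s (y, h2)) \<in> S"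
        using eng.IH x unfolding y_def by blast+
      have "x \<in> carrier G" using x S by blast
      then have "s (x, h1 \<otimes> h2) = (fst (s (x, h1)) \<otimes> fst (s (y, h2)), snd (s (y, h2)))"
        "t (x, h1 \<otimes> h2) = (fst (s (x, h1)) \<otimes> fst (s (y, h2)), snd (s (y, h2)))"
        using braiding_operator_mult_right[OF s _ h] braiding_operator_mult_right[OF t _ h] xy(1,3)
        unfolding y_def by simp_all
      then show "s (x, h1 \<otimes> h2) = t (x, h1 \<otimes> h2) \<and> snd (s (x, h1 \<otimes> h2)) \<in> S"
        using xy(4) by simp
    qed
  qed
  have "\<forall>h\<in>carrier G. s (g, h) = t (g, h)" if "g \<in> generate G S" for g
    using that
  proof (induction rule: generate.induct)
    case one
    show ?case using braiding_operatorD(4)[OF s] braiding_operatorD(4)[OF t] by simp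
  next
    case (incl x)
    then show ?case using 1 S by simp
  next
    case (inv x)
    show ?case
    proof
      fix h assume h: "h \<in> carrier G"
      have x: "x \<in> carrier G" using inv S by blast
      obtain f k where fk: "s (inv x, h) = (f, k)" by (rule prod.exhaust)
      have cl: "f \<in> carrier G" "k \<in> carrier G"
        using braiding_operatorD(1,2)[OF s _ h, of "inv x"] x fk by simp_all
      have "s (x, f) = (h, inv k)"
        using braiding_operator_inv_left[OF s inv_closed[OF x] h fk] x by simp
      then have "t (x, f) = (h, inv k)" using 1 inv S cl(1) by simp
      then show "s (inv x, h) = t (inv x, h)"
        using braiding_operator_inv_left[OF t x cl(1)] fk cl by simp
    qed
  next
    case (eng g1 g2)
    have "g1 \<in> carrier G" "g2 \<in> carrier G" using eng.hyps S by auto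
    then show ?case
      using eng.IH braiding_operator_mult_left[OF s] braiding_operator_mult_left[OF t]
        braiding_operatorD(1)[OF t] by simp
  qed
  then show ?thesis using gh S by blast
qed

section \<open>The braiding operator of the universal group\<close>

text \<open>A commutative square, read from another corner.\<close>

lemma (in group) square_turn:
  assumes "a \<otimes> b = c \<otimes> d" "a \<in> carrier G" "b \<in> carrier G" "c \<in> carrier G" "d \<in> carrier G"
  shows "b \<otimes> inv d = inv a \<otimes> c"
proof -
  have "b = inv a \<otimes> (c \<otimes> d)" using assms by (metis inv_solve_left m_closed)
  then show ?thesis using assms by (metis inv_closed inv_solve_right m_assoc m_closed)
qed

context ybe
begin

lemma word_class_append_cong:
  assumes "u \<in> words" "v \<in> words" "u' \<in> words" "v' \<in> words"
    "word_class u = word_class u'" "word_class v = word_class v'"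
  shows "word_class (u @ v) = word_class (u' @ v')"
  using assms word_class_mult by metis

lemma word_class_cancel: "x \<in> X \<Longrightarrow> word_class [(x, b), (x, \<not> b)] = word_class []"
  using inverse_word_cancel[of "[(x, b)]" X] by (intro word_class_freely_equal) simp

lemma word_class_crossing:
  assumes "crossing x y u v"
  shows "word_class [(x, True), (y, True)] = word_class [(u, True), (v, True)]"
  using word_class_relator[of x y] assms by (simp add: crossing_def sigma_def gamma_def)

text \<open>The relations imposed by the four braidings of signed letters all follow from the
  defining relation of the group, since a signed crossing is one of its squares read from
  another corner.\<close>

lemma word_class_signed_crossing:
  assumes "signed_crossing a b x y u v"
  shows "word_class [(x, a), (y, b)] = word_class [(u, b), (v, a)]"
proof -
  let ?U = "universal_group X r"
  interpret U: group ?U by (rule group_universal_group)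
  note cl = signed_crossing_closed[OF assms]
  define c where "c = (\<lambda>x. word_class [(x, True)])"
  have c: "c z \<in> carrier ?U" if "z \<in> X" for z using that by (simp add: c_def)
  have T: "word_class [(z, True)] = c z" for z by (simp add: c_def)
  have F: "word_class [(z, False)] = inv\<^bsub>?U\<^esub> (c z)" if "z \<in> X" for z
    using that word_class_cancel[of z False]
    by (intro U.inv_equality[symmetric]) (simp_all add: c_def word_class_mult word_class_one)
  have two: "word_class [(z, a), (z', b)] = word_class [(z, a)] \<otimes>\<^bsub>?U\<^esub> word_class [(z', b)]"
    if "z \<in> X" "z' \<in> X" for z z' a b
    using that by (simp add: word_class_mult)
  have cr: "c z \<otimes>\<^bsub>?U\<^esub> c z' = c w \<otimes>\<^bsub>?U\<^esub> c w'" if "crossing z z' w w'" for z z' w w'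
    using word_class_crossing[OF that] crossing_closed[OF that] by (simp add: two c_def)
  consider "a" "b" | "a" "\<not> b" | "\<not> a" "b" | "\<not> a" "\<not> b" by blast
  then show ?thesis
  proof cases
    case 1
    then show ?thesis using word_class_crossing assms by (simp add: signed_crossing_def)
  next
    case 2
    then have "c u \<otimes>\<^bsub>?U\<^esub> c x = c v \<otimes>\<^bsub>?U\<^esub> c y"
      using assms cr[of v y u x] by (simp add: signed_crossing_def)
    then have "c x \<otimes>\<^bsub>?U\<^esub> inv\<^bsub>?U\<^esub> c y = inv\<^bsub>?U\<^esub> c u \<otimes>\<^bsub>?U\<^esub> c v"
      by (rule U.square_turn) (use c cl in simp_all)
    then show ?thesis using 2 cl by (simp add: two F T)
  next
    case 3
    then have "c x \<otimes>\<^bsub>?U\<^esub> c u = c y \<otimes>\<^bsub>?U\<^esub> c v"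
      using assms cr by (simp add: signed_crossing_def)
    then have "c u \<otimes>\<^bsub>?U\<^esub> inv\<^bsub>?U\<^esub> c v = inv\<^bsub>?U\<^esub> c x \<otimes>\<^bsub>?U\<^esub> c y"
      by (rule U.square_turn) (use c cl in simp_all)
    then show ?thesis using 3 cl by (simp add: two F T)
  next
    case 4
    then have "c v \<otimes>\<^bsub>?U\<^esub> c u = c y \<otimes>\<^bsub>?U\<^esub> c x"
      using assms cr by (simp add: signed_crossing_def)
    then have "inv\<^bsub>?U\<^esub> (c v \<otimes>\<^bsub>?U\<^esub> c u) = inv\<^bsub>?U\<^esub> (c y \<otimes>\<^bsub>?U\<^esub> c x)" by simp
    then show ?thesis using 4 cl c by (simp add: two F T U.inv_mult_group)
  qed
qed

lemma mor_rel_word_class: "(u, v) \<in> mor_rel f \<Longrightarrow> word_class u = word_class v"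
proof (induction f arbitrary: u v)
  case (MTens f g)
  then obtain a b a' b' where ab: "u = a @ b" "v = a' @ b'" "(a, a') \<in> mor_rel f" "(b, b') \<in> mor_rel g"
    by (auto elim: word_tensorE)
  show ?case unfolding ab(1,2)
    by (rule word_class_append_cong)
      (use mor_rel_typed[OF ab(3)] mor_rel_typed[OF ab(4)] MTens.IH(1)[OF ab(3)] MTens.IH(2)[OF ab(4)]
        in \<open>simp_all add: signed_words_def\<close>)
next
  case Ev
  then show ?case using word_class_cancel[of _ True] by (auto simp: evaluation_rel_def)
next
  case Coev
  then show ?case using word_class_cancel[of _ False] by (auto simp: coevaluation_rel_def)
qed (auto simp: crossing_rel_def word_class_signed_crossing)

text \<open>The equivalence of words to which the relations of the FRT construction reduce on the
  diagonal. Relations of morphisms are not symmetric, so the converses have to be added.\<close>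

definition word_sim :: "('x word \<times> 'x word) set"
  where "word_sim = ((\<Union>f\<in>Collect well_typed. mor_rel f) \<union> (\<Union>f\<in>Collect well_typed. mor_rel f)\<inverse>)\<^sup>*"

lemma mor_rel_word_sim: "well_typed f \<Longrightarrow> (u, v) \<in> mor_rel f \<Longrightarrow> (u, v) \<in> word_sim"
  unfolding word_sim_def by blast

lemma word_sim_sym: "(u, v) \<in> word_sim \<Longrightarrow> (v, u) \<in> word_sim"
  unfolding word_sim_def by (metis converse_Un converse_converse rtrancl_converseI sup_commute)

lemma word_sim_trans: "(u, v) \<in> word_sim \<Longrightarrow> (v, w) \<in> word_sim \<Longrightarrow> (u, w) \<in> word_sim"
  unfolding word_sim_def by (rule rtrancl_trans)

lemma word_sim_induct:
  assumes "(u, v) \<in> word_sim"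
    and "\<And>p. P p p" and "\<And>p q. P p q \<Longrightarrow> P q p" and "\<And>p q s. P p q \<Longrightarrow> P q s \<Longrightarrow> P p s"
    and "\<And>f p q. well_typed f \<Longrightarrow> (p, q) \<in> mor_rel f \<Longrightarrow> P p q"
  shows "P u v"
  using assms(1) unfolding word_sim_def
proof (induction rule: rtrancl_induct)
  case (step p q)
  then have "P p q" using assms(3,5) by blast
  with step.IH show ?case by (rule assms(4))
qed (rule assms(2))

lemma word_sim_refl [simp]: "(u, u) \<in> word_sim"
  by (simp add: word_sim_def)

lemma signed_words_sign_of: "w \<in> words \<Longrightarrow> w \<in> typed_words (map (letter_obj \<circ> snd) w)"
proof -
  have "sign_of (letter_obj b) = b" for b by (simp add: sign_of_def letter_obj_def)
  then show "w \<in> words \<Longrightarrow> ?thesis" by (simp add: signed_words_def o_def)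
qed

lemma word_sim_append:
  assumes "(u, v) \<in> word_sim" "s \<in> words" "t \<in> words"
  shows "(s @ u @ t, s @ v @ t) \<in> word_sim"
  using assms(1) unfolding word_sim_def
proof (induction rule: rtrancl_induct)
  case (step v w)
  have c: "(s @ p @ t, s @ q @ t) \<in> (\<Union>f\<in>Collect well_typed. mor_rel f)"
    if pq: "(p, q) \<in> (\<Union>f\<in>Collect well_typed. mor_rel f)" for p q
  proof -
    obtain f where f: "well_typed f" "(p, q) \<in> mor_rel f" using pq by blast
    let ?f = "MTens (MId (map (letter_obj \<circ> snd) s)) (MTens f (MId (map (letter_obj \<circ> snd) t)))"
    have "(s @ p @ t, s @ q @ t) \<in> mor_rel ?f"
      unfolding mor_rel.simps using f(2) signed_words_sign_of assms(2,3)
      by (intro word_tensorI) (auto simp: Id_on_iff simp del: map_map)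
    moreover have "well_typed ?f" using f(1) by simp
    ultimately show ?thesis by blast
  qed
  then have "(s @ v @ t, s @ w @ t) \<in> (\<Union>f\<in>Collect well_typed. mor_rel f) \<union> (\<Union>f\<in>Collect well_typed. mor_rel f)\<inverse>"
    using step.hyps(2) by blast
  then show ?case using step.IH by (rule rtrancl_into_rtrancl[rotated])
qed simp

text \<open>The comparison of the remnant with the universal group, on the level of words. The
  evaluation and the coevaluation provide the cancellations, the braiding of two positive
  letters provides the relators, and tensor products of morphisms with identities make the
  equivalence a congruence.\<close>

theorem word_class_eq_iff_sim:
  assumes "u \<in> words" "v \<in> words"
  shows "word_class u = word_class v \<longleftrightarrow> (u, v) \<in> word_sim"
proof
  assume "word_class u = word_class v"
  with assms show "(u, v) \<in> word_sim"
  proof (rule word_class_eq_imp[of "\<lambda>u v. (u, v) \<in> word_sim", rotated 6])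
    fix x :: 'x and b assume "x \<in> X"
    then have "([(x, True), (x, False)], []) \<in> mor_rel Ev" "([], [(x, False), (x, True)]) \<in> mor_rel Coev"
      by (auto simp: evaluation_rel_def coevaluation_rel_def)
    then have "([(x, True), (x, False)], []) \<in> word_sim" "([], [(x, False), (x, True)]) \<in> word_sim"
      using mor_rel_word_sim[of Ev] mor_rel_word_sim[of Coev] by auto
    then show "([(x, b), (x, \<not> b)], []) \<in> word_sim" using word_sim_sym by (cases b) auto
  next
    fix x y assume xy: "x \<in> X" "y \<in> X"
    then have "crossing x y (sigma r x y) (gamma r y x)"
      by (simp add: crossing_def sigma_def gamma_def)
    then have "([(x, True), (y, True)], [(sigma r x y, True), (gamma r y x, True)]) \<in> mor_rel (Kap Xob Xob)"
      by (simp add: crossing_rel_def sign_of_def signed_crossing_def)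
    then show "([(x, True), (y, True)], [(sigma r x y, True), (gamma r y x, True)]) \<in> word_sim"
      using mor_rel_word_sim[of "Kap Xob Xob"] by simp
  next
    fix w show "(w, w) \<in> word_sim" by (simp add: word_sim_def)
  qed (use word_sim_sym word_sim_trans word_sim_append in blast)+
next
  assume "(u, v) \<in> word_sim"
  then show "word_class u = word_class v"
    by (rule word_sim_induct) (simp_all add: mor_rel_word_class)
qed

text \<open>Equivalent words act equally on a word braided past them, and are carried to equivalent
  words. This is naturality of the braiding, and it is the reason why the braiding descends to
  the group.\<close>

lemma word_sim_braid_left:
  assumes "(u, u1) \<in> word_sim" "u \<in> words" "v \<in> words"
    "word_braid u v = (v', u')" "word_braid u1 v = (v1, u2)"
  shows "v' = v1 \<and> (u', u2) \<in> word_sim"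
proof -
  have step: "fst (word_braid p v) = fst (word_braid q v) \<and>
    (snd (word_braid p v), snd (word_braid q v)) \<in> word_sim"
    if f: "well_typed f" "(p, q) \<in> mor_rel f" for f p q
  proof -
    have "p \<in> words" using mor_rel_typed[OF f(2)] by (simp add: signed_words_def)
    then have "\<exists>s. word_braid p v = (fst (word_braid q v), s) \<and> (s, snd (word_braid q v)) \<in> mor_rel f"
      using left_naturalD[OF natural_mor_rel assms(3), of p f "fst (word_braid q v)" "snd (word_braid q v)"] f(2) by auto
    then show ?thesis using mor_rel_word_sim f(1) by fastforce
  qed
  from assms(1) have "fst (word_braid u v) = fst (word_braid u1 v) \<and>
    (snd (word_braid u v), snd (word_braid u1 v)) \<in> word_sim"
  proof (rule word_sim_induct)
    fix p q s assume "fst (word_braid p v) = fst (word_braid q v) \<and> (snd (word_braid p v), snd (word_braid q v)) \<in> word_sim" "fst (word_braid q v) = fst (word_braid s v) \<and> (snd (word_braid q v), snd (word_braid s v)) \<in> word_sim"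
    then show "fst (word_braid p v) = fst (word_braid s v) \<and> (snd (word_braid p v), snd (word_braid s v)) \<in> word_sim" using word_sim_trans by auto
  qed (use word_sim_sym step in auto)
  then show ?thesis using assms by simp
qed

lemma word_sim_braid_right:
  assumes "(v, v1) \<in> word_sim" "u \<in> words" "v \<in> words"
    "word_braid u v = (v', u')" "word_braid u v1 = (v2, u1)"
  shows "u' = u1 \<and> (v', v2) \<in> word_sim"
proof -
  have step: "snd (word_braid u p) = snd (word_braid u q) \<and>
    (fst (word_braid u p), fst (word_braid u q)) \<in> word_sim"
    if f: "well_typed f" "(p, q) \<in> mor_rel f" for f p q
  proof -
    have "p \<in> words" using mor_rel_typed[OF f(2)] by (simp add: signed_words_def)
    then have "\<exists>s. word_braid u p = (s, snd (word_braid u q)) \<and> (s, fst (word_braid u q)) \<in> mor_rel f"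
      using right_naturalD[OF natural_mor_rel assms(2), of p f "fst (word_braid u q)" "snd (word_braid u q)"] f(2) by auto
    then show ?thesis using mor_rel_word_sim f(1) by fastforce
  qed
  from assms(1) have "snd (word_braid u v) = snd (word_braid u v1) \<and>
    (fst (word_braid u v), fst (word_braid u v1)) \<in> word_sim"
  proof (rule word_sim_induct)
    fix p q s assume "snd (word_braid u p) = snd (word_braid u q) \<and> (fst (word_braid u p), fst (word_braid u q)) \<in> word_sim" "snd (word_braid u q) = snd (word_braid u s) \<and> (fst (word_braid u q), fst (word_braid u s)) \<in> word_sim"
    then show "snd (word_braid u p) = snd (word_braid u s) \<and> (fst (word_braid u p), fst (word_braid u s)) \<in> word_sim" using word_sim_trans by auto
  qed (use word_sim_sym step in auto)
  then show ?thesis using assms by simp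
qed

text \<open>The braiding of any two representing words; \<open>class_braid_word_class\<close> shows that all of
  them give the same result.\<close>

definition class_braid :: "'x word set set \<times> 'x word set set \<Rightarrow> 'x word set set \<times> 'x word set set"
  where "class_braid p = (SOME q. \<exists>u v u' v'. u \<in> words \<and> v \<in> words \<and>
    word_braid u v = (v', u') \<and> p = (word_class u, word_class v) \<and> q = (word_class v', word_class u'))"

lemma class_braid_word_class:
  assumes "u \<in> words" "v \<in> words" "word_braid u v = (v', u')"
  shows "class_braid (word_class u, word_class v) = (word_class v', word_class u')"
  unfolding class_braid_def
proof (rule some_equality)
  show "\<exists>u1 v1 u2 v2. u1 \<in> words \<and> v1 \<in> words \<and> word_braid u1 v1 = (v2, u2) \<and>
    (word_class u, word_class v) = (word_class u1, word_class v1) \<and>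
    (word_class v', word_class u') = (word_class v2, word_class u2)"
    using assms by blast
next
  fix q assume "\<exists>u1 v1 u' v'. u1 \<in> words \<and> v1 \<in> words \<and> word_braid u1 v1 = (v', u') \<and>
    (word_class u, word_class v) = (word_class u1, word_class v1) \<and> q = (word_class v', word_class u')"
  then obtain u1 v1 u2 v2 where 1: "u1 \<in> words" "v1 \<in> words"
    "word_braid u1 v1 = (v2, u2)" "word_class u = word_class u1" "word_class v = word_class v1"
    "q = (word_class v2, word_class u2)" by auto
  have sim: "(u, u1) \<in> word_sim" "(v, v1) \<in> word_sim"
    using 1 assms word_class_eq_iff_sim by blast+
  obtain v3 u3 where 3: "word_braid u1 v = (v3, u3)" by (rule prod.exhaust)
  have a: "v' = v3" "(u', u3) \<in> word_sim"
    using word_sim_braid_left[OF sim(1) assms(1,2,3) 3] by simp_all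
  have b: "u3 = u2" "(v3, v2) \<in> word_sim"
    using word_sim_braid_right[OF sim(2) 1(1) assms(2) 3 1(3)] by simp_all
  show "q = (word_class v', word_class u')"
    using a b 1(6) word_braid_closed[OF assms] word_braid_closed[OF 1(1-3)]
      word_class_eq_iff_sim[of v' v2] word_class_eq_iff_sim[of u' u2] by simp
qed

text \<open>The braiding of two words is itself one of the morphisms, so it does not change the
  product.\<close>

lemma word_braid_class_mult:
  assumes "u \<in> words" "v \<in> words" "word_braid u v = (v', u')"
  shows "word_class (v' @ u') = word_class (u @ v)"
proof -
  have "(u @ v, v' @ u') \<in> mor_rel (kap_word (map (letter_obj \<circ> snd) u) (map (letter_obj \<circ> snd) v))"
    unfolding mor_rel_kap_word using assms signed_words_sign_of by blast
  then show ?thesis using mor_rel_word_class by metis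
qed

theorem braiding_operator_class_braid: "braiding_operator (universal_group X r) class_braid"
  unfolding braiding_operator_def
proof (intro conjI ballI)
  let ?U = "universal_group X r"
  note cw = class_braid_word_class
  have obt: thesis if "g \<in> carrier ?U" "\<And>w. w \<in> words \<Longrightarrow> g = word_class w \<Longrightarrow> thesis" for g thesis
    using that by (auto simp: carrier_universal_group)
  show "class_braid \<in> carrier ?U \<times> carrier ?U \<rightarrow> carrier ?U \<times> carrier ?U"
  proof
    fix p assume "p \<in> carrier ?U \<times> carrier ?U"
    then obtain u v where uv: "u \<in> words" "v \<in> words" "p = (word_class u, word_class v)"
      by (auto simp: carrier_universal_group)
    obtain v' u' where b: "word_braid u v = (v', u')" by (rule prod.exhaust)
    show "class_braid p \<in> carrier ?U \<times> carrier ?U"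
      using cw[OF uv(1,2) b] uv word_braid_closed[OF uv(1,2) b] by simp
  qed
  fix g assume "g \<in> carrier ?U"
  then obtain u where u: "u \<in> words" "g = word_class u" by (rule obt)
  show "class_braid (\<one>\<^bsub>?U\<^esub>, g) = (g, \<one>\<^bsub>?U\<^esub>)" "class_braid (g, \<one>\<^bsub>?U\<^esub>) = (\<one>\<^bsub>?U\<^esub>, g)"
    using u cw[of "[]" u u "[]"] cw[of u "[]" "[]" u] by (simp_all add: word_class_one)
  fix h assume "h \<in> carrier ?U"
  then obtain v where v: "v \<in> words" "h = word_class v" by (rule obt)
  obtain v' u' where b: "word_braid u v = (v', u')" by (rule prod.exhaust)
  note bc = word_braid_closed[OF u(1) v(1) b]
  show "fst (class_braid (g, h)) \<otimes>\<^bsub>?U\<^esub> snd (class_braid (g, h)) = g \<otimes>\<^bsub>?U\<^esub> h"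
    using cw[OF u(1) v(1) b] u v bc word_braid_class_mult[OF u(1) v(1) b] by (simp add: word_class_mult)
  fix f assume "f \<in> carrier ?U"
  then obtain w where w: "w \<in> words" "f = word_class w" by (rule obt)
  show "class_braid (g \<otimes>\<^bsub>?U\<^esub> h, f) =
    (let (f', h') = class_braid (h, f); (f'', g') = class_braid (g, f') in (f'', g' \<otimes>\<^bsub>?U\<^esub> h'))"
  proof -
    obtain w1 v1 where 1: "word_braid v w = (w1, v1)" by (rule prod.exhaust)
    note c1 = word_braid_closed[OF v(1) w(1) 1]
    obtain w2 u1 where 2: "word_braid u w1 = (w2, u1)" by (rule prod.exhaust)
    have c2: "u1 \<in> words" using word_braid_closed[OF u(1) _ 2] c1 by blast
    have "word_braid (u @ v) w = (w2, u1 @ v1)" using 1 2 by (simp add: word_braid_append_left)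
    then show ?thesis
      using cw[of "u @ v" w w2 "u1 @ v1"] cw[OF v(1) w(1) 1] cw[OF u(1) _ 2] u v w c1 c2
      by (simp add: word_class_mult)
  qed
  show "class_braid (g, h \<otimes>\<^bsub>?U\<^esub> f) =
    (let (h', g') = class_braid (g, h); (f', g'') = class_braid (g', f) in (h' \<otimes>\<^bsub>?U\<^esub> f', g''))"
  proof -
    obtain w2 u1 where 2: "word_braid u' w = (w2, u1)" by (rule prod.exhaust)
    have c2: "w2 \<in> words" using word_braid_closed[OF _ w(1) 2] bc by blast
    have "word_braid u (v @ w) = (v' @ w2, u1)" using b 2 by (simp add: word_braid_append_right)
    then show ?thesis
      using cw[of u "v @ w" "v' @ w2" u1] cw[OF u(1) v(1) b] cw[OF _ w(1) 2] u v w bc c2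
      by (simp add: word_class_mult)
  qed
qed

lemma class_braid_gen:
  assumes "crossing x y u v"
  shows "class_braid (universal_gen X r x, universal_gen X r y) = (universal_gen X r u, universal_gen X r v)"
proof -
  have "letter_braid (x, True) (y, True) = ((u, True), (v, True))"
    using assms crossing_closed[OF assms] by (simp add: letter_braid_signed signed_crossing_def)
  then have "word_braid [(x, True)] [(y, True)] = ([(u, True)], [(v, True)])" by simp
  then show ?thesis
    using class_braid_word_class[of "[(x, True)]" "[(y, True)]"] crossing_closed[OF assms]
    by (simp add: universal_gen_word_class)
qed

lemma generate_universal_group:
  "generate (universal_group X r) (universal_gen X r ` X) = carrier (universal_group X r)"
proof -
  let ?U = "universal_group X r" and ?S = "universal_gen X r ` X"
  interpret U: group ?U by (rule group_universal_group)
  have S: "?S \<subseteq> carrier ?U" by (auto simp: universal_gen_word_class)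
  have "word_class w \<in> generate ?U ?S" if "w \<in> words" for w
    using that
  proof (induction w)
    case Nil
    then show ?case using generate.one[of ?U ?S] by (simp add: word_class_one)
  next
    case (Cons c w)
    obtain x b where c: "c = (x, b)" by (rule prod.exhaust)
    then have x: "x \<in> X" using Cons by simp
    have "word_class [(x, b)] \<in> generate ?U ?S"
    proof (cases b)
      case True
      then show ?thesis using x by (auto intro: generate.incl simp: universal_gen_word_class)
    next
      case False
      have "word_class [(x, False)] = inv\<^bsub>?U\<^esub> (universal_gen X r x)"
        using x word_class_cancel[of x False]
        by (intro U.inv_equality[symmetric]) (simp_all add: universal_gen_word_class word_class_mult word_class_one)
      then show ?thesis using x False by (auto intro: generate.inv)
    qed
    then have "word_class [(x, b)] \<otimes>\<^bsub>?U\<^esub> word_class w \<in> generate ?U ?S"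
      using Cons by (intro generate.eng) simp_all
    then show ?case using c x Cons.prems by (simp add: word_class_mult)
  qed
  then show ?thesis using U.generate_in_carrier[OF S] by (auto simp: carrier_universal_group)
qed

text \<open>The operator on classes of words shows that a braiding operator extending \<open>r\<close> exists, so
  the choice in \<open>universal_braiding\<close> makes sense, and uniqueness shows that it returns this
  operator. The condition \<open>surj\<close> for uniqueness is the surjectivity of the maps \<open>\<gamma>\<close>.\<close>

theorem universal_braiding_eq:
  assumes "g \<in> carrier (universal_group X r)" "h \<in> carrier (universal_group X r)"
  shows "universal_braiding X r (g, h) = class_braid (g, h)"
proof -
  let ?U = "universal_group X r"
  let ?P = "\<lambda>s. braiding_operator ?U s \<and> (\<forall>x\<in>X. \<forall>y\<in>X.
    s (universal_gen X r x, universal_gen X r y) =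
      (universal_gen X r (sigma r x y), universal_gen X r (gamma r y x)))"
  interpret U: group ?U by (rule group_universal_group)
  have cr: "crossing x y (sigma r x y) (gamma r y x)" if "x \<in> X" "y \<in> X" for x y
    using that by (simp add: crossing_def sigma_def gamma_def)
  have P: "?P class_braid"
    using braiding_operator_class_braid class_braid_gen[OF cr] by simp
  then have P': "?P (universal_braiding X r)"
    unfolding universal_braiding_def by (rule someI[of ?P])
  show ?thesis
  proof (rule U.braiding_operator_unique[OF _ _ _ generate_universal_group _ _ _ assms])
    show "braiding_operator ?U (universal_braiding X r)" "braiding_operator ?U class_braid"
      using P P' by blast+
    show "universal_gen X r ` X \<subseteq> carrier ?U" by (auto simp: universal_gen_word_class)
  next
    fix g h assume "g \<in> universal_gen X r ` X" "h \<in> universal_gen X r ` X"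
    then obtain x y where xy: "x \<in> X" "y \<in> X" "g = universal_gen X r x" "h = universal_gen X r y" by blast
    show "universal_braiding X r (g, h) = class_braid (g, h)" using P P' xy by simp
    show "snd (universal_braiding X r (g, h)) \<in> universal_gen X r ` X"
      using P' xy sigma_gamma_closed by simp
    obtain z u where "crossing z y u x" using crossing_right xy by blast
    then show "\<exists>z\<in>universal_gen X r ` X. snd (universal_braiding X r (z, h)) = g"
      using P' xy by (intro bexI[of _ "universal_gen X r z"]) (auto simp: crossing_def sigma_def gamma_def)
  qed
qed

section \<open>The lattice of the FRT construction\<close>

text \<open>The relation between tuples given by a morphism, with the types left implicit.\<close>

definition arrow :: "mor_term \<Rightarrow> 'x list \<Rightarrow> 'x list \<Rightarrow> bool"
  where "arrow f p q \<longleftrightarrow> p \<in> Xpow X (dom_of f) \<and> q \<in> Xpow X (cod_of f) \<and>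
    (word_of (dom_of f) p, word_of (cod_of f) q) \<in> mor_rel f"

lemma omega_arrow:
  assumes "well_typed f" "p \<in> Xpow X (dom_of f)"
  shows "q \<in> omega X r (mor_class f) {p} \<longleftrightarrow> arrow f p q"
proof
  assume "q \<in> omega X r (mor_class f) {p}"
  then obtain w where w: "q = map fst w" "(word_of (dom_of f) p, w) \<in> mor_rel f"
    unfolding omega_mor_class[OF assms] by blast
  have "w \<in> typed_words (cod_of f)" using mor_rel_typed[OF w(2)] by blast
  then obtain q' where "q' \<in> Xpow X (cod_of f)" "w = word_of (cod_of f) q'" "map fst w = q'"
    by (rule signed_words_word_of)
  then show "arrow f p q" using w assms by (simp add: arrow_def)
next
  assume "arrow f p q"
  then show "q \<in> omega X r (mor_class f) {p}"
    unfolding omega_mor_class[OF assms] arrow_def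
    by (intro CollectI exI[of _ "word_of (cod_of f) q"]) (simp add: Xpow_def)
qed

lemma frt_rels_iff:
  "(A, B) \<in> frt_rels X r \<longleftrightarrow> (\<exists>f p q. well_typed f \<and> p \<in> Xpow X (dom_of f) \<and> q \<in> Xpow X (cod_of f) \<and>
    A = {(cod_of f, p', q) | p'. arrow f p p'} \<and> B = {(dom_of f, p, q') | q'. arrow f q' q})"
proof -
  have "(A, B) \<in> frt_rels X r \<longleftrightarrow> (\<exists>f p q. well_typed f \<and> p \<in> Xpow X (dom_of f) \<and> q \<in> Xpow X (cod_of f) \<and>
    A = {(cod_of f, p', q) | p'. p' \<in> omega X r (mor_class f) {p}} \<and>
    B = {(dom_of f, p, q') | q'. q' \<in> Xpow X (dom_of f) \<and> q \<in> omega X r (mor_class f) {q'}})"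
    unfolding frt_rels_def Hom_B_def by blast
  also have "\<dots> \<longleftrightarrow> (\<exists>f p q. well_typed f \<and> p \<in> Xpow X (dom_of f) \<and> q \<in> Xpow X (cod_of f) \<and>
    A = {(cod_of f, p', q) | p'. arrow f p p'} \<and> B = {(dom_of f, p, q') | q'. arrow f q' q})"
  proof (intro ex_cong1 conj_cong HOL.refl)
    fix f p q assume "well_typed f" "p \<in> Xpow X (dom_of f)"
    then show "(A = {(cod_of f, p', q) | p'. p' \<in> omega X r (mor_class f) {p}}) =
      (A = {(cod_of f, p', q) | p'. arrow f p p'})" by (simp add: omega_arrow)
    have "q' \<in> Xpow X (dom_of f) \<and> q \<in> omega X r (mor_class f) {q'} \<longleftrightarrow> arrow f q' q" for q'
      using omega_arrow[OF \<open>well_typed f\<close>, of q' q] by (auto simp: arrow_def)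
    then show "(B = {(dom_of f, p, q') | q'. q' \<in> Xpow X (dom_of f) \<and> q \<in> omega X r (mor_class f) {q'}}) =
      (B = {(dom_of f, p, q') | q'. arrow f q' q})" by simp
  qed
  finally show ?thesis .
qed

lemma symbols_iff [simp]: "(a, p, q) \<in> frt_symbols X \<longleftrightarrow> p \<in> Xpow X a \<and> q \<in> Xpow X a"
  by (simp add: frt_symbols_def)

sublocale frt: presentation "frt_symbols X" "frt_rels X r"
  by unfold_locales (auto simp: frt_rels_iff arrow_def)

abbreviation "frtL \<equiv> frt_lattice X r"
abbreviation "frtH \<equiv> frt_hopf X r"
abbreviation "gen \<equiv> frt_gen X r"
abbreviation "comul \<equiv> comult (frt_bialgebra X r)"
abbreviation "cqt \<equiv> frt_cqt X r"
abbreviation "quo \<equiv> remnant_proj frtH"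

lemma frt_rel_all_iff:
  "(\<forall>A B. (A, B) \<in> frt_rels X r \<longrightarrow> ((\<forall>g\<in>A. P g) \<longleftrightarrow> (\<forall>g\<in>B. P g))) \<longleftrightarrow>
    (\<forall>f p q. well_typed f \<longrightarrow> p \<in> Xpow X (dom_of f) \<longrightarrow> q \<in> Xpow X (cod_of f) \<longrightarrow>
      ((\<forall>p'. arrow f p p' \<longrightarrow> P (cod_of f, p', q)) \<longleftrightarrow> (\<forall>q'. arrow f q' q \<longrightarrow> P (dom_of f, p, q'))))"
proof -
  have "(\<forall>g\<in>{(cod_of f, p', q) | p'. arrow f p p'}. P g) \<longleftrightarrow> (\<forall>p'. arrow f p p' \<longrightarrow> P (cod_of f, p', q))"
    "(\<forall>g\<in>{(dom_of f, p, q') | q'. arrow f q' q}. P g) \<longleftrightarrow> (\<forall>q'. arrow f q' q \<longrightarrow> P (dom_of f, p, q'))" for f p q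
    by blast+
  then show ?thesis unfolding frt_rels_iff by simp blast
qed

lemma frtL_complete_lattice: "complete_lattice frtL"
  unfolding frt_lattice_def by (rule frt.complete_lattice_axioms)

lemma le_frtL [simp]: "le frtL = (\<subseteq>)"
  by (simp add: frt_lattice_def)

lemma frtH_fields [simp]:
  "carrier frtH = carrier frtL" "le frtH = (\<subseteq>)" "eq frtH = (=)"
  "hmult frtH = hmult (frt_bialgebra X r)" "hone frtH = gen [] [] []"
  "comult frtH = comul" "counit frtH = counit (frt_bialgebra X r)"
  by (simp_all add: frt_hopf_def frt_bialgebra_def Let_def suplat_bialgebra.defs suplat_hopf.defs)
    (simp_all add: frt_lattice_def presented_def)

lemma frt_gen_closed: "p \<in> Xpow X a \<Longrightarrow> q \<in> Xpow X a \<Longrightarrow> gen a p q \<in> carrier frtL"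
  by (simp add: frt_gen_def frt_lattice_def)

lemma frt_gen_subset_iff:
  "p \<in> Xpow X a \<Longrightarrow> q \<in> Xpow X a \<Longrightarrow> C \<in> carrier frtL \<Longrightarrow> gen a p q \<subseteq> C \<longleftrightarrow> (a, p, q) \<in> C"
  unfolding frt_gen_def frt_lattice_def by (rule frt.gen_subset_iff) simp

lemma frt_symbols_subset: "C \<in> carrier frtL \<Longrightarrow> C \<subseteq> frt_symbols X"
  unfolding frt_lattice_def by (rule frt.subset_G)

lemma frt_typed: "C \<in> carrier frtL \<Longrightarrow> (a, p, q) \<in> C \<Longrightarrow> p \<in> Xpow X a \<and> q \<in> Xpow X a"
  using frt_symbols_subset by fastforce

lemma frtL_iff:
  "C \<in> carrier frtL \<longleftrightarrow> C \<subseteq> frt_symbols X \<and>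
    (\<forall>f p q. well_typed f \<longrightarrow> p \<in> Xpow X (dom_of f) \<longrightarrow> q \<in> Xpow X (cod_of f) \<longrightarrow>
      ((\<forall>p'. arrow f p p' \<longrightarrow> (cod_of f, p', q) \<in> C) \<longleftrightarrow> (\<forall>q'. arrow f q' q \<longrightarrow> (dom_of f, p, q') \<in> C)))"
  unfolding frt_lattice_def presented_iff subset_eq frt_rel_all_iff[of "\<lambda>g. g \<in> C"] ..

text \<open>The defining relations, as seen by a predicate that respects joins: an arrow may be moved
  from the first to the second index.\<close>

lemma stable_arrow:
  assumes "join_stable frtL P" "well_typed f" "p \<in> Xpow X (dom_of f)" "q \<in> Xpow X (cod_of f)"
  shows "(\<forall>p'. arrow f p p' \<longrightarrow> P (gen (cod_of f) p' q)) \<longleftrightarrow>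
    (\<forall>q'. arrow f q' q \<longrightarrow> P (gen (dom_of f) p q'))"
proof -
  have "\<forall>A B. (A, B) \<in> frt_rels X r \<longrightarrow>
    ((\<forall>g\<in>A. P (presented_gen (frt_symbols X) (frt_rels X r) g)) \<longleftrightarrow>
     (\<forall>g\<in>B. P (presented_gen (frt_symbols X) (frt_rels X r) g)))"
    using frt.join_stable_rel assms(1) unfolding frt_lattice_def by blast
  from this[unfolded frt_rel_all_iff] show ?thesis
    using assms(2-4) by (simp add: frt_gen_def)
qed

lemma stable_extension:
  assumes "\<And>f p q. well_typed f \<Longrightarrow> p \<in> Xpow X (dom_of f) \<Longrightarrow> q \<in> Xpow X (cod_of f) \<Longrightarrow>
    (\<forall>p'. arrow f p p' \<longrightarrow> P (cod_of f) p' q) \<longleftrightarrow> (\<forall>q'. arrow f q' q \<longrightarrow> P (dom_of f) p q')"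
  shows "join_stable frtL (\<lambda>C. \<forall>(a, p, q)\<in>C. P a p q)"
    and "p \<in> Xpow X a \<Longrightarrow> q \<in> Xpow X a \<Longrightarrow>
      (\<forall>(a', p', q')\<in>gen a p q. P a' p' q') \<longleftrightarrow> P a p q"
proof -
  let ?P = "\<lambda>(a, p, q). P a p q"
  have "\<forall>A B. (A, B) \<in> frt_rels X r \<longrightarrow> ((\<forall>g\<in>A. ?P g) \<longleftrightarrow> (\<forall>g\<in>B. ?P g))"
    unfolding frt_rel_all_iff using assms by simp
  then have *: "(\<forall>g\<in>A. ?P g) \<longleftrightarrow> (\<forall>g\<in>B. ?P g)" if "(A, B) \<in> frt_rels X r" for A B using that by blast
  show "join_stable frtL (\<lambda>C. \<forall>(a, p, q)\<in>C. P a p q)"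
    using frt.join_stable_extension(1)[of ?P, OF *] unfolding frt_lattice_def .
  show "(\<forall>(a', p', q')\<in>gen a p q. P a' p' q') \<longleftrightarrow> P a p q" if "p \<in> Xpow X a" "q \<in> Xpow X a"
    using frt.join_stable_extension(2)[of ?P, OF *, of "(a, p, q)"] that by (simp add: frt_gen_def)
qed

abbreviation "frtLL \<equiv> tensor frtL frtL"

section \<open>Sweedler expressions\<close>

lemma comult_frt:
  "comul C = join_ext frtLL (\<lambda>(a, p, q). \<Squnion>\<^bsub>frtLL\<^esub>
    {pure_tensor frtL frtL (gen a p l) (gen a l q) | l. l \<in> Xpow X a}) C"
  by (simp add: frt_bialgebra_def Let_def)

lemma comult_closed_subset_iff:
  assumes C: "C \<in> carrier frtL"
  shows "comul C \<in> carrier frtLL"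
    and "Z \<in> carrier frtLL \<Longrightarrow> comul C \<subseteq> Z \<longleftrightarrow>
      (\<forall>(a, p, q)\<in>C. \<forall>l\<in>Xpow X a. (gen a p l, gen a l q) \<in> Z)"
proof -
  interpret T: complete_lattice frtLL
    by (rule tensor_complete_lattice[OF frtL_complete_lattice frtL_complete_lattice])
  define S where "S = (\<lambda>(a, p, q). {pure_tensor frtL frtL (gen a p l) (gen a l q) | l. l \<in> Xpow X a})"
  have eq: "comul C = join_ext frtLL (\<lambda>s. \<Squnion>\<^bsub>frtLL\<^esub> (S s)) C"
    unfolding comult_frt S_def by (rule arg_cong[of _ _ "\<lambda>f. join_ext frtLL f C"]) auto
  have S: "S (a, p, q) \<subseteq> carrier frtLL" if "(a, p, q) \<in> C" for a p q
    using frt_typed[OF C that] pure_tensor_closed[OF frtL_complete_lattice frtL_complete_lattice] frt_gen_closed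
    by (auto simp: S_def)
  have im: "(\<lambda>s. \<Squnion>\<^bsub>frtLL\<^esub> (S s)) ` C \<subseteq> carrier frtLL"
    using S T.sup_closed by (auto simp del: T.sup_closed)
  show "comul C \<in> carrier frtLL"
    unfolding eq join_ext_def by (rule T.sup_closed[OF im])
  assume Z: "Z \<in> carrier frtLL"
  have "comul C \<subseteq> Z \<longleftrightarrow> (\<forall>s\<in>C. \<Squnion>\<^bsub>frtLL\<^esub> (S s) \<subseteq> Z)"
    unfolding eq using join_ext_le_iff[OF T.complete_lattice_axioms im Z] by simp
  also have "\<dots> \<longleftrightarrow> (\<forall>(a, p, q)\<in>C. \<forall>l\<in>Xpow X a. (gen a p l, gen a l q) \<in> Z)"
  proof (rule ball_cong[OF HOL.refl])
    fix s assume s: "s \<in> C"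
    obtain a p q where apq: "s = (a, p, q)" by (rule prod_cases3)
    note t = frt_typed[OF C s[unfolded apq]]
    have "\<Squnion>\<^bsub>frtLL\<^esub> (S s) \<subseteq> Z \<longleftrightarrow> (\<forall>x\<in>S s. x \<subseteq> Z)"
      using T.sup_le_iff[OF _ Z, of "S s"] S s apq by simp
    also have "\<dots> \<longleftrightarrow> (\<forall>l\<in>Xpow X a. (gen a p l, gen a l q) \<in> Z)"
      using pure_tensor_subset_iff[OF frtL_complete_lattice frtL_complete_lattice _ _ Z] frt_gen_closed t
      by (auto simp: S_def apq simp del: le_tensor) blast+
    finally show "\<Squnion>\<^bsub>frtLL\<^esub> (S s) \<subseteq> Z \<longleftrightarrow>
      (case s of (a, p, q) \<Rightarrow> \<forall>l\<in>Xpow X a. (gen a p l, gen a l q) \<in> Z)"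
      by (simp add: apq)
  qed
  finally show "comul C \<subseteq> Z \<longleftrightarrow>
    (\<forall>(a, p, q)\<in>C. \<forall>l\<in>Xpow X a. (gen a p l, gen a l q) \<in> Z)" .
qed

lemma comult_members:
  "C \<in> carrier frtL \<Longrightarrow> (x, y) \<in> comul C \<Longrightarrow> x \<in> carrier frtL \<and> y \<in> carrier frtL"
  using comult_closed_subset_iff(1)[of C] by (auto simp: tensor_iff)

definition bistable :: "('x frt_symbol set \<Rightarrow> 'x frt_symbol set \<Rightarrow> bool) \<Rightarrow> bool"
  where "bistable P \<longleftrightarrow> (\<forall>x\<in>carrier frtL. join_stable frtL (\<lambda>y. P x y)) \<and>
    (\<forall>y\<in>carrier frtL. join_stable frtL (\<lambda>x. P x y))"

text \<open>A bistable predicate is an element of the tensor product, so that it holds on \<open>\<Delta>(C)\<close> if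
  and only if it holds on the pure tensors of which \<open>\<Delta>(C)\<close> is the join.\<close>

lemma sweedler_symbols:
  assumes "bistable P" "C \<in> carrier frtL"
  shows "(\<forall>(x, y)\<in>comul C. P x y) \<longleftrightarrow>
    (\<forall>(a, p, q)\<in>C. \<forall>l\<in>Xpow X a. P (gen a p l) (gen a l q))"
proof -
  let ?Z = "{(x, y). x \<in> carrier frtL \<and> y \<in> carrier frtL \<and> P x y}"
  have Z: "?Z \<in> carrier frtLL"
    using assms(1) unfolding bistable_def
    by (intro tensor_Collect frtL_complete_lattice) auto
  have "(\<forall>(x, y)\<in>comul C. P x y) \<longleftrightarrow> comul C \<subseteq> ?Z"
    using comult_members[OF assms(2)] by auto
  also have "\<dots> \<longleftrightarrow> (\<forall>(a, p, q)\<in>C. \<forall>l\<in>Xpow X a. (gen a p l, gen a l q) \<in> ?Z)"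
    by (rule comult_closed_subset_iff(2)[OF assms(2) Z])
  also have "\<dots> \<longleftrightarrow> (\<forall>(a, p, q)\<in>C. \<forall>l\<in>Xpow X a. P (gen a p l) (gen a l q))"
    using frt_typed[OF assms(2)] frt_gen_closed by fastforce
  finally show ?thesis .
qed

text \<open>The comultiplication respects the defining relations: an arrow is moved through the
  middle index \<open>l\<close> by applying the relation once in the first and once in the second tensor
  factor.\<close>

lemma sweedler_arrow:
  assumes P: "bistable P" and f: "well_typed f" "p \<in> Xpow X (dom_of f)" "q \<in> Xpow X (cod_of f)"
  shows "(\<forall>p'. arrow f p p' \<longrightarrow> (\<forall>l\<in>Xpow X (cod_of f). P (gen (cod_of f) p' l) (gen (cod_of f) l q))) \<longleftrightarrow>
    (\<forall>q'. arrow f q' q \<longrightarrow> (\<forall>l\<in>Xpow X (dom_of f). P (gen (dom_of f) p l) (gen (dom_of f) l q')))"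
proof -
  let ?a = "dom_of f" and ?b = "cod_of f"
  have 1: "(\<forall>p'. arrow f p p' \<longrightarrow> P (gen ?b p' l) (gen ?b l q)) \<longleftrightarrow>
    (\<forall>k. arrow f k l \<longrightarrow> P (gen ?a p k) (gen ?b l q))" if "l \<in> Xpow X ?b" for l
    using P that f frt_gen_closed unfolding bistable_def by (intro stable_arrow) auto
  have 2: "(\<forall>l. arrow f k l \<longrightarrow> P (gen ?a p k) (gen ?b l q)) \<longleftrightarrow>
    (\<forall>q'. arrow f q' q \<longrightarrow> P (gen ?a p k) (gen ?a k q'))" if "k \<in> Xpow X ?a" for k
    using P that f frt_gen_closed unfolding bistable_def by (intro stable_arrow) auto
  have typed: "k \<in> Xpow X ?a" "l \<in> Xpow X ?b" if "arrow f k l" for k l using that by (auto simp: arrow_def)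
  have "(\<forall>p'. arrow f p p' \<longrightarrow> (\<forall>l\<in>Xpow X ?b. P (gen ?b p' l) (gen ?b l q))) \<longleftrightarrow>
    (\<forall>l\<in>Xpow X ?b. \<forall>p'. arrow f p p' \<longrightarrow> P (gen ?b p' l) (gen ?b l q))" by blast
  also have "\<dots> \<longleftrightarrow> (\<forall>l\<in>Xpow X ?b. \<forall>k. arrow f k l \<longrightarrow> P (gen ?a p k) (gen ?b l q))"
    using 1 by (rule ball_cong[OF HOL.refl])
  also have "\<dots> \<longleftrightarrow> (\<forall>k\<in>Xpow X ?a. \<forall>l. arrow f k l \<longrightarrow> P (gen ?a p k) (gen ?b l q))"
    using typed by blast
  also have "\<dots> \<longleftrightarrow> (\<forall>k\<in>Xpow X ?a. \<forall>q'. arrow f q' q \<longrightarrow> P (gen ?a p k) (gen ?a k q'))"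
    using 2 by (rule ball_cong[OF HOL.refl])
  finally show ?thesis by blast
qed

lemma sweedler_stable:
  assumes "bistable P"
  shows "join_stable frtL (\<lambda>C. \<forall>(x, y)\<in>comul C. P x y)"
    and "p \<in> Xpow X a \<Longrightarrow> q \<in> Xpow X a \<Longrightarrow> (\<forall>(x, y)\<in>comul (gen a p q). P x y) \<longleftrightarrow>
      (\<forall>l\<in>Xpow X a. P (gen a p l) (gen a l q))"
proof -
  interpret L: complete_lattice frtL by (rule frtL_complete_lattice)
  let ?Q = "\<lambda>a p q. \<forall>l\<in>Xpow X a. P (gen a p l) (gen a l q)"
  have ext1: "join_stable frtL (\<lambda>C. \<forall>(a, p, q)\<in>C. ?Q a p q)"
    by (rule stable_extension(1), rule sweedler_arrow[OF assms])
  have ext2: "(\<forall>(a', p', q')\<in>gen a p q. ?Q a' p' q') \<longleftrightarrow> ?Q a p q"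
    if "p \<in> Xpow X a" "q \<in> Xpow X a" for a p q
    by (rule stable_extension(2), rule sweedler_arrow[OF assms]) (use that in simp_all)
  have "(\<forall>(x, y)\<in>comul (\<Squnion>\<^bsub>frtL\<^esub> A). P x y) \<longleftrightarrow>
    (\<forall>C\<in>A. \<forall>(x, y)\<in>comul C. P x y)" if A: "A \<subseteq> carrier frtL" for A
    using sweedler_symbols[OF assms L.sup_closed[OF A]] sweedler_symbols[OF assms] A join_stableD[OF ext1 A]
    by (simp add: subset_iff)
  then show "join_stable frtL (\<lambda>C. \<forall>(x, y)\<in>comul C. P x y)"
    by (simp add: join_stable_def)
  show "(\<forall>(x, y)\<in>comul (gen a p q). P x y) \<longleftrightarrow>
      (\<forall>l\<in>Xpow X a. P (gen a p l) (gen a l q))" if "p \<in> Xpow X a" "q \<in> Xpow X a"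
    using sweedler_symbols[OF assms frt_gen_closed[OF that]] ext2[OF that] by simp
qed

text \<open>Iterating \<open>sweedler_symbols\<close>: the condition over the inner comultiplication is again
  bistable, in its first variable by \<open>sweedler_stable\<close> and in the other one because a
  conjunction of predicates respecting joins respects joins.\<close>

lemma sweedler3_symbols:
  assumes C: "C \<in> carrier frtL"
    and P: "\<And>y z. y \<in> carrier frtL \<Longrightarrow> z \<in> carrier frtL \<Longrightarrow> join_stable frtL (\<lambda>x. P x y z)"
      "\<And>x z. x \<in> carrier frtL \<Longrightarrow> z \<in> carrier frtL \<Longrightarrow> join_stable frtL (\<lambda>y. P x y z)"
      "\<And>x y. x \<in> carrier frtL \<Longrightarrow> y \<in> carrier frtL \<Longrightarrow> join_stable frtL (\<lambda>z. P x y z)"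
  shows "(\<forall>(x, y, z)\<in>sweedler3 frtH C. P x y z) \<longleftrightarrow>
    (\<forall>(a, p, q)\<in>C. \<forall>m\<in>Xpow X a. \<forall>l\<in>Xpow X a. P (gen a p l) (gen a l m) (gen a m q))"
proof -
  let ?D = "comul"
  let ?P = "\<lambda>v z. \<forall>(x, y)\<in>?D v. P x y z"
  have bi: "bistable (\<lambda>x y. P x y z)" if "z \<in> carrier frtL" for z
    using P that by (simp add: bistable_def)
  have "bistable ?P"
    unfolding bistable_def
  proof (intro conjI ballI)
    fix v assume v: "v \<in> carrier frtL"
    show "join_stable frtL (?P v)"
    proof (rule join_stable_ball)
      fix xy assume "xy \<in> ?D v"
      then show "join_stable frtL (\<lambda>z. case xy of (x, y) \<Rightarrow> P x y z)"
        using comult_members[OF v] P(3) by (cases xy) simp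
    qed
  next
    fix z assume "z \<in> carrier frtL"
    then show "join_stable frtL (\<lambda>v. ?P v z)" using sweedler_stable(1)[OF bi] by blast
  qed
  have "(\<forall>(x, y, z)\<in>sweedler3 frtH C. P x y z) \<longleftrightarrow> (\<forall>(v, z)\<in>?D C. ?P v z)"
    unfolding sweedler3_def by auto
  also have "\<dots> \<longleftrightarrow> (\<forall>(a, p, q)\<in>C. \<forall>m\<in>Xpow X a. ?P (gen a p m) (gen a m q))"
    by (rule sweedler_symbols[OF \<open>bistable ?P\<close> C])
  also have "\<dots> \<longleftrightarrow> (\<forall>(a, p, q)\<in>C. \<forall>m\<in>Xpow X a. \<forall>l\<in>Xpow X a.
    P (gen a p l) (gen a l m) (gen a m q))"
  proof (rule ball_cong[OF HOL.refl])
    fix s assume s: "s \<in> C"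
    obtain a p q where apq: "s = (a, p, q)" by (rule prod_cases3)
    note t = frt_typed[OF C s[unfolded apq]]
    have "?P (gen a p m) (gen a m q) \<longleftrightarrow>
      (\<forall>l\<in>Xpow X a. P (gen a p l) (gen a l m) (gen a m q))" if "m \<in> Xpow X a" for m
      using sweedler_stable(2)[OF bi] t that frt_gen_closed by blast
    then show "(case s of (a, p, q) \<Rightarrow> \<forall>m\<in>Xpow X a. ?P (gen a p m) (gen a m q)) \<longleftrightarrow>
      (case s of (a, p, q) \<Rightarrow> \<forall>m\<in>Xpow X a. \<forall>l\<in>Xpow X a.
        P (gen a p l) (gen a l m) (gen a m q))"
      by (simp add: apq)
  qed
  finally show ?thesis .
qed

lemma counit_empty_iff: "counit (frt_bialgebra X r) C = {} \<longleftrightarrow> (\<forall>(a, p, q)\<in>C. p \<noteq> q)"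
  by (simp add: frt_bialgebra_def Let_def join_ext_unit_empty_iff split_beta)

end

section \<open>The co-quasitriangular structure and its convolution inverse\<close>

lemma ball_triple_cong:
  assumes "\<And>a p q. (a, p, q) \<in> A \<Longrightarrow> P a p q \<longleftrightarrow> Q a p q"
  shows "(\<forall>(a, p, q)\<in>A. P a p q) \<longleftrightarrow> (\<forall>(a, p, q)\<in>A. Q a p q)"
  using assms by blast

lemma join_ext_unit_triple_empty_iff:
  "join_ext unit_obj (\<lambda>(a, p, q). f a p q) C = {} \<longleftrightarrow> (\<forall>(a, p, q)\<in>C. f a p q = {})"
  unfolding join_ext_unit_empty_iff by (rule ball_cong[OF HOL.refl]) (simp add: case_prod_unfold)

context ybe
begin

definition symbol_braid ::
  "base_obj list \<Rightarrow> base_obj list \<Rightarrow> 'x list \<Rightarrow> 'x list \<Rightarrow> 'x list \<Rightarrow> 'x list \<Rightarrow> bool"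
  where "symbol_braid a b p p' q' q \<longleftrightarrow> p \<in> Xpow X a \<and> p' \<in> Xpow X b \<and> q' \<in> Xpow X b \<and> q \<in> Xpow X a \<and>
    word_braid (word_of a p) (word_of b p') = (word_of b q', word_of a q)"

lemma word_of_inj: "p \<in> Xpow X a \<Longrightarrow> q \<in> Xpow X a \<Longrightarrow> word_of a p = word_of a q \<Longrightarrow> p = q"
  by (metis (mono_tags, lifting) Xpow_def map_word_of(1) mem_Collect_eq)

lemma symbol_braid_ex:
  assumes "p \<in> Xpow X a" "p' \<in> Xpow X b"
  shows "\<exists>q' q. symbol_braid a b p p' q' q"
proof -
  obtain w' v' where b: "word_braid (word_of a p) (word_of b p') = (w', v')" by (rule prod.exhaust)
  note c = word_braid_closed[OF word_of_group_words[OF assms(1)] word_of_group_words[OF assms(2)] b]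
  have "map snd v' = map sign_of a" "map snd w' = map sign_of b"
    using c assms by (simp_all add: Xpow_def)
  then show ?thesis
    using assms b c word_of_map_fst[of v' a] word_of_map_fst[of w' b] map_fst_Xpow[of v' X a] map_fst_Xpow[of w' X b]
    unfolding symbol_braid_def by (intro exI[of _ "map fst w'"] exI[of _ "map fst v'"]) simp
qed

lemma symbol_braid_ex_out:
  assumes "q \<in> Xpow X a" "q' \<in> Xpow X b"
  shows "\<exists>p p'. symbol_braid a b p p' q' q"
proof -
  obtain v w where vw: "v \<in> words" "w \<in> words" "word_braid v w = (word_of b q', word_of a q)"
    using word_braid_surj[OF word_of_group_words[OF assms(1)] word_of_group_words[OF assms(2)]] by blast
  have "map snd v = map sign_of a" "map snd w = map sign_of b"
    using word_braid_closed[OF vw] assms by (simp_all add: Xpow_def)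
  then show ?thesis
    using assms vw word_of_map_fst[of v a] word_of_map_fst[of w b] map_fst_Xpow[of v X a] map_fst_Xpow[of w X b]
    unfolding symbol_braid_def by (intro exI[of _ "map fst v"] exI[of _ "map fst w"]) simp
qed

lemma symbol_braid_unique:
  assumes "symbol_braid a b p p' q' q" "symbol_braid a b p p' s' s"
  shows "q' = s' \<and> q = s"
  using assms word_of_inj unfolding symbol_braid_def by (metis prod.inject)

lemma symbol_braid_out_unique:
  assumes "symbol_braid a b p p' q' q" "symbol_braid a b s s' q' q"
  shows "p = s \<and> p' = s'"
  using assms word_of_inj word_of_group_words word_braid_inj unfolding symbol_braid_def by metis

lemma omega_kappa_iff:
  assumes "p \<in> Xpow X a" "p' \<in> Xpow X b" "q' \<in> Xpow X b" "q \<in> Xpow X a"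
  shows "omega X r (kappa_B a b) {p @ p'} = {q' @ q} \<longleftrightarrow> symbol_braid a b p p' q' q"
proof -
  note t = kap_word_typing[of a b]
  obtain s' s where b: "symbol_braid a b p p' s' s" using symbol_braid_ex assms by blast
  have len: "length p = length a" "length p' = length b" "length s' = length b" "length s = length a"
    "length q' = length b" "length q = length a"
    using b assms by (auto simp: symbol_braid_def Xpow_def)
  have pp: "p @ p' \<in> Xpow X (dom_of (kap_word a b))"
    using assms t by (simp add: Xpow_append Xpow_def)
  have "(word_of a p @ word_of b p', w) \<in> mor_rel (kap_word a b) \<longleftrightarrow> w = word_of b s' @ word_of a s" for w
  proof
    assume "(word_of a p @ word_of b p', w) \<in> mor_rel (kap_word a b)"
    then obtain v u u' v' where 1: "word_of a p @ word_of b p' = v @ u" "w = u' @ v'"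
      "v \<in> typed_words a" "word_braid v u = (u', v')" unfolding mor_rel_kap_word by blast
    have "length v = length (word_of a p)"
      using 1(3) len by (metis (mono_tags, lifting) length_map map_word_of(2) mem_Collect_eq signed_words_def)
    then have "v = word_of a p" "u = word_of b p'" using 1(1) by simp_all
    then show "w = word_of b s' @ word_of a s" using 1 b by (simp add: symbol_braid_def)
  next
    assume "w = word_of b s' @ word_of a s"
    then show "(word_of a p @ word_of b p', w) \<in> mor_rel (kap_word a b)"
      unfolding mor_rel_kap_word using b word_of_signed_words unfolding symbol_braid_def by blast
  qed
  then have "{map fst w | w. (word_of a p @ word_of b p', w) \<in> mor_rel (kap_word a b)} =
    {map fst (word_of b s' @ word_of a s)}" by (simp only:) simp
  moreover have "word_of (dom_of (kap_word a b)) (p @ p') = word_of a p @ word_of b p'"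
    using t word_of_append[OF len(1)] by simp
  ultimately have "omega X r (kappa_B a b) {p @ p'} = {s' @ s}"
    unfolding kappa_B_def omega_mor_class[OF conjunct1[OF t] pp] using len by simp
  moreover have "s' @ s = q' @ q \<longleftrightarrow> s' = q' \<and> s = q" using len by simp
  moreover have "symbol_braid a b p p' q' q \<longleftrightarrow> s' = q' \<and> s = q"
    using b symbol_braid_unique[OF b, of q' q] by blast
  ultimately show ?thesis by simp
qed

lemma frt_cqt_empty_iff:
  assumes "A \<in> carrier frtL" "B \<in> carrier frtL"
  shows "cqt A B = {} \<longleftrightarrow> (\<forall>(a, p, q)\<in>A. \<forall>(b, p', q')\<in>B. \<not> symbol_braid a b p p' q' q)"
proof -
  show ?thesis
    unfolding frt_cqt_def join_ext_unit_triple_empty_iff truth_empty_iff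
    by (intro ball_triple_cong arg_cong[of _ _ Not] omega_kappa_iff)
      (use frt_typed[OF assms(1)] frt_typed[OF assms(2)] in blast)+
qed

text \<open>As the braiding is a bijection of pairs of tuples, reversing it inverts the
  co-quasitriangular structure. In formulas this interchanges the two indices of every
  generator.\<close>

definition inverse_cqt :: "'x frt_symbol set \<Rightarrow> 'x frt_symbol set \<Rightarrow> unit set"
  where "inverse_cqt A B = truth (\<exists>(a, p, q)\<in>A. \<exists>(b, p', q')\<in>B. symbol_braid a b q q' p' p)"

lemma inverse_cqt_empty_iff:
  "inverse_cqt A B = {} \<longleftrightarrow> (\<forall>(a, p, q)\<in>A. \<forall>(b, p', q')\<in>B. \<not> symbol_braid a b q q' p' p)"
  unfolding inverse_cqt_def truth_empty_iff by blast

lemma symbol_braid_slide_left: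
  assumes R: "natural R" "\<And>u v. (u, v) \<in> R \<Longrightarrow> u \<in> typed_words a \<and> v \<in> typed_words b"
    and pq: "p \<in> Xpow X a" "q \<in> Xpow X b" and s: "s \<in> Xpow X c" "s' \<in> Xpow X c"
  shows "(\<exists>p'\<in>Xpow X b. (word_of a p, word_of b p') \<in> R \<and> symbol_braid b c p' s s' q) \<longleftrightarrow>
    (\<exists>q'\<in>Xpow X a. (word_of a q', word_of b q) \<in> R \<and> symbol_braid a c p s s' q')"
proof -
  have nat: "(\<exists>w. (word_of a p, w) \<in> R \<and> word_braid w (word_of c s) = (word_of c s', word_of b q)) \<longleftrightarrow>
    (\<exists>u. word_braid (word_of a p) (word_of c s) = (word_of c s', u) \<and> (u, word_of b q) \<in> R)"
    by (rule left_naturalD[OF R(1) word_of_group_words[OF s(1)] word_of_group_words[OF pq(1)]])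
  show ?thesis
  proof
    assume "\<exists>p'\<in>Xpow X b. (word_of a p, word_of b p') \<in> R \<and> symbol_braid b c p' s s' q"
    then obtain u where u: "word_braid (word_of a p) (word_of c s) = (word_of c s', u)" "(u, word_of b q) \<in> R"
      using nat unfolding symbol_braid_def by blast
    obtain q' where "q' \<in> Xpow X a" "u = word_of a q'"
      using R(2)[OF u(2)] signed_words_word_of by blast
    then show "\<exists>q'\<in>Xpow X a. (word_of a q', word_of b q) \<in> R \<and> symbol_braid a c p s s' q'"
      using u pq s unfolding symbol_braid_def by blast
  next
    assume "\<exists>q'\<in>Xpow X a. (word_of a q', word_of b q) \<in> R \<and> symbol_braid a c p s s' q'"
    then obtain w where w: "(word_of a p, w) \<in> R" "word_braid w (word_of c s) = (word_of c s', word_of b q)"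
      using nat unfolding symbol_braid_def by blast
    obtain p' where "p' \<in> Xpow X b" "w = word_of b p'"
      using R(2)[OF w(1)] signed_words_word_of by blast
    then show "\<exists>p'\<in>Xpow X b. (word_of a p, word_of b p') \<in> R \<and> symbol_braid b c p' s s' q"
      using w pq s unfolding symbol_braid_def by blast
  qed
qed

text \<open>Naturality of the braiding, in the form required for a structure to respect the defining
  relations: the first part is for the co-quasitriangular structure, and the second one, which
  is naturality with respect to the converse relation, for its inverse.\<close>

lemma symbol_braid_arrow_left:
  assumes f: "p \<in> Xpow X (dom_of f)" "q \<in> Xpow X (cod_of f)" and s: "s \<in> Xpow X c" "s' \<in> Xpow X c"
  shows "(\<exists>p'. arrow f p p' \<and> symbol_braid (cod_of f) c p' s s' q) \<longleftrightarrow>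
      (\<exists>q'. arrow f q' q \<and> symbol_braid (dom_of f) c p s s' q')"
    and "(\<exists>p'. arrow f p p' \<and> symbol_braid (cod_of f) c q s s' p') \<longleftrightarrow>
      (\<exists>q'. arrow f q' q \<and> symbol_braid (dom_of f) c q' s s' p)"
  using symbol_braid_slide_left[OF natural_mor_rel mor_rel_typed f s]
    symbol_braid_slide_left[of "(mor_rel f)\<inverse>" "cod_of f" "dom_of f" q p s c s']
    natural_converse[OF natural_mor_rel word_relation_mor_rel, of f] mor_rel_typed[of _ _ f] f s
  unfolding arrow_def by blast+

lemma symbol_braid_slide_right:
  assumes R: "natural R" "\<And>u v. (u, v) \<in> R \<Longrightarrow> u \<in> typed_words a \<and> v \<in> typed_words b"
    and pq: "p \<in> Xpow X a" "q \<in> Xpow X b" and s: "s \<in> Xpow X c" "s' \<in> Xpow X c"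
  shows "(\<exists>p'\<in>Xpow X b. (word_of a p, word_of b p') \<in> R \<and> symbol_braid c b s p' q s') \<longleftrightarrow>
    (\<exists>q'\<in>Xpow X a. (word_of a q', word_of b q) \<in> R \<and> symbol_braid c a s p q' s')"
proof -
  have nat: "(\<exists>w. (word_of a p, w) \<in> R \<and> word_braid (word_of c s) w = (word_of b q, word_of c s')) \<longleftrightarrow>
    (\<exists>u. word_braid (word_of c s) (word_of a p) = (u, word_of c s') \<and> (u, word_of b q) \<in> R)"
    by (rule right_naturalD[OF R(1) word_of_group_words[OF s(1)] word_of_group_words[OF pq(1)]])
  show ?thesis
  proof
    assume "\<exists>p'\<in>Xpow X b. (word_of a p, word_of b p') \<in> R \<and> symbol_braid c b s p' q s'"
    then obtain u where u: "word_braid (word_of c s) (word_of a p) = (u, word_of c s')" "(u, word_of b q) \<in> R"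
      using nat unfolding symbol_braid_def by blast
    obtain q' where "q' \<in> Xpow X a" "u = word_of a q'"
      using R(2)[OF u(2)] signed_words_word_of by blast
    then show "\<exists>q'\<in>Xpow X a. (word_of a q', word_of b q) \<in> R \<and> symbol_braid c a s p q' s'"
      using u pq s unfolding symbol_braid_def by blast
  next
    assume "\<exists>q'\<in>Xpow X a. (word_of a q', word_of b q) \<in> R \<and> symbol_braid c a s p q' s'"
    then obtain w where w: "(word_of a p, w) \<in> R" "word_braid (word_of c s) w = (word_of b q, word_of c s')"
      using nat unfolding symbol_braid_def by blast
    obtain p' where "p' \<in> Xpow X b" "w = word_of b p'"
      using R(2)[OF w(1)] signed_words_word_of by blast
    then show "\<exists>p'\<in>Xpow X b. (word_of a p, word_of b p') \<in> R \<and> symbol_braid c b s p' q s'"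
      using w pq s unfolding symbol_braid_def by blast
  qed
qed

lemma symbol_braid_arrow_right:
  assumes f: "p \<in> Xpow X (dom_of f)" "q \<in> Xpow X (cod_of f)" and s: "s \<in> Xpow X c" "s' \<in> Xpow X c"
  shows "(\<exists>p'. arrow f p p' \<and> symbol_braid c (cod_of f) s p' q s') \<longleftrightarrow>
      (\<exists>q'. arrow f q' q \<and> symbol_braid c (dom_of f) s p q' s')"
    and "(\<exists>p'. arrow f p p' \<and> symbol_braid c (cod_of f) s q p' s') \<longleftrightarrow>
      (\<exists>q'. arrow f q' q \<and> symbol_braid c (dom_of f) s q' p s')"
  using symbol_braid_slide_right[OF natural_mor_rel mor_rel_typed f s]
    symbol_braid_slide_right[of "(mor_rel f)\<inverse>" "cod_of f" "dom_of f" q p s c s']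
    natural_converse[OF natural_mor_rel word_relation_mor_rel, of f] mor_rel_typed[of _ _ f] f s
  unfolding arrow_def by blast+

text \<open>A relation \<open>K\<close> between generators that respects the defining relations in both arguments
  gives a scalar-valued bimorphism; the predicate below says that it vanishes.\<close>

lemma symbol_pairing_stable:
  assumes left: "\<And>f p q c s s'. p \<in> Xpow X (dom_of f) \<Longrightarrow> q \<in> Xpow X (cod_of f) \<Longrightarrow>
      s \<in> Xpow X c \<Longrightarrow> s' \<in> Xpow X c \<Longrightarrow>
      (\<exists>p'. arrow f p p' \<and> K (cod_of f) p' q c s s') \<longleftrightarrow> (\<exists>q'. arrow f q' q \<and> K (dom_of f) p q' c s s')"
    and right: "\<And>f p q c s s'. p \<in> Xpow X (dom_of f) \<Longrightarrow> q \<in> Xpow X (cod_of f) \<Longrightarrow>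
      s \<in> Xpow X c \<Longrightarrow> s' \<in> Xpow X c \<Longrightarrow>
      (\<exists>p'. arrow f p p' \<and> K c s s' (cod_of f) p' q) \<longleftrightarrow> (\<exists>q'. arrow f q' q \<and> K c s s' (dom_of f) p q')"
  shows "bistable (\<lambda>A B. \<forall>(a, p, q)\<in>A. \<forall>(b, p', q')\<in>B. \<not> K a p q b p' q')"
    and "p \<in> Xpow X a \<Longrightarrow> q \<in> Xpow X a \<Longrightarrow> p' \<in> Xpow X b \<Longrightarrow> q' \<in> Xpow X b \<Longrightarrow>
      (\<forall>(a, p, q)\<in>gen a p q. \<forall>(b, p', q')\<in>gen b p' q'. \<not> K a p q b p' q') \<longleftrightarrow> \<not> K a p q b p' q'"
proof -
  let ?P = "\<lambda>A B. \<forall>(a, p, q)\<in>A. \<forall>(b, p', q')\<in>B. \<not> K a p q b p' q'"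
  have L: "(\<forall>p'. arrow f p p' \<longrightarrow> (\<forall>(c, s, s')\<in>B. \<not> K (cod_of f) p' q c s s')) \<longleftrightarrow>
      (\<forall>q'. arrow f q' q \<longrightarrow> (\<forall>(c, s, s')\<in>B. \<not> K (dom_of f) p q' c s s'))"
    if B: "B \<in> carrier frtL" and f: "p \<in> Xpow X (dom_of f)" "q \<in> Xpow X (cod_of f)" for B f p q
  proof -
    have "(\<forall>p'. arrow f p p' \<longrightarrow> (\<forall>(c, s, s')\<in>B. \<not> K (cod_of f) p' q c s s')) \<longleftrightarrow>
      (\<forall>(c, s, s')\<in>B. \<not> (\<exists>p'. arrow f p p' \<and> K (cod_of f) p' q c s s'))" by blast
    also have "\<dots> \<longleftrightarrow> (\<forall>(c, s, s')\<in>B. \<not> (\<exists>q'. arrow f q' q \<and> K (dom_of f) p q' c s s'))"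
      by (intro ball_triple_cong arg_cong[of _ _ Not] left[OF f]) (use frt_typed[OF B] in blast)+
    finally show ?thesis by blast
  qed
  have R: "(\<forall>p'. arrow f p p' \<longrightarrow> (\<forall>(c, s, s')\<in>A. \<not> K c s s' (cod_of f) p' q)) \<longleftrightarrow>
      (\<forall>q'. arrow f q' q \<longrightarrow> (\<forall>(c, s, s')\<in>A. \<not> K c s s' (dom_of f) p q'))"
    if A: "A \<in> carrier frtL" and f: "p \<in> Xpow X (dom_of f)" "q \<in> Xpow X (cod_of f)" for A f p q
  proof -
    have "(\<forall>p'. arrow f p p' \<longrightarrow> (\<forall>(c, s, s')\<in>A. \<not> K c s s' (cod_of f) p' q)) \<longleftrightarrow>
      (\<forall>(c, s, s')\<in>A. \<not> (\<exists>p'. arrow f p p' \<and> K c s s' (cod_of f) p' q))" by blast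
    also have "\<dots> \<longleftrightarrow> (\<forall>(c, s, s')\<in>A. \<not> (\<exists>q'. arrow f q' q \<and> K c s s' (dom_of f) p q'))"
      by (intro ball_triple_cong arg_cong[of _ _ Not] right[OF f]) (use frt_typed[OF A] in blast)+
    finally show ?thesis by blast
  qed
  show "bistable ?P"
    unfolding bistable_def
  proof (intro conjI ballI)
    fix B assume B: "B \<in> carrier frtL"
    show "join_stable frtL (\<lambda>A. ?P A B)"
      using stable_extension(1)[of "\<lambda>a p q. \<forall>(b, p', q')\<in>B. \<not> K a p q b p' q'"] L[OF B] by blast
  next
    fix A assume A: "A \<in> carrier frtL"
    have "(\<lambda>B. ?P A B) = (\<lambda>B. \<forall>(b, p', q')\<in>B. \<forall>(a, p, q)\<in>A. \<not> K a p q b p' q')" by blast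
    then show "join_stable frtL (\<lambda>B. ?P A B)"
      using stable_extension(1)[of "\<lambda>b p' q'. \<forall>(a, p, q)\<in>A. \<not> K a p q b p' q'"] R[OF A] by simp
  qed
  show "?P (gen a p q) (gen b p' q') \<longleftrightarrow> \<not> K a p q b p' q'"
    if t: "p \<in> Xpow X a" "q \<in> Xpow X a" "p' \<in> Xpow X b" "q' \<in> Xpow X b"
  proof -
    have "?P (gen a p q) (gen b p' q') \<longleftrightarrow> (\<forall>(b, p', q')\<in>gen b p' q'. \<not> K a p q b p' q')"
      by (rule stable_extension(2)[of "\<lambda>a p q. \<forall>(b, p', q')\<in>gen b p' q'. \<not> K a p q b p' q'"])
        (use t L[OF frt_gen_closed] in blast)+
    also have "\<dots> \<longleftrightarrow> \<not> K a p q b p' q'"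
    proof (rule stable_extension(2)[of "\<lambda>b p' q'. \<not> K a p q b p' q'"])
      fix f k l assume "k \<in> Xpow X (dom_of f)" "l \<in> Xpow X (cod_of f)"
      then show "(\<forall>p'. arrow f k p' \<longrightarrow> \<not> K a p q (cod_of f) p' l) \<longleftrightarrow>
        (\<forall>q'. arrow f q' l \<longrightarrow> \<not> K a p q (dom_of f) k q')"
        using right[of k f l p a q] t by blast
    qed (use t in auto)
    finally show ?thesis .
  qed
qed

lemma bistable_cong:
  assumes "bistable P" "\<And>x y. x \<in> carrier frtL \<Longrightarrow> y \<in> carrier frtL \<Longrightarrow> P x y \<longleftrightarrow> Q x y"
  shows "bistable Q"
proof -
  interpret complete_lattice frtL by (rule frtL_complete_lattice)
  show ?thesis using assms unfolding bistable_def join_stable_def by (auto simp: subset_iff)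
qed

lemma cqt_bistable: "bistable (\<lambda>A B. cqt A B = {})"
  and cqt_gen: "p \<in> Xpow X a \<Longrightarrow> q \<in> Xpow X a \<Longrightarrow> p' \<in> Xpow X b \<Longrightarrow> q' \<in> Xpow X b \<Longrightarrow>
    cqt (gen a p q) (gen b p' q') = {} \<longleftrightarrow> \<not> symbol_braid a b p p' q' q"
proof -
  let ?K = "\<lambda>a p q b p' q'. symbol_braid a b p p' q' q"
  note s = symbol_pairing_stable[of ?K, OF symbol_braid_arrow_left(1) symbol_braid_arrow_right(1)]
  show "bistable (\<lambda>A B. cqt A B = {})"
    by (rule bistable_cong[OF s(1)]) (simp_all add: frt_cqt_empty_iff)
  show "cqt (gen a p q) (gen b p' q') = {} \<longleftrightarrow> \<not> symbol_braid a b p p' q' q"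
    if "p \<in> Xpow X a" "q \<in> Xpow X a" "p' \<in> Xpow X b" "q' \<in> Xpow X b"
    using s(2)[of p a q p' b q'] frt_cqt_empty_iff[OF frt_gen_closed frt_gen_closed, of p a q p' b q'] that by simp
qed

lemma inverse_cqt_bistable: "bistable (\<lambda>A B. inverse_cqt A B = {})"
  and inverse_cqt_gen: "p \<in> Xpow X a \<Longrightarrow> q \<in> Xpow X a \<Longrightarrow> p' \<in> Xpow X b \<Longrightarrow> q' \<in> Xpow X b \<Longrightarrow>
    inverse_cqt (gen a p q) (gen b p' q') = {} \<longleftrightarrow> \<not> symbol_braid a b q q' p' p"
proof -
  let ?K = "\<lambda>a p q b p' q'. symbol_braid a b q q' p' p"
  note s = symbol_pairing_stable[of ?K, OF symbol_braid_arrow_left(2) symbol_braid_arrow_right(2)]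
  show "bistable (\<lambda>A B. inverse_cqt A B = {})"
    unfolding inverse_cqt_empty_iff by (rule s(1)) simp_all
  show "inverse_cqt (gen a p q) (gen b p' q') = {} \<longleftrightarrow> \<not> symbol_braid a b q q' p' p"
    if "p \<in> Xpow X a" "q \<in> Xpow X a" "p' \<in> Xpow X b" "q' \<in> Xpow X b"
    unfolding inverse_cqt_empty_iff by (rule s(2)) (use that in simp_all)
qed

lemma convolution_empty_iff:
  assumes R: "bistable (\<lambda>A B. R A B = ({} :: unit set))" and R': "bistable (\<lambda>A B. R' A B = ({} :: unit set))"
  shows "A \<in> carrier frtL \<Longrightarrow> B \<in> carrier frtL \<Longrightarrow> \<Squnion>\<^bsub>unit_obj\<^esub> {R a1 b1 \<inter> R' a2 b2 | a1 a2 b1 b2.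
      (a1, a2) \<in> comult frtH A \<and> (b1, b2) \<in> comult frtH B} = {} \<longleftrightarrow>
    (\<forall>(a, p, q)\<in>A. \<forall>(b, p', q')\<in>B. \<forall>l\<in>Xpow X a. \<forall>l'\<in>Xpow X b.
      R (gen a p l) (gen b p' l') = {} \<or> R' (gen a l q) (gen b l' q') = {})"
    (is "_ \<Longrightarrow> _ \<Longrightarrow> ?L A B \<longleftrightarrow> ?C")
    and "p \<in> Xpow X a \<Longrightarrow> q \<in> Xpow X a \<Longrightarrow> p' \<in> Xpow X b \<Longrightarrow> q' \<in> Xpow X b \<Longrightarrow>
      \<Squnion>\<^bsub>unit_obj\<^esub> {R a1 b1 \<inter> R' a2 b2 | a1 a2 b1 b2.
        (a1, a2) \<in> comult frtH (gen a p q) \<and> (b1, b2) \<in> comult frtH (gen b p' q')} = {} \<longleftrightarrow>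
      (\<forall>l\<in>Xpow X a. \<forall>l'\<in>Xpow X b.
        R (gen a p l) (gen b p' l') = {} \<or> R' (gen a l q) (gen b l' q') = {})"
proof -
  let ?D = "comul"
  let ?P = "\<lambda>a1 a2 b1 b2. R a1 b1 = {} \<or> R' a2 b2 = {}"
  have inter: "s \<inter> t = {} \<longleftrightarrow> s = {} \<or> t = {}" for s t :: "unit set" by auto
  have b1: "bistable (\<lambda>b1 b2. ?P a1 a2 b1 b2)" if "a1 \<in> carrier frtL" "a2 \<in> carrier frtL" for a1 a2
    using R R' that unfolding bistable_def by (auto intro: join_stable_disj)
  have b2: "bistable (\<lambda>a1 a2. \<forall>(b1, b2)\<in>?D B. ?P a1 a2 b1 b2)" if B: "B \<in> carrier frtL" for B
    unfolding bistable_def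
  proof (intro conjI ballI join_stable_ball)
    fix x b assume x: "x \<in> carrier frtL" and b: "b \<in> ?D B"
    obtain b1 b2 where bb: "b = (b1, b2)" by (rule prod.exhaust)
    have c: "b1 \<in> carrier frtL" "b2 \<in> carrier frtL" using comult_members[OF B] b bb by auto
    show "join_stable frtL (\<lambda>y. case b of (b1, b2) \<Rightarrow> ?P x y b1 b2)"
      "join_stable frtL (\<lambda>y. case b of (b1, b2) \<Rightarrow> ?P y x b1 b2)"
      using R R' x c unfolding bistable_def bb by (auto intro: join_stable_disj)
  qed
  have start: "?L A B \<longleftrightarrow> (\<forall>(a1, a2)\<in>?D A. \<forall>(b1, b2)\<in>?D B. ?P a1 a2 b1 b2)" for A B
  proof -
    have "?L A B \<longleftrightarrow> (\<forall>a1 a2 b1 b2. (a1, a2) \<in> ?D A \<and> (b1, b2) \<in> ?D B \<longrightarrow> R a1 b1 \<inter> R' a2 b2 = {})"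
      unfolding sup_unit_obj by (simp add: Union_empty_conv) blast
    then show ?thesis unfolding inter by (simp only:) blast
  qed
  show "?L A B \<longleftrightarrow> ?C" if A: "A \<in> carrier frtL" and B: "B \<in> carrier frtL"
  proof -
    have "?L A B \<longleftrightarrow> (\<forall>(a, p, q)\<in>A. \<forall>l\<in>Xpow X a. \<forall>(b1, b2)\<in>?D B. ?P (gen a p l) (gen a l q) b1 b2)"
      unfolding start by (rule sweedler_symbols[OF b2[OF B] A])
    also have "\<dots> \<longleftrightarrow> (\<forall>(a, p, q)\<in>A. \<forall>l\<in>Xpow X a. \<forall>(b, p', q')\<in>B. \<forall>l'\<in>Xpow X b.
      ?P (gen a p l) (gen a l q) (gen b p' l') (gen b l' q'))"
    proof (rule ball_cong[OF HOL.refl])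
      fix s assume s: "s \<in> A"
      obtain a p q where apq: "s = (a, p, q)" by (rule prod_cases3)
      note t = frt_typed[OF A s[unfolded apq]]
      have "(\<forall>(b1, b2)\<in>?D B. ?P (gen a p l) (gen a l q) b1 b2) \<longleftrightarrow>
        (\<forall>(b, p', q')\<in>B. \<forall>l'\<in>Xpow X b.
          ?P (gen a p l) (gen a l q) (gen b p' l') (gen b l' q'))"
        if "l \<in> Xpow X a" for l
        by (rule sweedler_symbols[OF b1 B]) (use t that frt_gen_closed in simp_all)
      then show "(case s of (a, p, q) \<Rightarrow> \<forall>l\<in>Xpow X a. \<forall>(b1, b2)\<in>?D B. ?P (gen a p l) (gen a l q) b1 b2) \<longleftrightarrow>
        (case s of (a, p, q) \<Rightarrow> \<forall>l\<in>Xpow X a. \<forall>(b, p', q')\<in>B. \<forall>l'\<in>Xpow X b.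
      ?P (gen a p l) (gen a l q) (gen b p' l') (gen b l' q'))"
        by (simp add: apq)
    qed
    also have "\<dots> \<longleftrightarrow> ?C" by fast
    finally show ?thesis .
  qed
  show "?L (gen a p q) (gen b p' q') \<longleftrightarrow> (\<forall>l\<in>Xpow X a. \<forall>l'\<in>Xpow X b.
    ?P (gen a p l) (gen a l q) (gen b p' l') (gen b l' q'))"
    if t: "p \<in> Xpow X a" "q \<in> Xpow X a" "p' \<in> Xpow X b" "q' \<in> Xpow X b"
  proof -
    have "?L (gen a p q) (gen b p' q') \<longleftrightarrow> (\<forall>l\<in>Xpow X a. \<forall>(b1, b2)\<in>?D (gen b p' q').
      ?P (gen a p l) (gen a l q) b1 b2)"
      unfolding start by (rule sweedler_stable(2)[OF b2[OF frt_gen_closed[OF t(3,4)]] t(1,2)])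
    also have "\<dots> \<longleftrightarrow> (\<forall>l\<in>Xpow X a. \<forall>l'\<in>Xpow X b.
      ?P (gen a p l) (gen a l q) (gen b p' l') (gen b l' q'))"
      by (rule ball_cong[OF HOL.refl], rule sweedler_stable(2)[OF b1 t(3,4)])
        (use t frt_gen_closed in simp_all)
    finally show ?thesis .
  qed
qed

lemma counit_gen: "p \<in> Xpow X a \<Longrightarrow> q \<in> Xpow X a \<Longrightarrow> counit frtH (gen a p q) = {} \<longleftrightarrow> p \<noteq> q"
  unfolding frtH_fields counit_empty_iff by (rule stable_extension(2)) auto

lemma counit_pair_empty_iff:
  "counit frtH A \<inter> counit frtH B = {} \<longleftrightarrow> (\<forall>(a, p, q)\<in>A. \<forall>(b, p', q')\<in>B. p \<noteq> q \<or> p' \<noteq> q')"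
proof -
  have inter: "s \<inter> t = {} \<longleftrightarrow> s = {} \<or> t = {}" for s t :: "unit set" by auto
  show ?thesis unfolding inter by (auto simp: counit_empty_iff)
qed

lemma sup_bimorphism_unit_iff:
  "sup_bimorphism frtH frtH unit_obj R' \<longleftrightarrow> bistable (\<lambda>A B. R' A B = {})"
proof -
  have "join_stable frtH = join_stable frtL" by (rule join_stable_cong) simp_all
  then show ?thesis by (simp add: sup_bimorphism_def sup_morphism_unit_iff bistable_def)
qed

text \<open>Given \<open>p, p'\<close>, the braiding leaves one choice for the middle indices \<open>l, l'\<close> in each
  convolution product, and bijectivity makes the product nonzero precisely on diagonal
  generators, where both counits are.\<close>

lemma inverse_cqt_is_convolution_inverse: "is_convolution_inverse frtH (cqt) inverse_cqt"
  unfolding is_convolution_inverse_def sup_bimorphism_unit_iff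
proof (intro conjI ballI inverse_cqt_bistable)
  fix A B assume "A \<in> carrier frtH" "B \<in> carrier frtH"
  then have AB: "A \<in> carrier frtL" "B \<in> carrier frtL" by simp_all
  show "\<Squnion>\<^bsub>unit_obj\<^esub> {cqt a1 b1 \<inter> inverse_cqt a2 b2 | a1 a2 b1 b2.
      (a1, a2) \<in> comult frtH A \<and> (b1, b2) \<in> comult frtH B} = counit frtH A \<inter> counit frtH B"
  proof (rule unit_set_eqI, unfold convolution_empty_iff(1)[OF cqt_bistable inverse_cqt_bistable AB] counit_pair_empty_iff)
    have "(\<forall>l\<in>Xpow X a. \<forall>l'\<in>Xpow X b. cqt (gen a p l) (gen b p' l') = {} \<or>
        inverse_cqt (gen a l q) (gen b l' q') = {}) \<longleftrightarrow> p \<noteq> q \<or> p' \<noteq> q'"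
      if t: "p \<in> Xpow X a" "q \<in> Xpow X a" "p' \<in> Xpow X b" "q' \<in> Xpow X b" for a p q b p' q'
    proof -
      obtain s' s where s: "symbol_braid a b p p' s' s" using symbol_braid_ex t by blast
      then have "s \<in> Xpow X a" "s' \<in> Xpow X b" by (auto simp: symbol_braid_def)
      then show ?thesis
        using t cqt_gen inverse_cqt_gen s symbol_braid_unique[OF s] symbol_braid_out_unique[OF s] by metis
    qed
    then show "(\<forall>(a, p, q)\<in>A. \<forall>(b, p', q')\<in>B. \<forall>l\<in>Xpow X a. \<forall>l'\<in>Xpow X b.
        cqt (gen a p l) (gen b p' l') = {} \<or>
        inverse_cqt (gen a l q) (gen b l' q') = {}) \<longleftrightarrow>
      (\<forall>(a, p, q)\<in>A. \<forall>(b, p', q')\<in>B. p \<noteq> q \<or> p' \<noteq> q')"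
      by (intro ball_triple_cong) (use frt_typed[OF AB(1)] frt_typed[OF AB(2)] in blast)
  qed
  show "\<Squnion>\<^bsub>unit_obj\<^esub> {inverse_cqt a1 b1 \<inter> cqt a2 b2 | a1 a2 b1 b2.
      (a1, a2) \<in> comult frtH A \<and> (b1, b2) \<in> comult frtH B} = counit frtH A \<inter> counit frtH B"
  proof (rule unit_set_eqI, unfold convolution_empty_iff(1)[OF inverse_cqt_bistable cqt_bistable AB] counit_pair_empty_iff)
    have "(\<forall>l\<in>Xpow X a. \<forall>l'\<in>Xpow X b. inverse_cqt (gen a p l) (gen b p' l') = {} \<or>
        cqt (gen a l q) (gen b l' q') = {}) \<longleftrightarrow> p \<noteq> q \<or> p' \<noteq> q'"
      if t: "p \<in> Xpow X a" "q \<in> Xpow X a" "p' \<in> Xpow X b" "q' \<in> Xpow X b" for a p q b p' q'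
    proof -
      obtain s s' where s: "symbol_braid a b s s' p' p" using symbol_braid_ex_out t by blast
      then have "s \<in> Xpow X a" "s' \<in> Xpow X b" by (auto simp: symbol_braid_def)
      then show ?thesis
        using t cqt_gen inverse_cqt_gen s symbol_braid_unique[OF s] symbol_braid_out_unique[OF s] by metis
    qed
    then show "(\<forall>(a, p, q)\<in>A. \<forall>(b, p', q')\<in>B. \<forall>l\<in>Xpow X a. \<forall>l'\<in>Xpow X b.
        inverse_cqt (gen a p l) (gen b p' l') = {} \<or>
        cqt (gen a l q) (gen b l' q') = {}) \<longleftrightarrow>
      (\<forall>(a, p, q)\<in>A. \<forall>(b, p', q')\<in>B. p \<noteq> q \<or> p' \<noteq> q')"
      by (intro ball_triple_cong) (use frt_typed[OF AB(1)] frt_typed[OF AB(2)] in blast)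
  qed
qed

text \<open>Every convolution inverse has these values on generators, so it does not matter which one
  is chosen. Indeed, let \<open>s, s'\<close> be the words that are braided to \<open>p', p\<close>. Then the convolution
  product of the structure with its inverse, at \<open>[s, q]\<close> and \<open>[s', q']\<close>, has the value of the
  inverse at \<open>[p, q]\<close> and \<open>[p', q']\<close> as its only possibly nonzero term, and it is known to be
  nonzero exactly if \<open>s = q\<close> and \<open>s' = q'\<close>.\<close>

lemma convolution_inverse_frt:
  shows "bistable (\<lambda>A B. convolution_inverse frtH (cqt) A B = {})"
    and "p \<in> Xpow X a \<Longrightarrow> q \<in> Xpow X a \<Longrightarrow> p' \<in> Xpow X b \<Longrightarrow> q' \<in> Xpow X b \<Longrightarrow>
      convolution_inverse frtH (cqt) (gen a p q) (gen b p' q') = {} \<longleftrightarrow>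
        \<not> symbol_braid a b q q' p' p"
proof -
  let ?R = "cqt" and ?S = "convolution_inverse frtH (cqt)"
  have inv: "is_convolution_inverse frtH ?R ?S"
    unfolding convolution_inverse_def
    by (rule someI[of "is_convolution_inverse frtH (cqt)"]) (rule inverse_cqt_is_convolution_inverse)
  then show bi: "bistable (\<lambda>A B. ?S A B = {})"
    unfolding is_convolution_inverse_def sup_bimorphism_unit_iff by blast
  show "?S (gen a p q) (gen b p' q') = {} \<longleftrightarrow> \<not> symbol_braid a b q q' p' p"
    if t: "p \<in> Xpow X a" "q \<in> Xpow X a" "p' \<in> Xpow X b" "q' \<in> Xpow X b"
  proof -
    obtain s s' where s: "symbol_braid a b s s' p' p" using symbol_braid_ex_out t by blast
    then have st: "s \<in> Xpow X a" "s' \<in> Xpow X b" by (auto simp: symbol_braid_def)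
    have g: "gen a k l \<in> carrier frtH" if "k \<in> Xpow X a" "l \<in> Xpow X a" for a k l
      using frt_gen_closed that by simp
    have "\<Squnion>\<^bsub>unit_obj\<^esub> {?R a1 b1 \<inter> ?S a2 b2 | a1 a2 b1 b2.
      (a1, a2) \<in> comult frtH (gen a s q) \<and> (b1, b2) \<in> comult frtH (gen b s' q')} =
      counit frtH (gen a s q) \<inter> counit frtH (gen b s' q')"
      using inv g[OF st(1) t(2)] g[OF st(2) t(4)] unfolding is_convolution_inverse_def by blast
    then have "(\<forall>l\<in>Xpow X a. \<forall>l'\<in>Xpow X b. ?R (gen a s l) (gen b s' l') = {} \<or>
        ?S (gen a l q) (gen b l' q') = {}) \<longleftrightarrow> s \<noteq> q \<or> s' \<noteq> q'"
      unfolding convolution_empty_iff(2)[OF cqt_bistable bi st(1) t(2) st(2) t(4), symmetric]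
        counit_gen[OF st(1) t(2), symmetric] counit_gen[OF st(2) t(4), symmetric] by auto
    moreover have "?R (gen a s l) (gen b s' l') = {} \<longleftrightarrow> l \<noteq> p \<or> l' \<noteq> p'"
      if "l \<in> Xpow X a" "l' \<in> Xpow X b" for l l'
      using cqt_gen[OF st(1) that(1) st(2) that(2)] symbol_braid_unique[OF s] s by blast
    moreover have "symbol_braid a b q q' p' p \<longleftrightarrow> s = q \<and> s' = q'"
      using s symbol_braid_out_unique[OF s] by blast
    ultimately show ?thesis using t by auto
  qed
qed

abbreviation "univG \<equiv> universal_group X r"

section \<open>The quotient by the kernel of the counit\<close>

definition symbol_class :: "base_obj list \<Rightarrow> 'x list \<Rightarrow> 'x word set set"
  where "symbol_class a p = word_class (word_of a p)"

definition diagonal_classes :: "'x frt_symbol set \<Rightarrow> 'x word set set set"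
  where "diagonal_classes C = {symbol_class a p | a p. (a, p, p) \<in> C}"

text \<open>The largest element of \<open>H\<close> whose diagonal generators have classes in \<open>T\<close>; in particular
  it contains all off-diagonal generators. For \<open>T = {}\<close> it is the join of the kernel of the
  counit.\<close>

definition class_hull :: "'x word set set set \<Rightarrow> 'x frt_symbol set"
  where "class_hull T = {(a, p, q) \<in> frt_symbols X. p = q \<longrightarrow> symbol_class a p \<in> T}"

lemma class_hull_iff: "(a, p, q) \<in> class_hull T \<longleftrightarrow>
    p \<in> Xpow X a \<and> q \<in> Xpow X a \<and> (p = q \<longrightarrow> symbol_class a p \<in> T)"
  by (simp add: class_hull_def)

lemma arrow_symbol_class: "arrow f p q \<Longrightarrow> symbol_class (dom_of f) p = symbol_class (cod_of f) q"
  unfolding arrow_def symbol_class_def using mor_rel_word_class by blast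

text \<open>If \<open>f\<close> does not relate \<open>p\<close> to \<open>q\<close>, both sides of the relation consist of off-diagonal
  generators. Otherwise each side has one diagonal generator, and both have the same class.\<close>

lemma class_hull_closed: "class_hull T \<in> carrier frtL"
  unfolding frtL_iff
proof (intro conjI allI impI)
  show "class_hull T \<subseteq> frt_symbols X" by (auto simp: class_hull_def)
  fix f p q assume pq: "p \<in> Xpow X (dom_of f)" "q \<in> Xpow X (cod_of f)"
  have t: "p' \<in> Xpow X (dom_of f)" "q' \<in> Xpow X (cod_of f)" if "arrow f p' q'" for p' q'
    using that by (auto simp: arrow_def)
  have "(\<forall>p'. arrow f p p' \<longrightarrow> (cod_of f, p', q) \<in> class_hull T) \<longleftrightarrow>
    (arrow f p q \<longrightarrow> symbol_class (cod_of f) q \<in> T)"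
    unfolding class_hull_iff using pq t by blast
  also have "\<dots> \<longleftrightarrow> (arrow f p q \<longrightarrow> symbol_class (dom_of f) p \<in> T)"
    using arrow_symbol_class by metis
  also have "\<dots> \<longleftrightarrow> (\<forall>q'. arrow f q' q \<longrightarrow> (dom_of f, p, q') \<in> class_hull T)"
    unfolding class_hull_iff using pq t by blast
  finally show "(\<forall>p'. arrow f p p' \<longrightarrow> (cod_of f, p', q) \<in> class_hull T) \<longleftrightarrow>
    (\<forall>q'. arrow f q' q \<longrightarrow> (dom_of f, p, q') \<in> class_hull T)" .
qed

text \<open>This adjunction carries all further computations of classes.\<close>

lemma diagonal_classes_subset_iff:
  assumes "C \<in> carrier frtL" shows "diagonal_classes C \<subseteq> T \<longleftrightarrow> C \<subseteq> class_hull T"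
proof
  assume "diagonal_classes C \<subseteq> T"
  then show "C \<subseteq> class_hull T"
    using frt_symbols_subset[OF assms] unfolding diagonal_classes_def class_hull_def by blast
next
  assume "C \<subseteq> class_hull T"
  then show "diagonal_classes C \<subseteq> T"
    unfolding diagonal_classes_def using class_hull_iff by blast
qed

lemma symbol_class_closed: "p \<in> Xpow X a \<Longrightarrow> symbol_class a p \<in> carrier univG"
  by (simp add: symbol_class_def word_of_group_words)

lemma diagonal_classes_closed: "C \<in> carrier frtL \<Longrightarrow> diagonal_classes C \<subseteq> carrier univG"
  using frt_typed symbol_class_closed unfolding diagonal_classes_def by blast

lemma symbol_class_surj:
  assumes "g \<in> carrier univG" obtains a p where "p \<in> Xpow X a" "g = symbol_class a p"
proof -
  obtain w where w: "w \<in> words" "g = word_class w" using assms by (auto simp: carrier_universal_group)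
  obtain p where "p \<in> Xpow X (map (letter_obj \<circ> snd) w)" "w = word_of (map (letter_obj \<circ> snd) w) p"
    using signed_words_word_of[OF signed_words_sign_of[OF w(1)]] by blast
  then show thesis using that w(2) by (simp add: symbol_class_def)
qed

lemma diagonal_classes_hull:
  assumes "T \<subseteq> carrier univG" shows "diagonal_classes (class_hull T) = T"
proof
  show "diagonal_classes (class_hull T) \<subseteq> T"
    using diagonal_classes_subset_iff[OF class_hull_closed] by blast
  show "T \<subseteq> diagonal_classes (class_hull T)"
  proof
    fix g assume "g \<in> T"
    then obtain a p where "p \<in> Xpow X a" "g = symbol_class a p" using assms symbol_class_surj by blast
    then show "g \<in> diagonal_classes (class_hull T)"
      using \<open>g \<in> T\<close> unfolding diagonal_classes_def class_hull_iff by blast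
  qed
qed

lemma class_hull_mono_iff:
  "T \<subseteq> carrier univG \<Longrightarrow> class_hull T \<subseteq> class_hull U \<longleftrightarrow> T \<subseteq> U"
  using diagonal_classes_subset_iff[OF class_hull_closed, of T U] diagonal_classes_hull[of T] by simp

lemma diagonal_classes_gen:
  assumes "p \<in> Xpow X a" "q \<in> Xpow X a"
  shows "diagonal_classes (gen a p q) = (if p = q then {symbol_class a p} else {})"
proof -
  have "diagonal_classes (gen a p q) \<subseteq> T \<longleftrightarrow> (if p = q then {symbol_class a p} else {}) \<subseteq> T" for T
    using diagonal_classes_subset_iff[OF frt_gen_closed[OF assms]]
      frt_gen_subset_iff[OF assms class_hull_closed] assms by (auto simp: class_hull_iff)
  then show ?thesis by blast
qed

lemma diagonal_classes_sup:
  assumes "\<C> \<subseteq> carrier frtL"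
  shows "diagonal_classes (\<Squnion>\<^bsub>frtL\<^esub> \<C>) = \<Union>(diagonal_classes ` \<C>)"
proof -
  interpret L: complete_lattice frtL by (rule frtL_complete_lattice)
  have "diagonal_classes (\<Squnion>\<^bsub>frtL\<^esub> \<C>) \<subseteq> T \<longleftrightarrow> \<Union>(diagonal_classes ` \<C>) \<subseteq> T" for T
  proof -
    have "diagonal_classes (\<Squnion>\<^bsub>frtL\<^esub> \<C>) \<subseteq> T \<longleftrightarrow> (\<forall>C\<in>\<C>. C \<subseteq> class_hull T)"
      using diagonal_classes_subset_iff[OF L.sup_closed[OF assms]]
        L.sup_le_iff[OF assms class_hull_closed] by simp
    also have "\<dots> \<longleftrightarrow> (\<forall>C\<in>\<C>. diagonal_classes C \<subseteq> T)"
      using assms diagonal_classes_subset_iff by blast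
    finally show ?thesis by blast
  qed
  then show ?thesis by blast
qed

lemma counit_kernel_frt: "counit_kernel frtH = class_hull {}"
proof -
  interpret L: complete_lattice frtL by (rule frtL_complete_lattice)
  have iff: "counit frtH C = {} \<longleftrightarrow> C \<subseteq> class_hull {}" if "C \<in> carrier frtL" for C
    unfolding frtH_fields counit_empty_iff diagonal_classes_subset_iff[OF that, symmetric]
      diagonal_classes_def by blast
  have "counit_kernel frtH = \<Squnion>\<^bsub>frtL\<^esub> {h \<in> carrier frtL. h \<subseteq> class_hull {}}"
  proof -
    have "{h \<in> carrier frtH. counit frtH h = {}} = {h \<in> carrier frtL. h \<subseteq> class_hull {}}"
      using iff by auto
    then show ?thesis unfolding counit_kernel_def
      by (simp only:) (rule sup_cong, simp_all)
  qed
  also have "\<dots> = class_hull {}"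
  proof (rule L.le_antisym)
    show "\<Squnion>\<^bsub>frtL\<^esub> {h \<in> carrier frtL. h \<subseteq> class_hull {}} \<sqsubseteq>\<^bsub>frtL\<^esub> class_hull {}"
      by (subst L.sup_le_iff) (auto simp: class_hull_closed)
    show "class_hull {} \<sqsubseteq>\<^bsub>frtL\<^esub> \<Squnion>\<^bsub>frtL\<^esub> {h \<in> carrier frtL. h \<subseteq> class_hull {}}"
      by (rule L.sup_upper) (auto simp: class_hull_closed)
  qed (auto simp: class_hull_closed)
  finally show ?thesis .
qed

definition diagonal_symbol :: "'x word \<Rightarrow> 'x frt_symbol"
  where "diagonal_symbol w = (map (letter_obj \<circ> snd) w, map fst w, map fst w)"

lemma diagonal_symbol_word_of: "p \<in> Xpow X a \<Longrightarrow> diagonal_symbol (word_of a p) = (a, p, p)"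
proof -
  assume p: "p \<in> Xpow X a"
  then have l: "length p = length a" by (simp add: Xpow_def)
  have "map (letter_obj \<circ> snd) (word_of a p) = map letter_obj (map snd (word_of a p))" by simp
  also have "\<dots> = map (letter_obj \<circ> sign_of) a" using l by simp
  also have "\<dots> = a" by (simp add: o_def)
  finally show ?thesis using l by (simp add: diagonal_symbol_def)
qed

text \<open>In an element containing all off-diagonal generators, the relation of a morphism from \<open>p\<close>
  to \<open>q\<close> reduces to an equivalence between the diagonal generators of \<open>p\<close> and of \<open>q\<close>.\<close>

lemma diagonal_symbol_sim:
  assumes K: "K \<in> carrier frtL" "class_hull {} \<subseteq> K" and "(u, v) \<in> word_sim"
  shows "diagonal_symbol u \<in> K \<longleftrightarrow> diagonal_symbol v \<in> K"
  using assms(3)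
proof (rule word_sim_induct)
  fix f u v assume f: "well_typed f" "(u, v) \<in> mor_rel f"
  have "u \<in> typed_words (dom_of f)" "v \<in> typed_words (cod_of f)"
    using mor_rel_typed[OF f(2)] by blast+
  then obtain p q where p: "p \<in> Xpow X (dom_of f)" "u = word_of (dom_of f) p"
    and q: "q \<in> Xpow X (cod_of f)" "v = word_of (cod_of f) q"
    using signed_words_word_of by metis
  have a: "arrow f p q" using p q f by (simp add: arrow_def)
  have t: "p' \<in> Xpow X (dom_of f)" "q' \<in> Xpow X (cod_of f)" if "arrow f p' q'" for p' q'
    using that by (auto simp: arrow_def)
  have off: "(b, s, s') \<in> K" if "s \<in> Xpow X b" "s' \<in> Xpow X b" "s \<noteq> s'" for b s s'
    using K(2) that class_hull_iff by blast
  have "(\<forall>p'. arrow f p p' \<longrightarrow> (cod_of f, p', q) \<in> K) \<longleftrightarrow> (\<forall>q'. arrow f q' q \<longrightarrow> (dom_of f, p, q') \<in> K)"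
    using K(1) f(1) p(1) q(1) unfolding frtL_iff by blast
  moreover have "(\<forall>p'. arrow f p p' \<longrightarrow> (cod_of f, p', q) \<in> K) \<longleftrightarrow> (cod_of f, q, q) \<in> K"
    using a t off[OF _ q(1)] by blast
  moreover have "(\<forall>q'. arrow f q' q \<longrightarrow> (dom_of f, p, q') \<in> K) \<longleftrightarrow> (dom_of f, p, p) \<in> K"
    using a t off[OF p(1)] by blast
  ultimately show "diagonal_symbol u \<in> K \<longleftrightarrow> diagonal_symbol v \<in> K"
    using diagonal_symbol_word_of[OF p(1)] diagonal_symbol_word_of[OF q(1)] p q by simp
qed auto

lemma join_counit_kernel:
  assumes C: "C \<in> carrier frtL"
  shows "C \<squnion>\<^bsub>frtH\<^esub> counit_kernel frtH = class_hull (diagonal_classes C)"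
proof -
  interpret L: complete_lattice frtL by (rule frtL_complete_lattice)
  let ?K = "\<Squnion>\<^bsub>frtL\<^esub> {C, class_hull {}}"
  have s: "{C, class_hull {}} \<subseteq> carrier frtL" using C class_hull_closed by simp
  have le: "?K \<subseteq> Z \<longleftrightarrow> C \<subseteq> Z \<and> class_hull {} \<subseteq> Z" if "Z \<in> carrier frtL" for Z
    using L.sup_le_iff[OF s that] by simp
  have K: "?K \<in> carrier frtL" "C \<subseteq> ?K" "class_hull {} \<subseteq> ?K"
    using L.sup_closed[OF s] le[OF L.sup_closed[OF s]] by simp_all
  have e: "C \<squnion>\<^bsub>frtH\<^esub> counit_kernel frtH = ?K"
    unfolding join_def counit_kernel_frt by (rule sup_cong) simp_all
  have "?K \<subseteq> class_hull (diagonal_classes C)"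
    using le[OF class_hull_closed] diagonal_classes_subset_iff[OF C] by (auto simp: class_hull_def)
  moreover have "(a, p, q) \<in> ?K" if "(a, p, q) \<in> class_hull (diagonal_classes C)" for a p q
  proof (cases "p = q")
    case False
    then show ?thesis using that K(3) by (auto simp: class_hull_iff)
  next
    case True
    have p: "p \<in> Xpow X a" "symbol_class a p \<in> diagonal_classes C"
      using that True by (auto simp: class_hull_iff)
    then obtain b q' where b: "symbol_class a p = symbol_class b q'" "(b, q', q') \<in> C"
      unfolding diagonal_classes_def by blast
    have q': "q' \<in> Xpow X b" using frt_typed[OF C b(2)] by blast
    have "(word_of a p, word_of b q') \<in> word_sim"
      using b(1) word_class_eq_iff_sim p(1) q' by (simp add: symbol_class_def word_of_group_words)
    from diagonal_symbol_sim[OF K(1,3) this] show ?thesis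
      using True b(2) K(2) p(1) q' by (auto simp: diagonal_symbol_word_of)
  qed
  ultimately show ?thesis unfolding e by auto
qed

text \<open>The element of the quotient that corresponds to a set \<open>T\<close> of group elements. The quotient
  is the power set of the universal group through this correspondence; see \<open>carrier_frtQ\<close> and
  \<open>le_frtQ\<close>.\<close>

definition fibre :: "'x word set set set \<Rightarrow> 'x frt_symbol set set"
  where "fibre T = {C \<in> carrier frtL. diagonal_classes C = T}"

lemma remnant_proj_frt:
  assumes "C \<in> carrier frtL"
  shows "quo C = fibre (diagonal_classes C)"
proof -
  have "class_hull (diagonal_classes K) = class_hull (diagonal_classes C) \<longleftrightarrow>
    diagonal_classes K = diagonal_classes C" if "K \<in> carrier frtL" for K
    using diagonal_classes_hull diagonal_classes_closed[OF that] diagonal_classes_closed[OF assms] by metis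
  then show ?thesis
    unfolding remnant_proj_def fibre_def using join_counit_kernel assms by auto
qed

lemma class_hull_fibre: "T \<subseteq> carrier univG \<Longrightarrow> class_hull T \<in> fibre T"
  by (simp add: fibre_def class_hull_closed diagonal_classes_hull)

lemma fibre_inj:
  assumes "T \<subseteq> carrier univG" "fibre T = fibre U" shows "T = U"
  using class_hull_fibre[OF assms(1)] assms unfolding fibre_def by auto

lemma remnant_incl_frt:
  assumes "T \<subseteq> carrier univG"
  shows "remnant_incl frtH (fibre T) = class_hull T"
proof -
  have "(\<lambda>h. h \<squnion>\<^bsub>frtH\<^esub> counit_kernel frtH) ` fibre T = (\<lambda>h. class_hull T) ` fibre T"
    by (rule image_cong[OF HOL.refl]) (auto simp: fibre_def join_counit_kernel)
  then show ?thesis using class_hull_fibre[OF assms] by (simp add: remnant_incl_def image_constant)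
qed

abbreviation "frtQ \<equiv> remnant_lattice frtH"

lemma carrier_frtQ: "carrier frtQ = fibre ` Pow (carrier univG)"
proof
  show "carrier frtQ \<subseteq> fibre ` Pow (carrier univG)"
    using remnant_proj_frt diagonal_classes_closed by (auto simp: remnant_lattice_def)
  show "fibre ` Pow (carrier univG) \<subseteq> carrier frtQ"
  proof
    fix q assume "q \<in> fibre ` Pow (carrier univG)"
    then obtain T where "T \<subseteq> carrier univG" "q = fibre T" by blast
    then have "q = quo (class_hull T)"
      using remnant_proj_frt[OF class_hull_closed] diagonal_classes_hull by simp
    then show "q \<in> carrier frtQ" using class_hull_closed by (auto simp: remnant_lattice_def)
  qed
qed

lemma le_frtQ:
  "T \<subseteq> carrier univG \<Longrightarrow> U \<subseteq> carrier univG \<Longrightarrow> fibre T \<sqsubseteq>\<^bsub>frtQ\<^esub> fibre U \<longleftrightarrow> T \<subseteq> U"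
  by (simp add: remnant_lattice_def remnant_incl_frt class_hull_mono_iff)

lemma frtQ_complete_lattice: "complete_lattice frtQ"
proof -
  have po: "partial_order frtQ"
  proof unfold_locales
    fix p q s assume "p \<in> carrier frtQ" "q \<in> carrier frtQ" "s \<in> carrier frtQ"
      "p \<sqsubseteq>\<^bsub>frtQ\<^esub> q" "q \<sqsubseteq>\<^bsub>frtQ\<^esub> s"
    then show "p \<sqsubseteq>\<^bsub>frtQ\<^esub> s" by (auto simp: carrier_frtQ le_frtQ)
  next
    fix p q assume "p \<in> carrier frtQ" "q \<in> carrier frtQ" "p \<sqsubseteq>\<^bsub>frtQ\<^esub> q" "q \<sqsubseteq>\<^bsub>frtQ\<^esub> p"
    then show "p .=\<^bsub>frtQ\<^esub> q" by (auto simp: carrier_frtQ le_frtQ remnant_lattice_def[of frtH, THEN arg_cong[of _ _ eq]])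
  qed (auto simp: remnant_lattice_def)
  show ?thesis
  proof (rule partial_order.complete_lattice_criterion1[OF po])
    show "\<exists>g. greatest frtQ g (carrier frtQ)"
      by (rule exI[of _ "fibre (carrier univG)"]) (auto simp: greatest_def carrier_frtQ le_frtQ)
  next
    fix A assume A: "A \<subseteq> carrier frtQ" "A \<noteq> {}"
    define \<T> where "\<T> = {T. T \<subseteq> carrier univG \<and> fibre T \<in> A}"
    have A_eq: "A = fibre ` \<T>" and ne: "\<T> \<noteq> {}" and sub: "\<And>T. T \<in> \<T> \<Longrightarrow> T \<subseteq> carrier univG"
      using A by (auto simp: \<T>_def carrier_frtQ)
    have I: "\<Inter>\<T> \<subseteq> carrier univG" using ne sub by blast
    have low: "fibre U \<in> Lower frtQ A \<longleftrightarrow> U \<subseteq> \<Inter>\<T>" if U: "U \<subseteq> carrier univG" for U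
    proof -
      have "fibre U \<in> Lower frtQ A \<longleftrightarrow> (\<forall>T\<in>\<T>. fibre U \<sqsubseteq>\<^bsub>frtQ\<^esub> fibre T)"
      proof -
        have "A \<inter> carrier frtQ = fibre ` \<T>" using A(1) A_eq by blast
        moreover have "fibre U \<in> carrier frtQ" using U carrier_frtQ by blast
        ultimately have "fibre U \<in> Lower frtQ A \<longleftrightarrow> (\<forall>x. x \<in> fibre ` \<T> \<longrightarrow> fibre U \<sqsubseteq>\<^bsub>frtQ\<^esub> x)"
          by (simp only: Lower_def) simp
        then show ?thesis by blast
      qed
      also have "\<dots> \<longleftrightarrow> (\<forall>T\<in>\<T>. U \<subseteq> T)" using le_frtQ[OF U sub] by blast
      finally show ?thesis by blast
    qed
    have "y \<sqsubseteq>\<^bsub>frtQ\<^esub> fibre (\<Inter>\<T>)" if y: "y \<in> Lower frtQ A" for y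
    proof -
      obtain U where U: "U \<subseteq> carrier univG" "y = fibre U"
        using y by (auto simp: Lower_def carrier_frtQ)
      then show ?thesis using low[OF U(1)] le_frtQ[OF U(1) I] y by simp
    qed
    then have "greatest frtQ (fibre (\<Inter>\<T>)) (Lower frtQ A)"
      unfolding greatest_def using low[OF I] by (auto simp: Lower_def)
    then show "\<exists>i. greatest frtQ i (Lower frtQ A)" ..
  qed
qed

lemma sup_frtQ:
  assumes "\<And>T. T \<in> \<T> \<Longrightarrow> T \<subseteq> carrier univG"
  shows "\<Squnion>\<^bsub>frtQ\<^esub> (fibre ` \<T>) = fibre (\<Union>\<T>)"
proof -
  interpret Q: complete_lattice frtQ by (rule frtQ_complete_lattice)
  have im: "fibre ` \<T> \<subseteq> carrier frtQ" using assms by (auto simp: carrier_frtQ)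
  obtain U where U: "U \<subseteq> carrier univG" "\<Squnion>\<^bsub>frtQ\<^esub> (fibre ` \<T>) = fibre U"
    using Q.sup_closed[OF im] by (auto simp: carrier_frtQ)
  have "U \<subseteq> V \<longleftrightarrow> \<Union>\<T> \<subseteq> V" if V: "V \<subseteq> carrier univG" for V
  proof -
    have "fibre U \<sqsubseteq>\<^bsub>frtQ\<^esub> fibre V \<longleftrightarrow> (\<forall>T\<in>\<T>. fibre T \<sqsubseteq>\<^bsub>frtQ\<^esub> fibre V)"
      using Q.sup_le_iff[OF im, of "fibre V"] V U by (simp add: carrier_frtQ)
    then show ?thesis using le_frtQ U V assms by auto
  qed
  from this[of U] this[of "\<Union>\<T>"] have "U = \<Union>\<T>" using U(1) assms by blast
  then show ?thesis using U by simp
qed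

lemma remnant_proj_sup_morphism: "sup_morphism frtL frtQ (quo)"
  unfolding sup_morphism_def
proof (intro conjI allI impI)
  interpret L: complete_lattice frtL by (rule frtL_complete_lattice)
  show "quo \<in> carrier frtL \<rightarrow> carrier frtQ"
    by (auto simp: remnant_lattice_def)
  fix \<C> assume C: "\<C> \<subseteq> carrier frtL"
  have "quo ` \<C> = fibre ` diagonal_classes ` \<C>"
    unfolding image_image by (rule image_cong[OF HOL.refl]) (use C remnant_proj_frt in blast)
  moreover have "\<Squnion>\<^bsub>frtQ\<^esub> (fibre ` diagonal_classes ` \<C>) = fibre (\<Union>(diagonal_classes ` \<C>))"
    by (rule sup_frtQ) (use C diagonal_classes_closed in blast)
  ultimately show "quo (\<Squnion>\<^bsub>frtL\<^esub> \<C>) = \<Squnion>\<^bsub>frtQ\<^esub> (quo ` \<C>)"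
    using remnant_proj_frt[OF L.sup_closed[OF C]] diagonal_classes_sup[OF C] by simp
qed

lemma bottom_frtQ: "\<bottom>\<^bsub>frtQ\<^esub> = fibre {}"
proof -
  interpret Q: complete_lattice frtQ by (rule frtQ_complete_lattice)
  show ?thesis using sup_frtQ[of "{}"] Q.weak_sup_empty by (simp add: remnant_lattice_def)
qed

lemma remnant_proj_gen:
  "p \<in> Xpow X a \<Longrightarrow> q \<in> Xpow X a \<Longrightarrow>
    quo (gen a p q) = fibre (if p = q then {symbol_class a p} else {})"
  by (simp add: remnant_proj_frt frt_gen_closed diagonal_classes_gen)

section \<open>The remnant\<close>

abbreviation "frtR \<equiv> remnant_hopf frtH"
abbreviation "frtQQ \<equiv> tensor frtQ frtQ"

text \<open>The inverse of \<open>fibre\<close>.\<close>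

definition fibre_label :: "'x frt_symbol set set \<Rightarrow> 'x word set set set"
  where "fibre_label q = diagonal_classes (remnant_incl frtH q)"

lemma fibre_label_fibre [simp]: "T \<subseteq> carrier univG \<Longrightarrow> fibre_label (fibre T) = T"
  by (simp add: fibre_label_def remnant_incl_frt diagonal_classes_hull)

lemma fibre_label_sup:
  assumes "A \<subseteq> carrier frtQ"
  shows "fibre_label (\<Squnion>\<^bsub>frtQ\<^esub> A) = \<Union>(fibre_label ` A)"
proof -
  define \<T> where "\<T> = fibre_label ` A"
  have A: "\<exists>T. T \<subseteq> carrier univG \<and> q = fibre T" if "q \<in> A" for q
    using that assms unfolding carrier_frtQ by blast
  have sub: "T \<subseteq> carrier univG" if "T \<in> \<T>" for T
    using that A unfolding \<T>_def by force
  have "fibre (fibre_label q) = q" if "q \<in> A" for q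
    using A[OF that] by auto
  then have "A = fibre ` \<T>" unfolding \<T>_def image_image by simp
  then have "\<Squnion>\<^bsub>frtQ\<^esub> A = fibre (\<Union>\<T>)" using sup_frtQ[OF sub] by simp
  moreover have "\<Union>\<T> \<subseteq> carrier univG" using sub by blast
  ultimately show ?thesis by (simp add: \<T>_def)
qed

text \<open>Enough elements of \<open>Q \<otimes> Q\<close> to tell the relevant elements apart: under \<open>Q \<otimes> Q \<cong> P(G \<times> G)\<close>
  these are all relations on the group.\<close>

definition label_relation :: "('x word set set \<Rightarrow> 'x word set set \<Rightarrow> bool) \<Rightarrow> ('x frt_symbol set set \<times> 'x frt_symbol set set) set"
  where "label_relation K = {(x, y). x \<in> carrier frtQ \<and> y \<in> carrier frtQ \<and>
    (\<forall>g\<in>fibre_label x. \<forall>h\<in>fibre_label y. K g h)}"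

lemma label_relation_closed: "label_relation K \<in> carrier frtQQ"
  unfolding label_relation_def
proof (rule tensor_Collect[OF frtQ_complete_lattice frtQ_complete_lattice])
  fix q
  show "join_stable frtQ (\<lambda>x. \<forall>g\<in>fibre_label x. \<forall>h\<in>fibre_label q. K g h)"
    unfolding join_stable_def by (auto simp: fibre_label_sup)
  show "join_stable frtQ (\<lambda>y. \<forall>g\<in>fibre_label q. \<forall>h\<in>fibre_label y. K g h)"
    unfolding join_stable_def by (auto simp: fibre_label_sup)
qed

lemma label_relation_fibre:
  "T \<subseteq> carrier univG \<Longrightarrow> U \<subseteq> carrier univG \<Longrightarrow>
    (fibre T, fibre U) \<in> label_relation K \<longleftrightarrow> (\<forall>g\<in>T. \<forall>h\<in>U. K g h)"
  by (auto simp: label_relation_def carrier_frtQ)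

lemma fibre_closed [simp]: "T \<subseteq> carrier univG \<Longrightarrow> fibre T \<in> carrier frtQ"
  by (auto simp: carrier_frtQ)

lemma pure_frtQ_subset_iff:
  "x \<in> carrier frtQ \<Longrightarrow> y \<in> carrier frtQ \<Longrightarrow> Z \<in> carrier frtQQ \<Longrightarrow>
    pure_tensor frtQ frtQ x y \<subseteq> Z \<longleftrightarrow> (x, y) \<in> Z"
  by (rule pure_tensor_subset_iff[OF frtQ_complete_lattice frtQ_complete_lattice])

lemma pure_frtQ_closed:
  "x \<in> carrier frtQ \<Longrightarrow> y \<in> carrier frtQ \<Longrightarrow> pure_tensor frtQ frtQ x y \<in> carrier frtQQ"
  by (rule pure_tensor_closed[OF frtQ_complete_lattice frtQ_complete_lattice])

lemma pure_singleton_inj: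
  assumes "g \<in> carrier univG" "h \<in> carrier univG" "g' \<in> carrier univG" "h' \<in> carrier univG"
    "pure_tensor frtQ frtQ (fibre {g}) (fibre {h}) = pure_tensor frtQ frtQ (fibre {g'}) (fibre {h'})"
  shows "g = g' \<and> h = h'"
proof -
  let ?Z = "label_relation (\<lambda>a b. a = g' \<and> b = h')"
  have "pure_tensor frtQ frtQ (fibre {g'}) (fibre {h'}) \<subseteq> ?Z"
    using assms by (simp add: pure_frtQ_subset_iff label_relation_closed label_relation_fibre)
  then have "pure_tensor frtQ frtQ (fibre {g}) (fibre {h}) \<subseteq> ?Z" using assms(5) by simp
  then show ?thesis
    using assms(1-4) by (simp add: pure_frtQ_subset_iff label_relation_closed label_relation_fibre)
qed

lemma remnant_proj_closed: "C \<in> carrier frtL \<Longrightarrow> quo C \<in> carrier frtQ"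
  using remnant_proj_sup_morphism by (auto simp: sup_morphism_def)

lemma tensor_frtQ_bottom:
  assumes "Z \<in> carrier frtQQ" "x \<in> carrier frtQ"
  shows "(fibre {}, x) \<in> Z" "(x, fibre {}) \<in> Z"
proof -
  have e: "\<Squnion>\<^bsub>frtQ\<^esub> {} = fibre {}" using sup_frtQ[of "{}"] by simp
  show "(fibre {}, x) \<in> Z"
    using join_stableD[of frtQ "\<lambda>l. (l, x) \<in> Z" "{}"] assms e by (simp add: tensor_iff)
  show "(x, fibre {}) \<in> Z"
    using join_stableD[of frtQ "\<lambda>l. (x, l) \<in> Z" "{}"] assms e by (simp add: tensor_iff)
qed

lemma proj_pair_bistable:
  assumes "Z \<in> carrier frtQQ"
  shows "bistable (\<lambda>x y. (quo x, quo y) \<in> Z)"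
  unfolding bistable_def
proof (intro conjI ballI)
  fix x assume "x \<in> carrier frtL"
  then have q: "quo x \<in> carrier frtQ" by (rule remnant_proj_closed)
  show "join_stable frtL (\<lambda>y. (quo x, quo y) \<in> Z)"
    using assms q by (intro join_stable_morphism[OF remnant_proj_sup_morphism, of "\<lambda>y. (quo x, y) \<in> Z"])
      (simp add: tensor_iff)
  show "join_stable frtL (\<lambda>y. (quo y, quo x) \<in> Z)"
    using assms q by (intro join_stable_morphism[OF remnant_proj_sup_morphism, of "\<lambda>y. (y, quo x) \<in> Z"])
      (simp add: tensor_iff)
qed

lemma proj_gen_pair:
  assumes "Z \<in> carrier frtQQ" "p \<in> Xpow X a" "q \<in> Xpow X a" "p' \<in> Xpow X b" "q' \<in> Xpow X b"
  shows "(quo (gen a p q), quo (gen b p' q')) \<in> Z \<longleftrightarrow>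
    (p = q \<and> p' = q' \<longrightarrow> (fibre {symbol_class a p}, fibre {symbol_class b p'}) \<in> Z)"
  using assms by (simp add: remnant_proj_gen tensor_frtQ_bottom symbol_class_closed)

lemma frtR_fields [simp]: "carrier frtR = carrier frtQ" "le frtR = le frtQ"
  by (simp_all add: remnant_hopf_def)

lemma frtR_tensor: "tensor frtR frtR = frtQQ" "pure_tensor frtR frtR = pure_tensor frtQ frtQ"
  "tensor_map frtR frtR = tensor_map frtQ frtQ" "\<bottom>\<^bsub>frtR\<^esub> = fibre {}"
  using tensor_cong[of frtR frtQ frtR frtQ] tensor_map_cong[of frtR frtQ frtR frtQ]
    bottom_cong[of frtR frtQ] bottom_frtQ by simp_all

text \<open>On the quotient the comultiplication duplicates group elements, because in \<open>\<Delta>([p, p])\<close>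
  only the term with middle index \<open>p\<close> is a tensor of two diagonal generators.\<close>

lemma comult_frtR:
  assumes T: "T \<subseteq> carrier univG"
  shows "comult frtR (fibre T) \<in> carrier frtQQ"
    and "Z \<in> carrier frtQQ \<Longrightarrow> comult frtR (fibre T) \<subseteq> Z \<longleftrightarrow> (\<forall>g\<in>T. (fibre {g}, fibre {g}) \<in> Z)"
proof -
  let ?D = "comul (class_hull T)"
  have e: "comult frtR (fibre T) = tensor_map frtQ frtQ (quo) (quo) ?D"
    by (simp add: remnant_hopf_def remnant_incl_frt T)
  have cl: "quo x \<in> carrier frtQ \<and> quo y \<in> carrier frtQ" if "(x, y) \<in> ?D" for x y
    using comult_members[OF class_hull_closed that] remnant_proj_closed by blast
  show "comult frtR (fibre T) \<in> carrier frtQQ"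
    unfolding e by (rule tensor_map_closed[OF frtQ_complete_lattice frtQ_complete_lattice cl])
  assume Z: "Z \<in> carrier frtQQ"
  have "comult frtR (fibre T) \<subseteq> Z \<longleftrightarrow> (\<forall>(x, y)\<in>?D. (quo x, quo y) \<in> Z)"
    unfolding e by (rule tensor_map_subset_iff[OF frtQ_complete_lattice frtQ_complete_lattice cl Z])
  also have "\<dots> \<longleftrightarrow> (\<forall>(a, p, q)\<in>class_hull T. \<forall>l\<in>Xpow X a.
    (quo (gen a p l), quo (gen a l q)) \<in> Z)"
    by (rule sweedler_symbols[OF proj_pair_bistable[OF Z] class_hull_closed])
  also have "\<dots> \<longleftrightarrow> (\<forall>(a, p, q)\<in>class_hull T. \<forall>l\<in>Xpow X a.
    p = l \<and> l = q \<longrightarrow> (fibre {symbol_class a p}, fibre {symbol_class a l}) \<in> Z)"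
    by (intro ball_triple_cong ball_cong[OF HOL.refl] proj_gen_pair[OF Z]) (simp_all add: class_hull_iff)
  also have "\<dots> \<longleftrightarrow> (\<forall>a p. p \<in> Xpow X a \<longrightarrow> symbol_class a p \<in> T \<longrightarrow>
    (fibre {symbol_class a p}, fibre {symbol_class a p}) \<in> Z)"
    using class_hull_iff by blast
  also have "\<dots> \<longleftrightarrow> (\<forall>g\<in>T. (fibre {g}, fibre {g}) \<in> Z)"
    (is "?L \<longleftrightarrow> ?R")
  proof
    assume L: ?L
    show ?R
    proof
      fix g assume g: "g \<in> T"
      then obtain a p where "p \<in> Xpow X a" "g = symbol_class a p" using T symbol_class_surj by blast
      then show "(fibre {g}, fibre {g}) \<in> Z" using L g by blast
    qed
  qed blast
  finally show "comult frtR (fibre T) \<subseteq> Z \<longleftrightarrow> (\<forall>g\<in>T. (fibre {g}, fibre {g}) \<in> Z)" .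
qed

text \<open>If \<open>T\<close> is group-like, then \<open>T \<times> T\<close> is contained in the diagonal, so that \<open>T\<close> has at most
  one element.\<close>

lemma grouplike_iff:
  assumes T: "T \<subseteq> carrier univG"
  shows "fibre T \<noteq> fibre {} \<and> comult frtR (fibre T) = pure_tensor frtQ frtQ (fibre T) (fibre T) \<longleftrightarrow>
    (\<exists>g\<in>carrier univG. T = {g})"
proof
  assume L: "fibre T \<noteq> fibre {} \<and> comult frtR (fibre T) = pure_tensor frtQ frtQ (fibre T) (fibre T)"
  have "comult frtR (fibre T) \<subseteq> label_relation (=)"
    using T by (subst comult_frtR(2)[OF T label_relation_closed]) (auto simp: label_relation_fibre subset_iff)
  then have "(fibre T, fibre T) \<in> label_relation (=)"
    using L T by (simp add: pure_frtQ_subset_iff label_relation_closed)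
  then have "\<forall>g\<in>T. \<forall>h\<in>T. g = h" using T by (simp add: label_relation_fibre)
  moreover have "T \<noteq> {}" using L by blast
  ultimately obtain g where "T = {g}" by blast
  then show "\<exists>g\<in>carrier univG. T = {g}" using T by blast
next
  assume "\<exists>g\<in>carrier univG. T = {g}"
  then obtain g where g: "g \<in> carrier univG" "T = {g}" by blast
  have "comult frtR (fibre T) \<subseteq> Z \<longleftrightarrow> pure_tensor frtQ frtQ (fibre T) (fibre T) \<subseteq> Z"
    if "Z \<in> carrier frtQQ" for Z
    using comult_frtR(2)[OF T that] T g pure_frtQ_subset_iff that by simp
  then have "comult frtR (fibre T) = pure_tensor frtQ frtQ (fibre T) (fibre T)"
    using comult_frtR(1)[OF T] pure_frtQ_closed[of "fibre T" "fibre T"] T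
    by (intro subset_antisym_Galois[where K="carrier frtQQ"]) simp_all
  moreover have "fibre T \<noteq> fibre {}" using fibre_inj[OF T] g by blast
  ultimately show "fibre T \<noteq> fibre {} \<and> comult frtR (fibre T) = pure_tensor frtQ frtQ (fibre T) (fibre T)"
    by blast
qed

abbreviation "frtRem \<equiv> remnant frtH"

lemma carrier_remnant: "carrier frtRem = (\<lambda>g. fibre {g}) ` carrier univG"
proof -
  have "carrier frtRem = {q \<in> carrier frtQ. q \<noteq> fibre {} \<and> comult frtR q = pure_tensor frtQ frtQ q q}"
    by (simp add: remnant_def Let_def frtR_tensor)
  also have "\<dots> = fibre ` {T. T \<subseteq> carrier univG \<and> fibre T \<noteq> fibre {} \<and>
      comult frtR (fibre T) = pure_tensor frtQ frtQ (fibre T) (fibre T)}"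
    unfolding carrier_frtQ by blast
  also have "{T. T \<subseteq> carrier univG \<and> fibre T \<noteq> fibre {} \<and>
      comult frtR (fibre T) = pure_tensor frtQ frtQ (fibre T) (fibre T)} = (\<lambda>g. {g}) ` carrier univG"
  proof (rule Set.set_eqI)
    fix T
    have "T \<subseteq> carrier univG \<and> fibre T \<noteq> fibre {} \<and>
        comult frtR (fibre T) = pure_tensor frtQ frtQ (fibre T) (fibre T) \<longleftrightarrow>
      T \<subseteq> carrier univG \<and> (\<exists>g\<in>carrier univG. T = {g})"
      by (rule conj_cong[OF HOL.refl grouplike_iff])
    then show "T \<in> {T. T \<subseteq> carrier univG \<and> fibre T \<noteq> fibre {} \<and>
        comult frtR (fibre T) = pure_tensor frtQ frtQ (fibre T) (fibre T)} \<longleftrightarrow>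
      T \<in> (\<lambda>g. {g}) ` carrier univG" unfolding mem_Collect_eq by (simp only:) auto
  qed
  finally show ?thesis by (simp add: image_image)
qed

lemma remnant_one: "\<one>\<^bsub>frtRem\<^esub> = fibre {\<one>\<^bsub>univG\<^esub>}"
proof -
  have "[] \<in> Xpow X []" by (simp add: Xpow_def)
  then show ?thesis
    by (simp add: remnant_def Let_def remnant_hopf_def remnant_proj_gen symbol_class_def word_class_one)
qed

lemma diagonal_classes_join_ext:
  assumes "\<And>s. s \<in> C \<Longrightarrow> f s \<in> carrier frtL"
  shows "diagonal_classes (join_ext frtL f C) = (\<Union>s\<in>C. diagonal_classes (f s))"
    and "join_ext frtL f C \<in> carrier frtL"
proof -
  interpret L: complete_lattice frtL by (rule frtL_complete_lattice)
  have "f ` C \<subseteq> carrier frtL" using assms by blast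
  then show "diagonal_classes (join_ext frtL f C) = (\<Union>s\<in>C. diagonal_classes (f s))"
    "join_ext frtL f C \<in> carrier frtL"
    unfolding join_ext_def using diagonal_classes_sup L.sup_closed by simp_all
qed

lemma symbol_class_append:
  assumes "p \<in> Xpow X a" "q \<in> Xpow X b"
  shows "symbol_class (a @ b) (p @ q) = symbol_class a p \<otimes>\<^bsub>univG\<^esub> symbol_class b q"
  using assms word_of_append[of p a b q] unfolding symbol_class_def
  by (simp add: word_class_mult word_of_group_words Xpow_def[of X a])

text \<open>A concatenation of two generators is diagonal exactly if both generators are, since their
  indices have equal lengths.\<close>

lemma remnant_mult:
  assumes "g \<in> carrier univG" "h \<in> carrier univG"
  shows "fibre {g} \<otimes>\<^bsub>frtRem\<^esub> fibre {h} = fibre {g \<otimes>\<^bsub>univG\<^esub> h}"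
proof -
  let ?A = "class_hull {g}" and ?B = "class_hull {h}"
  let ?gen = "\<lambda>s t. gen (fst s @ fst t) (fst (snd s) @ fst (snd t)) (snd (snd s) @ snd (snd t))"
  have typed: "fst (snd s) \<in> Xpow X (fst s) \<and> snd (snd s) \<in> Xpow X (fst s)" if "s \<in> class_hull T" for s T
    using that by (cases s) (auto simp: class_hull_iff)
  have app: "p @ q \<in> Xpow X (a @ b)" if "p \<in> Xpow X a" "q \<in> Xpow X b" for p q a b
    using that by (auto simp: Xpow_def)
  have gen: "?gen s t \<in> carrier frtL" if "s \<in> ?A" "t \<in> ?B" for s t
    using typed[OF that(1)] typed[OF that(2)] by (intro frt_gen_closed app) auto
  have inner: "join_ext frtL (?gen s) ?B \<in> carrier frtL"
    "diagonal_classes (join_ext frtL (?gen s) ?B) = (\<Union>t\<in>?B. diagonal_classes (?gen s t))" if "s \<in> ?A" for s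
    using diagonal_classes_join_ext[of ?B "?gen s"] gen that by simp_all
  have m: "hmult (frt_bialgebra X r) ?A ?B = join_ext frtL (\<lambda>s. join_ext frtL (?gen s) ?B) ?A"
    by (simp add: frt_bialgebra_def Let_def case_prod_unfold)
  have "diagonal_classes (hmult (frt_bialgebra X r) ?A ?B) = (\<Union>s\<in>?A. \<Union>t\<in>?B. diagonal_classes (?gen s t))"
    unfolding m using diagonal_classes_join_ext(1)[of ?A "\<lambda>s. join_ext frtL (?gen s) ?B"] inner by simp
  also have "\<dots> = {g \<otimes>\<^bsub>univG\<^esub> h}"
  proof -
    have val: "diagonal_classes (?gen s t) = (if fst (snd s) = snd (snd s) \<and> fst (snd t) = snd (snd t)
        then {g \<otimes>\<^bsub>univG\<^esub> h} else {})" if st: "s \<in> ?A" "t \<in> ?B" for s t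
    proof -
      obtain a p q where s: "s = (a, p, q)" by (rule prod_cases3)
      obtain b p' q' where t: "t = (b, p', q')" by (rule prod_cases3)
      have ty: "p \<in> Xpow X a" "q \<in> Xpow X a" "p' \<in> Xpow X b" "q' \<in> Xpow X b"
        using typed[OF st(1)] typed[OF st(2)] s t by simp_all
      have "p @ p' = q @ q' \<longleftrightarrow> p = q \<and> p' = q'" using ty by (simp add: Xpow_def)
      moreover have "p = q \<longrightarrow> symbol_class a p = g" "p' = q' \<longrightarrow> symbol_class b p' = h"
        using st s t by (simp_all add: class_hull_iff)
      ultimately show ?thesis
        using diagonal_classes_gen[OF app[OF ty(1,3)] app[OF ty(2,4)]] symbol_class_append[OF ty(2,4)]
        by (auto simp: s t)
    qed
    obtain a p where a: "p \<in> Xpow X a" "g = symbol_class a p" using symbol_class_surj assms(1) by blast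
    obtain b q where b: "q \<in> Xpow X b" "h = symbol_class b q" using symbol_class_surj assms(2) by blast
    have wit: "(a, p, p) \<in> ?A" "(b, q, q) \<in> ?B" using a b by (simp_all add: class_hull_iff)
    have "diagonal_classes (?gen (a, p, p) (b, q, q)) = {g \<otimes>\<^bsub>univG\<^esub> h}" using val[OF wit] by simp
    then have "{g \<otimes>\<^bsub>univG\<^esub> h} \<subseteq> (\<Union>s\<in>?A. \<Union>t\<in>?B. diagonal_classes (?gen s t))" using wit by blast
    moreover have "diagonal_classes (?gen s t) \<subseteq> {g \<otimes>\<^bsub>univG\<^esub> h}" if "s \<in> ?A" "t \<in> ?B" for s t
      using val[OF that] by simp
    ultimately show ?thesis by blast
  qed
  finally have d: "diagonal_classes (hmult (frt_bialgebra X r) ?A ?B) = {g \<otimes>\<^bsub>univG\<^esub> h}" .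
  have c: "hmult (frt_bialgebra X r) ?A ?B \<in> carrier frtL"
    unfolding m by (rule diagonal_classes_join_ext(2)) (rule inner(1))
  have "fibre {g} \<otimes>\<^bsub>frtRem\<^esub> fibre {h} = quo (hmult (frt_bialgebra X r) ?A ?B)"
    using assms by (simp add: remnant_def Let_def remnant_hopf_def remnant_incl_frt)
  then show ?thesis using remnant_proj_frt[OF c] d by simp
qed

section \<open>The induced braiding operator\<close>

lemma frtH_tensor: "tensor frtH frtH = frtLL" "pure_tensor frtH frtH = pure_tensor frtL frtL"
  using tensor_cong[of frtH frtL frtH frtL] by simp_all

lemma act_subset_iff:
  assumes "x \<in> carrier frtL" "y \<in> carrier frtL" "W \<in> carrier frtLL"
  shows "act frtLL s (pure_tensor frtL frtL x y) \<subseteq> W \<longleftrightarrow> s = {} \<or> (x, y) \<in> W"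
proof -
  interpret T: complete_lattice frtLL
    by (rule tensor_complete_lattice[OF frtL_complete_lattice frtL_complete_lattice])
  have "\<bottom>\<^bsub>frtLL\<^esub> \<subseteq> W" using T.bottom_lower[OF assms(3)] by simp
  then show ?thesis
    using pure_tensor_subset_iff[OF frtL_complete_lattice frtL_complete_lattice assms] by (simp add: act_def)
qed

lemma sweedler3_members:
  assumes "C \<in> carrier frtL" "(x, y, z) \<in> sweedler3 frtH C"
  shows "x \<in> carrier frtL" "y \<in> carrier frtL" "z \<in> carrier frtL"
proof -
  obtain v where v: "(v, z) \<in> comul C" "(x, y) \<in> comul v"
    using assms(2) by (auto simp: sweedler3_def)
  show "x \<in> carrier frtL" "y \<in> carrier frtL" "z \<in> carrier frtL"
    using comult_members[OF assms(1) v(1)] comult_members[OF _ v(2)] by blast+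
qed

lemma Gamma_subset_iff:
  assumes AB: "A \<in> carrier frtL" "B \<in> carrier frtL"
  shows "Gamma frtH R A B \<in> carrier frtLL"
    and "W \<in> carrier frtLL \<Longrightarrow> Gamma frtH R A B \<subseteq> W \<longleftrightarrow>
      (\<forall>(a1, a2, a3)\<in>sweedler3 frtH A. \<forall>(b1, b2, b3)\<in>sweedler3 frtH B.
        R a1 b1 = {} \<or> convolution_inverse frtH R a3 b3 = {} \<or> (b2, a2) \<in> W)"
proof -
  interpret T: complete_lattice frtLL
    by (rule tensor_complete_lattice[OF frtL_complete_lattice frtL_complete_lattice])
  let ?S = "{act frtLL (R a1 b1 \<inter> convolution_inverse frtH R a3 b3) (pure_tensor frtL frtL b2 a2)
      | a1 a2 a3 b1 b2 b3. (a1, a2, a3) \<in> sweedler3 frtH A \<and> (b1, b2, b3) \<in> sweedler3 frtH B}"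
  have e: "Gamma frtH R A B = \<Squnion>\<^bsub>frtLL\<^esub> ?S" by (simp add: Gamma_def frtH_tensor)
  have S: "?S \<subseteq> carrier frtLL"
    using sweedler3_members[OF AB(1)] sweedler3_members[OF AB(2)]
      pure_tensor_closed[OF frtL_complete_lattice frtL_complete_lattice] by (auto simp: act_def)
  show "Gamma frtH R A B \<in> carrier frtLL" unfolding e by (rule T.sup_closed[OF S])
  assume W: "W \<in> carrier frtLL"
  have inter: "s \<inter> t = {} \<longleftrightarrow> s = {} \<or> t = {}" for s t :: "unit set" by auto
  have "Gamma frtH R A B \<subseteq> W \<longleftrightarrow> (\<forall>K\<in>?S. K \<subseteq> W)"
    unfolding e using T.sup_le_iff[OF S W] by simp
  also have "\<dots> \<longleftrightarrow> (\<forall>a1 a2 a3 b1 b2 b3. (a1, a2, a3) \<in> sweedler3 frtH A \<longrightarrow> (b1, b2, b3) \<in> sweedler3 frtH B \<longrightarrow>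
    act frtLL (R a1 b1 \<inter> convolution_inverse frtH R a3 b3) (pure_tensor frtL frtL b2 a2) \<subseteq> W)"
    by blast
  also have "\<dots> \<longleftrightarrow> (\<forall>a1 a2 a3 b1 b2 b3. (a1, a2, a3) \<in> sweedler3 frtH A \<longrightarrow> (b1, b2, b3) \<in> sweedler3 frtH B \<longrightarrow>
    R a1 b1 = {} \<or> convolution_inverse frtH R a3 b3 = {} \<or> (b2, a2) \<in> W)"
    using act_subset_iff[OF sweedler3_members(2)[OF AB(2)] sweedler3_members(2)[OF AB(1)] W]
    by (simp add: inter cong: imp_cong)
  finally show "Gamma frtH R A B \<subseteq> W \<longleftrightarrow>
      (\<forall>(a1, a2, a3)\<in>sweedler3 frtH A. \<forall>(b1, b2, b3)\<in>sweedler3 frtH B.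
        R a1 b1 = {} \<or> convolution_inverse frtH R a3 b3 = {} \<or> (b2, a2) \<in> W)" by (simp only:) blast
qed

lemma symbol_braid_class:
  assumes "symbol_braid a b p p' l' l"
  shows "class_braid (symbol_class a p, symbol_class b p') = (symbol_class b l', symbol_class a l)"
  using assms class_braid_word_class word_of_group_words unfolding symbol_braid_def symbol_class_def by blast

text \<open>The expression \<open>\<Gamma>\<close> at the elements \<open>g\<close> and \<open>h\<close>, tested against an arbitrary element \<open>Z\<close>
  above it. On generators \<open>[p, q]\<close> and \<open>[p', q']\<close> the factors from the co-quasitriangular
  structure and its inverse force the pairs \<open>(p, p')\<close> and \<open>(q, q')\<close> to be braided to the inner
  indices \<open>(l', l)\<close> and \<open>(m', m)\<close>. The middle factors \<open>[l', m']\<close> and \<open>[l, m]\<close> vanish in the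
  quotient unless they are diagonal. Then \<open>p = q\<close> and \<open>p' = q'\<close>, and what remains is the pair of
  classes of the braided words.\<close>

lemma Gamma_hull:
  assumes g: "g \<in> carrier univG" and h: "h \<in> carrier univG"
    and Z: "Z \<in> carrier frtQQ"
  shows "(\<forall>(a1, a2, a3)\<in>sweedler3 frtH (class_hull {g}). \<forall>(b1, b2, b3)\<in>sweedler3 frtH (class_hull {h}).
      cqt a1 b1 = {} \<or> convolution_inverse frtH (cqt) a3 b3 = {} \<or>
      (quo b2, quo a2) \<in> Z) \<longleftrightarrow>
    (fibre {fst (class_braid (g, h))}, fibre {snd (class_braid (g, h))}) \<in> Z"
proof -
  let ?A = "class_hull {g}" and ?B = "class_hull {h}"
  let ?R = "cqt" and ?S = "convolution_inverse frtH (cqt)"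
  let ?P = "\<lambda>a1 a2 a3 b1 b2 b3. ?R a1 b1 = {} \<or> ?S a3 b3 = {} \<or> (quo b2, quo a2) \<in> Z"
  let ?gen = "gen"
  have bi: "join_stable frtL (\<lambda>x. ?R x c = {})" "join_stable frtL (\<lambda>x. ?R c x = {})"
    "join_stable frtL (\<lambda>x. ?S x c = {})" "join_stable frtL (\<lambda>x. ?S c x = {})"
    "join_stable frtL (\<lambda>x. (quo x, quo c) \<in> Z)"
    "join_stable frtL (\<lambda>x. (quo c, quo x) \<in> Z)"
    if "c \<in> carrier frtL" for c
    using cqt_bistable convolution_inverse_frt(1) proj_pair_bistable[OF Z] that unfolding bistable_def by blast+
  have stA: "join_stable frtL (\<lambda>x. ?P x a2 a3 b1 b2 b3)" "join_stable frtL (\<lambda>x. ?P a1 x a3 b1 b2 b3)"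
    "join_stable frtL (\<lambda>x. ?P a1 a2 x b1 b2 b3)" "join_stable frtL (\<lambda>x. ?P a1 a2 a3 x b2 b3)"
    "join_stable frtL (\<lambda>x. ?P a1 a2 a3 b1 x b3)" "join_stable frtL (\<lambda>x. ?P a1 a2 a3 b1 b2 x)"
    if "a1 \<in> carrier frtL" "a2 \<in> carrier frtL" "a3 \<in> carrier frtL"
      "b1 \<in> carrier frtL" "b2 \<in> carrier frtL" "b3 \<in> carrier frtL" for a1 a2 a3 b1 b2 b3
    using bi that by (intro join_stable_disj; simp)+
  note memA = sweedler3_members[OF class_hull_closed[of "{g}"]]
  note memB = sweedler3_members[OF class_hull_closed[of "{h}"]]
  have stB: "join_stable frtL (\<lambda>x. \<forall>(b1, b2, b3)\<in>sweedler3 frtH ?B. ?P x a2 a3 b1 b2 b3)"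
    "join_stable frtL (\<lambda>x. \<forall>(b1, b2, b3)\<in>sweedler3 frtH ?B. ?P a1 x a3 b1 b2 b3)"
    "join_stable frtL (\<lambda>x. \<forall>(b1, b2, b3)\<in>sweedler3 frtH ?B. ?P a1 a2 x b1 b2 b3)"
    if c: "a1 \<in> carrier frtL" "a2 \<in> carrier frtL" "a3 \<in> carrier frtL" for a1 a2 a3
  proof -
    have "join_stable frtL (\<lambda>x. case b of (b1, b2, b3) \<Rightarrow> ?P x a2 a3 b1 b2 b3) \<and>
      join_stable frtL (\<lambda>x. case b of (b1, b2, b3) \<Rightarrow> ?P a1 x a3 b1 b2 b3) \<and>
      join_stable frtL (\<lambda>x. case b of (b1, b2, b3) \<Rightarrow> ?P a1 a2 x b1 b2 b3)"
      if b: "b \<in> sweedler3 frtH ?B" for b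
    proof -
      obtain b1 b2 b3 where e: "b = (b1, b2, b3)" by (rule prod_cases3)
      note m = memB[OF b[unfolded e]]
      show ?thesis unfolding e prod.case using stA(1,2,3)[OF c m] by blast
    qed
    then show "join_stable frtL (\<lambda>x. \<forall>(b1, b2, b3)\<in>sweedler3 frtH ?B. ?P x a2 a3 b1 b2 b3)"
      "join_stable frtL (\<lambda>x. \<forall>(b1, b2, b3)\<in>sweedler3 frtH ?B. ?P a1 x a3 b1 b2 b3)"
      "join_stable frtL (\<lambda>x. \<forall>(b1, b2, b3)\<in>sweedler3 frtH ?B. ?P a1 a2 x b1 b2 b3)"
      by (intro join_stable_ball; blast)+
  qed
  have "(\<forall>(a1, a2, a3)\<in>sweedler3 frtH ?A. \<forall>(b1, b2, b3)\<in>sweedler3 frtH ?B. ?P a1 a2 a3 b1 b2 b3) \<longleftrightarrow>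
    (\<forall>(a, p, q)\<in>?A. \<forall>m\<in>Xpow X a. \<forall>l\<in>Xpow X a. \<forall>(b1, b2, b3)\<in>sweedler3 frtH ?B.
      ?P (?gen a p l) (?gen a l m) (?gen a m q) b1 b2 b3)"
    by (rule sweedler3_symbols[OF class_hull_closed stB])
  also have "\<dots> \<longleftrightarrow> (\<forall>(a, p, q)\<in>?A. \<forall>m\<in>Xpow X a. \<forall>l\<in>Xpow X a.
    \<forall>(b, p', q')\<in>?B. \<forall>m'\<in>Xpow X b. \<forall>l'\<in>Xpow X b.
      ?P (?gen a p l) (?gen a l m) (?gen a m q) (?gen b p' l') (?gen b l' m') (?gen b m' q'))"
  proof (intro ball_triple_cong ball_cong[OF HOL.refl])
    fix a p q m l assume "(a, p, q) \<in> ?A" "m \<in> Xpow X a" "l \<in> Xpow X a"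
    then have c: "?gen a p l \<in> carrier frtL" "?gen a l m \<in> carrier frtL" "?gen a m q \<in> carrier frtL"
      using frt_gen_closed by (simp_all add: class_hull_iff)
    show "(\<forall>(b1, b2, b3)\<in>sweedler3 frtH ?B. ?P (?gen a p l) (?gen a l m) (?gen a m q) b1 b2 b3) \<longleftrightarrow>
      (\<forall>(b, p', q')\<in>?B. \<forall>m'\<in>Xpow X b. \<forall>l'\<in>Xpow X b.
        ?P (?gen a p l) (?gen a l m) (?gen a m q) (?gen b p' l') (?gen b l' m') (?gen b m' q'))"
      by (rule sweedler3_symbols[OF class_hull_closed stA(4,5,6)[OF c]])
  qed
  also have "\<dots> \<longleftrightarrow> (\<forall>(a, p, q)\<in>?A. \<forall>m\<in>Xpow X a. \<forall>l\<in>Xpow X a.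
    \<forall>(b, p', q')\<in>?B. \<forall>m'\<in>Xpow X b. \<forall>l'\<in>Xpow X b.
      \<not> symbol_braid a b p p' l' l \<or> \<not> symbol_braid a b q q' m' m \<or>
      (l' = m' \<and> l = m \<longrightarrow> (fibre {symbol_class b l'}, fibre {symbol_class a l}) \<in> Z))"
    by (intro ball_triple_cong ball_cong[OF HOL.refl] arg_cong2[of _ _ _ _ "(\<or>)"]
        cqt_gen convolution_inverse_frt(2) proj_gen_pair[OF Z]) (simp_all add: class_hull_iff)
  also have "\<dots> \<longleftrightarrow> (fibre {fst (class_braid (g, h))}, fibre {snd (class_braid (g, h))}) \<in> Z"
    (is "?L \<longleftrightarrow> ?F")
  proof
    assume L: ?L
    obtain a p where a: "p \<in> Xpow X a" "g = symbol_class a p" using symbol_class_surj g by blast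
    obtain b p' where b: "p' \<in> Xpow X b" "h = symbol_class b p'" using symbol_class_surj h by blast
    obtain l' l where l: "symbol_braid a b p p' l' l" using symbol_braid_ex a(1) b(1) by blast
    have t: "l \<in> Xpow X a" "l' \<in> Xpow X b" using l by (auto simp: symbol_braid_def)
    have mem: "(a, p, p) \<in> ?A" "(b, p', p') \<in> ?B" using a b by (simp_all add: class_hull_iff)
    have "(fibre {symbol_class b l'}, fibre {symbol_class a l}) \<in> Z"
      using bspec[OF L mem(1)] t l mem(2) by blast
    then show ?F using symbol_braid_class[OF l] a b by simp
  next
    assume F: ?F
    have "(fibre {symbol_class b l}, fibre {symbol_class a k}) \<in> Z"
      if A: "(a, p, q) \<in> ?A" and B: "(b, p', q') \<in> ?B"
        and s: "symbol_braid a b p p' l k" "symbol_braid a b q q' l k" for a p q b p' q' l k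
    proof -
      have "p = q" "p' = q'" using symbol_braid_out_unique[OF s] by simp_all
      then have "symbol_class a p = g" "symbol_class b p' = h" using A B by (simp_all add: class_hull_iff)
      then show ?thesis using F symbol_braid_class[OF s(1)] by simp
    qed
    then show ?L by blast
  qed
  finally show ?thesis .
qed

lemma tensor_map_Gamma:
  assumes g: "g \<in> carrier univG" and h: "h \<in> carrier univG"
  shows "tensor_map frtQ frtQ (quo) (quo)
      (Gamma frtH (cqt) (class_hull {g}) (class_hull {h})) =
    pure_tensor frtQ frtQ (fibre {fst (class_braid (g, h))}) (fibre {snd (class_braid (g, h))})"
    (is "tensor_map _ _ ?pi ?pi ?G = ?T")
proof -
  note Gc = Gamma_subset_iff[OF class_hull_closed[of "{g}"] class_hull_closed[of "{h}"], where R="cqt"]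
  have s: "fst (class_braid (g, h)) \<in> carrier univG" "snd (class_braid (g, h)) \<in> carrier univG"
    using braiding_operatorD(1,2)[OF braiding_operator_class_braid g h] .
  have cl: "?pi x \<in> carrier frtQ \<and> ?pi y \<in> carrier frtQ" if "(x, y) \<in> ?G" for x y
    using Gc(1) that remnant_proj_closed by (auto simp: tensor_iff)
  have "tensor_map frtQ frtQ ?pi ?pi ?G \<subseteq> Z \<longleftrightarrow> ?T \<subseteq> Z" if Z: "Z \<in> carrier frtQQ" for Z
  proof -
    let ?W = "{(x, y). x \<in> carrier frtL \<and> y \<in> carrier frtL \<and> (?pi x, ?pi y) \<in> Z}"
    have W: "?W \<in> carrier frtLL"
      using proj_pair_bistable[OF Z] unfolding bistable_def
      by (intro tensor_Collect frtL_complete_lattice) auto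
    have "tensor_map frtQ frtQ ?pi ?pi ?G \<subseteq> Z \<longleftrightarrow> (\<forall>(x, y)\<in>?G. (?pi x, ?pi y) \<in> Z)"
      by (rule tensor_map_subset_iff[OF frtQ_complete_lattice frtQ_complete_lattice cl Z])
    also have "\<dots> \<longleftrightarrow> ?G \<subseteq> ?W"
      using Gc(1) by (auto simp: tensor_iff)
    also have "\<dots> \<longleftrightarrow> (\<forall>(a1, a2, a3)\<in>sweedler3 frtH (class_hull {g}). \<forall>(b1, b2, b3)\<in>sweedler3 frtH (class_hull {h}).
      cqt a1 b1 = {} \<or> convolution_inverse frtH (cqt) a3 b3 = {} \<or> (b2, a2) \<in> ?W)"
      by (rule Gc(2)[OF W])
    also have "\<dots> \<longleftrightarrow> (\<forall>(a1, a2, a3)\<in>sweedler3 frtH (class_hull {g}). \<forall>(b1, b2, b3)\<in>sweedler3 frtH (class_hull {h}).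
      cqt a1 b1 = {} \<or> convolution_inverse frtH (cqt) a3 b3 = {} \<or> (?pi b2, ?pi a2) \<in> Z)"
      using sweedler3_members[OF class_hull_closed]
      by (intro ball_triple_cong arg_cong2[of _ _ _ _ "(\<or>)"] HOL.refl) simp
    also have "\<dots> \<longleftrightarrow> (fibre {fst (class_braid (g, h))}, fibre {snd (class_braid (g, h))}) \<in> Z"
      by (rule Gamma_hull[OF g h Z])
    also have "\<dots> \<longleftrightarrow> ?T \<subseteq> Z" using s Z by (simp add: pure_frtQ_subset_iff)
    finally show ?thesis .
  qed
  then show ?thesis
    using tensor_map_closed[OF frtQ_complete_lattice frtQ_complete_lattice cl]
      pure_frtQ_closed s by (intro subset_antisym_Galois[where K="carrier frtQQ"]) simp_all
qed

lemma induced_braiding_frt: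
  assumes g: "g \<in> carrier univG" and h: "h \<in> carrier univG"
  shows "induced_braiding frtH (cqt) (fibre {g}, fibre {h}) =
    (fibre {fst (class_braid (g, h))}, fibre {snd (class_braid (g, h))})"
proof -
  let ?s = "fst (class_braid (g, h))" and ?t = "snd (class_braid (g, h))"
  have s: "?s \<in> carrier univG" "?t \<in> carrier univG"
    using braiding_operatorD(1,2)[OF braiding_operator_class_braid g h] .
  have "induced_braiding frtH (cqt) (fibre {g}, fibre {h}) =
    (THE (p', q'). p' \<in> carrier frtRem \<and> q' \<in> carrier frtRem \<and>
      pure_tensor frtQ frtQ (fibre {?s}) (fibre {?t}) = pure_tensor frtQ frtQ p' q')"
    using g h by (simp add: induced_braiding_def Let_def frtR_tensor remnant_incl_frt tensor_map_Gamma)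
  also have "\<dots> = (fibre {?s}, fibre {?t})"
  proof (rule the_equality)
    fix x assume x: "case x of (p', q') \<Rightarrow> p' \<in> carrier frtRem \<and> q' \<in> carrier frtRem \<and>
      pure_tensor frtQ frtQ (fibre {?s}) (fibre {?t}) = pure_tensor frtQ frtQ p' q'"
    obtain p' q' where e: "x = (p', q')" by (rule prod.exhaust)
    then obtain a b where "a \<in> carrier univG" "b \<in> carrier univG" "p' = fibre {a}" "q' = fibre {b}"
      using x by (auto simp: carrier_remnant)
    then show "x = (fibre {?s}, fibre {?t})" using pure_singleton_inj[OF s, of a b] x e by simp
  qed (use s in \<open>simp add: carrier_remnant\<close>)
  finally show ?thesis .
qed

text \<open>All structure is transported along the bijection between group elements and singletons.\<close>

theorem remnant_recovers_universal_group:
  "group frtRem \<and> braiding_operator frtRem (induced_braiding frtH (cqt)) \<and>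
    (\<exists>\<phi> \<in> iso frtRem univG. \<forall>a \<in> carrier frtRem. \<forall>b \<in> carrier frtRem.
      map_prod \<phi> \<phi> (induced_braiding frtH (cqt) (a, b)) = universal_braiding X r (\<phi> a, \<phi> b))"
proof (intro conjI)
  let ?s = "induced_braiding frtH (cqt)"
  interpret U: group univG by (rule group_universal_group)
  define \<psi> where "\<psi> = (\<lambda>g. fibre {g} :: 'x frt_symbol set set)"
  have car: "carrier frtRem = \<psi> ` carrier univG" by (simp add: carrier_remnant \<psi>_def)
  have mult: "\<psi> g \<otimes>\<^bsub>frtRem\<^esub> \<psi> h = \<psi> (g \<otimes>\<^bsub>univG\<^esub> h)" if "g \<in> carrier univG" "h \<in> carrier univG" for g h
    using remnant_mult that by (simp add: \<psi>_def)
  have one: "\<one>\<^bsub>frtRem\<^esub> = \<psi> \<one>\<^bsub>univG\<^esub>" by (simp add: remnant_one \<psi>_def)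
  have inj: "inj_on \<psi> (carrier univG)"
  proof (rule inj_onI)
    fix g h assume "g \<in> carrier univG" "\<psi> g = \<psi> h"
    then have "{g} = {h}" unfolding \<psi>_def by (intro fibre_inj) simp_all
    then show "g = h" by simp
  qed
  have br: "?s (\<psi> g, \<psi> h) = map_prod \<psi> \<psi> (class_braid (g, h))" if "g \<in> carrier univG" "h \<in> carrier univG" for g h
    using induced_braiding_frt[OF that] by (cases "class_braid (g, h)") (simp add: \<psi>_def)
  note B = braiding_operator_class_braid
  note Bc = braiding_operatorD(1,2)[OF B]
  have hom: "\<psi> \<in> hom univG frtRem" using car mult by (auto simp: hom_def)
  then have "group (frtRem \<lparr>carrier := \<psi> ` carrier univG, one := \<psi> \<one>\<^bsub>univG\<^esub>\<rparr>)"
    by (rule U.hom_imp_img_group)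
  moreover have "frtRem \<lparr>carrier := \<psi> ` carrier univG, one := \<psi> \<one>\<^bsub>univG\<^esub>\<rparr> = frtRem"
    unfolding car[symmetric] one[symmetric] by simp
  ultimately show "group frtRem" by simp
  show "braiding_operator frtRem ?s"
    unfolding braiding_operator_def car
  proof (intro conjI funcsetI ballI)
    fix p assume "p \<in> \<psi> ` carrier univG \<times> \<psi> ` carrier univG"
    then obtain g h where gh: "g \<in> carrier univG" "h \<in> carrier univG" "p = (\<psi> g, \<psi> h)" by auto
    then show "?s p \<in> \<psi> ` carrier univG \<times> \<psi> ` carrier univG"
      using br[OF gh(1,2)] Bc[OF gh(1,2)] by (simp add: map_prod_def split_beta)
  next
    fix p q assume "p \<in> \<psi> ` carrier univG" "q \<in> \<psi> ` carrier univG"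
    then obtain g h where gh: "g \<in> carrier univG" "h \<in> carrier univG" "p = \<psi> g" "q = \<psi> h" by blast
    then show "fst (?s (p, q)) \<otimes>\<^bsub>frtRem\<^esub> snd (?s (p, q)) = p \<otimes>\<^bsub>frtRem\<^esub> q"
      using br[OF gh(1,2)] Bc[OF gh(1,2)] braiding_operatorD(3)[OF B gh(1,2)] by (simp add: mult)
  next
    fix p assume "p \<in> \<psi> ` carrier univG"
    then obtain g where g: "g \<in> carrier univG" "p = \<psi> g" by blast
    then show "?s (\<one>\<^bsub>frtRem\<^esub>, p) = (p, \<one>\<^bsub>frtRem\<^esub>)" "?s (p, \<one>\<^bsub>frtRem\<^esub>) = (\<one>\<^bsub>frtRem\<^esub>, p)"
      using br[OF U.one_closed g(1)] br[OF g(1) U.one_closed] braiding_operatorD(4,5)[OF B g(1) g(1)]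
      by (simp_all add: one)
  next
    fix p q t assume "p \<in> \<psi> ` carrier univG" "q \<in> \<psi> ` carrier univG" "t \<in> \<psi> ` carrier univG"
    then obtain g h f where e: "g \<in> carrier univG" "h \<in> carrier univG" "f \<in> carrier univG"
      "p = \<psi> g" "q = \<psi> h" "t = \<psi> f" by blast
    note c = Bc[OF e(2,3)]
    note c2 = Bc[OF e(1) c(1)]
    show "?s (p \<otimes>\<^bsub>frtRem\<^esub> q, t) =
      (let (f', h') = ?s (q, t); (f'', g') = ?s (p, f') in (f'', g' \<otimes>\<^bsub>frtRem\<^esub> h'))"
      using braiding_operator_mult_left[OF B e(1-3)] c c2 br[OF U.m_closed[OF e(1,2)] e(3)]
        br[OF e(2,3)] br[OF e(1) c(1)] e
      by (simp add: mult Let_def split_beta)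
    note d = Bc[OF e(1,2)]
    note d2 = Bc[OF d(2) e(3)]
    show "?s (p, q \<otimes>\<^bsub>frtRem\<^esub> t) =
      (let (h', g') = ?s (p, q); (f', g'') = ?s (g', t) in (h' \<otimes>\<^bsub>frtRem\<^esub> f', g''))"
      using braiding_operator_mult_right[OF B e(1-3)] d d2 br[OF e(1) U.m_closed[OF e(2,3)]]
        br[OF e(1,2)] br[OF d(2) e(3)] e
      by (simp add: mult Let_def split_beta)
  qed
  show "\<exists>\<phi> \<in> iso frtRem univG. \<forall>a \<in> carrier frtRem. \<forall>b \<in> carrier frtRem.
      map_prod \<phi> \<phi> (?s (a, b)) = universal_braiding X r (\<phi> a, \<phi> b)"
  proof
    let ?\<phi> = "inv_into (carrier univG) \<psi>"
    have "\<psi> \<in> iso univG frtRem" using hom inj car by (simp add: iso_def bij_betw_def)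
    then show "?\<phi> \<in> iso frtRem univG" by (rule U.iso_set_sym)
    have \<phi>: "?\<phi> (\<psi> g) = g" if "g \<in> carrier univG" for g using inj that by (rule inv_into_f_f)
    show "\<forall>a \<in> carrier frtRem. \<forall>b \<in> carrier frtRem.
      map_prod ?\<phi> ?\<phi> (?s (a, b)) = universal_braiding X r (?\<phi> a, ?\<phi> b)"
    proof (intro ballI)
      fix a b assume "a \<in> carrier frtRem" "b \<in> carrier frtRem"
      then obtain g h where gh: "g \<in> carrier univG" "h \<in> carrier univG" "a = \<psi> g" "b = \<psi> h"
        unfolding car by blast
      then show "map_prod ?\<phi> ?\<phi> (?s (a, b)) = universal_braiding X r (?\<phi> a, ?\<phi> b)"
        using br[OF gh(1,2)] Bc[OF gh(1,2)] universal_braiding_eq[OF gh(1,2)] \<phi>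
        by (simp add: map_prod_def split_beta)
    qed
  qed
qed

end

theorem theorem5p1:
  fixes X :: "'x set" and r :: "'x \<times> 'x \<Rightarrow> 'x \<times> 'x"
  assumes "ybe_solution X r"
  shows "group (remnant (frt_hopf X r)) \<and>
    braiding_operator (remnant (frt_hopf X r)) (induced_braiding (frt_hopf X r) (frt_cqt X r)) \<and>
    (\<exists>\<phi> \<in> iso (remnant (frt_hopf X r)) (universal_group X r).
      \<forall>a \<in> carrier (remnant (frt_hopf X r)). \<forall>b \<in> carrier (remnant (frt_hopf X r)).
        map_prod \<phi> \<phi> (induced_braiding (frt_hopf X r) (frt_cqt X r) (a, b)) =
          universal_braiding X r (\<phi> a, \<phi> b))"
proof -
  interpret ybe X r by (rule ybe.intro) (rule assms)
  show ?thesis by (rule remnant_recovers_universal_group)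
qed

end
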